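(* Let $\mathcal{A}$ be a $k$-linear abelian category with enough injectives, let $\mathfrak{i}=\operatorname{Inj}(\mathcal{A})$ be its linear category of injectives and let $\mathsf{Com}^+(\mathfrak{i})$ be the dg category of bounded below complexes of injectives. The canonical projection $\pi:\mathbf{C}(\mathsf{Com}^+(\mathfrak{i}))\to\mathbf{C}(\mathfrak{i})$ has a $B_\infty$-section $$\operatorname{embr}_\delta:\mathbf{C}(\mathfrak{i})\to\mathbf{C}(\mathsf{Com}^+(\mathfrak{i})):\ \phi_n\mapsto\sum_{m=0}^n\phi_n\{\delta^{\otimes m}\}$$ (for $\phi_n$ of arity $n$), which is an inverse of $\pi$ in the homotopy category of $B_\infty$-algebras. In particular, both $\pi$ and $\operatorname{embr}_\delta$ are quasi-isomorphisms, establishing $\mathbf{C}_{\mathrm{ab}}(\mathcal{A})\cong\mathbf{C}_{\mathrm{ex}}(\mathcal{A})$.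
   Context: $k$ is a commutative ring. Graded means $\mathbb{Z}$-graded, with the Koszul sign rule; $[M,N]^p=\prod_i\operatorname{Hom}_k(M^i,N^{i+p})$; $(\Sigma M)^i=M^{i+1}$, and $\sigma m\in\Sigma M$ is the element of degree $|m|-1$ corresponding to $m$. A quiver $\mathfrak{a}$ consists of a set of objects and graded $k$-modules $\mathfrak{a}(A,A')$. Put $\mathbf{C}_{br}(\mathfrak{a})=\prod_{n\ge 0}\prod_{A_0,\dots,A_n}[\Sigma\mathfrak{a}(A_{n-1},A_n)\otimes\cdots\otimes\Sigma\mathfrak{a}(A_0,A_1),\Sigma\mathfrak{a}(A_0,A_n)]$ (for $n=0$: $\prod_A\Sigma\mathfrak{a}(A,A)$). It is a brace algebra with $\phi\{\phi_1,\dots,\phi_r\}=\sum\phi(1\otimes\cdots\otimes\phi_1\otimes1\otimes\cdots\otimes\phi_r\otimes1\otimes\cdots\otimes1)$ (sum over all order-preserving insertions); put $\phi\{\delta^{\otimes m}\}=\phi\{\delta,\dots,\delta\}$ ($m$ times) and $\langle x,y\rangle=x\{y\}-(-1)^{|x||y|}y\{x\}$. An $A_{[0,\infty[}$-structure on $\mathfrak{a}$ is $b\in\mathbf{C}^1_{br}(\mathfrak{a})$ with $b\{b\}=0$; a dg structure is one whose only nonzero components have arity $1$ and $2$. Such $b$ makes $\mathbf{C}_{br}(\mathfrak{a})$ a $B_\infty$-algebra with operations the braces, the differential $D_1=\langle b,-\rangle$ and $D_n(\phi_1,\dots,\phi_n)=b\{\phi_1,\dots,\phi_n\}$ for $n\ge2$.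 A $B_\infty$-morphism is a graded linear map commuting with all these operations. The Hochschild complex is $\mathbf{C}(\mathfrak{a})=\Sigma^{-1}\mathbf{C}_{br}(\mathfrak{a})$; "$B_\infty$-morphism between Hochschild complexes" refers to the operations on the $\mathbf{C}_{br}$'s. An element $\phi\in\mathbf{C}^{i,n}(\mathfrak{a})=\prod[\mathfrak{a}(A_{n-1},A_n)\otimes\cdots\otimes\mathfrak{a}(A_0,A_1),\mathfrak{a}(A_0,A_n)]^i$ (arity $n$, Hochschild degree $i+n$) corresponds to the element of $\mathbf{C}_{br}$ sending $(\sigma f_n,\dots,\sigma f_1)$ to $(-1)^{ni+(n-1)|f_n|+\cdots+|f_2|}\sigma\phi(f_n,\dots,f_1)$. For a linear category $\mathfrak{a}$ (a quiver concentrated in degree $0$ with composition), $\mathsf{Com}^+(\mathfrak{a})$ is the dg category of bounded below complexes $(C,\delta_C)$ of $\mathfrak{a}$-objects, with $\mathsf{Com}^+(\mathfrak{a})(C,D)^n=\prod_i\mathfrak{a}(C^i,D^{i+n})$, composition $(fg)_i=f_{i+|g|}g_i$ and differential $d(f)=\delta f-(-1)^{|f|}f\delta$. The linear category $\mathfrak{a}$ is a full subcategory via complexes concentrated in degree $0$, and $\pi$ is restriction of cochains to this full subcategory. The differentials $\delta_C$ determine an arity zero element $\delta\in\mathbf{C}^1(\mathsf{Com}^+(\mathfrak{a}))$. In the formula for $\operatorname{embr}_\delta$, a cochain $\phi_n$ of arity $n$ on $\mathfrak{a}$ is regarded as a cochain on $\mathsf{Com}^+(\mathfrak{a})$ by applying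 it componentwise: $\phi_n(f_n,\dots,f_1)_i=\phi_n((f_n)_{i+|f_1|+\cdots+|f_{n-1}|},\dots,(f_2)_{i+|f_1|},(f_1)_i)$. The dg category $\mathsf{Com}^+(\mathfrak{i})$ is also denoted $D^+_{\mathrm{dg}}(\mathcal{A})$. By definition $\mathbf{C}_{\mathrm{ab}}(\mathcal{A})=\mathbf{C}(\mathfrak{i})$ and $\mathbf{C}_{\mathrm{ex}}(\mathcal{A})=\mathbf{C}(D^+_{\mathrm{dg}}(\mathcal{A}))$. The homotopy category of $B_\infty$-algebras is the localization at quasi-isomorphisms. *)

theory Defs
  imports Complex_Main "HOL-Library.Function_Algebras"
begin

text \<open>
  Conventions.  The ground ring is a type of class \<open>comm_ring_1\<close>.  A family of modules
  is a family of submodules of one ambient module, given by a type of class \<open>ab_group_add\<close>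
  with a scalar multiplication \<open>sc\<close> satisfying \<open>module sc\<close>; no generality is lost, since
  any family of modules embeds in its direct sum.  Function types carry the pointwise group
  structure.  Linear maps out of a tensor product are multilinear maps.
\<close>

definition ksign :: "int \<Rightarrow> 'v::ab_group_add \<Rightarrow> 'v" where
  "ksign e x = (if even e then x else - x)"

definition wdeg :: "(int \<times> 'a) list \<Rightarrow> int" where
  "wdeg w = sum_list (map fst w)"


section \<open>Categories and localization\<close>

record ('o, 'm) cat =
  Obj :: "'o set"
  Hom :: "'o \<Rightarrow> 'o \<Rightarrow> 'm set"
  cmp :: "'o \<Rightarrow> 'o \<Rightarrow> 'o \<Rightarrow> 'm \<Rightarrow> 'm \<Rightarrow> 'm"
  idn :: "'o \<Rightarrow> 'm"

text \<open>For \<open>f : X \<rightarrow> Y\<close> and \<open>g : Y \<rightarrow> Z\<close>, the composite \<open>g f\<close> is \<open>cmp C X Y Z g f\<close>; the objects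
  are needed because hom-sets of different pairs of objects may overlap.\<close>

definition category :: "('o, 'm) cat \<Rightarrow> bool" where
  "category C \<longleftrightarrow>
     (\<forall>X\<in>Obj C. idn C X \<in> Hom C X X) \<and>
     (\<forall>X\<in>Obj C. \<forall>Y\<in>Obj C. \<forall>Z\<in>Obj C. \<forall>f\<in>Hom C X Y. \<forall>g\<in>Hom C Y Z.
        cmp C X Y Z g f \<in> Hom C X Z) \<and>
     (\<forall>X\<in>Obj C. \<forall>Y\<in>Obj C. \<forall>f\<in>Hom C X Y.
        cmp C X X Y f (idn C X) = f \<and> cmp C X Y Y (idn C Y) f = f) \<and>
     (\<forall>W\<in>Obj C. \<forall>X\<in>Obj C. \<forall>Y\<in>Obj C. \<forall>Z\<in>Obj C.
        \<forall>f\<in>Hom C W X. \<forall>g\<in>Hom C X Y. \<forall>h\<in>Hom C Y Z.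
        cmp C W X Z (cmp C X Y Z h g) f = cmp C W Y Z h (cmp C W X Y g f))"

definition inverse_arrows :: "('o, 'm) cat \<Rightarrow> 'o \<Rightarrow> 'o \<Rightarrow> 'm \<Rightarrow> 'm \<Rightarrow> bool" where
  "inverse_arrows C X Y f g \<longleftrightarrow>
     X \<in> Obj C \<and> Y \<in> Obj C \<and> f \<in> Hom C X Y \<and> g \<in> Hom C Y X \<and>
     cmp C X Y X g f = idn C X \<and> cmp C Y X Y f g = idn C Y"

definition isomorphic :: "('o, 'm) cat \<Rightarrow> 'o \<Rightarrow> 'o \<Rightarrow> bool" where
  "isomorphic C X Y \<longleftrightarrow> (\<exists>f g. inverse_arrows C X Y f g)"

text \<open>Gabriel--Zisman localization of \<open>C\<close> at arrows \<open>W X Y \<subseteq> Hom C X Y\<close>: arrows are zigzags,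
  read from source to target, modulo the usual relations.  \<open>Bwd Y f X\<close> is the formal inverse,
  from \<open>Y\<close> to \<open>X\<close>, of \<open>f : X \<rightarrow> Y\<close>.\<close>

datatype ('o, 'm) zstep = Fwd 'o 'm 'o | Bwd 'o 'm 'o

inductive zigzag ::
  "('o, 'm) cat \<Rightarrow> ('o \<Rightarrow> 'o \<Rightarrow> 'm set) \<Rightarrow> 'o \<Rightarrow> ('o, 'm) zstep list \<Rightarrow> 'o \<Rightarrow> bool"
  for C W where
  zz_nil: "X \<in> Obj C \<Longrightarrow> zigzag C W X [] X"
| zz_fwd: "X \<in> Obj C \<Longrightarrow> f \<in> Hom C X Y \<Longrightarrow> zigzag C W Y z Z \<Longrightarrow> zigzag C W X (Fwd X f Y # z) Z"
| zz_bwd: "Y \<in> Obj C \<Longrightarrow> f \<in> W X Y \<Longrightarrow> zigzag C W X z Z \<Longrightarrow> zigzag C W Y (Bwd Y f X # z) Z"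

inductive zz_eq ::
  "('o, 'm) cat \<Rightarrow> ('o \<Rightarrow> 'o \<Rightarrow> 'm set) \<Rightarrow> 'o \<Rightarrow> 'o \<Rightarrow>
   ('o, 'm) zstep list \<Rightarrow> ('o, 'm) zstep list \<Rightarrow> bool"
  for C W where
  zz_refl: "zigzag C W X z Y \<Longrightarrow> zz_eq C W X Y z z"
| zz_sym: "zz_eq C W X Y z z' \<Longrightarrow> zz_eq C W X Y z' z"
| zz_trans: "zz_eq C W X Y z z' \<Longrightarrow> zz_eq C W X Y z' z'' \<Longrightarrow> zz_eq C W X Y z z''"
| zz_append: "zz_eq C W X Y z z' \<Longrightarrow> zz_eq C W Y Z y y' \<Longrightarrow> zz_eq C W X Z (z @ y) (z' @ y')"
| zz_id: "X \<in> Obj C \<Longrightarrow> zz_eq C W X X [Fwd X (idn C X) X] []"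
| zz_comp: "X \<in> Obj C \<Longrightarrow> Y \<in> Obj C \<Longrightarrow> Z \<in> Obj C \<Longrightarrow> f \<in> Hom C X Y \<Longrightarrow> g \<in> Hom C Y Z \<Longrightarrow>
    zz_eq C W X Z [Fwd X f Y, Fwd Y g Z] [Fwd X (cmp C X Y Z g f) Z]"
| zz_inv1: "X \<in> Obj C \<Longrightarrow> Y \<in> Obj C \<Longrightarrow> f \<in> W X Y \<Longrightarrow> zz_eq C W X X [Fwd X f Y, Bwd Y f X] []"
| zz_inv2: "X \<in> Obj C \<Longrightarrow> Y \<in> Obj C \<Longrightarrow> f \<in> W X Y \<Longrightarrow> zz_eq C W Y Y [Bwd Y f X, Fwd X f Y] []"

definition zz_class ::
  "('o, 'm) cat \<Rightarrow> ('o \<Rightarrow> 'o \<Rightarrow> 'm set) \<Rightarrow> 'o \<Rightarrow> 'o \<Rightarrow> ('o, 'm) zstep list \<Rightarrow> ('o, 'm) zstep list set" where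
  "zz_class C W X Y z = {z'. zz_eq C W X Y z z'}"

definition localization ::
  "('o, 'm) cat \<Rightarrow> ('o \<Rightarrow> 'o \<Rightarrow> 'm set) \<Rightarrow> ('o, ('o, 'm) zstep list set) cat" where
  "localization C W =
     \<lparr> Obj = Obj C,
       Hom = (\<lambda>X Y. {zz_class C W X Y z | z. zigzag C W X z Y}),
       cmp = (\<lambda>X Y Z b a. \<Union>f\<in>a. \<Union>g\<in>b. zz_class C W X Z (f @ g)),
       idn = (\<lambda>X. zz_class C W X X []) \<rparr>"

definition loc_arrow ::
  "('o, 'm) cat \<Rightarrow> ('o \<Rightarrow> 'o \<Rightarrow> 'm set) \<Rightarrow> 'o \<Rightarrow> 'o \<Rightarrow> 'm \<Rightarrow> ('o, 'm) zstep list set" where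
  "loc_arrow C W X Y f = zz_class C W X Y [Fwd X f Y]"


section \<open>Linear abelian categories and injectives\<close>

definition linear_category ::
  "('k::comm_ring_1 \<Rightarrow> 'm::ab_group_add \<Rightarrow> 'm) \<Rightarrow> ('o, 'm) cat \<Rightarrow> bool" where
  "linear_category sc C \<longleftrightarrow>
     module sc \<and> category C \<and>
     (\<forall>X\<in>Obj C. \<forall>Y\<in>Obj C. module.subspace sc (Hom C X Y)) \<and>
     (\<forall>X\<in>Obj C. \<forall>Y\<in>Obj C. \<forall>Z\<in>Obj C.
        \<forall>f\<in>Hom C X Y. \<forall>f'\<in>Hom C X Y. \<forall>g\<in>Hom C Y Z. \<forall>g'\<in>Hom C Y Z. \<forall>c.
          cmp C X Y Z g (f + f') = cmp C X Y Z g f + cmp C X Y Z g f' \<and>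
          cmp C X Y Z (g + g') f = cmp C X Y Z g f + cmp C X Y Z g' f \<and>
          cmp C X Y Z g (sc c f) = sc c (cmp C X Y Z g f) \<and>
          cmp C X Y Z (sc c g) f = sc c (cmp C X Y Z g f))"

definition zero_object :: "('o, 'm) cat \<Rightarrow> 'o \<Rightarrow> bool" where
  "zero_object C Z \<longleftrightarrow>
     Z \<in> Obj C \<and> (\<forall>X\<in>Obj C. (\<exists>!f. f \<in> Hom C X Z) \<and> (\<exists>!f. f \<in> Hom C Z X))"

definition is_product :: "('o, 'm) cat \<Rightarrow> 'o \<Rightarrow> 'o \<Rightarrow> 'o \<Rightarrow> 'm \<Rightarrow> 'm \<Rightarrow> bool" where
  "is_product C X Y P p q \<longleftrightarrow>
     P \<in> Obj C \<and> p \<in> Hom C P X \<and> q \<in> Hom C P Y \<and>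
     (\<forall>T\<in>Obj C. \<forall>f\<in>Hom C T X. \<forall>g\<in>Hom C T Y.
        \<exists>!h. h \<in> Hom C T P \<and> cmp C T P X p h = f \<and> cmp C T P Y q h = g)"

definition is_mono :: "('o, 'm) cat \<Rightarrow> 'o \<Rightarrow> 'o \<Rightarrow> 'm \<Rightarrow> bool" where
  "is_mono C X Y f \<longleftrightarrow>
     f \<in> Hom C X Y \<and>
     (\<forall>T\<in>Obj C. \<forall>g\<in>Hom C T X. \<forall>h\<in>Hom C T X. cmp C T X Y f g = cmp C T X Y f h \<longrightarrow> g = h)"

definition is_epi :: "('o, 'm) cat \<Rightarrow> 'o \<Rightarrow> 'o \<Rightarrow> 'm \<Rightarrow> bool" where
  "is_epi C X Y f \<longleftrightarrow>
     f \<in> Hom C X Y \<and>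
     (\<forall>T\<in>Obj C. \<forall>g\<in>Hom C Y T. \<forall>h\<in>Hom C Y T. cmp C X Y T g f = cmp C X Y T h f \<longrightarrow> g = h)"

definition is_kernel :: "('o, 'm::zero) cat \<Rightarrow> 'o \<Rightarrow> 'o \<Rightarrow> 'm \<Rightarrow> 'o \<Rightarrow> 'm \<Rightarrow> bool" where
  "is_kernel C X Y f K i \<longleftrightarrow>
     K \<in> Obj C \<and> i \<in> Hom C K X \<and> cmp C K X Y f i = 0 \<and>
     (\<forall>T\<in>Obj C. \<forall>g\<in>Hom C T X. cmp C T X Y f g = 0 \<longrightarrow>
        (\<exists>!h. h \<in> Hom C T K \<and> cmp C T K X i h = g))"

definition is_cokernel :: "('o, 'm::zero) cat \<Rightarrow> 'o \<Rightarrow> 'o \<Rightarrow> 'm \<Rightarrow> 'o \<Rightarrow> 'm \<Rightarrow> bool" where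
  "is_cokernel C X Y f Q q \<longleftrightarrow>
     Q \<in> Obj C \<and> q \<in> Hom C Y Q \<and> cmp C X Y Q q f = 0 \<and>
     (\<forall>T\<in>Obj C. \<forall>g\<in>Hom C Y T. cmp C X Y T g f = 0 \<longrightarrow>
        (\<exists>!h. h \<in> Hom C Q T \<and> cmp C Y Q T h q = g))"

definition linear_abelian_category ::
  "('k::comm_ring_1 \<Rightarrow> 'm::ab_group_add \<Rightarrow> 'm) \<Rightarrow> ('o, 'm) cat \<Rightarrow> bool" where
  "linear_abelian_category sc C \<longleftrightarrow>
     linear_category sc C \<and>
     (\<exists>Z. zero_object C Z) \<and>
     (\<forall>X\<in>Obj C. \<forall>Y\<in>Obj C. \<exists>P p q. is_product C X Y P p q) \<and>
     (\<forall>X\<in>Obj C. \<forall>Y\<in>Obj C. \<forall>f\<in>Hom C X Y. \<exists>K i. is_kernel C X Y f K i) \<and>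
     (\<forall>X\<in>Obj C. \<forall>Y\<in>Obj C. \<forall>f\<in>Hom C X Y. \<exists>Q q. is_cokernel C X Y f Q q) \<and>
     (\<forall>X\<in>Obj C. \<forall>Y\<in>Obj C. \<forall>f. is_mono C X Y f \<longrightarrow>
        (\<exists>Z\<in>Obj C. \<exists>g\<in>Hom C Y Z. is_kernel C Y Z g X f)) \<and>
     (\<forall>X\<in>Obj C. \<forall>Y\<in>Obj C. \<forall>f. is_epi C X Y f \<longrightarrow>
        (\<exists>Z\<in>Obj C. \<exists>g\<in>Hom C Z X. is_cokernel C Z X g Y f))"

definition injective_object :: "('o, 'm) cat \<Rightarrow> 'o \<Rightarrow> bool" where
  "injective_object C I \<longleftrightarrow>
     I \<in> Obj C \<and>
     (\<forall>X\<in>Obj C. \<forall>Y\<in>Obj C. \<forall>f g. is_mono C X Y f \<longrightarrow> g \<in> Hom C X I \<longrightarrow>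
        (\<exists>h\<in>Hom C Y I. cmp C X Y I h f = g))"

definition enough_injectives :: "('o, 'm) cat \<Rightarrow> bool" where
  "enough_injectives C \<longleftrightarrow>
     (\<forall>X\<in>Obj C. \<exists>I f. injective_object C I \<and> is_mono C X I f)"

definition Inj :: "('o, 'm) cat \<Rightarrow> ('o, 'm) cat" where
  "Inj C = C\<lparr>Obj := {I. injective_object C I}\<rparr>"


section \<open>B-infinity algebras\<close>

text \<open>
  A B-infinity algebra on a graded module \<open>V\<close> is a dg bialgebra structure (product of degree 0,
  differential of degree 1, unit the empty word) on the cofree tensor coalgebra \<open>T(V)\<close>.
  The product and differential are determined by their components in \<open>V\<close>, namely
  \<open>bmul : V\<^sup>\<otimes>\<^sup>k \<otimes> V\<^sup>\<otimes>\<^sup>l \<rightarrow> V\<close> and \<open>bdif : V\<^sup>\<otimes>\<^sup>n \<rightarrow> V\<close>, and identities between coalgebra maps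
  (or coderivations) may be checked after projection to \<open>V\<close>.  Words are lists of
  homogeneous elements together with their degrees.
\<close>

record 'v binf =
  homog :: "int \<Rightarrow> 'v set"
  bmul :: "(int \<times> 'v) list \<Rightarrow> (int \<times> 'v) list \<Rightarrow> 'v"
  bdif :: "(int \<times> 'v) list \<Rightarrow> 'v"

definition gword :: "(int \<Rightarrow> 'v set) \<Rightarrow> (int \<times> 'v) list \<Rightarrow> bool" where
  "gword V w \<longleftrightarrow> (\<forall>(p, x)\<in>set w. x \<in> V p)"

definition multilinear ::
  "('k \<Rightarrow> 'v::ab_group_add \<Rightarrow> 'v) \<Rightarrow> (int \<Rightarrow> 'v set) \<Rightarrow> ((int \<times> 'v) list \<Rightarrow> 'v) \<Rightarrow> bool" where
  "multilinear sc V F \<longleftrightarrow>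
     (\<forall>u v p. \<forall>x\<in>V p. \<forall>y\<in>V p. \<forall>c. gword V u \<longrightarrow> gword V v \<longrightarrow>
        F (u @ (p, x + y) # v) = F (u @ (p, x) # v) + F (u @ (p, y) # v) \<and>
        F (u @ (p, sc c x) # v) = sc c (F (u @ (p, x) # v)))"

text \<open>\<open>mul_word m r F x y\<close> is \<open>F\<close> applied to the part of word length \<open>r\<close> of the product of the
  words \<open>x\<close> and \<open>y\<close>: the sum over all ways to cut both words into \<open>r\<close> consecutive
  pieces (not both empty), the pieces of \<open>y\<close> being moved past the pieces of \<open>x\<close> to their right.\<close>

primrec mul_word ::
  "((int \<times> 'v) list \<Rightarrow> (int \<times> 'v) list \<Rightarrow> 'v) \<Rightarrow> nat \<Rightarrow> ((int \<times> 'v) list \<Rightarrow> 'v::ab_group_add) \<Rightarrow>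
   (int \<times> 'v) list \<Rightarrow> (int \<times> 'v) list \<Rightarrow> 'v" where
  "mul_word m 0 F x y = (if x = [] \<and> y = [] then F [] else 0)"
| "mul_word m (Suc r) F x y =
     (\<Sum>(a, b) \<in> {..length x} \<times> {..length y} - {(0, 0)}.
        ksign (wdeg (take b y) * wdeg (drop a x))
          (mul_word m r
            (\<lambda>t. F ((wdeg (take a x) + wdeg (take b y), m (take a x) (take b y)) # t))
            (drop a x) (drop b y)))"

definition mul_total ::
  "((int \<times> 'v) list \<Rightarrow> (int \<times> 'v) list \<Rightarrow> 'v) \<Rightarrow> ((int \<times> 'v) list \<Rightarrow> 'v::ab_group_add) \<Rightarrow>
   (int \<times> 'v) list \<Rightarrow> (int \<times> 'v) list \<Rightarrow> 'v" where
  "mul_total m F x y = (\<Sum>r\<le>length x + length y. mul_word m r F x y)"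

text \<open>\<open>F\<close> applied to the value at \<open>x\<close> of the coderivation with components \<open>D\<close>, of degree 1.\<close>

definition der_total ::
  "((int \<times> 'v) list \<Rightarrow> 'v) \<Rightarrow> ((int \<times> 'v) list \<Rightarrow> 'v::ab_group_add) \<Rightarrow> (int \<times> 'v) list \<Rightarrow> 'v" where
  "der_total D F x =
     (\<Sum>i\<le>length x. \<Sum>j\<in>{i<..length x}.
        ksign (wdeg (take i x))
          (F (take i x @
              (wdeg (take (j - i) (drop i x)) + 1, D (take (j - i) (drop i x))) # drop j x)))"

definition binf_algebra ::
  "('k::comm_ring_1 \<Rightarrow> 'v::ab_group_add \<Rightarrow> 'v) \<Rightarrow> 'v binf \<Rightarrow> bool" where
  "binf_algebra sc A \<longleftrightarrow>
     module sc \<and> (\<forall>p. module.subspace sc (homog A p)) \<and>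
     (\<forall>x y. gword (homog A) x \<longrightarrow> gword (homog A) y \<longrightarrow>
        bmul A x y \<in> homog A (wdeg x + wdeg y)) \<and>
     (\<forall>x. gword (homog A) x \<longrightarrow> bdif A x \<in> homog A (wdeg x + 1)) \<and>
     (\<forall>x. gword (homog A) x \<longrightarrow> multilinear sc (homog A) (bmul A x)) \<and>
     (\<forall>y. gword (homog A) y \<longrightarrow> multilinear sc (homog A) (\<lambda>x. bmul A x y)) \<and>
     multilinear sc (homog A) (bdif A) \<and>
     bdif A [] = 0 \<and>
     (\<forall>x. gword (homog A) x \<longrightarrow>
        bmul A x [] = (if length x = 1 then snd (hd x) else 0) \<and>
        bmul A [] x = (if length x = 1 then snd (hd x) else 0)) \<and>
     (\<forall>x y z. gword (homog A) x \<longrightarrow> gword (homog A) y \<longrightarrow> gword (homog A) z \<longrightarrow>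
        mul_total (bmul A) (\<lambda>t. bmul A t z) x y = mul_total (bmul A) (bmul A x) y z) \<and>
     (\<forall>x. gword (homog A) x \<longrightarrow> der_total (bdif A) (bdif A) x = 0) \<and>
     (\<forall>x y. gword (homog A) x \<longrightarrow> gword (homog A) y \<longrightarrow>
        mul_total (bmul A) (bdif A) x y =
          der_total (bdif A) (\<lambda>t. bmul A t y) x
          + ksign (wdeg x) (der_total (bdif A) (bmul A x) y))"

definition binf_morphism ::
  "('k::comm_ring_1 \<Rightarrow> 'v::ab_group_add \<Rightarrow> 'v) \<Rightarrow> ('k \<Rightarrow> 'w::ab_group_add \<Rightarrow> 'w) \<Rightarrow>
   'v binf \<Rightarrow> 'w binf \<Rightarrow> (int \<Rightarrow> 'v \<Rightarrow> 'w) \<Rightarrow> bool" where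
  "binf_morphism sc sc' A B f \<longleftrightarrow>
     binf_algebra sc A \<and> binf_algebra sc' B \<and>
     (\<forall>p. \<forall>x\<in>homog A p. f p x \<in> homog B p) \<and>
     (\<forall>p. \<forall>x\<in>homog A p. \<forall>y\<in>homog A p. \<forall>c.
        f p (x + y) = f p x + f p y \<and> f p (sc c x) = sc' c (f p x)) \<and>
     (\<forall>x y. gword (homog A) x \<longrightarrow> gword (homog A) y \<longrightarrow>
        f (wdeg x + wdeg y) (bmul A x y) =
          bmul B (map (\<lambda>(p, v). (p, f p v)) x) (map (\<lambda>(p, v). (p, f p v)) y)) \<and>
     (\<forall>x. gword (homog A) x \<longrightarrow>
        f (wdeg x + 1) (bdif A x) = bdif B (map (\<lambda>(p, v). (p, f p v)) x))"

definition cocycles :: "'v::ab_group_add binf \<Rightarrow> int \<Rightarrow> 'v set" where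
  "cocycles A p = {x \<in> homog A p. bdif A [(p, x)] = 0}"

definition cohomologous :: "'v::ab_group_add binf \<Rightarrow> int \<Rightarrow> ('v \<times> 'v) set" where
  "cohomologous A p =
     {(x, y). x \<in> cocycles A p \<and> y \<in> cocycles A p \<and>
              (\<exists>z\<in>homog A (p - 1). x - y = bdif A [(p - 1, z)])}"

definition cohomology :: "'v::ab_group_add binf \<Rightarrow> int \<Rightarrow> 'v set set" where
  "cohomology A p = cocycles A p // cohomologous A p"

definition binf_quasi_iso ::
  "('k::comm_ring_1 \<Rightarrow> 'v::ab_group_add \<Rightarrow> 'v) \<Rightarrow> ('k \<Rightarrow> 'w::ab_group_add \<Rightarrow> 'w) \<Rightarrow>
   'v binf \<Rightarrow> 'w binf \<Rightarrow> (int \<Rightarrow> 'v \<Rightarrow> 'w) \<Rightarrow> bool" where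
  "binf_quasi_iso sc sc' A B f \<longleftrightarrow>
     binf_morphism sc sc' A B f \<and>
     (\<forall>p. bij_betw (\<lambda>c. cohomologous B p `` (f p ` c)) (cohomology A p) (cohomology B p))"

text \<open>The category of B-infinity algebras that live in the ambient module \<open>'u\<close>; a graded map is
  normalized to be undefined outside its domain.\<close>

definition binf_cat ::
  "('k::comm_ring_1 \<Rightarrow> 'u::ab_group_add \<Rightarrow> 'u) \<Rightarrow> ('u binf, int \<Rightarrow> 'u \<Rightarrow> 'u) cat" where
  "binf_cat sc =
     \<lparr> Obj = {A. binf_algebra sc A},
       Hom = (\<lambda>A B. {f. binf_morphism sc sc A B f \<and> (\<forall>p x. x \<notin> homog A p \<longrightarrow> f p x = undefined)}),
       cmp = (\<lambda>A B C g f p x. if x \<in> homog A p then g p (f p x) else undefined),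
       idn = (\<lambda>A p x. if x \<in> homog A p then x else undefined) \<rparr>"

definition binf_weq ::
  "('k::comm_ring_1 \<Rightarrow> 'u::ab_group_add \<Rightarrow> 'u) \<Rightarrow> 'u binf \<Rightarrow> 'u binf \<Rightarrow> (int \<Rightarrow> 'u \<Rightarrow> 'u) set" where
  "binf_weq sc A B = {f \<in> Hom (binf_cat sc) A B. binf_quasi_iso sc sc A B f}"

definition Ho_binf ::
  "('k::comm_ring_1 \<Rightarrow> 'u::ab_group_add \<Rightarrow> 'u) \<Rightarrow>
   ('u binf, ('u binf, int \<Rightarrow> 'u \<Rightarrow> 'u) zstep list set) cat" where
  "Ho_binf sc = localization (binf_cat sc) (binf_weq sc)"

text \<open>Transport along an injective linear map \<open>j\<close>, so that algebras over different carrier types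
  become objects of one category.\<close>

definition binf_transport :: "('v \<Rightarrow> 'u) \<Rightarrow> 'v binf \<Rightarrow> 'u binf" where
  "binf_transport j A =
     \<lparr> homog = (\<lambda>p. j ` homog A p),
       bmul = (\<lambda>x y. j (bmul A (map (map_prod id (inv j)) x) (map (map_prod id (inv j)) y))),
       bdif = (\<lambda>x. j (bdif A (map (map_prod id (inv j)) x))) \<rparr>"

definition map_transport ::
  "('v \<Rightarrow> 'u) \<Rightarrow> ('w \<Rightarrow> 'u) \<Rightarrow> 'v binf \<Rightarrow> (int \<Rightarrow> 'v \<Rightarrow> 'w) \<Rightarrow> int \<Rightarrow> 'u \<Rightarrow> 'u" where
  "map_transport i j A f p x = (if x \<in> i ` homog A p then j (f p (inv i x)) else undefined)"

text \<open>The image in the homotopy category of a morphism \<open>f : A \<rightarrow> B\<close>, with \<open>A\<close> and \<open>B\<close> embedded in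
  \<open>'u\<close> by \<open>i\<close> and \<open>j\<close>.\<close>

definition Ho_arrow ::
  "('k::comm_ring_1 \<Rightarrow> 'u::ab_group_add \<Rightarrow> 'u) \<Rightarrow> ('v \<Rightarrow> 'u) \<Rightarrow> ('w \<Rightarrow> 'u) \<Rightarrow>
   'v binf \<Rightarrow> 'w binf \<Rightarrow> (int \<Rightarrow> 'v \<Rightarrow> 'w) \<Rightarrow> ('u binf, int \<Rightarrow> 'u \<Rightarrow> 'u) zstep list set" where
  "Ho_arrow sc i j A B f =
     loc_arrow (binf_cat sc) (binf_weq sc) (binf_transport i A) (binf_transport j B)
       (map_transport i j A f)"


section \<open>Quivers, cochains and braces\<close>

record ('o, 'm) quiver =
  QObj :: "'o set"
  QHom :: "'o \<Rightarrow> 'o \<Rightarrow> int \<Rightarrow> 'm set"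

text \<open>
  The arguments \<open>(x\<^sub>n, \<dots>, x\<^sub>1)\<close> of a cochain, with \<open>x\<^sub>j\<close> of degree \<open>d\<^sub>j\<close> going from \<open>A\<^bsub>j-1\<^esub>\<close> to \<open>A\<^sub>j\<close>, are
  encoded by the object \<open>A\<^sub>n\<close> and the list \<open>[(d\<^sub>n, x\<^sub>n, A\<^bsub>n-1\<^esub>), \<dots>, (d\<^sub>1, x\<^sub>1, A\<^sub>0)]\<close>.
  The suspension is the identity on elements: \<open>\<sigma>f\<close> is represented by \<open>f\<close>, with \<open>d = |f| - 1\<close>.
\<close>

type_synonym ('o, 'm) qpath = "(int \<times> 'm \<times> 'o) list"
type_synonym ('o, 'm) cochain = "'o \<Rightarrow> ('o, 'm) qpath \<Rightarrow> 'm"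

definition src :: "'o \<Rightarrow> ('o, 'm) qpath \<Rightarrow> 'o" where
  "src B w = (if w = [] then B else snd (snd (last w)))"

text \<open>Composable words of homogeneous elements of the suspended quiver.\<close>

fun sword :: "('o, 'm, 'z) quiver_scheme \<Rightarrow> 'o \<Rightarrow> ('o, 'm) qpath \<Rightarrow> bool" where
  "sword Q B [] \<longleftrightarrow> B \<in> QObj Q"
| "sword Q B ((d, x, A) # w) \<longleftrightarrow> B \<in> QObj Q \<and> x \<in> QHom Q A B (d + 1) \<and> sword Q A w"

text \<open>The degree \<open>p\<close> part of \<open>C\<^bsub>br\<^esub>\<close>; all arities are present simultaneously, the arity being
  the length of the word.\<close>

definition Cbr ::
  "('k \<Rightarrow> 'm::ab_group_add \<Rightarrow> 'm) \<Rightarrow> ('o, 'm, 'z) quiver_scheme \<Rightarrow> int \<Rightarrow> ('o, 'm) cochain set" where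
  "Cbr sc Q p =
     {\<phi>. (\<forall>B w. sword Q B w \<longrightarrow> \<phi> B w \<in> QHom Q (src B w) B (wdeg w + p + 1)) \<and>
         (\<forall>B w. \<not> sword Q B w \<longrightarrow> \<phi> B w = 0) \<and>
         (\<forall>B u d x y A v c.
            sword Q B (u @ (d, x, A) # v) \<longrightarrow> sword Q B (u @ (d, y, A) # v) \<longrightarrow>
              \<phi> B (u @ (d, x + y, A) # v) = \<phi> B (u @ (d, x, A) # v) + \<phi> B (u @ (d, y, A) # v) \<and>
              \<phi> B (u @ (d, sc c x, A) # v) = sc c (\<phi> B (u @ (d, x, A) # v)))}"

definition cochain_scale :: "('k \<Rightarrow> 'm \<Rightarrow> 'm) \<Rightarrow> 'k \<Rightarrow> ('o, 'm) cochain \<Rightarrow> ('o, 'm) cochain" where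
  "cochain_scale sc c \<phi> = (\<lambda>B w. sc c (\<phi> B w))"

text \<open>\<open>F\<close> applied to \<open>\<Sum> (1 \<otimes> \<dots> \<otimes> \<phi>\<^sub>1 \<otimes> 1 \<otimes> \<dots> \<otimes> \<phi>\<^sub>r \<otimes> 1 \<otimes> \<dots> \<otimes> 1)(w)\<close>, where \<open>w\<close> is preceded
  by arguments of total degree \<open>s\<close>, which contribute to the Koszul signs.\<close>

primrec brace_sum ::
  "(int \<times> ('o, 'm::ab_group_add) cochain) list \<Rightarrow> int \<Rightarrow> 'o \<Rightarrow> ('o, 'm) qpath \<Rightarrow>
   (('o, 'm) qpath \<Rightarrow> 'm) \<Rightarrow> 'm" where
  "brace_sum [] s B w F = F w"
| "brace_sum (p\<phi> # \<phi>s) s B w F =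
     (\<Sum>i\<le>length w. \<Sum>j\<in>{i..length w}.
        let u = take i w; v = take (j - i) (drop i w); C = src B u; C' = src C v in
        ksign (fst p\<phi> * (s + wdeg u))
          (brace_sum \<phi>s (s + wdeg u + wdeg v) C' (drop j w)
            (\<lambda>t. F (u @ (fst p\<phi> + wdeg v, snd p\<phi> C v, C') # t))))"

text \<open>The brace \<open>\<phi>{\<phi>\<^sub>1, \<dots>, \<phi>\<^sub>r}\<close>; the \<open>\<phi>\<^sub>i\<close> are listed with their degrees.\<close>

definition brace ::
  "('o, 'm::ab_group_add, 'z) quiver_scheme \<Rightarrow> ('o, 'm) cochain \<Rightarrow>
   (int \<times> ('o, 'm) cochain) list \<Rightarrow> ('o, 'm) cochain" where
  "brace Q \<phi> \<phi>s B w = (if sword Q B w then brace_sum \<phi>s 0 B w (\<phi> B) else 0)"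

text \<open>The correspondence between cochains of arity \<open>n\<close> and quiver degree \<open>i\<close>, on words of elements
  of the quiver, and cochains on words of suspended elements, and its inverse.\<close>

fun arg_sign :: "('o, 'm) qpath \<Rightarrow> int" where
  "arg_sign [] = 0"
| "arg_sign ((d, x) # w) = int (length w) * d + arg_sign w"

definition shift_degs :: "int \<Rightarrow> ('o, 'm) qpath \<Rightarrow> ('o, 'm) qpath" where
  "shift_degs e w = map (\<lambda>(d, x). (d + e, x)) w"

definition to_br ::
  "('o, 'm::ab_group_add, 'z) quiver_scheme \<Rightarrow> int \<Rightarrow> nat \<Rightarrow> ('o, 'm) cochain \<Rightarrow> ('o, 'm) cochain" where
  "to_br Q i n \<phi> B w =
     (if sword Q B w \<and> length w = n
      then ksign (int n * i + arg_sign (shift_degs 1 w)) (\<phi> B (shift_degs 1 w)) else 0)"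

definition of_br :: "int \<Rightarrow> nat \<Rightarrow> ('o, 'm::ab_group_add) cochain \<Rightarrow> ('o, 'm) cochain" where
  "of_br i n \<phi> B w =
     (if length w = n then ksign (int n * i + arg_sign w) (\<phi> B (shift_degs (- 1) w)) else 0)"

text \<open>The data of a dg category: \<open>dcmp Q X Y Z q p g f\<close> is \<open>g f\<close>, and \<open>ddif Q X Y p f\<close> is \<open>d f\<close>,
  for \<open>f : X \<rightarrow> Y\<close> of degree \<open>p\<close> and \<open>g : Y \<rightarrow> Z\<close> of degree \<open>q\<close>.\<close>

record ('o, 'm) dgcat = "('o, 'm) quiver" +
  dcmp :: "'o \<Rightarrow> 'o \<Rightarrow> 'o \<Rightarrow> int \<Rightarrow> int \<Rightarrow> 'm \<Rightarrow> 'm \<Rightarrow> 'm"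
  ddif :: "'o \<Rightarrow> 'o \<Rightarrow> int \<Rightarrow> 'm \<Rightarrow> 'm"

fun dg_mult :: "('o, 'm::ab_group_add) dgcat \<Rightarrow> ('o, 'm) cochain" where
  "dg_mult Q B [(q, g, A), (p, f, A')] = dcmp Q A' A B q p g f"
| "dg_mult Q B _ = 0"

fun dg_diff :: "('o, 'm::ab_group_add) dgcat \<Rightarrow> ('o, 'm) cochain" where
  "dg_diff Q B [(p, f, A)] = ddif Q A B p f"
| "dg_diff Q B _ = 0"

definition dg_structure :: "('o, 'm::ab_group_add) dgcat \<Rightarrow> ('o, 'm) cochain" where
  "dg_structure Q = to_br Q 0 2 (dg_mult Q) + to_br Q 1 1 (dg_diff Q)"

text \<open>The B-infinity algebra \<open>C\<^bsub>br\<^esub>(Q)\<close> of an A-infinity structure \<open>b\<close>: the component of the product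
  on \<open>V\<^sup>\<otimes>\<^sup>k \<otimes> V\<^sup>\<otimes>\<^sup>l\<close> is the brace for \<open>k = 1\<close> and vanishes for \<open>k > 1\<close>.  The Hochschild complex
  \<open>C(Q) = \<Sigma>\<^sup>-\<^sup>1 C\<^bsub>br\<^esub>(Q)\<close> is the same graded module with degrees raised by 1.\<close>

definition Cbr_mul ::
  "('o, 'm::ab_group_add, 'z) quiver_scheme \<Rightarrow> (int \<times> ('o, 'm) cochain) list \<Rightarrow>
   (int \<times> ('o, 'm) cochain) list \<Rightarrow> ('o, 'm) cochain" where
  "Cbr_mul Q x y =
     (case x of
        [] \<Rightarrow> (case y of [(q, \<psi>)] \<Rightarrow> \<psi> | _ \<Rightarrow> 0)
      | [(p, \<phi>)] \<Rightarrow> brace Q \<phi> y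
      | _ \<Rightarrow> 0)"

definition Cbr_dif ::
  "('o, 'm::ab_group_add, 'z) quiver_scheme \<Rightarrow> ('o, 'm) cochain \<Rightarrow>
   (int \<times> ('o, 'm) cochain) list \<Rightarrow> ('o, 'm) cochain" where
  "Cbr_dif Q b x =
     (case x of
        [] \<Rightarrow> 0
      | [(p, \<phi>)] \<Rightarrow> brace Q b [(p, \<phi>)] - ksign (1 * p) (brace Q \<phi> [(1, b)])
      | _ \<Rightarrow> brace Q b x)"

definition Cbr_binf ::
  "('k \<Rightarrow> 'm::ab_group_add \<Rightarrow> 'm) \<Rightarrow> ('o, 'm) dgcat \<Rightarrow> ('o, 'm) cochain binf" where
  "Cbr_binf sc Q =
     \<lparr> homog = Cbr sc Q, bmul = Cbr_mul Q, bdif = Cbr_dif Q (dg_structure Q) \<rparr>"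


section \<open>Bounded below complexes\<close>

definition linear_dg :: "('o, 'm::ab_group_add) cat \<Rightarrow> ('o, 'm) dgcat" where
  "linear_dg C =
     \<lparr> QObj = Obj C,
       QHom = (\<lambda>X Y n. if n = 0 then Hom C X Y else {0}),
       dcmp = (\<lambda>X Y Z q p. cmp C X Y Z),
       ddif = (\<lambda>X Y p f. 0) \<rparr>"

type_synonym ('o, 'm) cplx = "(int \<Rightarrow> 'o) \<times> (int \<Rightarrow> 'm)"

definition bb_complex :: "('o, 'm::zero) cat \<Rightarrow> ('o, 'm) cplx \<Rightarrow> bool" where
  "bb_complex C X \<longleftrightarrow>
     (\<forall>i. fst X i \<in> Obj C \<and> snd X i \<in> Hom C (fst X i) (fst X (i + 1)) \<and>
          cmp C (fst X i) (fst X (i + 1)) (fst X (i + 2)) (snd X (i + 1)) (snd X i) = 0) \<and>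
     (\<exists>N. \<forall>i<N. zero_object C (fst X i))"

definition com_cmp ::
  "('o, 'm) cat \<Rightarrow> ('o, 'm) cplx \<Rightarrow> ('o, 'm) cplx \<Rightarrow> ('o, 'm) cplx \<Rightarrow> int \<Rightarrow> int \<Rightarrow>
   (int \<Rightarrow> 'm) \<Rightarrow> (int \<Rightarrow> 'm) \<Rightarrow> int \<Rightarrow> 'm" where
  "com_cmp C X Y Z q p g f =
     (\<lambda>i. cmp C (fst X i) (fst Y (i + p)) (fst Z (i + p + q)) (g (i + p)) (f i))"

definition Com_plus ::
  "('o, 'm::ab_group_add) cat \<Rightarrow> (('o, 'm) cplx, int \<Rightarrow> 'm) dgcat" where
  "Com_plus C =
     \<lparr> QObj = {X. bb_complex C X},
       QHom = (\<lambda>X Y n. {f. \<forall>i. f i \<in> Hom C (fst X i) (fst Y (i + n))}),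
       dcmp = com_cmp C,
       ddif = (\<lambda>X Y p f. com_cmp C X Y Y 1 p (snd Y) f - ksign p (com_cmp C X X Y p 1 f (snd X))) \<rparr>"

definition com_scale :: "('k \<Rightarrow> 'm \<Rightarrow> 'm) \<Rightarrow> 'k \<Rightarrow> (int \<Rightarrow> 'm) \<Rightarrow> int \<Rightarrow> 'm" where
  "com_scale sc c f = (\<lambda>i. sc c (f i))"

text \<open>The embedding of \<open>C\<close> in \<open>Com\<^sup>+(C)\<close> by complexes concentrated in degree 0, \<open>z\<close> being a zero
  object of \<open>C\<close>.  The degree 0 component identifies morphisms of such complexes with those of \<open>C\<close>.\<close>

definition stalk :: "'o \<Rightarrow> 'o \<Rightarrow> ('o, 'm::zero) cplx" where
  "stalk z A = ((\<lambda>i. if i = 0 then A else z), (\<lambda>i. 0))"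

definition stalk_mor :: "'m::zero \<Rightarrow> int \<Rightarrow> 'm" where
  "stalk_mor f = (\<lambda>i. if i = 0 then f else 0)"

definition proj ::
  "('o, 'm::ab_group_add) cat \<Rightarrow> 'o \<Rightarrow> int \<Rightarrow> (('o, 'm) cplx, int \<Rightarrow> 'm) cochain \<Rightarrow>
   ('o, 'm) cochain" where
  "proj C z p \<phi> B w =
     (if sword (linear_dg C) B w
      then \<phi> (stalk z B) (map (\<lambda>(d, f, A). (d, stalk_mor f, stalk z A)) w) 0
      else 0)"

text \<open>Componentwise extension of cochains (on unsuspended words).\<close>

fun comp_word :: "int \<Rightarrow> (('o, 'm) cplx, int \<Rightarrow> 'm) qpath \<Rightarrow> ('o, 'm) qpath" where
  "comp_word i [] = []"
| "comp_word i ((d, f, A) # w) = (0, f (i + wdeg w), fst A (i + wdeg w)) # comp_word i w"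

definition componentwise :: "('o, 'm) cochain \<Rightarrow> (('o, 'm) cplx, int \<Rightarrow> 'm) cochain" where
  "componentwise \<phi> B w = (\<lambda>i. \<phi> (fst B (i + wdeg w)) (comp_word i w))"

definition delta_elt ::
  "('o, 'm::ab_group_add) cat \<Rightarrow> (('o, 'm) cplx, int \<Rightarrow> 'm) cochain" where
  "delta_elt C = to_br (Com_plus C) 1 0 (\<lambda>B w. snd B)"

definition embr_arity ::
  "('o, 'm::ab_group_add) cat \<Rightarrow> nat \<Rightarrow> ('o, 'm) cochain \<Rightarrow> (('o, 'm) cplx, int \<Rightarrow> 'm) cochain" where
  "embr_arity C n \<phi> =
     (\<Sum>m\<le>n. brace (Com_plus C)
        (to_br (Com_plus C) 0 n (componentwise (of_br 0 n \<phi>)))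
        (replicate m (0, delta_elt C)))"

text \<open>A linear category is concentrated in degree 0, so that an element of degree \<open>p\<close> of
  \<open>C\<^bsub>br\<^esub>(C)\<close> has at most one nonzero component, in arity \<open>p + 1\<close> (its Hochschild degree).\<close>

definition embr ::
  "('o, 'm::ab_group_add) cat \<Rightarrow> int \<Rightarrow> ('o, 'm) cochain \<Rightarrow> (('o, 'm) cplx, int \<Rightarrow> 'm) cochain" where
  "embr C p \<phi> = embr_arity C (nat (p + 1)) \<phi>"

definition D_plus_dg ::
  "('o, 'm::ab_group_add) cat \<Rightarrow> (('o, 'm) cplx, int \<Rightarrow> 'm) dgcat" where
  "D_plus_dg A = Com_plus (Inj A)"

definition C_ab ::
  "('k \<Rightarrow> 'm::ab_group_add \<Rightarrow> 'm) \<Rightarrow> ('o, 'm) cat \<Rightarrow> ('o, 'm) cochain binf" where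
  "C_ab sc A = Cbr_binf sc (linear_dg (Inj A))"

definition C_ex ::
  "('k \<Rightarrow> 'm::ab_group_add \<Rightarrow> 'm) \<Rightarrow> ('o, 'm) cat \<Rightarrow> (('o, 'm) cplx, int \<Rightarrow> 'm) cochain binf" where
  "C_ex sc A = Cbr_binf (com_scale sc) (D_plus_dg A)"

end

theory Submission
  imports Defs
begin

text \<open>
  The component of \<open>embr\<^sub>\<delta> \<phi>\<close> ending in degree \<open>l\<close> is \<open>\<phi>\<close> applied to the sum of all words of
  components with any number of differentials inserted between the letters.  This sum of words
  is compatible with insertion of cochains, and the dg structure of \<open>Com\<^sup>+(C)\<close> is itself \<open>embr\<^sub>\<delta>\<close> of
  the composition of \<open>C\<close>; hence \<open>embr\<^sub>\<delta>\<close> is a morphism, and \<open>\<pi>\<close> is a retraction of it.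

  Conversely, the identity of \<open>X\<^sup>l\<close> is a morphism of degree \<open>-l\<close> from a complex \<open>X\<close> to the complex
  \<open>X\<^sup>l\<close> concentrated in degree 0.  Given a cochain on \<open>Com\<^sup>+(C)\<close>, apply it to the words
  \<open>(f\<^sub>n, \<dots>, f\<^sub>1)\<close> in which such a morphism is inserted, with all letters to its left replaced by their
  components (and differentials) in \<open>C\<close>.  The sum over the places of insertion is a homotopy:
  its boundary telescopes to the extreme terms, in which the morphism stands at the left end
  (this gives \<open>\<phi>\<close>) or at the right end (this gives \<open>embr\<^sub>\<delta> (\<pi> \<phi>)\<close>).

  So \<open>\<pi>\<close> is a quasi-isomorphism with a section, and the section becomes its inverse wherever \<open>\<pi>\<close> is
  inverted.
\<close>


section \<open>Signed sums of words\<close>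

text \<open>Sums of words are always tested against an arbitrary functional \<open>F\<close>.
  Reading off the first letter replaces \<open>F\<close> by \<open>F\<close> with that letter
  prepended, so every recursion stays within one kind of statement; multilinearity of
  \<open>F\<close> turns a sum of values of a cochain into a single letter.

  As \<open>F\<close> has no fixed arity, the sum over all insertions of differentials is finite
  only because each differential lowers the degree in the complex by one, until zero objects are
  reached. This is where boundedness below enters.

  The signs of the extension and of the homotopy have one origin. The crossing into degree
  \<open>l\<close> has suspended degree \<open>- l - 1\<close>, and exchanging it with a letter or a
  differential that ends in degree \<open>l\<close> costs the sign of \<open>l\<close>; this is the
  sign attached to each letter of \<open>delta_words\<close>.

  As to the algebras, the differential is the commutator with the one-letter word of the dg
  structure in the tensor coalgebra, so its axioms reduce to associativity of the product and to
  \<open>b{b} = 0\<close>.\<close>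

lemma ksign_zero_exp [simp]: "ksign 0 x = x"
  by (simp add: ksign_def)

lemma ksign_zero [simp]: "ksign e 0 = 0"
  by (simp add: ksign_def)

lemma ksign_add: "ksign e (x + y) = ksign e x + ksign e y"
  by (simp add: ksign_def)

lemma ksign_minus: "ksign e (- x) = - ksign e x"
  by (simp add: ksign_def)

lemma ksign_diff: "ksign e (x - y) = ksign e x - ksign e y"
  by (simp add: ksign_def)

lemma ksign_ksign: "ksign e (ksign f x) = ksign (e + f) x"
  by (auto simp: ksign_def)

lemma ksign_cong: "even (e - f) \<Longrightarrow> ksign e x = ksign f x"
  by (auto simp: ksign_def)

lemma ksign_uminus_exp: "ksign (- e) x = ksign e x"
  by (auto simp: ksign_def)

lemma ksign_sum: "ksign e (sum f A) = (\<Sum>x\<in>A. ksign e (f x))"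
  by (simp add: ksign_def sum_negf)

lemma ksign_apply: "ksign e f i = ksign e (f i)"
  by (simp add: ksign_def)

text \<open>A list of pairs \<open>(e, t)\<close> stands for the formal sum of the \<open>(-1)\<^sup>e t\<close>, and \<open>lsum L F\<close> for its image
  under \<open>F\<close>.\<close>

definition lsum :: "(int \<times> 'a) list \<Rightarrow> ('a \<Rightarrow> 'v::ab_group_add) \<Rightarrow> 'v" where
  "lsum L F = (\<Sum>(e, t)\<leftarrow>L. ksign e (F t))"

definition pre :: "int \<Rightarrow> ('a \<Rightarrow> 'b) \<Rightarrow> (int \<times> 'a) list \<Rightarrow> (int \<times> 'b) list" where
  "pre k h L = map (\<lambda>(e, t). (e + k, h t)) L"

definition lbind :: "(int \<times> 'a) list \<Rightarrow> ('a \<Rightarrow> (int \<times> 'b) list) \<Rightarrow> (int \<times> 'b) list" where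
  "lbind L M = concat (map (\<lambda>(e, t). pre e id (M t)) L)"

lemma lsum_Nil [simp]: "lsum [] F = 0"
  by (simp add: lsum_def)

lemma lsum_Cons [simp]: "lsum ((e, t) # L) F = ksign e (F t) + lsum L F"
  by (simp add: lsum_def)

lemma lsum_append [simp]: "lsum (L @ M) F = lsum L F + lsum M F"
  by (simp add: lsum_def)

lemma lsum_cong:
  "(\<And>e t. (e, t) \<in> set L \<Longrightarrow> F t = G t) \<Longrightarrow> lsum L F = lsum L G"
  unfolding lsum_def by (rule arg_cong[where f = sum_list], rule map_cong) auto

lemma lsum_zero [simp]: "lsum L (\<lambda>t. 0) = 0"
  by (induction L) auto

lemma lsum_eq_0: "(\<And>e t. (e, t) \<in> set L \<Longrightarrow> F t = 0) \<Longrightarrow> lsum L F = 0"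
  using lsum_cong[of L F "\<lambda>t. 0"] by simp

lemma lsum_add: "lsum L (\<lambda>t. F t + G t) = lsum L F + lsum L G"
  by (induction L) (auto simp: ksign_add)

lemma lsum_ksign: "lsum L (\<lambda>t. ksign k (F t)) = ksign k (lsum L F)"
  by (induction L) (auto simp: ksign_add ksign_ksign add.commute)

lemma lsum_minus: "lsum L (\<lambda>t. - F t) = - lsum L F"
  by (induction L) (auto simp: ksign_minus)

lemma lsum_diff: "lsum L (\<lambda>t. F t - G t) = lsum L F - lsum L G"
  by (induction L) (auto simp: ksign_diff)

lemma lsum_apply: "lsum L G x = lsum L (\<lambda>t. G t x)"
  by (induction L) (auto simp: ksign_apply)

lemma lsum_swap: "lsum L (\<lambda>x. lsum M (G x)) = lsum M (\<lambda>y. lsum L (\<lambda>x. G x y))"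
  by (induction L) (auto simp: lsum_add lsum_ksign)

lemma lsum_pre [simp]: "lsum (pre k h L) F = ksign k (lsum L (\<lambda>t. F (h t)))"
  by (induction L) (auto simp: pre_def ksign_add ksign_ksign add.commute)

lemma lsum_lbind [simp]: "lsum (lbind L M) F = lsum L (\<lambda>t. lsum (M t) F)"
  by (induction L) (auto simp: lbind_def)

text \<open>Cochains are additive only on letters from the hom-modules, hence the subgroup
  \<open>H\<close>. That the sum stays in \<open>H\<close> is needed for the induction; with
  \<open>g = id\<close> the lemma serves just to place sums of values in a hom-module.\<close>

lemma lsum_additive_on:
  fixes g :: "'v::ab_group_add \<Rightarrow> 'w::ab_group_add"
  assumes add: "\<And>x y. x \<in> H \<Longrightarrow> y \<in> H \<Longrightarrow> g (x + y) = g x + g y"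
    and H: "0 \<in> H" "\<And>x y. x \<in> H \<Longrightarrow> y \<in> H \<Longrightarrow> x + y \<in> H" "\<And>x. x \<in> H \<Longrightarrow> - x \<in> H"
    and F: "\<And>e t. (e, t) \<in> set L \<Longrightarrow> F t \<in> H"
  shows "lsum L F \<in> H \<and> g (lsum L F) = lsum L (\<lambda>t. g (F t))"
proof -
  have g0: "g 0 = 0"
    using add[of 0 0] H(1) by simp
  have gm: "g (- x) = - g x" if "x \<in> H" for x
    using add[of x "- x"] H(3) that g0 by (simp add: eq_neg_iff_add_eq_0 add.commute)
  have k: "ksign e x \<in> H \<and> g (ksign e x) = ksign e (g x)" if "x \<in> H" for e x
    using that H(3) gm by (auto simp: ksign_def)
  show ?thesis
    using F
  proof (induction L)
    case Nil
    then show ?case using H g0 by simp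
  next
    case (Cons a L)
    obtain e t where a: "a = (e, t)" by (cases a)
    have "F t \<in> H" "lsum L F \<in> H \<and> g (lsum L F) = lsum L (\<lambda>t. g (F t))"
      using Cons a by auto
    then show ?case
      using k[of "F t" e] H add a by auto
  qed
qed

lemma lsum_additive:
  fixes g :: "'v::ab_group_add \<Rightarrow> 'w::ab_group_add"
  assumes "\<And>x y. g (x + y) = g x + g y"
  shows "g (lsum L F) = lsum L (\<lambda>t. g (F t))"
  using lsum_additive_on[of UNIV g L F] assms by simp

lemma set_pre: "(e, t) \<in> set (pre k h L) \<longleftrightarrow> (\<exists>e' t'. (e', t') \<in> set L \<and> e = e' + k \<and> t = h t')"
  by (force simp: pre_def)

lemma set_lbind:
  "(e, t) \<in> set (lbind L M) \<longleftrightarrow> (\<exists>e1 x e2. (e1, x) \<in> set L \<and> (e2, t) \<in> set (M x) \<and> e = e2 + e1)"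
  by (force simp: lbind_def set_pre)

section \<open>Deconcatenation of words\<close>

primrec splittings :: "'a list \<Rightarrow> (int \<times> 'a list \<times> 'a list) list" where
  "splittings [] = [(0, [], [])]"
| "splittings (x # w) = (0, [], x # w) # pre 0 (\<lambda>(u, v). (x # u, v)) (splittings w)"

lemma lsum_splittings_Nil [simp]: "lsum (splittings []) F = F ([], [])"
  by simp

lemma lsum_splittings_Cons [simp]:
  "lsum (splittings (x # w)) F = F ([], x # w) + lsum (splittings w) (\<lambda>(u, v). F (x # u, v))"
  by (simp add: split_def)

declare splittings.simps [simp del]

lemma set_splittings: "(e, u, v) \<in> set (splittings w) \<longleftrightarrow> e = 0 \<and> u @ v = w"
proof (induction w arbitrary: e u v)
  case Nil
  then show ?case by (auto simp: splittings.simps)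
next
  case (Cons a w)
  have "(e, u, v) \<in> set (splittings (a # w)) \<longleftrightarrow>
     e = 0 \<and> (u = [] \<and> v = a # w \<or> (\<exists>u'. u = a # u' \<and> u' @ v = w))"
    using Cons by (auto simp: splittings.simps set_pre)
  then show ?case by (auto simp: append_eq_Cons_conv)
qed

lemma lsum_splittings_eq_sum:
  "lsum (splittings w) F = (\<Sum>j\<le>length w. F (take j w, drop j w))"
  by (induction w arbitrary: F) (auto simp: sum.atMost_Suc_shift split_def simp del: sum.atMost_Suc)

text \<open>Coassociativity of deconcatenation: both sides run over the cuts of \<open>w\<close>
  into three pieces.\<close>

lemma lsum_splittings_assoc:
  "lsum (splittings w) (\<lambda>(u, v). lsum (splittings v) (\<lambda>(v1, v2). G u v1 v2)) =
   lsum (splittings w) (\<lambda>(u, v). lsum (splittings u) (\<lambda>(u1, u2). G u1 u2 v))"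
proof (induction w arbitrary: G)
  case Nil
  then show ?case by simp
next
  case (Cons x w)
  have "lsum (splittings (x # w)) (\<lambda>(u, v). lsum (splittings u) (\<lambda>(u1, u2). G u1 u2 v)) =
     G [] [] (x # w) + lsum (splittings w) (\<lambda>(u, v). G [] (x # u) v
        + lsum (splittings u) (\<lambda>(u1, u2). G (x # u1) u2 v))"
    by (simp add: split_def)
  also have "\<dots> = G [] [] (x # w) + lsum (splittings w) (\<lambda>(u, v). G [] (x # u) v)
        + lsum (splittings w) (\<lambda>(u, v). lsum (splittings v) (\<lambda>(v1, v2). G (x # u) v1 v2))"
    using Cons[of "\<lambda>u. G (x # u)"] by (simp add: split_def lsum_add)
  also have "\<dots> = lsum (splittings (x # w)) (\<lambda>(u, v). lsum (splittings v) (\<lambda>(v1, v2). G u v1 v2))"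
    by (simp add: split_def)
  finally show ?case by simp
qed

lemma lsum_splittings_snoc:
  "lsum (splittings (w @ [g])) F = lsum (splittings w) (\<lambda>(u, v). F (u, v @ [g])) + F (w @ [g], [])"
  by (induction w arbitrary: F) (auto simp: split_def add.assoc)

section \<open>Degree, source and composability of words; insertion of cochains\<close>

lemma wdeg_Nil [simp]: "wdeg [] = 0"
  by (simp add: wdeg_def)

lemma wdeg_Cons [simp]: "wdeg ((d, x) # w) = d + wdeg w"
  by (simp add: wdeg_def)

lemma wdeg_append [simp]: "wdeg (u @ v) = wdeg u + wdeg v"
  by (simp add: wdeg_def)

lemma src_Nil [simp]: "src B [] = B"
  by (simp add: src_def)

lemma src_Cons [simp]: "src B ((d, x, A) # w) = src A w"
  by (simp add: src_def)

lemma src_append [simp]: "src B (u @ v) = src (src B u) v"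
  by (induction u arbitrary: B) auto

lemma sword_append: "sword Q B (u @ v) \<longleftrightarrow> sword Q B u \<and> sword Q (src B u) v"
proof (induction u arbitrary: B)
  case Nil
  then show ?case by (cases v) auto
qed auto

lemma sword_obj: "sword Q B w \<Longrightarrow> B \<in> QObj Q"
  by (cases w) auto

lemma sword_src: "sword Q B w \<Longrightarrow> src B w \<in> QObj Q"
  by (induction Q B w rule: sword.induct) auto

text \<open>The words that occur in \<open>\<Sum> (1 \<otimes> \<dots> \<otimes> \<psi>\<^sub>1 \<otimes> 1 \<otimes> \<dots> \<otimes> \<psi>\<^sub>r \<otimes> 1 \<otimes> \<dots> \<otimes> 1)(w)\<close>, for \<open>w\<close> preceded by arguments
  of degree \<open>s\<close>.  In contrast to \<open>brace_sum\<close>, the recursion looks at one letter at a time: either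
  it is skipped, or \<open>\<psi>\<^sub>1\<close> starts in front of it.\<close>

fun brace_words ::
  "(int \<times> ('o, 'm) cochain) list \<Rightarrow> int \<Rightarrow> 'o \<Rightarrow> ('o, 'm) qpath \<Rightarrow> (int \<times> ('o, 'm) qpath) list" where
  "brace_words [] s B w = [(0, w)]"
| "brace_words ((p, \<psi>) # Y) s B w =
     (case w of [] \<Rightarrow> [] | (d, x, A) # w' \<Rightarrow> pre 0 (Cons (d, x, A)) (brace_words ((p, \<psi>) # Y) (s + d) A w')) @
     lbind (splittings w) (\<lambda>(u, v). pre (p * s) (Cons (p + wdeg u, \<psi> B u, src B u))
        (brace_words Y (s + wdeg u) (src B u) v))"

declare brace_words.simps(2) [simp del]

text \<open>The half of the recursion of \<open>brace_words\<close> in which \<psi> starts right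
  here, possibly swallowing nothing; the other half skips a letter. Later inductions compare the two
  halves separately.\<close>

definition consume ::
  "int \<Rightarrow> ('o, 'm) cochain \<Rightarrow> (int \<times> ('o, 'm) cochain) list \<Rightarrow> int \<Rightarrow> 'o \<Rightarrow> ('o, 'm) qpath \<Rightarrow>
   (('o, 'm) qpath \<Rightarrow> 'v::ab_group_add) \<Rightarrow> 'v" where
  "consume p \<psi> Y s B w F =
     ksign (p * s) (lsum (splittings w) (\<lambda>(u, v). lsum (brace_words Y (s + wdeg u) (src B u) v)
        (\<lambda>t. F ((p + wdeg u, \<psi> B u, src B u) # t))))"

lemma lsum_brace_words_ne:
  "lsum (brace_words ((p, \<psi>) # Y) s B w) F =
     (case w of [] \<Rightarrow> 0 | (d, x, A) # w' \<Rightarrow>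
        lsum (brace_words ((p, \<psi>) # Y) (s + d) A w') (\<lambda>t. F ((d, x, A) # t)))
     + consume p \<psi> Y s B w F"
proof -
  have *: "(\<lambda>t. lsum (case t of (u, v) \<Rightarrow> pre (p * s) (Cons (p + wdeg u, \<psi> B u, src B u))
        (brace_words Y (s + wdeg u) (src B u) v)) F) =
     (\<lambda>t. ksign (p * s) (case t of (u, v) \<Rightarrow> lsum (brace_words Y (s + wdeg u) (src B u) v)
        (\<lambda>t. F ((p + wdeg u, \<psi> B u, src B u) # t))))"
    by (auto simp: fun_eq_iff)
  show ?thesis
    by (subst brace_words.simps(2)) (auto simp: consume_def * lsum_ksign split: list.splits)
qed

text \<open>In the double sum of \<open>brace_sum\<close>, the terms with \<open>i = 0\<close> are
  those where \<psi> starts in front of \<open>w\<close>. The terms with positive \<open>i\<close>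
  skip the first letter and form the same double sum for the rest of \<open>w\<close>.\<close>

lemma brace_sum_eq: "brace_sum Y s B w F = lsum (brace_words Y s B w) F"
proof (induction Y arbitrary: s B w F)
  case Nil
  then show ?case by simp
next
  case (Cons y Y)
  obtain p \<psi> where y: "y = (p, \<psi>)" by (cases y)
  define I where "I s B w F = (\<Sum>j\<le>length w. let v = take j w; C' = src B v in
        ksign (p * s) (brace_sum Y (s + wdeg v) C' (drop j w)
            (\<lambda>t. F ((p + wdeg v, \<psi> B v, C') # t))))"
    for s B and w :: "('b, 'a) qpath" and F :: "('b, 'a) qpath \<Rightarrow> 'a"
  have I: "I s B w F = consume p \<psi> Y s B w F" for s B w F
    by (simp add: I_def consume_def lsum_splittings_eq_sum Let_def ksign_sum Cons)
  show ?case
    unfolding y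
  proof (induction w arbitrary: s B F)
    case Nil
    have "brace_sum ((p, \<psi>) # Y) s B [] F = I s B [] F"
      by (simp add: I_def Let_def)
    then show ?case by (simp add: lsum_brace_words_ne I)
  next
    case (Cons x w)
    obtain d f A where x: "x = (d, f, A)" by (cases x) auto
    have "brace_sum ((p, \<psi>) # Y) s B (x # w) F =
       I s B (x # w) F + brace_sum ((p, \<psi>) # Y) (s + d) A w (\<lambda>t. F (x # t))"
      unfolding brace_sum.simps I_def length_Cons sum.atMost_Suc_shift[of _ "length w"]
        sum.shift_bounds_cl_Suc_ivl
      by (simp add: Let_def x atLeast0AtMost add.assoc sum.atMost_Suc_shift
          del: sum.atMost_Suc sum.cl_ivl_Suc)
    then show ?case
      unfolding I Cons.IH x lsum_brace_words_ne[of p \<psi> Y s B "(d, f, A) # w"] by simp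
  qed
qed

lemma brace_eq: "brace Q \<phi> Y B w = (if sword Q B w then lsum (brace_words Y 0 B w) (\<phi> B) else 0)"
  by (simp add: brace_def brace_sum_eq)

text \<open>Further arguments of total degree \<open>k\<close> in front are passed once by each
  inserted cochain, and the degrees of these add up to \<open>wdeg Y\<close>.\<close>

lemma lsum_brace_words_shift:
  "lsum (brace_words Y (s + k) B w) F = ksign (k * wdeg Y) (lsum (brace_words Y s B w) F)"
proof (induction "(Y, w)" arbitrary: Y w s B F rule: wf_induct_rule[OF wf_measure[of "\<lambda>(Y, w). length Y + length w"]])
  case 1
  note IH = 1[simplified]
  show ?case
  proof (cases Y)
    case Nil
    then show ?thesis by simp
  next
    case (Cons y Y')
    obtain p \<psi> where y: "y = (p, \<psi>)" by (cases y)
    have c: "consume p \<psi> Y' (s + k) B w F = ksign (k * wdeg Y) (consume p \<psi> Y' s B w F)"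
    proof -
      have "lsum (splittings w) (\<lambda>(u, v). lsum (brace_words Y' (s + k + wdeg u) (src B u) v)
          (\<lambda>t. F ((p + wdeg u, \<psi> B u, src B u) # t))) =
        lsum (splittings w) (\<lambda>(u, v). ksign (k * wdeg Y') (lsum (brace_words Y' (s + wdeg u) (src B u) v)
          (\<lambda>t. F ((p + wdeg u, \<psi> B u, src B u) # t))))"
        apply (rule lsum_cong)
        apply (clarsimp simp: set_splittings)
        subgoal for u v
          using IH[of Y' v "s + wdeg u" "src B u"] by (simp add: Cons ac_simps)
        done
      then show ?thesis
        by (simp add: consume_def Cons y split_def lsum_ksign ksign_ksign distrib_left ac_simps)
    qed
    show ?thesis
    proof (cases w)
      case Nil
      then show ?thesis using c by (simp add: Cons y lsum_brace_words_ne)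
    next
      case (Cons a w')
      obtain d f A where x: "a = (d, f, A)" by (cases a) auto
      have "lsum (brace_words Y (s + k + d) A w') (\<lambda>t. F (a # t)) =
        ksign (k * wdeg Y) (lsum (brace_words Y (s + d) A w') (\<lambda>t. F (a # t)))"
        using IH[of Y w' "s + d" A] Cons by (simp add: ac_simps)
      then show ?thesis
        using c by (simp add: Cons \<open>Y = y # Y'\<close> y lsum_brace_words_ne x ksign_add)
    qed
  qed
qed

lemma lsum_splittings_mid:
  "lsum (splittings (u @ x # v)) (\<lambda>(a, b). G a b) =
   lsum (splittings u) (\<lambda>(u1, u2). G u1 (u2 @ x # v)) + lsum (splittings v) (\<lambda>(v1, v2). G (u @ x # v1) v2)"
  by (induction u arbitrary: G) (auto simp: split_def add.assoc)

text \<open>An inserted cochain yields a single letter, so no cut of the resulting word goes through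
  an insertion: it cuts both \<open>Z\<close> and \<open>w\<close>. What stands in front of the
  second part is counted by \<open>wdeg w1\<close> and not by the degree of \<open>t1\<close>,
  because a Koszul sign counts only the original letters that a cochain passes.\<close>

lemma lsum_brace_words_comult:
  "lsum (brace_words Z s B w) (\<lambda>t. lsum (splittings t) (\<lambda>(t1, t2). G t1 t2)) =
   lsum (splittings Z) (\<lambda>(Z1, Z2). lsum (splittings w) (\<lambda>(w1, w2).
     lsum (brace_words Z1 s B w1) (\<lambda>t1. lsum (brace_words Z2 (s + wdeg w1) (src B w1) w2) (\<lambda>t2. G t1 t2))))"
proof (induction "(Z, w)" arbitrary: Z w s B G rule: wf_induct_rule[OF wf_measure[of "\<lambda>(Z, w). length Z + length w"]])
  case 1
  note IH = 1[simplified]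
  show ?case
  proof (cases Z)
    case Nil
    then show ?thesis by simp
  next
    case (Cons z Z')
    obtain p \<zeta> where z: "z = (p, \<zeta>)" by (cases z)
    have Z: "Z = (p, \<zeta>) # Z'" by (simp add: Cons z)
    let ?H = "\<lambda>x t'. lsum (splittings t') (\<lambda>(t1, t2). G (x # t1) t2)"
    let ?X = "\<lambda>Z1 Z2 w1 w2 G. lsum (brace_words Z1 s B w1) (\<lambda>t1. lsum (brace_words Z2 (s + wdeg w1) (src B w1) w2) (\<lambda>t2. G t1 t2))"
    let ?P = "case w of [] \<Rightarrow> 0 | (d, x, A) # w' \<Rightarrow> lsum (brace_words Z (s + d) A w') (?H (d, x, A))"
    let ?C = "consume p \<zeta> Z' s B w (\<lambda>t. case t of [] \<Rightarrow> 0 | x # t' \<Rightarrow> ?H x t')"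
    have "lsum (brace_words Z s B w) (\<lambda>t. lsum (splittings t) (\<lambda>(t1, t2). G t1 t2)) =
       lsum (brace_words Z s B w) (\<lambda>t. G [] t + (case t of [] \<Rightarrow> 0 | x # t' \<Rightarrow> ?H x t'))"
      by (rule lsum_cong) (auto simp: split_def split: list.splits)
    also have "\<dots> = lsum (brace_words Z s B w) (G []) + (?P + ?C)"
      unfolding lsum_add
      by (simp add: Z lsum_brace_words_ne[of p \<zeta> Z' s B w "\<lambda>t. case t of [] \<Rightarrow> 0 | x # t' \<Rightarrow> ?H x t'"] split: list.splits)
    finally have L: "lsum (brace_words Z s B w) (\<lambda>t. lsum (splittings t) (\<lambda>(t1, t2). G t1 t2)) =
       lsum (brace_words Z s B w) (G []) + (?P + ?C)" .
    have PP: "?P = (case w of [] \<Rightarrow> 0 | (d, x, A) # w' \<Rightarrow>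
       lsum (splittings w') (\<lambda>(w1, w2). lsum (brace_words Z (s + d + wdeg w1) (src A w1) w2) (G ((d, x, A) # w1))) +
       lsum (splittings Z') (\<lambda>(Z1, Z2). lsum (splittings w') (\<lambda>(w1, w2).
         lsum (brace_words ((p, \<zeta>) # Z1) (s + d) A w1) (\<lambda>t1. lsum (brace_words Z2 (s + d + wdeg w1) (src A w1) w2)
           (\<lambda>t2. G ((d, x, A) # t1) t2)))))"
    proof (cases w)
      case Nil
      then show ?thesis by simp
    next
      case (Cons a w')
      obtain d x A where a: "a = (d, x, A)" by (cases a) auto
      show ?thesis
        using IH[of Z w' "s + d" A "\<lambda>t1. G (a # t1)"] Cons a
        by (simp add: Z split_def)
    qed
    have CC: "?C = lsum (splittings Z') (\<lambda>(Z1, Z2). lsum (splittings w) (\<lambda>(w1, w2).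
        consume p \<zeta> Z1 s B w1 (\<lambda>t1. lsum (brace_words Z2 (s + wdeg w1) (src B w1) w2) (\<lambda>t2. G t1 t2))))"
    proof -
      have "?C = ksign (p * s) (lsum (splittings w) (\<lambda>(u, v). lsum (brace_words Z' (s + wdeg u) (src B u) v)
         (\<lambda>t. lsum (splittings t) (\<lambda>(t1, t2). G ((p + wdeg u, \<zeta> B u, src B u) # t1) t2))))"
        by (simp add: consume_def)
      also have "\<dots> = ksign (p * s) (lsum (splittings w) (\<lambda>(u, v). lsum (splittings Z') (\<lambda>(Z1, Z2).
           lsum (splittings v) (\<lambda>(v1, v2). lsum (brace_words Z1 (s + wdeg u) (src B u) v1)
            (\<lambda>t1. lsum (brace_words Z2 (s + wdeg u + wdeg v1) (src (src B u) v1) v2)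
             (\<lambda>t2. G ((p + wdeg u, \<zeta> B u, src B u) # t1) t2))))))"
        apply (intro arg_cong[where f = "ksign _"] lsum_cong)
        apply (clarsimp simp: set_splittings)
        subgoal for u v
          using IH[of Z' v "s + wdeg u" "src B u" "\<lambda>t1. G ((p + wdeg u, \<zeta> B u, src B u) # t1)"]
          by (simp add: Z)
        done
      also have "\<dots> = ksign (p * s) (lsum (splittings Z') (\<lambda>(Z1, Z2). lsum (splittings w) (\<lambda>(u, v).
           lsum (splittings v) (\<lambda>(v1, v2). lsum (brace_words Z1 (s + wdeg u) (src B u) v1)
            (\<lambda>t1. lsum (brace_words Z2 (s + wdeg (u @ v1)) (src B (u @ v1)) v2)
             (\<lambda>t2. G ((p + wdeg u, \<zeta> B u, src B u) # t1) t2))))))"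
        unfolding split_def lsum_swap[of "splittings w"] by (simp add: add.assoc)
      \<comment> \<open>Cutting what \<zeta> has left over after swallowing \<open>u\<close> amounts
        to cutting \<open>w\<close> and letting \<zeta> swallow an initial piece of the first
        part.\<close>
      also have "\<dots> = ksign (p * s) (lsum (splittings Z') (\<lambda>(Z1, Z2). lsum (splittings w) (\<lambda>(w1, w2).
           lsum (splittings w1) (\<lambda>(u, v). lsum (brace_words Z1 (s + wdeg u) (src B u) v)
            (\<lambda>t1. lsum (brace_words Z2 (s + wdeg (u @ v)) (src B (u @ v)) w2)
             (\<lambda>t2. G ((p + wdeg u, \<zeta> B u, src B u) # t1) t2))))))"
        by (intro arg_cong[where f = "ksign _"] lsum_cong) (clarsimp simp: set_splittings lsum_splittings_assoc simp del: wdeg_append src_append)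
      also have "\<dots> = ksign (p * s) (lsum (splittings Z') (\<lambda>(Z1, Z2). lsum (splittings w) (\<lambda>(w1, w2).
           lsum (splittings w1) (\<lambda>(u, v). lsum (brace_words Z1 (s + wdeg u) (src B u) v)
            (\<lambda>t1. lsum (brace_words Z2 (s + wdeg w1) (src B w1) w2)
             (\<lambda>t2. G ((p + wdeg u, \<zeta> B u, src B u) # t1) t2))))))"
        apply (intro arg_cong[where f = "ksign _"] lsum_cong)
        apply (clarsimp simp del: wdeg_append src_append)
        apply (intro lsum_cong)
        apply (clarsimp simp del: wdeg_append src_append)
        apply (intro lsum_cong)
        apply (auto simp: set_splittings simp del: wdeg_append src_append)
        done
      finally show ?thesis
        by (simp add: consume_def split_def lsum_ksign)
    qed
    have R: "lsum (splittings Z) (\<lambda>(Z1, Z2). lsum (splittings w) (\<lambda>(w1, w2). ?X Z1 Z2 w1 w2 G)) =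
       lsum (splittings w) (\<lambda>(w1, w2). lsum (brace_words Z (s + wdeg w1) (src B w1) w2) (G w1)) +
       lsum (splittings Z') (\<lambda>(Z1, Z2). lsum (splittings w) (\<lambda>(w1, w2). ?X ((p, \<zeta>) # Z1) Z2 w1 w2 G))"
      by (simp add: Z)
    have R1: "lsum (splittings w) (\<lambda>(w1, w2). lsum (brace_words Z (s + wdeg w1) (src B w1) w2) (G w1)) =
       lsum (brace_words Z s B w) (G []) + (case w of [] \<Rightarrow> 0 | (d, x, A) # w' \<Rightarrow>
         lsum (splittings w') (\<lambda>(w1, w2). lsum (brace_words Z (s + d + wdeg w1) (src A w1) w2) (G ((d, x, A) # w1))))"
      by (auto split: list.splits simp: add.assoc)
    have "lsum (splittings Z') (\<lambda>(Z1, Z2). lsum (splittings w) (\<lambda>(w1, w2). ?X ((p, \<zeta>) # Z1) Z2 w1 w2 G)) =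
      lsum (splittings Z') (\<lambda>(Z1, Z2). lsum (splittings w) (\<lambda>(w1, w2).
        (case w1 of [] \<Rightarrow> 0 | (d, x, A) # w' \<Rightarrow>
          lsum (brace_words ((p, \<zeta>) # Z1) (s + d) A w') (\<lambda>t1. lsum (brace_words Z2 (s + wdeg w1) (src B w1) w2)
           (\<lambda>t2. G ((d, x, A) # t1) t2))))) + ?C"
    proof -
      have eq: "?X ((p, \<zeta>) # Z1) Z2 w1 w2 G =
        (case w1 of [] \<Rightarrow> 0 | (d, x, A) # w' \<Rightarrow>
          lsum (brace_words ((p, \<zeta>) # Z1) (s + d) A w') (\<lambda>t1. lsum (brace_words Z2 (s + wdeg w1) (src B w1) w2)
           (\<lambda>t2. G ((d, x, A) # t1) t2))) +
        consume p \<zeta> Z1 s B w1 (\<lambda>t1. lsum (brace_words Z2 (s + wdeg w1) (src B w1) w2) (\<lambda>t2. G t1 t2))"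
        for Z1 Z2 w1 w2
        by (rule lsum_brace_words_ne)
      show ?thesis
        unfolding CC eq by (simp add: lsum_add split_def)
    qed
    also have "lsum (splittings Z') (\<lambda>(Z1, Z2). lsum (splittings w) (\<lambda>(w1, w2).
        (case w1 of [] \<Rightarrow> 0 | (d, x, A) # w' \<Rightarrow>
          lsum (brace_words ((p, \<zeta>) # Z1) (s + d) A w') (\<lambda>t1. lsum (brace_words Z2 (s + wdeg w1) (src B w1) w2)
           (\<lambda>t2. G ((d, x, A) # t1) t2))))) =
       (case w of [] \<Rightarrow> 0 | (d, x, A) # w' \<Rightarrow>
       lsum (splittings Z') (\<lambda>(Z1, Z2). lsum (splittings w') (\<lambda>(w1, w2).
         lsum (brace_words ((p, \<zeta>) # Z1) (s + d) A w1) (\<lambda>t1. lsum (brace_words Z2 (s + d + wdeg w1) (src A w1) w2)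
           (\<lambda>t2. G ((d, x, A) # t1) t2)))))"
      by (cases w) (auto simp: split_def add.assoc split: list.splits)
    finally show ?thesis
      unfolding L R R1 PP by (auto split: list.splits)
  qed
qed


section \<open>The brace identity\<close>

text \<open>Additivity and homogeneity are merged into one condition on linear combinations, so that
  an induction proves both at once. The target has its own scalar multiplication because components
  of cochains on complexes are read as functionals with values in the ambient module of the linear
  category.\<close>

definition mlin ::
  "('k \<Rightarrow> 'm::ab_group_add \<Rightarrow> 'm) \<Rightarrow> ('k \<Rightarrow> 'v::ab_group_add \<Rightarrow> 'v) \<Rightarrow> ('o, 'm, 'z) quiver_scheme \<Rightarrow>
   'o \<Rightarrow> (('o, 'm) qpath \<Rightarrow> 'v) \<Rightarrow> bool" where
  "mlin scl sco Q B F \<longleftrightarrow>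
     (\<forall>u d x y A v a c. sword Q B (u @ (d, x, A) # v) \<longrightarrow> sword Q B (u @ (d, y, A) # v) \<longrightarrow>
        F (u @ (d, scl a x + scl c y, A) # v) =
          sco a (F (u @ (d, x, A) # v)) + sco c (F (u @ (d, y, A) # v)))"

lemma mlinD:
  "mlin scl sco Q B F \<Longrightarrow> sword Q B (u @ (d, x, A) # v) \<Longrightarrow> sword Q B (u @ (d, y, A) # v) \<Longrightarrow>
   F (u @ (d, scl a x + scl c y, A) # v) =
     sco a (F (u @ (d, x, A) # v)) + sco c (F (u @ (d, y, A) # v))"
  by (simp add: mlin_def)

lemma mlin_head:
  "mlin scl sco Q B F \<Longrightarrow> sword Q B ((d, x, A) # v) \<Longrightarrow> sword Q B ((d, y, A) # v) \<Longrightarrow>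
   F ((d, scl a x + scl c y, A) # v) = sco a (F ((d, x, A) # v)) + sco c (F ((d, y, A) # v))"
  using mlinD[of scl sco Q B F "[]"] by simp

lemma mlin_Cons:
  assumes "mlin scl sco Q B F" "B \<in> QObj Q" "x \<in> QHom Q A B (d + 1)"
  shows "mlin scl sco Q A (\<lambda>t. F ((d, x, A) # t))"
  unfolding mlin_def
proof (intro allI impI)
  fix u d' y z A' v a c
  assume "sword Q A (u @ (d', y, A') # v)" "sword Q A (u @ (d', z, A') # v)"
  then show "F ((d, x, A) # u @ (d', scl a y + scl c z, A') # v) =
     sco a (F ((d, x, A) # u @ (d', y, A') # v)) + sco c (F ((d, x, A) # u @ (d', z, A') # v))"
    using mlinD[OF assms(1), of "(d, x, A) # u" d' y A' v z a c] assms(2,3) by simp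
qed

locale gquiver =
  fixes sc :: "'k::comm_ring_1 \<Rightarrow> 'm::ab_group_add \<Rightarrow> 'm"
    and Q :: "('o, 'm, 'z) quiver_scheme"
  assumes module_sc: "module sc"
    and QHom_sub: "X \<in> QObj Q \<Longrightarrow> Y \<in> QObj Q \<Longrightarrow> module.subspace sc (QHom Q X Y n)"
begin

sublocale md: module sc by (rule module_sc)

lemma QHom_0: "X \<in> QObj Q \<Longrightarrow> Y \<in> QObj Q \<Longrightarrow> 0 \<in> QHom Q X Y n"
  using QHom_sub md.subspace_0 by blast

lemma QHom_add:
  "X \<in> QObj Q \<Longrightarrow> Y \<in> QObj Q \<Longrightarrow> x \<in> QHom Q X Y n \<Longrightarrow> y \<in> QHom Q X Y n \<Longrightarrow> x + y \<in> QHom Q X Y n"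
  using QHom_sub md.subspace_add by blast

lemma QHom_scale:
  "X \<in> QObj Q \<Longrightarrow> Y \<in> QObj Q \<Longrightarrow> x \<in> QHom Q X Y n \<Longrightarrow> sc c x \<in> QHom Q X Y n"
  using QHom_sub md.subspace_scale by blast

lemma QHom_minus:
  "X \<in> QObj Q \<Longrightarrow> Y \<in> QObj Q \<Longrightarrow> x \<in> QHom Q X Y n \<Longrightarrow> - x \<in> QHom Q X Y n"
  using QHom_sub md.subspace_neg by blast

lemma sc_ksign: "sc c (ksign e x) = ksign e (sc c x)"
  by (simp add: ksign_def)

lemma Cbr_val:
  "\<phi> \<in> Cbr sc Q p \<Longrightarrow> sword Q B w \<Longrightarrow> \<phi> B w \<in> QHom Q (src B w) B (wdeg w + p + 1)"
  by (simp add: Cbr_def)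

lemma Cbr_nosword: "\<phi> \<in> Cbr sc Q p \<Longrightarrow> \<not> sword Q B w \<Longrightarrow> \<phi> B w = 0"
  by (simp add: Cbr_def)

lemma sword_lin:
  "sword Q B (u @ (d, x, A) # v) \<Longrightarrow> sword Q B (u @ (d, y, A) # v) \<Longrightarrow>
   sword Q B (u @ (d, sc a x + sc c y, A) # v)"
  using sword_obj[of Q A v] by (auto simp: sword_append intro!: QHom_add QHom_scale)

lemma Cbr_mlin: "\<phi> \<in> Cbr sc Q p \<Longrightarrow> mlin sc sc Q B (\<phi> B)"
  unfolding mlin_def
proof (intro allI impI)
  fix u d x y A v a c
  assume \<phi>: "\<phi> \<in> Cbr sc Q p"
    and x: "sword Q B (u @ (d, x, A) # v)" and y: "sword Q B (u @ (d, y, A) # v)"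
  have sx: "sword Q B (u @ (d, sc a x, A) # v)" for a
    using sword_lin[OF x x, of a 0] by simp
  have sy: "sword Q B (u @ (d, sc a y, A) # v)" for a
    using sword_lin[OF y y, of a 0] by simp
  show "\<phi> B (u @ (d, sc a x + sc c y, A) # v) =
    sc a (\<phi> B (u @ (d, x, A) # v)) + sc c (\<phi> B (u @ (d, y, A) # v))"
    using \<phi> sx[of a] sy[of c] x y unfolding Cbr_def by auto
qed

lemma CbrI:
  assumes "\<And>B w. sword Q B w \<Longrightarrow> \<phi> B w \<in> QHom Q (src B w) B (wdeg w + p + 1)"
    and "\<And>B w. \<not> sword Q B w \<Longrightarrow> \<phi> B w = 0"
    and m: "\<And>B. mlin sc sc Q B (\<phi> B)"
  shows "\<phi> \<in> Cbr sc Q p"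
  unfolding Cbr_def
proof (intro CollectI conjI allI impI)
  fix B u d x y A v c
  assume "sword Q B (u @ (d, x, A) # v)" "sword Q B (u @ (d, y, A) # v)"
  then show "\<phi> B (u @ (d, x + y, A) # v) = \<phi> B (u @ (d, x, A) # v) + \<phi> B (u @ (d, y, A) # v)"
       "\<phi> B (u @ (d, sc c x, A) # v) = sc c (\<phi> B (u @ (d, x, A) # v))"
    using mlinD[OF m, of B u d x A v y 1 1] mlinD[OF m, of B u d x A v x c 0] by simp_all
qed (use assms(1,2) in auto)

lemma gword_Cons [simp]: "gword V ((p, x) # w) \<longleftrightarrow> x \<in> V p \<and> gword V w"
  by (auto simp: gword_def)

lemma gword_append [simp]: "gword V (u @ w) \<longleftrightarrow> gword V u \<and> gword V w"
  by (auto simp: gword_def)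

lemma gword_Nil [simp]: "gword V []"
  by (auto simp: gword_def)

lemma brace_words_valid:
  "(e, t) \<in> set (brace_words Y s B w) \<Longrightarrow> sword Q B w \<Longrightarrow> gword (Cbr sc Q) Y \<Longrightarrow>
   sword Q B t \<and> src B t = src B w \<and> wdeg t = wdeg Y + wdeg w"
proof (induction "(Y, w)" arbitrary: Y w s B e t rule: wf_induct_rule[OF wf_measure[of "\<lambda>(Y, w). length Y + length w"]])
  case 1
  note IH = 1(1)[simplified]
  show ?case
  proof (cases Y)
    case Nil
    then show ?thesis using 1 by simp
  next
    case (Cons y Y')
    obtain p \<psi> where y: "y = (p, \<psi>)" by (cases y)
    from 1(2)
    consider (pass) d x A w' e' t' where "w = (d, x, A) # w'" "t = (d, x, A) # t'" "(e', t') \<in> set (brace_words Y (s + d) A w')"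
      | (cons) u v e' t' where "u @ v = w" "t = (p + wdeg u, \<psi> B u, src B u) # t'" "(e', t') \<in> set (brace_words Y' (s + wdeg u) (src B u) v)"
      unfolding Cons y by (subst (asm) brace_words.simps(2)) (auto simp: set_pre set_lbind set_splittings split: list.splits)
    then show ?thesis
    proof cases
      case pass
      then show ?thesis using IH[OF _ pass(3)] 1(3,4) by auto
    next
      case cons
      have "sword Q B u" "sword Q (src B u) v"
        using 1(3) cons(1) by (auto simp: sword_append)
      then show ?thesis
        using IH[OF _ cons(3)] 1(4) cons(1,2) Cons y Cbr_val[of \<psi> p B u]
        by (auto simp: sword_obj add_ac)
    qed
  qed
qed

end

lemma lsum_splittings_cong:
  "(\<And>u v. w = u @ v \<Longrightarrow> F u v = G u v) \<Longrightarrow>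
   lsum (splittings w) (\<lambda>(u, v). F u v) = lsum (splittings w) (\<lambda>(u, v). G u v)"
  by (rule lsum_cong) (auto simp: set_splittings)

context gquiver
begin

lemma mlin_head_add:
  fixes sco :: "'k \<Rightarrow> 'v::ab_group_add \<Rightarrow> 'v"
  assumes "module sco" "mlin sc sco Q B F" "sword Q B ((d, x, A) # v)" "sword Q B ((d, y, A) # v)"
  shows "F ((d, x + y, A) # v) = F ((d, x, A) # v) + F ((d, y, A) # v)"
proof -
  interpret o: module sco by fact
  show ?thesis using mlin_head[OF assms(2,3,4), of 1 1] by simp
qed

lemma mlin_head_ksign:
  fixes sco :: "'k \<Rightarrow> 'v::ab_group_add \<Rightarrow> 'v"
  assumes "module sco" "mlin sc sco Q B F" "sword Q B ((d, x, A) # v)"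
  shows "F ((d, ksign e x, A) # v) = ksign e (F ((d, x, A) # v))"
proof -
  interpret o: module sco by fact
  show ?thesis using mlin_head[OF assms(2,3,3), of "if even e then 1 else - 1" 0]
    by (simp add: ksign_def split: if_splits)
qed

lemma mlin_head_0:
  fixes sco :: "'k \<Rightarrow> 'v::ab_group_add \<Rightarrow> 'v"
  assumes "module sco" "mlin sc sco Q B F" "B \<in> QObj Q" "sword Q A v"
  shows "F ((d, 0, A) # v) = 0"
proof -
  interpret o: module sco by fact
  have "sword Q B ((d, 0, A) # v)"
    using assms sword_obj[OF assms(4)] QHom_0 by auto
  then show ?thesis using mlin_head[OF assms(2), of d 0 A v 0 0 0] by simp
qed

lemma lsum_head:
  fixes sco :: "'k \<Rightarrow> 'v::ab_group_add \<Rightarrow> 'v"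
  assumes "module sco" "mlin sc sco Q B F" "B \<in> QObj Q" "sword Q A v"
    and "\<And>e t. (e, t) \<in> set L \<Longrightarrow> h t \<in> QHom Q A B (d + 1)"
  shows "lsum L h \<in> QHom Q A B (d + 1)"
    and "F ((d, lsum L h, A) # v) = lsum L (\<lambda>t. F ((d, h t, A) # v))"
proof -
  have A: "A \<in> QObj Q" using sword_obj[OF assms(4)] .
  have "lsum L h \<in> QHom Q A B (d + 1) \<and>
    F ((d, lsum L h, A) # v) = lsum L (\<lambda>t. F ((d, h t, A) # v))"
    by (rule lsum_additive_on) (use assms A in \<open>auto intro!: mlin_head_add QHom_0 QHom_add QHom_minus\<close>)
  then show "lsum L h \<in> QHom Q A B (d + 1)"
    "F ((d, lsum L h, A) # v) = lsum L (\<lambda>t. F ((d, h t, A) # v))" by auto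
qed

lemma lsum_brace_words_QHom:
  assumes "sword Q B w" "gword (Cbr sc Q) Y" "\<phi> \<in> Cbr sc Q p"
  shows "lsum (brace_words Y s B w) (\<phi> B) \<in> QHom Q (src B w) B (wdeg w + (p + wdeg Y) + 1)"
proof -
  have "lsum (brace_words Y s B w) (\<phi> B) \<in> QHom Q (src B w) B (wdeg w + (p + wdeg Y) + 1)
     \<and> id (lsum (brace_words Y s B w) (\<phi> B)) = lsum (brace_words Y s B w) (\<lambda>t. id (\<phi> B t))"
  proof (rule lsum_additive_on)
    fix e t assume t: "(e, t) \<in> set (brace_words Y s B w)"
    show "\<phi> B t \<in> QHom Q (src B w) B (wdeg w + (p + wdeg Y) + 1)"
      using brace_words_valid[OF t assms(1,2)] Cbr_val[OF assms(3), of B t] by (auto simp: algebra_simps)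
  qed (use sword_obj[OF assms(1)] sword_src[OF assms(1)] in \<open>auto intro!: QHom_add QHom_0 QHom_minus\<close>)
  then show ?thesis by simp
qed

text \<open>The varying letter is skipped, or it lies behind the part that \<psi> swallows, or it is
  swallowed. The first two cases are inductive; in the last, linearity of \<psi> makes its value a
  linear combination, and \<open>F\<close> is linear in this new letter.\<close>

lemma mlin_lsum_brace_words:
  fixes sco :: "'k \<Rightarrow> 'v::ab_group_add \<Rightarrow> 'v"
  assumes mo: "module sco" and "mlin sc sco Q B F" "gword (Cbr sc Q) Y"
  shows "mlin sc sco Q B (\<lambda>w. lsum (brace_words Y s B w) F)"
proof -
  interpret o: module sco by fact
  have sum_lin: "lsum L (\<lambda>t. sco a (H t) + sco c (K t)) = sco a (lsum L H) + sco c (lsum L K)"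
    for L :: "(int \<times> 'x) list" and H K a c
    unfolding lsum_add
    using lsum_additive[of "sco a" L H] lsum_additive[of "sco c" L K] by (simp add: o.scale_right_distrib)
  have sum_lin2: "lsum L (\<lambda>(t, t'). sco a (H t t') + sco c (K t t')) =
      sco a (lsum L (\<lambda>(t, t'). H t t')) + sco c (lsum L (\<lambda>(t, t'). K t t'))"
    for L :: "(int \<times> 'x \<times> 'x) list" and H K a c
    by (simp add: split_def sum_lin)
  have sgn1: "ksign e (sco a x) = sco a (ksign e x)" for e a x
    by (simp add: ksign_def)
  have "sword Q B (u @ (d, x, A) # v) \<Longrightarrow> sword Q B (u @ (d, y, A) # v) \<Longrightarrow>
        mlin sc sco Q B F \<Longrightarrow> gword (Cbr sc Q) Y \<Longrightarrow>
        lsum (brace_words Y s B (u @ (d, sc a x + sc c y, A) # v)) F =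
          sco a (lsum (brace_words Y s B (u @ (d, x, A) # v)) F) + sco c (lsum (brace_words Y s B (u @ (d, y, A) # v)) F)"
    for u d x y A v a c
  proof (induction "(Y, u, v)" arbitrary: Y u v s B F
      rule: wf_induct_rule[OF wf_measure[of "\<lambda>(Y, u, v). length Y + length u + length v"]])
    case 1
    note IH = 1(1)[simplified]
    note sx = 1(2) note sy = 1(3) note F = 1(4) note Yg = 1(5)
    let ?l = "sc a x + sc c y"
    have sl: "sword Q B (u @ (d, ?l, A) # v)" by (rule sword_lin[OF sx sy])
    have B: "B \<in> QObj Q" using sword_obj[OF sx] .
    show ?case
    proof (cases Y)
      case Nil
      then show ?thesis using mlinD[OF F sx sy] by simp
    next
      case (Cons y' Y')
      obtain p \<psi> where y': "y' = (p, \<psi>)" by (cases y')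
      have Yg': "gword (Cbr sc Q) Y'" "\<psi> \<in> Cbr sc Q p" using Yg Cons y' by auto
      let ?P = "\<lambda>w. case w of [] \<Rightarrow> 0 | (d, x, A) # w' \<Rightarrow>
        lsum (brace_words ((p, \<psi>) # Y') (s + d) A w') (\<lambda>t. F ((d, x, A) # t))"
      have P: "?P (u @ (d, ?l, A) # v) = sco a (?P (u @ (d, x, A) # v)) + sco c (?P (u @ (d, y, A) # v))"
      proof (cases u)
        case Nil
        have "lsum (brace_words ((p, \<psi>) # Y') (s + d) A v) (\<lambda>t. F ((d, ?l, A) # t)) =
          lsum (brace_words ((p, \<psi>) # Y') (s + d) A v) (\<lambda>t. sco a (F ((d, x, A) # t)) + sco c (F ((d, y, A) # t)))"
        proof (rule lsum_cong)
          fix e t assume "(e, t) \<in> set (brace_words ((p, \<psi>) # Y') (s + d) A v)"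
          then have "sword Q A t"
            using brace_words_valid[of e t "(p, \<psi>) # Y'" "s + d" A v] sx Nil Yg' by simp
          then show "F ((d, ?l, A) # t) = sco a (F ((d, x, A) # t)) + sco c (F ((d, y, A) # t))"
            using mlin_head[OF F, of d x A t y] sx sy Nil by simp
        qed
        then show ?thesis using Nil by (simp add: sum_lin)
      next
        case (Cons a' u')
        obtain d' x' A' where a': "a' = (d', x', A')" by (cases a') auto
        have "mlin sc sco Q A' (\<lambda>t. F ((d', x', A') # t))"
          using mlin_Cons[OF F B] sx Cons a' by simp
        then show ?thesis
          using IH[of "(p, \<psi>) # Y'" u' v A' "\<lambda>t. F ((d', x', A') # t)" "s + d'"] sx sy Yg' Cons a'
            \<open>Y = y' # Y'\<close> y' by simp
      qed
      let ?I = "\<lambda>w1 w2. lsum (brace_words Y' (s + wdeg w1) (src B w1) w2)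
        (\<lambda>t. F ((p + wdeg w1, \<psi> B w1, src B w1) # t))"
      have c: "consume p \<psi> Y' s B w F = ksign (p * s) (lsum (splittings w) (\<lambda>(w1, w2). ?I w1 w2))" for w
        by (simp add: consume_def)
      have 1: "lsum (splittings u) (\<lambda>(u1, u2). ?I u1 (u2 @ (d, ?l, A) # v)) =
        lsum (splittings u) (\<lambda>(u1, u2). sco a (?I u1 (u2 @ (d, x, A) # v)) + sco c (?I u1 (u2 @ (d, y, A) # v)))"
      proof (rule lsum_splittings_cong)
        fix u1 u2 assume u: "u = u1 @ u2"
        have m: "mlin sc sco Q (src B u1) (\<lambda>t. F ((p + wdeg u1, \<psi> B u1, src B u1) # t))"
          using mlin_Cons[OF F B, of "\<psi> B u1" "src B u1" "p + wdeg u1"] Cbr_val[OF Yg'(2), of B u1] sx u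
          by (simp add: sword_append add_ac)
        show "?I u1 (u2 @ (d, ?l, A) # v) = sco a (?I u1 (u2 @ (d, x, A) # v)) + sco c (?I u1 (u2 @ (d, y, A) # v))"
          using IH[of Y' u2 v "src B u1" "\<lambda>t. F ((p + wdeg u1, \<psi> B u1, src B u1) # t)" "s + wdeg u1"]
            m sx sy Yg' u Cons by (simp add: sword_append)
      qed
      have 2: "lsum (splittings v) (\<lambda>(v1, v2). ?I (u @ (d, ?l, A) # v1) v2) =
        lsum (splittings v) (\<lambda>(v1, v2). sco a (?I (u @ (d, x, A) # v1) v2) + sco c (?I (u @ (d, y, A) # v1) v2))"
      proof (rule lsum_splittings_cong)
        fix v1 v2 assume v: "v = v1 @ v2"
        let ?C = "src A v1"
        have w: "sword Q B (u @ (d, x, A) # v1)" "sword Q B (u @ (d, y, A) # v1)" "sword Q ?C v2"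
          using sx sy v by (auto simp: sword_append)
        have "\<psi> B (u @ (d, ?l, A) # v1) = sc a (\<psi> B (u @ (d, x, A) # v1)) + sc c (\<psi> B (u @ (d, y, A) # v1))"
          by (rule mlinD[OF Cbr_mlin[OF Yg'(2)] w(1,2)])
        moreover have "\<psi> B (u @ (d, x, A) # v1) \<in> QHom Q ?C B (p + (wdeg u + (d + wdeg v1)) + 1)"
          "\<psi> B (u @ (d, y, A) # v1) \<in> QHom Q ?C B (p + (wdeg u + (d + wdeg v1)) + 1)"
          using Cbr_val[OF Yg'(2) w(1)] Cbr_val[OF Yg'(2) w(2)] by (auto simp: add_ac)
        ultimately have "F ((p + (wdeg u + (d + wdeg v1)), \<psi> B (u @ (d, ?l, A) # v1), ?C) # t) =
            sco a (F ((p + (wdeg u + (d + wdeg v1)), \<psi> B (u @ (d, x, A) # v1), ?C) # t)) +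
            sco c (F ((p + (wdeg u + (d + wdeg v1)), \<psi> B (u @ (d, y, A) # v1), ?C) # t))"
          if "sword Q ?C t" for t
          using that B by (auto intro!: mlin_head[OF F])
        then have "?I (u @ (d, ?l, A) # v1) v2 = lsum (brace_words Y' (s + wdeg (u @ (d, x, A) # v1)) ?C v2)
          (\<lambda>t. sco a (F ((p + (wdeg u + (d + wdeg v1)), \<psi> B (u @ (d, x, A) # v1), ?C) # t)) +
            sco c (F ((p + (wdeg u + (d + wdeg v1)), \<psi> B (u @ (d, y, A) # v1), ?C) # t)))"
          using brace_words_valid[OF _ w(3) Yg'(1)] by (auto intro!: lsum_cong)
        then show "?I (u @ (d, ?l, A) # v1) v2 = sco a (?I (u @ (d, x, A) # v1) v2) + sco c (?I (u @ (d, y, A) # v1) v2)"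
          by (simp add: sum_lin)
      qed
      have "consume p \<psi> Y' s B (u @ (d, ?l, A) # v) F =
         sco a (consume p \<psi> Y' s B (u @ (d, x, A) # v) F) + sco c (consume p \<psi> Y' s B (u @ (d, y, A) # v) F)"
        unfolding c lsum_splittings_mid 1 2 sum_lin2 by (simp add: o.scale_right_distrib ksign_add sgn1 add_ac)
      with P show ?thesis
        unfolding Cons y' lsum_brace_words_ne[of p \<psi> Y' s B] by (simp add: o.scale_right_distrib)
    qed
  qed
  then show ?thesis
    using assms unfolding mlin_def by blast
qed

lemma brace_Cbr:
  assumes "\<phi> \<in> Cbr sc Q p" "gword (Cbr sc Q) Y"
  shows "brace Q \<phi> Y \<in> Cbr sc Q (p + wdeg Y)"
proof (rule CbrI)
  fix B show "mlin sc sc Q B (brace Q \<phi> Y B)"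
    using mlin_lsum_brace_words[OF module_sc Cbr_mlin[OF assms(1)] assms(2), of B 0] sword_lin
    unfolding mlin_def brace_eq by simp
qed (use assms lsum_brace_words_QHom in \<open>auto simp: brace_eq\<close>)

text \<open>The induction removes the cochains in front of the varying one. When its turn comes, its
  value is the letter that \<open>F\<close> reads, and \<open>F\<close> is linear in that
  letter.\<close>

lemma lsum_brace_words_cochain_lin:
  fixes sco :: "'k \<Rightarrow> 'v::ab_group_add \<Rightarrow> 'v"
  assumes mo: "module sco"
  shows "sword Q B w \<Longrightarrow> mlin sc sco Q B F \<Longrightarrow> gword (Cbr sc Q) Y1 \<Longrightarrow> gword (Cbr sc Q) Y2 \<Longrightarrow>
    \<phi> \<in> Cbr sc Q p \<Longrightarrow> \<psi> \<in> Cbr sc Q p \<Longrightarrow>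
    lsum (brace_words (Y1 @ (p, cochain_scale sc a \<phi> + cochain_scale sc c \<psi>) # Y2) s B w) F =
    sco a (lsum (brace_words (Y1 @ (p, \<phi>) # Y2) s B w) F) + sco c (lsum (brace_words (Y1 @ (p, \<psi>) # Y2) s B w) F)"
proof (induction "(Y1, w)" arbitrary: Y1 w s B F
      rule: wf_induct_rule[OF wf_measure[of "\<lambda>(Y1, w). length Y1 + length w"]])
  case 1
  interpret o: module sco by fact
  have sum_lin: "lsum L (\<lambda>t. sco a (H t) + sco c (K t)) = sco a (lsum L H) + sco c (lsum L K)"
    for L :: "(int \<times> 'x) list" and H K a c
    unfolding lsum_add
    using lsum_additive[of "sco a" L H] lsum_additive[of "sco c" L K] by (simp add: o.scale_right_distrib)
  have sgn_lin: "ksign e (sco a x + sco c y) = sco a (ksign e x) + sco c (ksign e y)" for e a c x y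
    by (simp add: ksign_def)
  note IH = 1(1)[simplified]
  note w = 1(2) note F = 1(3) note g = 1(4-7)
  have B: "B \<in> QObj Q" using sword_obj[OF w] .
  let ?l = "cochain_scale sc a \<phi> + cochain_scale sc c \<psi>"
  have pass: "(case w of [] \<Rightarrow> 0 | (d, x, A) # w' \<Rightarrow>
        lsum (brace_words (Y1 @ (p, ?l) # Y2) (s + d) A w') (\<lambda>t. F ((d, x, A) # t))) =
      sco a (case w of [] \<Rightarrow> 0 | (d, x, A) # w' \<Rightarrow>
        lsum (brace_words (Y1 @ (p, \<phi>) # Y2) (s + d) A w') (\<lambda>t. F ((d, x, A) # t))) +
      sco c (case w of [] \<Rightarrow> 0 | (d, x, A) # w' \<Rightarrow>
        lsum (brace_words (Y1 @ (p, \<psi>) # Y2) (s + d) A w') (\<lambda>t. F ((d, x, A) # t)))"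
  proof (cases w)
    case Nil
    then show ?thesis by simp
  next
    case (Cons a' w')
    obtain d' x' A' where a': "a' = (d', x', A')" by (cases a') auto
    have "mlin sc sco Q A' (\<lambda>t. F ((d', x', A') # t))"
      using mlin_Cons[OF F B] w Cons a' by simp
    then show ?thesis
      using IH[of Y1 w' A' "\<lambda>t. F ((d', x', A') # t)" "s + d'"] w g Cons a' by simp
  qed
  show ?case
  proof (cases Y1)
    case Nil
    have "consume p ?l Y2 s B w F = ksign (p * s) (lsum (splittings w) (\<lambda>(w1, w2).
       sco a (lsum (brace_words Y2 (s + wdeg w1) (src B w1) w2) (\<lambda>t. F ((p + wdeg w1, \<phi> B w1, src B w1) # t))) +
       sco c (lsum (brace_words Y2 (s + wdeg w1) (src B w1) w2) (\<lambda>t. F ((p + wdeg w1, \<psi> B w1, src B w1) # t)))))"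
      unfolding consume_def
    proof (rule arg_cong[where f = "ksign _"], rule lsum_splittings_cong)
      fix w1 w2 assume ww: "w = w1 @ w2"
      have sw: "sword Q B w1" "sword Q (src B w1) w2" using w ww by (auto simp: sword_append)
      have "lsum (brace_words Y2 (s + wdeg w1) (src B w1) w2) (\<lambda>t. F ((p + wdeg w1, ?l B w1, src B w1) # t)) =
        lsum (brace_words Y2 (s + wdeg w1) (src B w1) w2) (\<lambda>t. sco a (F ((p + wdeg w1, \<phi> B w1, src B w1) # t)) +
          sco c (F ((p + wdeg w1, \<psi> B w1, src B w1) # t)))"
      proof (rule lsum_cong)
        fix e t assume "(e, t) \<in> set (brace_words Y2 (s + wdeg w1) (src B w1) w2)"
        then have "sword Q (src B w1) t" using brace_words_valid[OF _ sw(2) g(2)] by blast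
        then show "F ((p + wdeg w1, ?l B w1, src B w1) # t) = sco a (F ((p + wdeg w1, \<phi> B w1, src B w1) # t)) +
          sco c (F ((p + wdeg w1, \<psi> B w1, src B w1) # t))"
          using mlin_head[OF F, of "p + wdeg w1" "\<phi> B w1" "src B w1" t "\<psi> B w1" a c]
            Cbr_val[OF g(3) sw(1)] Cbr_val[OF g(4) sw(1)] B
          by (simp add: cochain_scale_def add_ac)
      qed
      then show "lsum (brace_words Y2 (s + wdeg w1) (src B w1) w2) (\<lambda>t. F ((p + wdeg w1, ?l B w1, src B w1) # t)) =
        sco a (lsum (brace_words Y2 (s + wdeg w1) (src B w1) w2) (\<lambda>t. F ((p + wdeg w1, \<phi> B w1, src B w1) # t))) +
        sco c (lsum (brace_words Y2 (s + wdeg w1) (src B w1) w2) (\<lambda>t. F ((p + wdeg w1, \<psi> B w1, src B w1) # t)))"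
        by (simp add: sum_lin)
    qed
    then have "consume p ?l Y2 s B w F = sco a (consume p \<phi> Y2 s B w F) + sco c (consume p \<psi> Y2 s B w F)"
      unfolding consume_def split_def by (simp only: sum_lin sgn_lin)
    with pass show ?thesis
      unfolding Nil append_Nil lsum_brace_words_ne[of p _ Y2 s B w] by (simp add: o.scale_right_distrib)
  next
    case (Cons y Y')
    obtain q \<zeta> where y: "y = (q, \<zeta>)" by (cases y)
    have \<zeta>: "\<zeta> \<in> Cbr sc Q q" and Y': "gword (Cbr sc Q) Y'" using g Cons y by auto
    have "consume q \<zeta> (Y' @ (p, ?l) # Y2) s B w F = ksign (q * s) (lsum (splittings w) (\<lambda>(w1, w2).
       sco a (lsum (brace_words (Y' @ (p, \<phi>) # Y2) (s + wdeg w1) (src B w1) w2) (\<lambda>t. F ((q + wdeg w1, \<zeta> B w1, src B w1) # t))) +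
       sco c (lsum (brace_words (Y' @ (p, \<psi>) # Y2) (s + wdeg w1) (src B w1) w2) (\<lambda>t. F ((q + wdeg w1, \<zeta> B w1, src B w1) # t)))))"
      unfolding consume_def
    proof (rule arg_cong[where f = "ksign _"], rule lsum_splittings_cong)
      fix w1 w2 assume ww: "w = w1 @ w2"
      have sw: "sword Q B w1" "sword Q (src B w1) w2" using w ww by (auto simp: sword_append)
      have m: "mlin sc sco Q (src B w1) (\<lambda>t. F ((q + wdeg w1, \<zeta> B w1, src B w1) # t))"
        using mlin_Cons[OF F B, of "\<zeta> B w1" "src B w1" "q + wdeg w1"] Cbr_val[OF \<zeta> sw(1)]
        by (simp add: add_ac)
      show "lsum (brace_words (Y' @ (p, ?l) # Y2) (s + wdeg w1) (src B w1) w2) (\<lambda>t. F ((q + wdeg w1, \<zeta> B w1, src B w1) # t)) =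
        sco a (lsum (brace_words (Y' @ (p, \<phi>) # Y2) (s + wdeg w1) (src B w1) w2) (\<lambda>t. F ((q + wdeg w1, \<zeta> B w1, src B w1) # t))) +
        sco c (lsum (brace_words (Y' @ (p, \<psi>) # Y2) (s + wdeg w1) (src B w1) w2) (\<lambda>t. F ((q + wdeg w1, \<zeta> B w1, src B w1) # t)))"
        using IH[of Y' w2 "src B w1" "\<lambda>t. F ((q + wdeg w1, \<zeta> B w1, src B w1) # t)" "s + wdeg w1"] sw m Y' g ww Cons
        by simp
    qed
    then have "consume q \<zeta> (Y' @ (p, ?l) # Y2) s B w F =
      sco a (consume q \<zeta> (Y' @ (p, \<phi>) # Y2) s B w F) + sco c (consume q \<zeta> (Y' @ (p, \<psi>) # Y2) s B w F)"
      unfolding consume_def split_def by (simp only: sum_lin sgn_lin)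
    with pass show ?thesis
      unfolding Cons y append_Cons lsum_brace_words_ne[of q \<zeta> "Y' @ _ # Y2" s B w]
      by (simp add: o.scale_right_distrib)
  qed
qed

text \<open>The product of the tensor coalgebra with components \<open>Cbr_mul\<close>, by a
  recursion like that of \<open>brace_words\<close>. No component takes two letters of
  \<open>Y\<close>, so the first letter of the result is either the first letter of
  \<open>Z\<close>, moved past all of \<open>Y\<close>, or \<psi> with an initial piece
  \<open>Z1\<close> inserted, where \<open>Z1\<close> is moved past the rest of
  \<open>Y\<close>.\<close>

fun mul_words :: "(int \<times> ('o, 'm) cochain) list \<Rightarrow> (int \<times> ('o, 'm) cochain) list \<Rightarrow>
    (int \<times> (int \<times> ('o, 'm) cochain) list) list" where
  "mul_words [] Z = [(0, Z)]"
| "mul_words ((q, \<psi>) # Y) Z =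
     (case Z of [] \<Rightarrow> [] | (p, \<zeta>) # Z' \<Rightarrow> pre (p * (q + wdeg Y)) (Cons (p, \<zeta>)) (mul_words ((q, \<psi>) # Y) Z')) @
     lbind (splittings Z) (\<lambda>(Z1, Z2). pre (wdeg Z1 * wdeg Y) (Cons (q + wdeg Z1, brace Q \<psi> Z1)) (mul_words Y Z2))"

declare mul_words.simps(2) [simp del]

lemma lsum_mul_words_ne:
  "lsum (mul_words ((q, \<psi>) # Y) Z) G =
    (case Z of [] \<Rightarrow> 0 | (p, \<zeta>) # Z' \<Rightarrow> ksign (p * (q + wdeg Y)) (lsum (mul_words ((q, \<psi>) # Y) Z') (\<lambda>T. G ((p, \<zeta>) # T)))) +
    lsum (splittings Z) (\<lambda>(Z1, Z2). ksign (wdeg Z1 * wdeg Y) (lsum (mul_words Y Z2) (\<lambda>T. G ((q + wdeg Z1, brace Q \<psi> Z1) # T))))"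
proof -
  have *: "(\<lambda>t. lsum (case t of (Z1, Z2) \<Rightarrow> pre (wdeg Z1 * wdeg Y) (Cons (q + wdeg Z1, brace Q \<psi> Z1)) (mul_words Y Z2)) G) =
     (\<lambda>t. case t of (Z1, Z2) \<Rightarrow> ksign (wdeg Z1 * wdeg Y) (lsum (mul_words Y Z2) (\<lambda>T. G ((q + wdeg Z1, brace Q \<psi> Z1) # T))))"
    by (auto simp: fun_eq_iff)
  show ?thesis
    by (subst mul_words.simps(2)) (auto simp: * split: list.splits)
qed

text \<open>The last conjunct allows \<open>lsum_brace_words_ne\<close>, which is about nonempty
  words of cochains, to be applied to every \<open>T\<close> that occurs in the product.\<close>

lemma mul_words_valid:
  "(e, T) \<in> set (mul_words Y Z) \<Longrightarrow> gword (Cbr sc Q) Y \<Longrightarrow> gword (Cbr sc Q) Z \<Longrightarrow>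
   gword (Cbr sc Q) T \<and> wdeg T = wdeg Y + wdeg Z \<and> (Y \<noteq> [] \<longrightarrow> T \<noteq> [])"
proof (induction "(Y, Z)" arbitrary: Y Z e T rule: wf_induct_rule[OF wf_measure[of "\<lambda>(Y, Z). length Y + length Z"]])
  case 1
  note IH = 1(1)[simplified]
  show ?case
  proof (cases Y)
    case Nil
    then show ?thesis using 1 by simp
  next
    case (Cons y Y')
    obtain q \<psi> where y: "y = (q, \<psi>)" by (cases y)
    from 1(2)
    consider (pass) p \<zeta> Z' e' T' where "Z = (p, \<zeta>) # Z'" "T = (p, \<zeta>) # T'" "(e', T') \<in> set (mul_words Y Z')"
      | (cons) Z1 Z2 e' T' where "Z1 @ Z2 = Z" "T = (q + wdeg Z1, brace Q \<psi> Z1) # T'" "(e', T') \<in> set (mul_words Y' Z2)"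
      unfolding Cons y by (subst (asm) mul_words.simps(2)) (auto simp: set_pre set_lbind set_splittings split: list.splits)
    then show ?thesis
    proof cases
      case pass
      then show ?thesis using IH[OF _ pass(3)] 1(3,4) by auto
    next
      case cons
      then show ?thesis
        using IH[OF _ cons(3)] 1(3,4) Cons y brace_Cbr[of \<psi> q Z1] by auto
    qed
  qed
qed

text \<open>The brace identity, in the form that inserting \<open>Z\<close> and then \<open>Y\<close> is inserting the product of
  \<open>Y\<close> and \<open>Z\<close>.\<close>

lemma brace_words_brace_words:
  fixes sco :: "'k \<Rightarrow> 'v::ab_group_add \<Rightarrow> 'v"
  assumes mo: "module sco"
  shows "sword Q B w \<Longrightarrow> gword (Cbr sc Q) Y \<Longrightarrow> gword (Cbr sc Q) Z \<Longrightarrow> mlin sc sco Q B F \<Longrightarrow>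
    lsum (brace_words Z s B w) (\<lambda>t. lsum (brace_words Y s B t) F) =
    lsum (mul_words Y Z) (\<lambda>T. lsum (brace_words T s B w) F)"
proof (induction "(Y, Z, w)" arbitrary: Y Z w s B F
      rule: wf_induct_rule[OF wf_measure[of "\<lambda>(Y, Z, w). length Y + length Z + length w"]])
  case 1
  note IH = 1(1)[simplified]
  note w = 1(2) and Yg = 1(3) and Zg = 1(4) and F = 1(5)
  have B: "B \<in> QObj Q" using sword_obj[OF w] .
  show ?case
  proof (cases Y)
    case Nil
    then show ?thesis by simp
  next
    case (Cons y Y')
    obtain q \<psi> where y: "y = (q, \<psi>)" by (cases y)
    have Y: "Y = (q, \<psi>) # Y'" by (simp add: Cons y)
    have Yg': "gword (Cbr sc Q) Y'" "\<psi> \<in> Cbr sc Q q" using Yg Y by auto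
    \<comment> \<open>On the left, the first cochain \<psi> of \<open>Y\<close> skips the first
      letter (\<open>L1\<close>) or starts there (\<open>L2\<close>). On the right, the first letter
      comes from \<open>w\<close> (\<open>R1\<close>), from a cochain of \<open>Z\<close> that does
      not enter \<psi> (\<open>R2\<close>), or from \<psi> with \<open>Z1\<close> inserted
      (\<open>R3\<close>).\<close>
    define L1 where "L1 = lsum (brace_words Z s B w) (\<lambda>t. case t of [] \<Rightarrow> 0 | (d, x, A) # t' \<Rightarrow>
        lsum (brace_words Y (s + d) A t') (\<lambda>t. F ((d, x, A) # t)))"
    define L2 where "L2 = lsum (brace_words Z s B w) (\<lambda>t. consume q \<psi> Y' s B t F)"
    define R1 where "R1 = (case w of [] \<Rightarrow> 0 | (d, x, A) # w' \<Rightarrow>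
        lsum (mul_words Y Z) (\<lambda>T. lsum (brace_words T (s + d) A w') (\<lambda>t. F ((d, x, A) # t))))"
    define R2 where "R2 = (case Z of [] \<Rightarrow> 0 | (p, \<zeta>) # Z' \<Rightarrow>
        ksign (p * (q + wdeg Y')) (lsum (mul_words Y Z') (\<lambda>T. consume p \<zeta> T s B w F)))"
    define R3 where "R3 = lsum (splittings Z) (\<lambda>(Z1, Z2). ksign (wdeg Z1 * wdeg Y')
        (lsum (mul_words Y' Z2) (\<lambda>T. consume (q + wdeg Z1) (brace Q \<psi> Z1) T s B w F)))"
    have L: "lsum (brace_words Z s B w) (\<lambda>t. lsum (brace_words Y s B t) F) = L1 + L2"
    proof -
      have "lsum (brace_words Z s B w) (\<lambda>t. lsum (brace_words Y s B t) F) =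
        lsum (brace_words Z s B w) (\<lambda>t. (case t of [] \<Rightarrow> 0 | (d, x, A) # t' \<Rightarrow>
          lsum (brace_words Y (s + d) A t') (\<lambda>t. F ((d, x, A) # t))) + consume q \<psi> Y' s B t F)"
        unfolding Y by (rule lsum_cong, rule lsum_brace_words_ne)
      then show ?thesis by (simp add: lsum_add L1_def L2_def)
    qed
    have R: "lsum (mul_words Y Z) (\<lambda>T. lsum (brace_words T s B w) F) = R1 + (R2 + R3)"
    proof -
      have "lsum (mul_words Y Z) (\<lambda>T. lsum (brace_words T s B w) F) =
        lsum (mul_words Y Z) (\<lambda>T. (case w of [] \<Rightarrow> 0 | (d, x, A) # w' \<Rightarrow>
          lsum (brace_words T (s + d) A w') (\<lambda>t. F ((d, x, A) # t))) +
          (case T of [] \<Rightarrow> 0 | (p, \<phi>) # T' \<Rightarrow> consume p \<phi> T' s B w F))"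
      proof (rule lsum_cong)
        fix e T assume "(e, T) \<in> set (mul_words Y Z)"
        then have "T \<noteq> []" using mul_words_valid Yg Zg Y by blast
        then obtain p \<phi> T' where T: "T = (p, \<phi>) # T'" by (cases T) auto
        show "lsum (brace_words T s B w) F = (case w of [] \<Rightarrow> 0 | (d, x, A) # w' \<Rightarrow>
          lsum (brace_words T (s + d) A w') (\<lambda>t. F ((d, x, A) # t))) +
          (case T of [] \<Rightarrow> 0 | (p, \<phi>) # T' \<Rightarrow> consume p \<phi> T' s B w F)"
          unfolding T list.case prod.case by (rule lsum_brace_words_ne)
      qed
      also have "\<dots> = R1 + lsum (mul_words Y Z) (\<lambda>T. case T of [] \<Rightarrow> 0 | (p, \<phi>) # T' \<Rightarrow> consume p \<phi> T' s B w F)"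
        unfolding lsum_add R1_def by (auto split: list.splits)
      also have "lsum (mul_words Y Z) (\<lambda>T. case T of [] \<Rightarrow> 0 | (p, \<phi>) # T' \<Rightarrow> consume p \<phi> T' s B w F) = R2 + R3"
        unfolding Y lsum_mul_words_ne[of q \<psi> Y' Z "\<lambda>T. case T of [] \<Rightarrow> 0 | (p, \<phi>) # T' \<Rightarrow> consume p \<phi> T' s B w F"]
        by (simp add: R2_def R3_def Y split: list.splits)
      finally show ?thesis .
    qed
    have L1: "L1 = R1 + R2"
    proof -
      have a: "(case w of [] \<Rightarrow> 0 | (d, x, A) # w' \<Rightarrow>
         lsum (brace_words Z (s + d) A w') (\<lambda>t'. lsum (brace_words Y (s + d) A t') (\<lambda>t. F ((d, x, A) # t)))) = R1"
      proof (cases w)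
        case Nil
        then show ?thesis by (simp add: R1_def)
      next
        case (Cons a' w')
        obtain d x A where a: "a' = (d, x, A)" by (cases a') auto
        have "mlin sc sco Q A (\<lambda>t. F ((d, x, A) # t))"
          using mlin_Cons[OF F B] w Cons a by simp
        then show ?thesis
          using IH[of Y Z w' A "\<lambda>t. F ((d, x, A) # t)" "s + d"] w Yg Zg by (simp add: R1_def Cons a)
      qed
      show ?thesis
      proof (cases Z)
        case Nil
        then have "L1 = (case w of [] \<Rightarrow> 0 | (d, x, A) # w' \<Rightarrow>
         lsum (brace_words Z (s + d) A w') (\<lambda>t'. lsum (brace_words Y (s + d) A t') (\<lambda>t. F ((d, x, A) # t))))"
          by (auto simp: L1_def split: list.splits)
        then show ?thesis using a Nil by (simp add: R2_def)
      next
        case (Cons z Z')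
        obtain p \<zeta> where z: "z = (p, \<zeta>)" by (cases z)
        have Z: "Z = (p, \<zeta>) # Z'" by (simp add: Cons z)
        let ?H = "\<lambda>t. case t of [] \<Rightarrow> 0 | (d, x, A) # t' \<Rightarrow>
          lsum (brace_words Y (s + d) A t') (\<lambda>t. F ((d, x, A) # t))"
        have "L1 = (case w of [] \<Rightarrow> 0 | (d, x, A) # w' \<Rightarrow>
          lsum (brace_words Z (s + d) A w') (\<lambda>t'. lsum (brace_words Y (s + d) A t') (\<lambda>t. F ((d, x, A) # t))))
          + consume p \<zeta> Z' s B w ?H"
          unfolding L1_def Z lsum_brace_words_ne[of p \<zeta> Z' s B w ?H] by (auto split: list.splits)
        moreover have "consume p \<zeta> Z' s B w ?H = R2"
        proof -
          have "lsum (brace_words Z' (s + wdeg u) (src B u) v)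
              (\<lambda>t. lsum (brace_words Y (s + (p + wdeg u)) (src B u) t) (\<lambda>t. F ((p + wdeg u, \<zeta> B u, src B u) # t))) =
            ksign (p * wdeg Y) (lsum (mul_words Y Z') (\<lambda>T. lsum (brace_words T (s + wdeg u) (src B u) v)
              (\<lambda>t. F ((p + wdeg u, \<zeta> B u, src B u) # t))))" (is "?l = ?r") if uv: "w = u @ v" for u v
          proof -
            have sw: "sword Q B u" "sword Q (src B u) v" using w uv by (auto simp: sword_append)
            have m: "mlin sc sco Q (src B u) (\<lambda>t. F ((p + wdeg u, \<zeta> B u, src B u) # t))"
              using mlin_Cons[OF F B, of "\<zeta> B u" "src B u" "p + wdeg u"] Cbr_val[OF _ sw(1), of \<zeta> p] Zg Z
              by (simp add: add_ac)
            \<comment> \<open>In front of \<open>Y\<close> now stands the value of \<zeta>, of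
              degree \<open>p + wdeg u\<close> instead of \<open>wdeg u\<close>. The surplus
              \<open>p\<close> is the sign with which \<zeta> passes \<open>Y\<close> in the
              product.\<close>
            have "?l = ksign (p * wdeg Y) (lsum (brace_words Z' (s + wdeg u) (src B u) v)
              (\<lambda>t. lsum (brace_words Y (s + wdeg u) (src B u) t) (\<lambda>t. F ((p + wdeg u, \<zeta> B u, src B u) # t))))"
              using lsum_brace_words_shift[of Y "s + wdeg u" p "src B u" _ "\<lambda>t. F ((p + wdeg u, \<zeta> B u, src B u) # t)"]
              by (simp add: add_ac lsum_ksign)
            also have "\<dots> = ?r"
              using IH[of Y Z' v "src B u" "\<lambda>t. F ((p + wdeg u, \<zeta> B u, src B u) # t)" "s + wdeg u"] sw m Yg Zg Z uv
              by simp
            finally show ?thesis .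
          qed
          then have "consume p \<zeta> Z' s B w ?H = ksign (p * s) (lsum (splittings w) (\<lambda>(u, v).
              ksign (p * wdeg Y) (lsum (mul_words Y Z') (\<lambda>T. lsum (brace_words T (s + wdeg u) (src B u) v)
              (\<lambda>t. F ((p + wdeg u, \<zeta> B u, src B u) # t))))))"
            unfolding consume_def list.case prod.case
            by (intro arg_cong[where f = "ksign _"] lsum_splittings_cong) auto
          also have "\<dots> = R2"
            unfolding R2_def Z consume_def split_def lsum_ksign lsum_swap[of "splittings w"]
            by (simp add: ksign_ksign Y add_ac)
          finally show ?thesis .
        qed
        ultimately show ?thesis using a by simp
      qed
    qed
    \<comment> \<open>The part of the word that \<psi> swallows is an insertion of some
      \<open>Z1\<close> into some \<open>w1\<close>, by \<open>lsum_brace_words_comult\<close>;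
      summing over these insertions turns \<psi> into its brace with \<open>Z1\<close>.\<close>
    have L2: "L2 = R3"
    proof -
      have step: "lsum (brace_words Z1 s B w1) (\<lambda>t1. lsum (brace_words Z2 (s + wdeg w1) (src B w1) w2)
            (\<lambda>t2. lsum (brace_words Y' (s + wdeg t1) (src B t1) t2) (\<lambda>t. F ((q + wdeg t1, \<psi> B t1, src B t1) # t)))) =
          ksign (wdeg Z1 * wdeg Y' + s * wdeg Z1) (lsum (mul_words Y' Z2) (\<lambda>T.
            lsum (brace_words T (s + wdeg w1) (src B w1) w2)
              (\<lambda>t. F ((q + wdeg Z1 + wdeg w1, brace Q \<psi> Z1 B w1, src B w1) # t))))"
        if ZZ: "Z = Z1 @ Z2" and ww: "w = w1 @ w2" for Z1 Z2 w1 w2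
      proof -
        have sw: "sword Q B w1" "sword Q (src B w1) w2" using w ww by (auto simp: sword_append)
        have Zg': "gword (Cbr sc Q) Z1" "gword (Cbr sc Q) Z2" using Zg ZZ by auto
        let ?d = "q + wdeg Z1 + wdeg w1" and ?C = "src B w1"
        have C: "?C \<in> QObj Q" using sword_src[OF sw(1)] .
        have v: "\<psi> B t1 \<in> QHom Q ?C B (?d + 1)" if "(e, t1) \<in> set (brace_words Z1 s B w1)" for e t1
          using brace_words_valid[OF that sw(1) Zg'(1)] Cbr_val[OF Yg'(2), of B t1] by (simp add: add_ac)
        have "lsum (brace_words Z1 s B w1) (\<lambda>t1. lsum (brace_words Z2 (s + wdeg w1) ?C w2)
            (\<lambda>t2. lsum (brace_words Y' (s + wdeg t1) (src B t1) t2) (\<lambda>t. F ((q + wdeg t1, \<psi> B t1, src B t1) # t)))) =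
          lsum (brace_words Z1 s B w1) (\<lambda>t1. ksign (wdeg Z1 * wdeg Y') (lsum (mul_words Y' Z2) (\<lambda>T.
            lsum (brace_words T (s + wdeg w1) ?C w2) (\<lambda>t. F ((?d, \<psi> B t1, ?C) # t)))))"
        proof (rule lsum_cong)
          fix e t1 assume t1: "(e, t1) \<in> set (brace_words Z1 s B w1)"
          have t: "wdeg t1 = wdeg Z1 + wdeg w1" "src B t1 = ?C"
            using brace_words_valid[OF t1 sw(1) Zg'(1)] by auto
          have m: "mlin sc sco Q ?C (\<lambda>t. F ((?d, \<psi> B t1, ?C) # t))"
            by (rule mlin_Cons[OF F B v[OF t1]])
          have "lsum (brace_words Z2 (s + wdeg w1) ?C w2)
            (\<lambda>t2. lsum (brace_words Y' (s + wdeg t1) (src B t1) t2) (\<lambda>t. F ((q + wdeg t1, \<psi> B t1, src B t1) # t))) =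
            lsum (brace_words Z2 (s + wdeg w1) ?C w2) (\<lambda>t2. ksign (wdeg Z1 * wdeg Y')
              (lsum (brace_words Y' (s + wdeg w1) ?C t2) (\<lambda>t. F ((?d, \<psi> B t1, ?C) # t))))"
            using lsum_brace_words_shift[of Y' "s + wdeg w1" "wdeg Z1" ?C _ "\<lambda>t. F ((?d, \<psi> B t1, ?C) # t)"] by (simp add: t add_ac)
          then show "lsum (brace_words Z2 (s + wdeg w1) ?C w2)
            (\<lambda>t2. lsum (brace_words Y' (s + wdeg t1) (src B t1) t2) (\<lambda>t. F ((q + wdeg t1, \<psi> B t1, src B t1) # t))) =
            ksign (wdeg Z1 * wdeg Y') (lsum (mul_words Y' Z2) (\<lambda>T.
            lsum (brace_words T (s + wdeg w1) ?C w2) (\<lambda>t. F ((?d, \<psi> B t1, ?C) # t))))"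
            using IH[of Y' Z2 w2 ?C "\<lambda>t. F ((?d, \<psi> B t1, ?C) # t)" "s + wdeg w1"] sw m Yg' Zg' ZZ ww Y
            by (simp add: lsum_ksign)
        qed
        also have "\<dots> = ksign (wdeg Z1 * wdeg Y') (lsum (mul_words Y' Z2) (\<lambda>T.
            lsum (brace_words T (s + wdeg w1) ?C w2) (\<lambda>t. lsum (brace_words Z1 s B w1) (\<lambda>t1. F ((?d, \<psi> B t1, ?C) # t)))))"
          unfolding lsum_ksign lsum_swap[of "brace_words Z1 s B w1" "mul_words Y' Z2"] lsum_swap[of "brace_words Z1 s B w1" "brace_words _ _ _ w2"] ..
        also have "\<dots> = ksign (wdeg Z1 * wdeg Y') (lsum (mul_words Y' Z2) (\<lambda>T.
            lsum (brace_words T (s + wdeg w1) ?C w2) (\<lambda>t. ksign (s * wdeg Z1) (F ((?d, brace Q \<psi> Z1 B w1, ?C) # t)))))"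
        proof (rule arg_cong[where f = "ksign _"], rule lsum_cong, rule lsum_cong)
          fix e T e' t assume T: "(e, T) \<in> set (mul_words Y' Z2)" and t: "(e', t) \<in> set (brace_words T (s + wdeg w1) ?C w2)"
          have st: "sword Q ?C t"
            using brace_words_valid[OF t sw(2)] mul_words_valid[OF T Yg'(1) Zg'(2)] by auto
          have "lsum (brace_words Z1 s B w1) (\<lambda>t1. F ((?d, \<psi> B t1, ?C) # t)) =
            F ((?d, lsum (brace_words Z1 s B w1) (\<psi> B), ?C) # t)"
            by (rule lsum_head(2)[OF mo F B st, symmetric]) (use v in auto)
          \<comment> \<open>A brace is defined with degree 0 in front, whereas here the letters in
            front have degree \<open>s\<close>.\<close>
          also have "lsum (brace_words Z1 s B w1) (\<psi> B) = ksign (s * wdeg Z1) (brace Q \<psi> Z1 B w1)"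
            using lsum_brace_words_shift[of Z1 0 s B w1 "\<psi> B"] sw by (simp add: brace_eq)
          also have "F ((?d, ksign (s * wdeg Z1) (brace Q \<psi> Z1 B w1), ?C) # t) =
             ksign (s * wdeg Z1) (F ((?d, brace Q \<psi> Z1 B w1, ?C) # t))"
          proof (rule mlin_head_ksign[OF mo F])
            show "sword Q B ((?d, brace Q \<psi> Z1 B w1, ?C) # t)"
              using B st Cbr_val[OF brace_Cbr[OF Yg'(2) Zg'(1)] sw(1)] by (simp add: add_ac)
          qed
          finally show "lsum (brace_words Z1 s B w1) (\<lambda>t1. F ((?d, \<psi> B t1, ?C) # t)) =
            ksign (s * wdeg Z1) (F ((?d, brace Q \<psi> Z1 B w1, ?C) # t))" .
        qed
        also have "\<dots> = ksign (wdeg Z1 * wdeg Y' + s * wdeg Z1) (lsum (mul_words Y' Z2) (\<lambda>T.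
            lsum (brace_words T (s + wdeg w1) ?C w2) (\<lambda>t. F ((?d, brace Q \<psi> Z1 B w1, ?C) # t))))"
          by (simp add: lsum_ksign ksign_ksign)
        finally show ?thesis .
      qed
      have "L2 = ksign (q * s) (lsum (brace_words Z s B w) (\<lambda>t. lsum (splittings t) (\<lambda>(t1, t2).
          lsum (brace_words Y' (s + wdeg t1) (src B t1) t2) (\<lambda>t. F ((q + wdeg t1, \<psi> B t1, src B t1) # t)))))"
        by (simp add: L2_def consume_def lsum_ksign)
      also have "\<dots> = ksign (q * s) (lsum (splittings Z) (\<lambda>(Z1, Z2). lsum (splittings w) (\<lambda>(w1, w2).
          ksign (wdeg Z1 * wdeg Y' + s * wdeg Z1) (lsum (mul_words Y' Z2) (\<lambda>T.
            lsum (brace_words T (s + wdeg w1) (src B w1) w2)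
              (\<lambda>t. F ((q + wdeg Z1 + wdeg w1, brace Q \<psi> Z1 B w1, src B w1) # t)))))))"
        unfolding lsum_brace_words_comult by (intro arg_cong[where f = "ksign _"] lsum_splittings_cong step)
      also have "\<dots> = R3"
        unfolding R3_def consume_def split_def lsum_ksign lsum_swap[of "splittings w" "mul_words _ _"]
        apply (subst lsum_ksign[symmetric])
        apply (rule lsum_cong)
        apply (simp add: ksign_ksign)
        apply (rule ksign_cong)
        apply (simp add: algebra_simps)
        done
      finally show ?thesis .
    qed
    show ?thesis by (simp add: L R L1 L2)
  qed
qed

lemma brace_brace:
  assumes "\<phi> \<in> Cbr sc Q p" "gword (Cbr sc Q) Y" "gword (Cbr sc Q) Z"
  shows "brace Q (brace Q \<phi> Y) Z = lsum (mul_words Y Z) (brace Q \<phi>)"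
proof (intro ext)
  fix B w
  show "brace Q (brace Q \<phi> Y) Z B w = lsum (mul_words Y Z) (brace Q \<phi>) B w"
  proof (cases "sword Q B w")
    case False
    then show ?thesis by (simp add: lsum_apply brace_eq)
  next
    case True
    have "brace Q (brace Q \<phi> Y) Z B w = lsum (brace_words Z 0 B w) (\<lambda>t. lsum (brace_words Y 0 B t) (\<phi> B))"
      using True brace_words_valid[OF _ True assms(3)] by (auto simp: brace_eq intro!: lsum_cong)
    also have "\<dots> = lsum (mul_words Y Z) (\<lambda>T. lsum (brace_words T 0 B w) (\<phi> B))"
      by (rule brace_words_brace_words[OF module_sc True assms(2,3) Cbr_mlin[OF assms(1)]])
    finally show ?thesis using True by (simp add: lsum_apply brace_eq)
  qed
qed

end


section \<open>The B-infinity algebra of a dg quiver\<close>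

text \<open>Each of the \<open>r\<close> pieces takes at least one letter. This lets
  \<open>mul_total_rec\<close> use a common range of \<open>r\<close> for all the remaining pairs of
  words.\<close>

lemma mul_word_eq_0: "length x + length y < r \<Longrightarrow> mul_word m r F x y = 0"
proof (induction r arbitrary: F x y)
  case 0
  then show ?case by simp
next
  case (Suc r)
  show ?case
    unfolding mul_word.simps
  proof (rule sum.neutral, rule ballI)
    fix p assume p: "p \<in> {..length x} \<times> {..length y} - {(0, 0)}"
    obtain a b where ab: "p = (a, b)" by (cases p)
    have "length (drop a x) + length (drop b y) < r"
      using p Suc.prems by (auto simp: ab)
    then show "(case p of (a, b) \<Rightarrow> ksign (wdeg (take b y) * wdeg (drop a x))
        (mul_word m r (\<lambda>t. F ((wdeg (take a x) + wdeg (take b y), m (take a x) (take b y)) # t))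
          (drop a x) (drop b y))) = 0"
      by (simp add: ab Suc.IH)
  qed
qed

lemma mul_total_rec:
  assumes "x \<noteq> [] \<or> y \<noteq> []"
  shows "mul_total m F x y =
    (\<Sum>(a, b) \<in> {..length x} \<times> {..length y} - {(0, 0)}.
        ksign (wdeg (take b y) * wdeg (drop a x))
          (mul_total m (\<lambda>t. F ((wdeg (take a x) + wdeg (take b y), m (take a x) (take b y)) # t))
            (drop a x) (drop b y)))"
proof -
  let ?S = "{..length x} \<times> {..length y} - {(0, 0)}"
  let ?F = "\<lambda>a b t. F ((wdeg (take a x) + wdeg (take b y), m (take a x) (take b y)) # t)"
  obtain n where n: "length x + length y = Suc n"
    using assms by (metis add_is_0 length_0_conv not0_implies_Suc)
  have ext: "mul_total m (?F a b) (drop a x) (drop b y) = (\<Sum>r\<le>n. mul_word m r (?F a b) (drop a x) (drop b y))"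
    if "(a, b) \<in> ?S" for a b
    unfolding mul_total_def
    by (rule sum.mono_neutral_left) (use that n in \<open>auto intro!: mul_word_eq_0\<close>)
  have "mul_total m F x y = (\<Sum>r\<le>n. mul_word m (Suc r) F x y)"
    using assms by (auto simp: mul_total_def n sum.atMost_Suc_shift simp del: sum.atMost_Suc)
  also have "\<dots> = (\<Sum>r\<le>n. \<Sum>(a, b)\<in>?S. ksign (wdeg (take b y) * wdeg (drop a x))
      (mul_word m r (?F a b) (drop a x) (drop b y)))"
    by simp
  also have "\<dots> = (\<Sum>p\<in>?S. \<Sum>r\<le>n. case p of (a, b) \<Rightarrow> ksign (wdeg (take b y) * wdeg (drop a x))
      (mul_word m r (?F a b) (drop a x) (drop b y)))"
    by (rule sum.swap)
  also have "\<dots> = (\<Sum>(a, b)\<in>?S. ksign (wdeg (take b y) * wdeg (drop a x))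
      (mul_total m (?F a b) (drop a x) (drop b y)))"
  proof (intro sum.cong refl)
    fix p assume p: "p \<in> ?S"
    obtain a b where ab: "p = (a, b)" by (cases p)
    show "(\<Sum>r\<le>n. case p of (a, b) \<Rightarrow> ksign (wdeg (take b y) * wdeg (drop a x))
        (mul_word m r (?F a b) (drop a x) (drop b y))) =
      (case p of (a, b) \<Rightarrow> ksign (wdeg (take b y) * wdeg (drop a x))
        (mul_total m (?F a b) (drop a x) (drop b y)))"
      unfolding ab prod.case ext[OF p[unfolded ab]] ksign_sum ..
  qed
  finally show ?thesis .
qed

lemma der_total_Nil [simp]: "der_total D F [] = 0"
  by (simp add: der_total_def)

lemma der_total_Cons:
  "der_total D F (y # x) =
     lsum (splittings x) (\<lambda>(u, v). F ((wdeg (y # u) + 1, D (y # u)) # v)) +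
     ksign (fst y) (der_total D (\<lambda>t. F (y # t)) x)"
proof -
  obtain q \<psi> where y: "y = (q, \<psi>)" by (cases y)
  show ?thesis
    unfolding der_total_def lsum_splittings_eq_sum length_Cons sum.atMost_Suc_shift[of _ "length x"]
      atLeastSucAtMost_greaterThanAtMost[symmetric] sum.shift_bounds_cl_Suc_ivl
    by (simp add: y atLeast0AtMost ksign_sum ksign_ksign)
qed

text \<open>The sign count in the induction step of \<open>der_total_eq\<close>. \<open>T\<close>
  stands for the word with \<open>b\<close> in front of all letters, which occurs in both products
  of the commutator and cancels.\<close>

lemma der_sign:
  "P - ksign q R + ksign q (M - ksign w N) =
   ksign q M + T + P - ksign (q + w) (ksign (q + w) T + N + ksign w R)"
  by (auto simp: ksign_def algebra_simps)

lemma lsum_plus: "lsum L (F + G) = lsum L F + lsum L G"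
  by (simp add: plus_fun_def lsum_add)

lemma multilinear_Cons:
  assumes "multilinear s V F" "x \<in> V p"
  shows "multilinear s V (\<lambda>t. F ((p, x) # t))"
  unfolding multilinear_def
proof (intro allI impI ballI)
  fix u v p' y z c
  assume "gword V u" "gword V v" "y \<in> V p'" "z \<in> V p'"
  then show "F ((p, x) # u @ (p', y + z) # v) = F ((p, x) # u @ (p', y) # v) + F ((p, x) # u @ (p', z) # v) \<and>
     F ((p, x) # u @ (p', s c y) # v) = s c (F ((p, x) # u @ (p', y) # v))"
    using assms(1)[unfolded multilinear_def, rule_format, of y p' z "(p, x) # u" v] assms(2)
    by (auto simp: gword_def)
qed

lemma multilinear_0:
  assumes "multilinear s V F" "module s" "0 \<in> V p" "gword V u" "gword V v"
  shows "F (u @ (p, 0) # v) = 0"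
proof -
  interpret module s by fact
  show ?thesis
    using assms(1)[unfolded multilinear_def, rule_format, of 0 p 0 u v 0] assms by simp
qed

lemma multilinear_diff:
  assumes "multilinear s V F" "module s" "module.subspace s (V p)" "gword V u" "gword V v"
    "x \<in> V p" "y \<in> V p"
  shows "F (u @ (p, x - y) # v) = F (u @ (p, x) # v) - F (u @ (p, y) # v)"
proof -
  interpret module s by fact
  have "x - y \<in> V p" using assms subspace_diff by blast
  then have "F (u @ (p, (x - y) + y) # v) = F (u @ (p, x - y) # v) + F (u @ (p, y) # v)"
    using assms unfolding multilinear_def by blast
  then show ?thesis by simp
qed

lemma multilinear_ksign:
  assumes "multilinear s V F" "module s" "module.subspace s (V p)" "gword V u" "gword V v" "x \<in> V p"
  shows "F (u @ (p, ksign e x) # v) = ksign e (F (u @ (p, x) # v))"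
proof -
  interpret module s by fact
  have z: "0 \<in> V p" using assms subspace_0 by blast
  show ?thesis
    using multilinear_diff[OF assms(1-5) z assms(6)] multilinear_0[OF assms(1,2) z assms(4,5)]
    by (simp add: ksign_def)
qed

section \<open>The product on the tensor coalgebra of cochains\<close>

context gquiver
begin

lemma module_cochain: "module (cochain_scale sc :: 'k \<Rightarrow> ('o, 'm) cochain \<Rightarrow> ('o, 'm) cochain)"
  by unfold_locales
    (auto simp: cochain_scale_def fun_eq_iff md.scale_right_distrib md.scale_left_distrib)

sublocale cd: module "cochain_scale sc :: 'k \<Rightarrow> ('o, 'm) cochain \<Rightarrow> ('o, 'm) cochain"
  by (rule module_cochain)

lemma Cbr_comb:
  assumes "\<phi> \<in> Cbr sc Q p" "\<psi> \<in> Cbr sc Q p"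
  shows "cochain_scale sc a \<phi> + cochain_scale sc c \<psi> \<in> Cbr sc Q p"
proof (rule CbrI)
  fix B w assume w: "sword Q B w"
  then show "(cochain_scale sc a \<phi> + cochain_scale sc c \<psi>) B w \<in> QHom Q (src B w) B (wdeg w + p + 1)"
    using Cbr_val[OF assms(1) w] Cbr_val[OF assms(2) w] sword_obj[OF w] sword_src[OF w]
    by (auto simp: cochain_scale_def intro!: QHom_add QHom_scale)
next
  fix B w assume "\<not> sword Q B w"
  then show "(cochain_scale sc a \<phi> + cochain_scale sc c \<psi>) B w = 0"
    using Cbr_nosword[OF assms(1)] Cbr_nosword[OF assms(2)] by (simp add: cochain_scale_def)
next
  fix B
  show "mlin sc sc Q B ((cochain_scale sc a \<phi> + cochain_scale sc c \<psi>) B)"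
    using Cbr_mlin[OF assms(1), of B] Cbr_mlin[OF assms(2), of B]
    by (simp add: mlin_def cochain_scale_def md.scale_right_distrib mult.commute add_ac)
qed

lemma Cbr_0: "0 \<in> Cbr sc Q p"
  by (rule CbrI) (auto simp: mlin_def intro!: QHom_0 dest: sword_obj sword_src)

lemma Cbr_sub: "module.subspace (cochain_scale sc) (Cbr sc Q p)"
proof (rule cd.subspaceI)
  show "0 \<in> Cbr sc Q p" by (rule Cbr_0)
  fix \<phi> assume \<phi>: "\<phi> \<in> Cbr sc Q p"
  show "cochain_scale sc c \<phi> \<in> Cbr sc Q p" for c
    using Cbr_comb[OF \<phi> \<phi>, of c 0] by simp
  show "\<phi> + \<psi> \<in> Cbr sc Q p" if "\<psi> \<in> Cbr sc Q p" for \<psi>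
    using Cbr_comb[OF \<phi> that, of 1 1] by simp
qed

lemma Cbr_ksign: "\<phi> \<in> Cbr sc Q p \<Longrightarrow> ksign e \<phi> \<in> Cbr sc Q p"
  using cd.subspace_neg[OF Cbr_sub] by (simp add: ksign_def)

lemma brace_Nil: "\<phi> \<in> Cbr sc Q p \<Longrightarrow> brace Q \<phi> [] = \<phi>"
  using Cbr_nosword by (fastforce simp: fun_eq_iff brace_eq)

lemma Cbr_mul_simps [simp]:
  "Cbr_mul Q [] [] = 0" "Cbr_mul Q [] [(q, \<psi>)] = \<psi>" "Cbr_mul Q [] (y1 # y2 # ys) = 0"
  "Cbr_mul Q [(p, \<phi>)] y = brace Q \<phi> y" "Cbr_mul Q (x1 # x2 # xs) y = 0"
  by (simp_all add: Cbr_mul_def)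

lemma Cbr_mul_long: "2 \<le> length x \<Longrightarrow> Cbr_mul Q x y = 0"
  by (cases x; cases "tl x") auto

lemma Cbr_mul_Nil_long: "2 \<le> length y \<Longrightarrow> Cbr_mul Q [] y = 0"
  by (cases y; cases "tl y") auto

lemma Cbr_mul_Cbr:
  assumes "gword (Cbr sc Q) x" "gword (Cbr sc Q) y"
  shows "Cbr_mul Q x y \<in> Cbr sc Q (wdeg x + wdeg y)"
proof (cases x)
  case Nil
  then show ?thesis
    using assms by (cases y; cases "tl y") (auto simp: Cbr_0)
next
  case (Cons a x')
  obtain p \<phi> where a: "a = (p, \<phi>)" by (cases a)
  show ?thesis
    using assms Cons a brace_Cbr[of \<phi> p y] by (cases x') (auto simp: Cbr_0)
qed

lemma brace_multilinear:
  assumes "\<phi> \<in> Cbr sc Q q"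
  shows "multilinear (cochain_scale sc) (Cbr sc Q) (brace Q \<phi>)"
  unfolding multilinear_def
proof (intro allI ballI impI)
  fix u v p x y c
  assume g: "gword (Cbr sc Q) u" "gword (Cbr sc Q) v" "x \<in> Cbr sc Q p" "y \<in> Cbr sc Q p"
  have *: "brace Q \<phi> (u @ (p, cochain_scale sc a x + cochain_scale sc c y) # v) =
    cochain_scale sc a (brace Q \<phi> (u @ (p, x) # v)) + cochain_scale sc c (brace Q \<phi> (u @ (p, y) # v))" for a c
    using lsum_brace_words_cochain_lin[OF module_sc _ Cbr_mlin[OF assms] g] by (auto simp: fun_eq_iff brace_eq cochain_scale_def)
  show "brace Q \<phi> (u @ (p, x + y) # v) = brace Q \<phi> (u @ (p, x) # v) + brace Q \<phi> (u @ (p, y) # v) \<and>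
    brace Q \<phi> (u @ (p, cochain_scale sc c x) # v) = cochain_scale sc c (brace Q \<phi> (u @ (p, x) # v))"
    using *[of 1 1] *[of c 0] by simp
qed

lemma zero_multilinear: "multilinear (cochain_scale sc) V (\<lambda>t. 0 :: ('o, 'm) cochain)"
  by (simp add: multilinear_def)

lemma Cbr_mul_multilinear_right:
  assumes "gword (Cbr sc Q) x"
  shows "multilinear (cochain_scale sc) (Cbr sc Q) (Cbr_mul Q x)"
proof (cases x)
  case Nil
  have "Cbr_mul Q [] (u @ (p, x) # v) = (if u = [] \<and> v = [] then x else 0)" for u v p x
    by (cases u; cases v; cases "tl u") auto
  then show ?thesis by (auto simp: multilinear_def Nil)
next
  case (Cons a x')
  obtain p \<phi> where a: "a = (p, \<phi>)" by (cases a)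
  have e: "Cbr_mul Q x = (if x' = [] then brace Q \<phi> else (\<lambda>t. 0))"
    by (cases x') (auto simp: fun_eq_iff Cons a)
  show ?thesis
    unfolding e using brace_multilinear[of \<phi> p] zero_multilinear assms Cons a by (cases x') auto
qed

lemma Cbr_mul_multilinear_left:
  "multilinear (cochain_scale sc) (Cbr sc Q) (\<lambda>x. Cbr_mul Q x y)"
proof -
  have *: "Cbr_mul Q (u @ (p, x) # v) y = (if u = [] \<and> v = [] then brace Q x y else 0)" for u v p x
    by (cases u; cases v; cases "tl u") auto
  have "brace Q (x + x') y = brace Q x y + brace Q x' y" for x x'
    by (auto simp: fun_eq_iff brace_eq lsum_plus)
  moreover have "brace Q (cochain_scale sc c x) y = cochain_scale sc c (brace Q x y)" for c x
    by (auto simp: fun_eq_iff brace_eq cochain_scale_def lsum_additive[of "sc c", OF md.scale_right_distrib])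
  ultimately show ?thesis by (auto simp: multilinear_def *)
qed

lemma mul_total_Cbr:
  "gword (Cbr sc Q) x \<Longrightarrow> gword (Cbr sc Q) y \<Longrightarrow> multilinear (cochain_scale sc) (Cbr sc Q) F \<Longrightarrow>
   mul_total (Cbr_mul Q) F x y = lsum (mul_words x y) F"
proof (induction "(x, y)" arbitrary: x y F rule: wf_induct_rule[OF wf_measure[of "\<lambda>(x, y). length x + length y"]])
  case 1
  note IH = 1(1)[simplified]
  note x = 1(2) and y = 1(3) and F = 1(4)
  have gt: "gword (Cbr sc Q) (take a z)" "gword (Cbr sc Q) (drop a z)" if "gword (Cbr sc Q) z" for a z
    using that unfolding gword_def by (auto dest: in_set_takeD in_set_dropD)
  show ?case
  proof (cases "x = [] \<and> y = []")
    case True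
    then show ?thesis by (simp add: mul_total_def)
  next
    case False
    let ?S = "{..length x} \<times> {..length y} - {(0, 0)}"
    let ?m = "\<lambda>a b. Cbr_mul Q (take a x) (take b y)"
    let ?F = "\<lambda>a b t. F ((wdeg (take a x) + wdeg (take b y), ?m a b) # t)"
    let ?f = "\<lambda>a b. ksign (wdeg (take b y) * wdeg (drop a x)) (lsum (mul_words (drop a x) (drop b y)) (?F a b))"
    have f: "mul_total (Cbr_mul Q) (?F a b) (drop a x) (drop b y) = lsum (mul_words (drop a x) (drop b y)) (?F a b)"
      if "(a, b) \<in> ?S" for a b
      using IH[of "drop a x" "drop b y" "?F a b"] that x y gt
        multilinear_Cons[OF F Cbr_mul_Cbr[OF gt(1)[OF x] gt(1)[OF y]], of a b] by auto
    have z: "?f a b = 0" if "?m a b = 0" for a b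
    proof -
      have "lsum (mul_words (drop a x) (drop b y)) (?F a b) = 0"
      proof (rule lsum_eq_0)
        fix e T assume "(e, T) \<in> set (mul_words (drop a x) (drop b y))"
        then have "gword (Cbr sc Q) T" using mul_words_valid gt x y by blast
        then show "?F a b T = 0"
          using multilinear_0[OF F module_cochain Cbr_0, of "[]" T] that by simp
      qed
      then show ?thesis by simp
    qed
    define g where "g a b = ?f a b" for a b
    \<comment> \<open>\<open>?S1\<close> is the cut that lets one letter of \<open>y\<close> pass,
      \<open>?S2\<close> are the cuts in which the first letter of \<open>x\<close> takes in an
      initial piece of \<open>y\<close>. At any other cut the component \<open>Cbr_mul\<close> is
      zero, and then so is the value of the multilinear \<open>F\<close>.\<close>
    let ?S1 = "if y = [] then {} else {(0, 1)}" and ?S2 = "if x = [] then {} else {1} \<times> {..length y}"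
    have "mul_total (Cbr_mul Q) F x y = (\<Sum>(a, b)\<in>?S. g a b)"
    proof -
      have "x \<noteq> [] \<or> y \<noteq> []" using False by blast
      then show ?thesis
        unfolding mul_total_rec[OF \<open>x \<noteq> [] \<or> y \<noteq> []\<close>]
      proof (intro sum.cong refl)
        fix i assume i: "i \<in> ?S"
        obtain a b where ab: "i = (a, b)" by (cases i)
        show "(case i of (a, b) \<Rightarrow> ksign (wdeg (take b y) * wdeg (drop a x))
             (mul_total (Cbr_mul Q) (?F a b) (drop a x) (drop b y))) = (case i of (a, b) \<Rightarrow> g a b)"
          unfolding ab prod.case f[OF i[unfolded ab]] g_def ..
      qed
    qed
    also have "\<dots> = (\<Sum>(a, b)\<in>?S1 \<union> ?S2. g a b)"
    proof (rule sum.mono_neutral_right)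
      show "\<forall>i\<in>?S - (?S1 \<union> ?S2). (case i of (a, b) \<Rightarrow> g a b) = 0"
      proof
        fix i assume i: "i \<in> ?S - (?S1 \<union> ?S2)"
        obtain a b where ab': "i = (a, b)" by (cases i)
        have ab: "a \<le> length x" "b \<le> length y" "a = 0 \<longrightarrow> 2 \<le> b" "a \<noteq> 0 \<longrightarrow> 2 \<le> a"
          using i by (cases x; cases y; auto simp: ab')+
        have "?m a b = 0"
        proof (cases "a = 0")
          case True
          then have "2 \<le> length (take b y)" using ab by auto
          then show ?thesis using True by (simp add: Cbr_mul_Nil_long)
        next
          case False
          then have "2 \<le> length (take a x)" using ab by auto
          then show ?thesis by (simp add: Cbr_mul_long)
        qed
        then show "(case i of (a, b) \<Rightarrow> g a b) = 0" unfolding ab' prod.case g_def by (rule z)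
      qed
      show "?S1 \<union> ?S2 \<subseteq> ?S"
        using False by (cases x; cases y) auto
    qed simp
    also have "\<dots> = (\<Sum>(a, b)\<in>?S1. g a b) + (\<Sum>(a, b)\<in>?S2. g a b)"
      by (rule sum.union_disjoint) auto
    also have "(\<Sum>(a, b)\<in>?S2. g a b) = (if x = [] then 0 else \<Sum>b\<le>length y. g 1 b)"
      using sum.cartesian_product[of g "{..length y}" "{1}"] by simp
    also have "(\<Sum>(a, b)\<in>?S1. g a b) = (if y = [] then 0 else g 0 1)"
      by simp
    finally have e: "mul_total (Cbr_mul Q) F x y =
      (if y = [] then 0 else ?f 0 1) + (if x = [] then 0 else \<Sum>b\<le>length y. ?f 1 b)"
      unfolding g_def .
    show ?thesis
    proof (cases x)
      case Nil
      then obtain p \<zeta> Z where "y = (p, \<zeta>) # Z" using False by (cases y) auto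
      then show ?thesis unfolding e using Nil by simp
    next
      case (Cons h Y)
      obtain q \<psi> where h: "h = (q, \<psi>)" by (cases h)
      have "(\<Sum>b\<le>length y. ?f 1 b) = lsum (splittings y) (\<lambda>(Z1, Z2). ksign (wdeg Z1 * wdeg Y)
         (lsum (mul_words Y Z2) (\<lambda>T. F ((q + wdeg Z1, brace Q \<psi> Z1) # T))))"
        by (simp add: lsum_splittings_eq_sum Cons h)
      moreover have "(if y = [] then 0 else ?f 0 1) = (case y of [] \<Rightarrow> 0 | (p, \<zeta>) # Z' \<Rightarrow>
         ksign (p * (q + wdeg Y)) (lsum (mul_words ((q, \<psi>) # Y) Z') (\<lambda>T. F ((p, \<zeta>) # T))))"
        by (auto simp: Cons h split: list.splits)
      moreover have "lsum (mul_words x y) F = (case y of [] \<Rightarrow> 0 | (p, \<zeta>) # Z' \<Rightarrow>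
         ksign (p * (q + wdeg Y)) (lsum (mul_words ((q, \<psi>) # Y) Z') (\<lambda>T. F ((p, \<zeta>) # T)))) +
         lsum (splittings y) (\<lambda>(Z1, Z2). ksign (wdeg Z1 * wdeg Y)
         (lsum (mul_words Y Z2) (\<lambda>T. F ((q + wdeg Z1, brace Q \<psi> Z1) # T))))"
        unfolding Cons h by (rule lsum_mul_words_ne)
      moreover have "mul_total (Cbr_mul Q) F x y = (if y = [] then 0 else ?f 0 1) + (\<Sum>b\<le>length y. ?f 1 b)"
        using e Cons by (simp only: list.distinct if_False)
      ultimately show ?thesis by (simp only:)
    qed
  qed
qed

lemma mul_words_length: "(e, T) \<in> set (mul_words Y Z) \<Longrightarrow> length Y \<le> length T"
proof (induction "(Y, Z)" arbitrary: Y Z e T rule: wf_induct_rule[OF wf_measure[of "\<lambda>(Y, Z). length Y + length Z"]])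
  case 1
  note IH = 1(1)[simplified]
  show ?case
  proof (cases Y)
    case Nil
    then show ?thesis by simp
  next
    case (Cons y Y')
    obtain q \<psi> where y: "y = (q, \<psi>)" by (cases y)
    from 1(2)
    consider (pass) p \<zeta> Z' e' T' where "Z = (p, \<zeta>) # Z'" "T = (p, \<zeta>) # T'" "(e', T') \<in> set (mul_words Y Z')"
      | (cons) Z1 Z2 e' T' where "Z1 @ Z2 = Z" "T = (q + wdeg Z1, brace Q \<psi> Z1) # T'" "(e', T') \<in> set (mul_words Y' Z2)"
      unfolding Cons y by (subst (asm) mul_words.simps(2)) (auto simp: set_pre set_lbind set_splittings split: list.splits)
    then show ?thesis
    proof cases
      case pass
      then show ?thesis using IH[OF _ pass(3)] by auto
    next
      case cons
      then show ?thesis using IH[OF _ cons(3)] Cons by auto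
    qed
  qed
qed

text \<open>A letter of \<open>Z\<close> left outside \<psi> makes the word at least two letters
  long, so a functional that kills such words sees only the term in which \<psi> absorbs all of
  \<open>Z\<close>.\<close>

lemma lsum_mul_words_single:
  assumes "\<And>T. 2 \<le> length T \<Longrightarrow> G T = 0"
  shows "lsum (mul_words [(q, \<psi>)] Z) G = G [(q + wdeg Z, brace Q \<psi> Z)]"
proof -
  have 1: "lsum (mul_words [(q, \<psi>)] Z') (\<lambda>T. G (h # T)) = 0" for Z' h
  proof (rule lsum_eq_0)
    fix e T assume "(e, T) \<in> set (mul_words [(q, \<psi>)] Z')"
    then have "1 \<le> length T" using mul_words_length by fastforce
    then show "G (h # T) = 0" using assms by simp
  qed
  have *: "lsum (splittings W) (\<lambda>(Z1, Z2). H Z1 Z2) = H W []" if "\<And>Z1 Z2. Z2 \<noteq> [] \<Longrightarrow> H Z1 Z2 = 0"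
    for W :: "(int \<times> ('o, 'm) cochain) list" and H
    using that by (induction W arbitrary: H) auto
  have "lsum (splittings Z) (\<lambda>(Z1, Z2). G ((q + wdeg Z1, brace Q \<psi> Z1) # Z2)) = G [(q + wdeg Z, brace Q \<psi> Z)]"
    using assms *[of "\<lambda>Z1 Z2. G ((q + wdeg Z1, brace Q \<psi> Z1) # Z2)" Z]
    by (auto simp: Suc_le_eq)
  then show ?thesis
    unfolding lsum_mul_words_ne[of q \<psi> "[]" Z G] 1 by (auto simp: split_def split: list.splits)
qed

text \<open>For a one-letter \<open>x\<close> this is the brace identity. For an empty
  \<open>x\<close>, both sides are the one-letter part of the product of \<open>y\<close> and
  \<open>z\<close>; for a longer \<open>x\<close>, every term is zero since products do not become
  shorter than their left factor.\<close>

lemma mul_assoc: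
  assumes x: "gword (Cbr sc Q) x" and y: "gword (Cbr sc Q) y" and z: "gword (Cbr sc Q) z"
  shows "lsum (mul_words x y) (\<lambda>t. Cbr_mul Q t z) = lsum (mul_words y z) (Cbr_mul Q x)"
proof -
  consider "x = []" | p \<phi> where "x = [(p, \<phi>)]" | "2 \<le> length x"
    by (cases x; cases "tl x") auto
  then show ?thesis
  proof cases
    case 1
    consider "y = []" | q \<psi> where "y = [(q, \<psi>)]" | "2 \<le> length y"
      by (cases y; cases "tl y") auto
    then have "Cbr_mul Q y z = lsum (mul_words y z) (Cbr_mul Q [])"
    proof cases
      case 1
      then show ?thesis by simp
    next
      case 2
      then show ?thesis by (simp add: lsum_mul_words_single Cbr_mul_Nil_long)
    next
      case 3
      then have "lsum (mul_words y z) (Cbr_mul Q []) = 0"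
        using mul_words_length by (intro lsum_eq_0 Cbr_mul_Nil_long) fastforce
      then show ?thesis using 3 by (simp add: Cbr_mul_long)
    qed
    then show ?thesis using 1 by simp
  next
    case 2
    have e: "Cbr_mul Q [(p, \<phi>)] = brace Q \<phi>" by (simp add: fun_eq_iff)
    show ?thesis
      unfolding 2 e using brace_brace[OF _ y z, of \<phi> p] x 2
      by (simp add: lsum_mul_words_single Cbr_mul_long)
  next
    case 3
    then have "lsum (mul_words x y) (\<lambda>t. Cbr_mul Q t z) = 0"
      using mul_words_length by (intro lsum_eq_0 Cbr_mul_long) fastforce
    moreover have "lsum (mul_words y z) (Cbr_mul Q x) = 0"
      using 3 by (intro lsum_eq_0 Cbr_mul_long)
    ultimately show ?thesis by simp
  qed
qed

lemma lsum_mul_words_Nil: "gword (Cbr sc Q) x \<Longrightarrow> lsum (mul_words x []) G = G x"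
proof (induction x arbitrary: G)
  case (Cons a x)
  obtain p \<phi> where a: "a = (p, \<phi>)" by (cases a)
  show ?case using Cons brace_Nil[of \<phi> p] by (simp add: a lsum_mul_words_ne)
qed simp

lemma Cbr_dif_simps [simp]:
  "Cbr_dif Q b [] = 0"
  "Cbr_dif Q b [(p, \<phi>)] = brace Q b [(p, \<phi>)] - ksign p (brace Q \<phi> [(1, b)])"
  "Cbr_dif Q b (x1 # x2 # xs) = brace Q b (x1 # x2 # xs)"
  by (simp_all add: Cbr_dif_def)

text \<open>The differential becomes a graded commutator for the product. On the empty word both
  terms equal \<open>b\<close> and cancel; on words of two or more letters the second term vanishes,
  which is why only the linear part of the differential has a correction.\<close>

lemma Cbr_dif_eq:
  assumes "b \<in> Cbr sc Q 1"
  shows "Cbr_dif Q b x = Cbr_mul Q [(1, b)] x - ksign (wdeg x) (Cbr_mul Q x [(1, b)])"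
  using brace_Nil[OF assms] by (cases x; cases "tl x") auto

text \<open>The commutator formula passes from the component to the whole coderivation. With it, all
  identities about the differential become identities about the associative product.\<close>

lemma der_total_eq:
  assumes b: "b \<in> Cbr sc Q 1"
  shows "gword (Cbr sc Q) x \<Longrightarrow> multilinear (cochain_scale sc) (Cbr sc Q) F \<Longrightarrow>
    der_total (Cbr_dif Q b) F x = lsum (mul_words [(1, b)] x) F - ksign (wdeg x) (lsum (mul_words x [(1, b)]) F)"
proof (induction x arbitrary: F)
  case Nil
  then show ?case using brace_Nil[OF b] by (simp add: lsum_mul_words_ne)
next
  case (Cons y x)
  obtain q \<psi> where y: "y = (q, \<psi>)" by (cases y)
  have \<psi>: "\<psi> \<in> Cbr sc Q q" and x: "gword (Cbr sc Q) x" using Cons y by auto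
  have Fy: "multilinear (cochain_scale sc) (Cbr sc Q) (\<lambda>t. F ((q, \<psi>) # t))"
    by (rule multilinear_Cons[OF Cons.prems(2) \<psi>])
  have L: "lsum (mul_words [(1, b)] (y # x)) F =
      ksign q (lsum (mul_words [(1, b)] x) (\<lambda>t. F (y # t))) + F ((1, b) # y # x) +
      lsum (splittings x) (\<lambda>(u, v). F ((q + wdeg u + 1, brace Q b (y # u)) # v))"
    by (simp add: lsum_mul_words_ne[of 1 b "[]" "(q, \<psi>) # x"] y brace_Nil[OF b] add_ac)
  have R: "lsum (mul_words (y # x) [(1, b)]) F =
      ksign (wdeg (y # x)) (F ((1, b) # y # x)) + lsum (mul_words x [(1, b)]) (\<lambda>t. F (y # t)) +
      ksign (wdeg x) (F ((q + 1, brace Q \<psi> [(1, b)]) # x))"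
    using lsum_mul_words_Nil[OF Cons.prems(1), of "\<lambda>T. F ((1, b) # T)"] lsum_mul_words_Nil[OF x, of "\<lambda>T. F ((q + 1, brace Q \<psi> [(1, b)]) # T)"]
    by (simp add: lsum_mul_words_ne[of q \<psi> x "[(1, b)]"] y brace_Nil[OF \<psi>] add_ac)
  have D: "lsum (splittings x) (\<lambda>(u, v). F ((wdeg (y # u) + 1, Cbr_dif Q b (y # u)) # v)) =
     lsum (splittings x) (\<lambda>(u, v). F ((q + wdeg u + 1, brace Q b (y # u)) # v)) -
     ksign q (F ((q + 1, brace Q \<psi> [(1, b)]) # x))"
  proof -
    have b1: "brace Q b [(q, \<psi>)] \<in> Cbr sc Q (q + 1)"
      using brace_Cbr[OF b, of "[(q, \<psi>)]"] \<psi> by (simp add: add_ac)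
    have b2: "brace Q \<psi> [(1, b)] \<in> Cbr sc Q (q + 1)"
      using brace_Cbr[OF \<psi>, of "[(1, b)]"] b by simp
    have "F ((q + 1, brace Q b [(q, \<psi>)] - ksign q (brace Q \<psi> [(1, b)])) # x) =
       F ((q + 1, brace Q b [(q, \<psi>)]) # x) - ksign q (F ((q + 1, brace Q \<psi> [(1, b)]) # x))"
      using multilinear_diff[OF Cons.prems(2) module_cochain Cbr_sub _ x b1 Cbr_ksign[OF b2], of "[]"]
        multilinear_ksign[OF Cons.prems(2) module_cochain Cbr_sub _ x b2, of "[]"] by simp
    then show ?thesis
      by (cases x) (auto simp: y split_def)
  qed
  show ?case
    unfolding der_total_Cons D L R
    using Cons.IH[OF x Fy] by (simp only: y fst_conv wdeg_Cons der_sign)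
qed

end

section \<open>The differential as a commutator with the dg structure\<close>

locale dg_quiver = gquiver sc Q
  for sc :: "'k::comm_ring_1 \<Rightarrow> 'm::ab_group_add \<Rightarrow> 'm" and Q :: "('o, 'm) dgcat" +
  assumes dg_Cbr: "dg_structure Q \<in> Cbr sc Q 1"
    and dg_square: "brace Q (dg_structure Q) [(1, dg_structure Q)] = 0"
begin

declare Cbr_mul_simps [simp del]

abbreviation "b \<equiv> dg_structure Q"

text \<open>Since \<open>b\<close> is odd, the two shuffles of \<open>b\<close> with itself cancel,
  and the remaining term is the letter \<open>b{b} = 0\<close>.\<close>

lemma lsum_mul_words_b_b:
  assumes "multilinear (cochain_scale sc) (Cbr sc Q) G"
  shows "lsum (mul_words [(1, b)] [(1, b)]) G = 0"
  using multilinear_0[OF assms module_cochain Cbr_0, of "[]" "[]" 2] brace_Nil[OF dg_Cbr] dg_square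
  by (simp add: lsum_mul_words_ne ksign_def)

lemma Cbr_dif_Cbr:
  assumes "gword (Cbr sc Q) x"
  shows "Cbr_dif Q b x \<in> Cbr sc Q (wdeg x + 1)"
  unfolding Cbr_dif_eq[OF dg_Cbr]
  using Cbr_mul_Cbr[of "[(1, b)]" x] Cbr_mul_Cbr[of x "[(1, b)]"] assms dg_Cbr
  by (intro cd.subspace_diff[OF Cbr_sub] Cbr_ksign) (auto simp: add_ac)

lemma Cbr_dif_multilinear: "multilinear (cochain_scale sc) (Cbr sc Q) (Cbr_dif Q b)"
  unfolding multilinear_def
proof (intro allI impI ballI)
  fix u v p x y c
  assume "gword (Cbr sc Q) u" "gword (Cbr sc Q) v" "x \<in> Cbr sc Q p" "y \<in> Cbr sc Q p"
  note g = this
  have bg: "gword (Cbr sc Q) [(1, b)]" using dg_Cbr by simp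
  have k: "ksign e (cochain_scale sc c X) = cochain_scale sc c (ksign e X)" for e and X :: "('o, 'm) cochain"
    by (simp add: ksign_def)
  have "Cbr_mul Q [(1, b)] (u @ (p, x + y) # v) = Cbr_mul Q [(1, b)] (u @ (p, x) # v) + Cbr_mul Q [(1, b)] (u @ (p, y) # v) \<and>
      Cbr_mul Q [(1, b)] (u @ (p, cochain_scale sc c x) # v) = cochain_scale sc c (Cbr_mul Q [(1, b)] (u @ (p, x) # v))"
    using Cbr_mul_multilinear_right[OF bg] g unfolding multilinear_def by blast
  moreover have "Cbr_mul Q (u @ (p, x + y) # v) [(1, b)] = Cbr_mul Q (u @ (p, x) # v) [(1, b)] + Cbr_mul Q (u @ (p, y) # v) [(1, b)] \<and>
      Cbr_mul Q (u @ (p, cochain_scale sc c x) # v) [(1, b)] = cochain_scale sc c (Cbr_mul Q (u @ (p, x) # v) [(1, b)])"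
    using Cbr_mul_multilinear_left[of "[(1, b)]"] g unfolding multilinear_def by blast
  ultimately show "Cbr_dif Q b (u @ (p, x + y) # v) = Cbr_dif Q b (u @ (p, x) # v) + Cbr_dif Q b (u @ (p, y) # v) \<and>
      Cbr_dif Q b (u @ (p, cochain_scale sc c x) # v) = cochain_scale sc c (Cbr_dif Q b (u @ (p, x) # v))"
    unfolding Cbr_dif_eq[OF dg_Cbr] wdeg_append wdeg_Cons
    by (simp add: ksign_add cd.scale_right_diff_distrib k)
qed

text \<open>Both the components \<open>Cbr_dif\<close> and the coderivation are commutators with the
  word \<open>[(1, b)]\<close>. So the Leibniz rule follows from associativity, and the square of
  the differential is the commutator with the product of that word with itself.\<close>

lemma binf_algebra_Cbr: "binf_algebra (cochain_scale sc) (Cbr_binf sc Q)"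
proof -
  let ?V = "Cbr sc Q" and ?m = "Cbr_mul Q" and ?D = "Cbr_dif Q b" and ?b = "[(1, b)]"
  have bg: "gword ?V ?b" using dg_Cbr by simp
  have D: "lsum (mul_words x y) ?D = lsum (mul_words x y) (?m ?b) - ksign (wdeg x + wdeg y) (lsum (mul_words x y) (\<lambda>t. ?m t ?b))"
    if "gword ?V x" "gword ?V y" for x y
  proof -
    have "lsum (mul_words x y) ?D = lsum (mul_words x y) (\<lambda>t. ?m ?b t - ksign (wdeg x + wdeg y) (?m t ?b))"
      using mul_words_valid[OF _ that] by (intro lsum_cong) (auto simp: Cbr_dif_eq[OF dg_Cbr])
    then show ?thesis by (simp add: lsum_diff lsum_ksign)
  qed
  have "mul_total ?m (\<lambda>t. ?m t z) x y = mul_total ?m (?m x) y z"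
    if "gword ?V x" "gword ?V y" "gword ?V z" for x y z
    using mul_assoc[OF that] that Cbr_mul_multilinear_left[of z] Cbr_mul_multilinear_right[of x]
    by (simp add: mul_total_Cbr)
  moreover have "der_total ?D ?D x = 0" if x: "gword ?V x" for x
  proof -
    have "der_total ?D ?D x = lsum (mul_words ?b x) ?D - ksign (wdeg x) (lsum (mul_words x ?b) ?D)"
      by (rule der_total_eq[OF dg_Cbr x Cbr_dif_multilinear])
    \<comment> \<open>The terms with \<open>b\<close> on both sides of \<open>x\<close> cancel by
      associativity, since the two commutators enter with opposite signs there.\<close>
    also have "\<dots> = lsum (mul_words ?b x) (?m ?b) - lsum (mul_words ?b ?b) (?m x)"
      using mul_assoc[OF bg x bg] mul_assoc[OF x bg bg]
      by (simp add: D x bg dg_Cbr ksign_diff ksign_ksign) (simp add: ksign_def)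
    also have "\<dots> = 0"
      using mul_assoc[OF bg bg x] lsum_mul_words_b_b[OF Cbr_mul_multilinear_left[of x]]
        lsum_mul_words_b_b[OF Cbr_mul_multilinear_right[OF x]] by simp
    finally show ?thesis .
  qed
  moreover have "mul_total ?m ?D x y = der_total ?D (\<lambda>t. ?m t y) x + ksign (wdeg x) (der_total ?D (?m x) y)"
    if x: "gword ?V x" and y: "gword ?V y" for x y
    using mul_assoc[OF bg x y] mul_assoc[OF x bg y] mul_assoc[OF x y bg]
    by (simp add: mul_total_Cbr[OF x y Cbr_dif_multilinear] D[OF x y]
        der_total_eq[OF dg_Cbr x Cbr_mul_multilinear_left] der_total_eq[OF dg_Cbr y Cbr_mul_multilinear_right[OF x]]
        ksign_diff ksign_ksign)
  moreover have "?m x [] = (if length x = 1 then snd (hd x) else 0) \<and>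
        ?m [] x = (if length x = 1 then snd (hd x) else 0)" if "gword ?V x" for x
    using that by (cases x; cases "tl x") (auto simp: brace_Nil Cbr_mul_simps)
  ultimately show ?thesis
    unfolding binf_algebra_def Cbr_binf_def
    using Cbr_sub Cbr_mul_Cbr Cbr_dif_Cbr Cbr_mul_multilinear_left Cbr_mul_multilinear_right
      Cbr_dif_multilinear module_cochain
    by simp
qed

end


section \<open>Extension of cochains to complexes\<close>

text \<open>Any bound will do; a chosen one makes the recursion of \<open>delta_words\<close>
  terminate, and \<open>lsum_delta_words'\<close> removes it from the recursion equation
  again.\<close>

definition lower_bound :: "('o, 'm) cat \<Rightarrow> ('o, 'm) cplx \<Rightarrow> int" where
  "lower_bound C X = (SOME N. \<forall>i<N. zero_object C (fst X i))"

lemma zero_object_below_lower_bound: "bb_complex C X \<Longrightarrow> i < lower_bound C X \<Longrightarrow> zero_object C (fst X i)"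
proof -
  assume "bb_complex C X" and i: "i < lower_bound C X"
  then have "\<exists>N. \<forall>i<N. zero_object C (fst X i)" by (simp add: bb_complex_def)
  then have "\<forall>i<lower_bound C X. zero_object C (fst X i)" unfolding lower_bound_def by (rule someI_ex)
  then show ?thesis using i by blast
qed

text \<open>The words obtained from the components of \<open>w\<close>, the leftmost of which ends in degree \<open>l\<close>, by inserting
  differentials.  The sum may be cut off at \<open>lower_bound\<close>, since the words omitted pass through
  zero objects.\<close>

function delta_words ::
  "('o, 'm::zero) cat \<Rightarrow> ('o, 'm) cplx \<Rightarrow> (('o, 'm) cplx, int \<Rightarrow> 'm) qpath \<Rightarrow> int \<Rightarrow>
   (int \<times> ('o, 'm) qpath) list" where
  "delta_words C B w l =
     (if l < lower_bound C B then []
      else (case w of [] \<Rightarrow> [(0, [])] | (d, f, A) # w' \<Rightarrow>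
          pre l (Cons (- 1, f (l - (d + 1)), fst A (l - (d + 1)))) (delta_words C A w' (l - (d + 1)))) @
        pre l (Cons (- 1, snd B (l - 1), fst B (l - 1))) (delta_words C B w (l - 1)))"
  by pat_completeness auto
termination
  by (relation "measures [\<lambda>(C, B, w, l). length w, \<lambda>(C, B, w, l). nat (l + 1 - lower_bound C B)]") auto

declare delta_words.simps [simp del]

lemma delta_words_below: "l < lower_bound C B \<Longrightarrow> delta_words C B w l = []"
  by (simp add: delta_words.simps)

lemma lsum_delta_words:
  "\<not> l < lower_bound C B \<Longrightarrow> lsum (delta_words C B w l) F =
     (case w of [] \<Rightarrow> F [] | (d, f, A) # w' \<Rightarrow>
       ksign l (lsum (delta_words C A w' (l - (d + 1))) (\<lambda>t. F ((- 1, f (l - (d + 1)), fst A (l - (d + 1))) # t)))) +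
     ksign l (lsum (delta_words C B w (l - 1)) (\<lambda>t. F ((- 1, snd B (l - 1), fst B (l - 1)) # t)))"
  by (subst delta_words.simps) (auto split: list.splits)

text \<open>The second part has to start in the degree where \<open>t1\<close> stops. A letter of
  suspended degree \<open>d\<close> lowers the degree by \<open>d + 1\<close> and a differential by
  1, so \<open>t1\<close> lowers it by \<open>wdeg w1\<close> plus its number of letters; as these
  all have degree -1, that number is \<open>- wdeg t1\<close>. No sign appears, because the sign of
  a letter depends only on the degree in which it ends.\<close>

lemma lsum_delta_words_comult:
  "lsum (delta_words C B w l) (\<lambda>t. lsum (splittings t) (\<lambda>(t1, t2). G t1 t2)) =
   lsum (splittings w) (\<lambda>(w1, w2). lsum (delta_words C B w1 l) (\<lambda>t1.
     lsum (delta_words C (src B w1) w2 (l - wdeg w1 + wdeg t1)) (\<lambda>t2. G t1 t2)))"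
proof (induction C B w l arbitrary: G rule: delta_words.induct)
  case (1 C B w l)
  show ?case
  proof (cases "l < lower_bound C B")
    case True
    then show ?thesis by (simp add: delta_words_below)
  next
    case False
    let ?\<delta> = "(- 1, snd B (l - 1), fst B (l - 1))"
    let ?R = "\<lambda>B w l G. lsum (splittings w) (\<lambda>(w1, w2). lsum (delta_words C B w1 l) (\<lambda>t1.
       lsum (delta_words C (src B w1) w2 (l - wdeg w1 + wdeg t1)) (\<lambda>t2. G t1 t2)))"
    have IH\<delta>: "lsum (delta_words C B w (l - 1)) (\<lambda>t. lsum (splittings t) (\<lambda>(t1, t2). G (?\<delta> # t1) t2)) =
        ?R B w (l - 1) (\<lambda>t1. G (?\<delta> # t1))"
      by (rule 1(2)[OF False])
    show ?thesis
    proof (cases w)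
      case Nil
      show ?thesis
        using IH\<delta> unfolding Nil
        by (simp add: lsum_delta_words[OF False] lsum_add ksign_add split_def algebra_simps)
    next
      case (Cons x w')
      obtain d f A where x: "x = (d, f, A)" by (cases x) auto
      let ?l = "l - (d + 1)"
      let ?f = "(- 1, f ?l, fst A ?l)"
      have IHf: "lsum (delta_words C A w' ?l) (\<lambda>t. lsum (splittings t) (\<lambda>(t1, t2). G (?f # t1) t2)) =
          ?R A w' ?l (\<lambda>t1. G (?f # t1))"
        using 1(1)[OF False Cons x[symmetric] refl] .
      have L: "lsum (delta_words C B w l) (\<lambda>t. lsum (splittings t) (\<lambda>(t1, t2). G t1 t2)) =
         lsum (delta_words C B w l) (G []) + ksign l (?R A w' ?l (\<lambda>t1. G (?f # t1))) +
         ksign l (?R B w (l - 1) (\<lambda>t1. G (?\<delta> # t1)))"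
        unfolding lsum_delta_words[OF False, of w] IH\<delta>[symmetric] IHf[symmetric]
        by (simp add: Cons x lsum_add ksign_add split_def algebra_simps)
      \<comment> \<open>The cut in front of the first letter of \<open>w\<close>, where
        \<open>t1\<close> consists of differentials only; \<open>F\<close> below treats the cuts
        behind that letter.\<close>
      have A: "lsum (delta_words C B [] l) (\<lambda>t1. lsum (delta_words C B w (l + wdeg t1)) (\<lambda>t2. G t1 t2)) =
         lsum (delta_words C B w l) (G []) + ksign l (lsum (delta_words C B [] (l - 1)) (\<lambda>t1.
            lsum (delta_words C B w (l - 1 + wdeg t1)) (\<lambda>t2. G (?\<delta> # t1) t2)))"
        by (subst lsum_delta_words[OF False]) (simp add: algebra_simps)
      have F: "lsum (delta_words C B (x # u) l) (\<lambda>t1. lsum (delta_words C (src A u) v (l - wdeg (x # u) + wdeg t1)) (\<lambda>t2. G t1 t2)) =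
         ksign l (lsum (delta_words C A u ?l) (\<lambda>t1. lsum (delta_words C (src A u) v (?l - wdeg u + wdeg t1)) (\<lambda>t2. G (?f # t1) t2))) +
         ksign l (lsum (delta_words C B (x # u) (l - 1)) (\<lambda>t1. lsum (delta_words C (src A u) v (l - 1 - wdeg (x # u) + wdeg t1)) (\<lambda>t2. G (?\<delta> # t1) t2)))"
        for u v
        by (subst lsum_delta_words[OF False]) (simp add: x algebra_simps)
      have "?R B w l G = lsum (delta_words C B [] l) (\<lambda>t1. lsum (delta_words C B w (l + wdeg t1)) (\<lambda>t2. G t1 t2)) +
         lsum (splittings w') (\<lambda>(u, v). lsum (delta_words C B (x # u) l) (\<lambda>t1.
           lsum (delta_words C (src A u) v (l - wdeg (x # u) + wdeg t1)) (\<lambda>t2. G t1 t2)))"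
        by (simp add: Cons x)
      also have "\<dots> = lsum (delta_words C B w l) (G []) + ksign l (?R A w' ?l (\<lambda>t1. G (?f # t1))) +
         ksign l (?R B w (l - 1) (\<lambda>t1. G (?\<delta> # t1)))"
        unfolding A F by (simp add: Cons x lsum_add lsum_ksign ksign_add split_def algebra_simps)
      finally show ?thesis unfolding L by simp
    qed
  qed
qed

text \<open>The rule of the recursion would let \<open>C\<close> vary, although no recursive call
  changes it. Fixing \<open>C\<close> makes the rule usable where the category is a parameter of the
  locale.\<close>

lemma delta_words_induct [case_names step]:
  fixes C :: "('o, 'm::zero) cat" and P :: "('o, 'm) cplx \<Rightarrow> (('o, 'm) cplx, int \<Rightarrow> 'm) qpath \<Rightarrow> int \<Rightarrow> bool"
  assumes "\<And>B w l. (\<And>d f A w'. \<not> l < lower_bound C B \<Longrightarrow> w = (d, f, A) # w' \<Longrightarrow> P A w' (l - (d + 1))) \<Longrightarrow>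
     (\<not> l < lower_bound C B \<Longrightarrow> P B w (l - 1)) \<Longrightarrow> P B w l"
  shows "P B w l"
proof -
  have "C' = C \<longrightarrow> P B w l" for C'
    by (induction C' B w l rule: delta_words.induct) (use assms in blast)
  then show ?thesis by blast
qed

section \<open>Linear categories and their complexes as graded quivers\<close>

locale lin_cat =
  fixes sc :: "'k::comm_ring_1 \<Rightarrow> 'm::ab_group_add \<Rightarrow> 'm" and C :: "('o, 'm) cat" and z :: 'o
  assumes lin: "linear_category sc C" and zero: "zero_object C z"
begin

abbreviation "LQ \<equiv> linear_dg C"
abbreviation "KQ \<equiv> Com_plus C"
abbreviation "csc \<equiv> com_scale sc"

lemma module_base: "module sc"
  using lin by (simp add: linear_category_def)

lemma Hom_sub: "X \<in> Obj C \<Longrightarrow> Y \<in> Obj C \<Longrightarrow> module.subspace sc (Hom C X Y)"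
  using lin by (simp add: linear_category_def)

sublocale bm: module sc by (rule module_base)

lemma QObj_LQ [simp]: "QObj LQ = Obj C"
  by (simp add: linear_dg_def)

lemma QHom_LQ: "QHom LQ X Y n = (if n = 0 then Hom C X Y else {0})"
  by (simp add: linear_dg_def)

lemma QObj_KQ: "X \<in> QObj KQ \<longleftrightarrow> bb_complex C X"
  by (simp add: Com_plus_def)

lemma QHom_KQ: "f \<in> QHom KQ X Y n \<longleftrightarrow> (\<forall>i. f i \<in> Hom C (fst X i) (fst Y (i + n)))"
  by (simp add: Com_plus_def)

lemma Obj_cplx: "X \<in> QObj KQ \<Longrightarrow> fst X i \<in> Obj C"
  by (simp add: QObj_KQ bb_complex_def)

sublocale L: gquiver sc LQ
proof
  fix X Y n assume "X \<in> QObj LQ" "Y \<in> QObj LQ"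
  then show "bm.subspace (QHom LQ X Y n)"
    by (simp add: QHom_LQ Hom_sub)
qed

lemma module_com: "module csc"
  by unfold_locales
    (auto simp: com_scale_def fun_eq_iff bm.scale_right_distrib bm.scale_left_distrib)

sublocale K: gquiver csc KQ
proof (rule gquiver.intro, rule module_com)
  interpret c: module csc by (rule module_com)
  fix X Y n assume "X \<in> QObj KQ" "Y \<in> QObj KQ"
  then have "bm.subspace (Hom C (fst X i) (fst Y (i + n)))" for i
    by (simp add: Hom_sub Obj_cplx)
  then show "c.subspace (QHom KQ X Y n)"
    by (auto simp: c.subspace_def bm.subspace_def QHom_KQ com_scale_def)
qed

lemma Hom_0: "X \<in> Obj C \<Longrightarrow> Y \<in> Obj C \<Longrightarrow> 0 \<in> Hom C X Y"
  using Hom_sub bm.subspace_0 by blast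

lemma zero_object_Obj: "zero_object C Z \<Longrightarrow> Z \<in> Obj C"
  by (simp add: zero_object_def)

lemma Hom_to_zero: "zero_object C Z \<Longrightarrow> X \<in> Obj C \<Longrightarrow> f \<in> Hom C X Z \<Longrightarrow> f = 0"
  using Hom_0[of X Z] zero_object_Obj unfolding zero_object_def by blast

lemma Hom_from_zero: "zero_object C Z \<Longrightarrow> X \<in> Obj C \<Longrightarrow> f \<in> Hom C Z X \<Longrightarrow> f = 0"
  using Hom_0[of Z X] zero_object_Obj unfolding zero_object_def by blast

lemma delta_words_letter:
  assumes "sword KQ B ((d, f, A) # w)"
  shows "f (l - (d + 1)) \<in> Hom C (fst A (l - (d + 1))) (fst B l)"
  using assms unfolding QHom_KQ sword.simps by (metis diff_add_cancel)

lemma delta_words_delta: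
  assumes "B \<in> QObj KQ"
  shows "snd B (l - 1) \<in> Hom C (fst B (l - 1)) (fst B l)"
  using assms unfolding QObj_KQ bb_complex_def by (metis diff_add_cancel)

lemma delta_words_valid:
  "(e, t) \<in> set (delta_words C B w l) \<Longrightarrow> sword KQ B w \<Longrightarrow>
   sword LQ (fst B l) t \<and> wdeg t = - int (length t) \<and>
   src (fst B l) t = fst (src B w) (l - wdeg w + wdeg t)"
proof (induction B w l arbitrary: e t rule: delta_words_induct[where C = C])
  case (step B w l)
  have B: "B \<in> QObj KQ" using sword_obj[OF step(4)] .
  have nb: "\<not> l < lower_bound C B" using step(3) by (auto simp: delta_words_below)
  have \<delta>: "snd B (l - 1) \<in> Hom C (fst B (l - 1)) (fst B l)"
    by (rule delta_words_delta[OF B])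
  from step(3)
  consider (nil) "w = []" "t = []"
    | (pass) d f A w' e' t' where "w = (d, f, A) # w'" "t = (- 1, f (l - (d + 1)), fst A (l - (d + 1))) # t'"
        "(e', t') \<in> set (delta_words C A w' (l - (d + 1)))"
    | (delta) e' t' where "t = (- 1, snd B (l - 1), fst B (l - 1)) # t'" "(e', t') \<in> set (delta_words C B w (l - 1))"
    by (subst (asm) delta_words.simps) (use nb in \<open>auto simp: set_pre split: list.splits\<close>)
  then show ?case
  proof cases
    case nil
    then show ?thesis using B by (simp add: Obj_cplx)
  next
    case pass
    have f: "f (l - (d + 1)) \<in> Hom C (fst A (l - (d + 1))) (fst B l)"
      using delta_words_letter[of B d f A w' l] step(4) pass(1) by simp
    show ?thesis
      using step(1)[OF nb pass(1,3)] step(4) pass f B by (simp add: QHom_LQ Obj_cplx algebra_simps)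
  next
    case delta
    show ?thesis
      using step(2)[OF nb delta(2) step(4)] delta \<delta> B by (simp add: QHom_LQ Obj_cplx algebra_simps)
  qed
qed

text \<open>A multilinear \<open>F\<close> vanishes automatically on nonempty words through a zero object; the extra
  condition makes the cutoff in \<open>delta_words\<close> harmless for the empty word too.\<close>

definition reg :: "('k \<Rightarrow> 'v::ab_group_add \<Rightarrow> 'v) \<Rightarrow> 'o \<Rightarrow> (('o, 'm) qpath \<Rightarrow> 'v) \<Rightarrow> bool" where
  "reg sco D F \<longleftrightarrow> mlin sc sco LQ D F \<and> (zero_object C D \<longrightarrow> F [] = 0)"

text \<open>The condition at the empty word survives the reading of a letter: a letter that starts
  at a zero object is zero, and \<open>F\<close> is linear in it.\<close>

lemma reg_Cons:
  fixes sco :: "'k \<Rightarrow> 'v::ab_group_add \<Rightarrow> 'v"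
  assumes mo: "module sco" and F: "reg sco D F" and D: "D \<in> Obj C" and D': "D' \<in> Obj C"
    and x: "x \<in> Hom C D' D"
  shows "reg sco D' (\<lambda>t. F ((- 1, x, D') # t))"
proof -
  have "F [(- 1, x, D')] = 0" if "zero_object C D'"
  proof -
    have "x = 0" using Hom_from_zero[OF that D x] .
    then show ?thesis
      using L.mlin_head_0[OF mo, of D F D' "[]" "- 1"] F D D' by (simp add: reg_def)
  qed
  then show ?thesis
    using mlin_Cons[of sc sco LQ D F x D' "- 1"] F x D by (simp add: reg_def QHom_LQ)
qed

lemma reg_zero_object:
  fixes sco :: "'k \<Rightarrow> 'v::ab_group_add \<Rightarrow> 'v"
  assumes mo: "module sco" and F: "reg sco D F" and D: "zero_object C D" and t: "sword LQ D t"
  shows "F t = 0"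
proof (cases t)
  case Nil
  then show ?thesis using F D by (simp add: reg_def)
next
  case (Cons a t')
  obtain d x A where a: "a = (d, x, A)" by (cases a) auto
  have "x = 0"
    using t Cons a Hom_to_zero[OF D, of A x] sword_obj[of LQ A t'] by (auto simp: QHom_LQ split: if_splits)
  then show ?thesis
    using L.mlin_head_0[OF mo, of D F A t' d] F t Cons a by (auto simp: reg_def)
qed

text \<open>The arity zero part at a zero object is an endomorphism of that object or lies in a zero
  module, hence vanishes.\<close>

lemma Cbr_reg: "\<phi> \<in> Cbr sc LQ p \<Longrightarrow> D \<in> Obj C \<Longrightarrow> reg sc D (\<phi> D)"
  using L.Cbr_mlin[of \<phi> p D] L.Cbr_val[of \<phi> p D "[]"] Hom_to_zero[of D D "\<phi> D []"]
  by (auto simp: reg_def QHom_LQ split: if_splits)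

lemma mlin_lsum_delta_words:
  fixes sco :: "'k \<Rightarrow> 'v::ab_group_add \<Rightarrow> 'v"
  assumes mo: "module sco"
  shows "sword KQ B (u @ (d, x, A) # v) \<Longrightarrow> sword KQ B (u @ (d, y, A) # v) \<Longrightarrow>
     w = u @ (d, csc a x + csc c y, A) # v \<Longrightarrow> mlin sc sco LQ (fst B l) F \<Longrightarrow>
     lsum (delta_words C B w l) F =
       sco a (lsum (delta_words C B (u @ (d, x, A) # v) l) F) + sco c (lsum (delta_words C B (u @ (d, y, A) # v) l) F)"
proof (induction B w l arbitrary: u F rule: delta_words_induct[where C = C])
  case (step B w l)
  interpret o: module sco by fact
  have sum_lin: "lsum L (\<lambda>t. sco a (H t) + sco c (K t)) = sco a (lsum L H) + sco c (lsum L K)"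
    for L :: "(int \<times> 'x) list" and H K a c
    unfolding lsum_add
    using lsum_additive[of "sco a" L H] lsum_additive[of "sco c" L K] by (simp add: o.scale_right_distrib)
  have sgn1: "ksign e (sco a x) = sco a (ksign e x)" for e a x
    by (simp add: ksign_def)
  note sx = step(3) and sy = step(4) and w = step(5) and F = step(6)
  have B: "B \<in> QObj KQ" using sword_obj[OF sx] .
  show ?case
  proof (cases "l < lower_bound C B")
    case True
    then show ?thesis by (simp add: delta_words_below)
  next
    case False
    let ?P = "\<lambda>w. case w of [] \<Rightarrow> F [] | (d, f, A) # w' \<Rightarrow>
       ksign l (lsum (delta_words C A w' (l - (d + 1))) (\<lambda>t. F ((- 1, f (l - (d + 1)), fst A (l - (d + 1))) # t)))"
    let ?D = "\<lambda>w. lsum (delta_words C B w (l - 1)) (\<lambda>t. F ((- 1, snd B (l - 1), fst B (l - 1)) # t))"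
    have D: "?D w = sco a (?D (u @ (d, x, A) # v)) + sco c (?D (u @ (d, y, A) # v))"
      by (rule step(2)[OF False sx sy w])
        (rule mlin_Cons[OF F], use B delta_words_delta[OF B, of l] in \<open>auto simp: QHom_LQ Obj_cplx\<close>)
    have P: "?P w = sco a (?P (u @ (d, x, A) # v)) + sco c (?P (u @ (d, y, A) # v))"
    proof (cases u)
      case Nil
      let ?l = "l - (d + 1)"
      have "lsum (delta_words C A v ?l) (\<lambda>t. F ((- 1, (csc a x + csc c y) ?l, fst A ?l) # t)) =
         lsum (delta_words C A v ?l) (\<lambda>t. sco a (F ((- 1, x ?l, fst A ?l) # t)) + sco c (F ((- 1, y ?l, fst A ?l) # t)))"
      proof (rule lsum_cong)
        fix e t assume "(e, t) \<in> set (delta_words C A v ?l)"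
        then have t: "sword LQ (fst A ?l) t" using delta_words_valid sx Nil by simp
        then show "F ((- 1, (csc a x + csc c y) ?l, fst A ?l) # t) =
           sco a (F ((- 1, x ?l, fst A ?l) # t)) + sco c (F ((- 1, y ?l, fst A ?l) # t))"
          using mlin_head[OF F, of "- 1" "x ?l" "fst A ?l" t "y ?l" a c]
            delta_words_letter[of B d x A v l] delta_words_letter[of B d y A v l] sx sy Nil B
          by (simp add: com_scale_def QHom_LQ Obj_cplx)
      qed
      then show ?thesis by (simp add: w Nil sum_lin ksign_add sgn1)
    next
      case (Cons x' u')
      obtain d' f A' where x': "x' = (d', f, A')" by (cases x') auto
      have "mlin sc sco LQ (fst A' (l - (d' + 1))) (\<lambda>t. F ((- 1, f (l - (d' + 1)), fst A' (l - (d' + 1))) # t))"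
        by (rule mlin_Cons[OF F]) (use B delta_words_letter[of B d' f A' "u' @ (d, x, A) # v" l] sx Cons x' in
            \<open>auto simp: QHom_LQ Obj_cplx\<close>)
      then have "lsum (delta_words C A' (u' @ (d, csc a x + csc c y, A) # v) (l - (d' + 1)))
            (\<lambda>t. F ((- 1, f (l - (d' + 1)), fst A' (l - (d' + 1))) # t)) =
          sco a (lsum (delta_words C A' (u' @ (d, x, A) # v) (l - (d' + 1)))
            (\<lambda>t. F ((- 1, f (l - (d' + 1)), fst A' (l - (d' + 1))) # t))) +
          sco c (lsum (delta_words C A' (u' @ (d, y, A) # v) (l - (d' + 1)))
            (\<lambda>t. F ((- 1, f (l - (d' + 1)), fst A' (l - (d' + 1))) # t)))"
        using sx sy w Cons x' by (intro step(1)[OF False _ _ _ refl]) auto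
      then show ?thesis
        unfolding w Cons x' append_Cons list.case prod.case by (simp only: ksign_add sgn1)
    qed
    show ?thesis
      unfolding lsum_delta_words[OF False, of w F] lsum_delta_words[OF False, of "u @ (d, x, A) # v" F]
        lsum_delta_words[OF False, of "u @ (d, y, A) # v" F] P D
      by (simp add: ksign_add sgn1 o.scale_right_distrib algebra_simps)
  qed
qed

text \<open>This is \<open>embr\<close>, defined on all cochains at once; the sign comes from desuspending and
  resuspending.\<close>

definition emb :: "int \<Rightarrow> ('o, 'm) cochain \<Rightarrow> (('o, 'm) cplx, int \<Rightarrow> 'm) cochain" where
  "emb p \<phi> B w = (if sword KQ B w
     then (\<lambda>i. let l = i + wdeg w + p + 1 in ksign ((p + 1) * l) (lsum (delta_words C B w l) (\<phi> (fst B l))))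
     else 0)"

lemma lsum_delta_words_Hom:
  assumes \<phi>: "\<phi> \<in> Cbr sc LQ p" and w: "sword KQ B w" and l: "l = i + wdeg w + p + 1"
  shows "lsum (delta_words C B w l) (\<phi> (fst B l)) \<in> Hom C (fst (src B w) i) (fst B l)"
proof -
  have o: "fst (src B w) i \<in> Obj C" "fst B l \<in> Obj C"
    using sword_obj[OF w] sword_src[OF w] by (auto simp: Obj_cplx)
  have "lsum (delta_words C B w l) (\<phi> (fst B l)) \<in> Hom C (fst (src B w) i) (fst B l)
     \<and> id (lsum (delta_words C B w l) (\<phi> (fst B l))) = lsum (delta_words C B w l) (\<lambda>t. id (\<phi> (fst B l) t))"
  proof (rule lsum_additive_on)
    fix e t assume t: "(e, t) \<in> set (delta_words C B w l)"
    have v: "sword LQ (fst B l) t" "src (fst B l) t = fst (src B w) (l - wdeg w + wdeg t)"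
      using delta_words_valid[OF t w] by auto
    show "\<phi> (fst B l) t \<in> Hom C (fst (src B w) i) (fst B l)"
    proof (cases "wdeg t + p + 1 = 0")
      case True
      then have "l - wdeg w + wdeg t = i" using l by simp
      then show ?thesis using L.Cbr_val[OF \<phi> v(1)] True v(2) by (simp add: QHom_LQ)
    next
      case False
      then show ?thesis using L.Cbr_val[OF \<phi> v(1)] Hom_0[OF o] by (simp add: QHom_LQ)
    qed
  qed (use o Hom_sub[OF o] bm.subspace_add bm.subspace_neg Hom_0 in auto)
  then show ?thesis by simp
qed

lemma emb_Cbr:
  assumes \<phi>: "\<phi> \<in> Cbr sc LQ p"
  shows "emb p \<phi> \<in> Cbr csc KQ p"
proof (rule K.CbrI)
  fix B w assume w: "sword KQ B w"
  have o: "fst (src B w) i \<in> Obj C" "fst B l \<in> Obj C" for i l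
    using sword_obj[OF w] sword_src[OF w] by (auto simp: Obj_cplx)
  have "ksign e x \<in> Hom C X Y" if "x \<in> Hom C X Y" "X \<in> Obj C" "Y \<in> Obj C" for e x X Y
    using that Hom_sub bm.subspace_neg by (simp add: ksign_def)
  then show "emb p \<phi> B w \<in> QHom KQ (src B w) B (wdeg w + p + 1)"
    using lsum_delta_words_Hom[OF \<phi> w] w o by (simp add: emb_def QHom_KQ Let_def add.assoc)
next
  fix B
  show "mlin csc csc KQ B (emb p \<phi> B)"
    unfolding mlin_def
  proof (intro allI impI ext)
    fix u d x y A v a c i
    assume s: "sword KQ B (u @ (d, x, A) # v)" "sword KQ B (u @ (d, y, A) # v)"
    let ?l = "i + (wdeg u + (d + wdeg v)) + p + 1"
    have k: "ksign e (sc a x) = sc a (ksign e x)" for e a x by (simp add: ksign_def)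
    show "emb p \<phi> B (u @ (d, csc a x + csc c y, A) # v) i =
      (csc a (emb p \<phi> B (u @ (d, x, A) # v)) + csc c (emb p \<phi> B (u @ (d, y, A) # v))) i"
      using mlin_lsum_delta_words[OF module_base s refl L.Cbr_mlin[OF \<phi>], of a c ?l] s K.sword_lin[OF s, of a c]
      by (simp add: emb_def Let_def com_scale_def ksign_add k)
  qed
qed (simp add: emb_def)

abbreviation "embw Y \<equiv> map (\<lambda>(q, \<psi>). (q, emb q \<psi>)) Y"

lemma wdeg_embw [simp]: "wdeg (embw Y) = wdeg Y"
  by (induction Y) auto

lemma gword_embw: "gword (Cbr sc LQ) Y \<Longrightarrow> gword (Cbr csc KQ) (embw Y)"
  by (induction Y) (auto simp: emb_Cbr gword_def)

text \<open>The compatibility of inserting differentials with inserting cochains. The degree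
  \<open>s + l\<close> in front makes the signs match: a letter of degree \<open>d\<close> changes
  \<open>s\<close> to \<open>s + d\<close> and \<open>l\<close> to \<open>l - (d + 1)\<close>, a
  differential changes only \<open>l\<close> to \<open>l - 1\<close>, and in both cases
  \<open>s + l\<close> drops by one, as it must for a letter of degree -1 in the linear
  category.\<close>

lemma delta_words_brace_words:
  fixes sco :: "'k \<Rightarrow> 'v::ab_group_add \<Rightarrow> 'v"
  assumes mo: "module sco"
  shows "sword KQ B w \<Longrightarrow> gword (Cbr sc LQ) Y \<Longrightarrow> reg sco (fst B l) F \<Longrightarrow>
    lsum (delta_words C B w l) (\<lambda>t. lsum (brace_words Y (s + l) (fst B l) t) F) =
    lsum (brace_words (embw Y) s B w) (\<lambda>t. lsum (delta_words C B t l) F)"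
proof (induction "(Y, w, B, l)" arbitrary: Y w B l s F
      rule: wf_induct_rule[OF wf_measures[of "[\<lambda>(Y, w, B, l). length Y + length w, \<lambda>(Y, w, B, l). nat (l + 1 - lower_bound C B)]"]])
  case 1
  note IH = 1(1)[simplified]
  note w = 1(2) and Yg = 1(3) and F = 1(4)
  have B: "B \<in> QObj KQ" using sword_obj[OF w] .
  have Bl: "fst B l \<in> Obj C" for l using Obj_cplx[OF B] .
  show ?case
  proof (cases "l < lower_bound C B")
    case True
    then show ?thesis by (simp add: delta_words_below)
  next
    case nb: False
    show ?thesis
    proof (cases Y)
      case Nil
      then show ?thesis by simp
    next
      case (Cons y Y')
      obtain q \<psi> where y: "y = (q, \<psi>)" by (cases y)
      have Y: "Y = (q, \<psi>) # Y'" by (simp add: Cons y)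
      have Yg': "gword (Cbr sc LQ) Y'" and \<psi>: "\<psi> \<in> Cbr sc LQ q" using Yg Y by auto
      have eY: "embw Y = (q, emb q \<psi>) # embw Y'" by (simp add: Y)
      let ?\<delta> = "(- 1, snd B (l - 1), fst B (l - 1))"
      \<comment> \<open>On the right, the words begin with a differential (\<open>D\<close>), with a
        letter of \<open>w\<close> (\<open>P\<close>) or with a value of the extension of \<psi>
        (\<open>E\<close>). The first two arise on the left by skipping a letter and applying the
        induction hypothesis; \<open>E\<close> has to come from \<psi> swallowing letters and
        differentials.\<close>
      define D where "D = ksign l (lsum (brace_words (embw Y) s B w) (\<lambda>t. lsum (delta_words C B t (l - 1)) (\<lambda>t. F (?\<delta> # t))))"
      define P where "P = (case w of [] \<Rightarrow> 0 | (d, f, A) # w' \<Rightarrow> ksign l (lsum (brace_words (embw Y) (s + d) A w')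
         (\<lambda>t. lsum (delta_words C A t (l - (d + 1))) (\<lambda>t. F ((- 1, f (l - (d + 1)), fst A (l - (d + 1))) # t)))))"
      define E where "E = ksign (q * s + l) (lsum (splittings w) (\<lambda>(w1, w2).
         lsum (brace_words (embw Y') (s + wdeg w1) (src B w1) w2) (\<lambda>t. lsum (delta_words C (src B w1) t (l - wdeg w1 - q - 1))
           (\<lambda>t. F ((- 1, emb q \<psi> B w1 (l - wdeg w1 - q - 1), fst (src B w1) (l - wdeg w1 - q - 1)) # t)))))"
      have IH\<delta>: "lsum (delta_words C B w (l - 1)) (\<lambda>t. lsum (brace_words Y (s + l - 1) (fst B (l - 1)) t) (\<lambda>t. F (?\<delta> # t))) =
         lsum (brace_words (embw Y) s B w) (\<lambda>t. lsum (delta_words C B t (l - 1)) (\<lambda>t. F (?\<delta> # t)))"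
        using IH[of Y w "l - 1" B "\<lambda>t. F (?\<delta> # t)" s] nb w Yg reg_Cons[OF mo F Bl Bl delta_words_delta[OF B]]
        by (simp add: add_diff_eq)
      have R: "lsum (brace_words (embw Y) s B w) (\<lambda>t. lsum (delta_words C B t l) F) = P + E + D"
      proof -
        let ?H = "\<lambda>t. case t of [] \<Rightarrow> F [] | (d, f, A) # w' \<Rightarrow>
          ksign l (lsum (delta_words C A w' (l - (d + 1))) (\<lambda>t. F ((- 1, f (l - (d + 1)), fst A (l - (d + 1))) # t)))"
        have "lsum (brace_words (embw Y) s B w) (\<lambda>t. lsum (delta_words C B t l) F) = lsum (brace_words (embw Y) s B w) ?H + D"
          unfolding lsum_delta_words[OF nb] by (simp add: D_def lsum_add lsum_ksign)
        also have "lsum (brace_words (embw Y) s B w) ?H = P + consume q (emb q \<psi>) (embw Y') s B w ?H"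
          unfolding eY lsum_brace_words_ne[of q "emb q \<psi>" "embw Y'" s B w ?H]
          by (simp add: P_def eY lsum_ksign split: list.splits)
        also have "consume q (emb q \<psi>) (embw Y') s B w ?H = E"
          unfolding consume_def E_def
          by (simp add: lsum_ksign split_def ksign_ksign algebra_simps)
        finally show ?thesis .
      qed
      have L: "lsum (delta_words C B w l) (\<lambda>t. lsum (brace_words Y (s + l) (fst B l) t) F) =
        P + D + lsum (delta_words C B w l) (\<lambda>t. consume q \<psi> Y' (s + l) (fst B l) t F)"
      proof -
        let ?H = "\<lambda>t. case t of [] \<Rightarrow> 0 | (d, x, A) # t' \<Rightarrow>
            lsum (brace_words Y (s + l + d) A t') (\<lambda>t. F ((d, x, A) # t))"
        have "lsum (delta_words C B w l) (\<lambda>t. lsum (brace_words Y (s + l) (fst B l) t) F) =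
          lsum (delta_words C B w l) (\<lambda>t. ?H t + consume q \<psi> Y' (s + l) (fst B l) t F)"
          unfolding Y by (rule lsum_cong, rule lsum_brace_words_ne)
        also have "\<dots> = lsum (delta_words C B w l) ?H + lsum (delta_words C B w l) (\<lambda>t. consume q \<psi> Y' (s + l) (fst B l) t F)"
          by (rule lsum_add)
        also have "lsum (delta_words C B w l) ?H = P + D"
        proof (cases w)
          case Nil
          then show ?thesis using IH\<delta> by (simp add: lsum_delta_words[OF nb] P_def D_def)
        next
          case (Cons x w')
          obtain d f A where x: "x = (d, f, A)" by (cases x) auto
          let ?l = "l - (d + 1)"
          have A: "A \<in> QObj KQ" using w Cons x sword_obj[of KQ A w'] by simp
          have "lsum (delta_words C A w' ?l) (\<lambda>t. lsum (brace_words Y (s + l - 1) (fst A ?l) t) (\<lambda>t. F ((- 1, f ?l, fst A ?l) # t))) =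
            lsum (brace_words (embw Y) (s + d) A w') (\<lambda>t. lsum (delta_words C A t ?l) (\<lambda>t. F ((- 1, f ?l, fst A ?l) # t)))"
            using IH[of Y w' ?l A "\<lambda>t. F ((- 1, f ?l, fst A ?l) # t)" "s + d"] w Cons x Yg
              reg_Cons[OF mo F Bl Obj_cplx[OF A] delta_words_letter[of B d f A w' l]]
            by (simp add: algebra_simps)
          then show ?thesis using IH\<delta> by (simp add: lsum_delta_words[OF nb, of "(d, f, A) # w'"] P_def D_def Cons x)
        qed
        finally show ?thesis .
      qed
      have step: "lsum (delta_words C B w1 l) (\<lambda>t1. lsum (delta_words C (src B w1) w2 (l - wdeg w1 + wdeg t1))
          (\<lambda>t2. lsum (brace_words Y' (s + l + wdeg t1) (src (fst B l) t1) t2)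
            (\<lambda>t. F ((q + wdeg t1, \<psi> (fst B l) t1, src (fst B l) t1) # t)))) =
         ksign ((q + 1) * l) (lsum (brace_words (embw Y') (s + wdeg w1) (src B w1) w2)
          (\<lambda>t. lsum (delta_words C (src B w1) t (l - wdeg w1 - q - 1))
           (\<lambda>t. F ((- 1, emb q \<psi> B w1 (l - wdeg w1 - q - 1), fst (src B w1) (l - wdeg w1 - q - 1)) # t))))"
        if ww: "w = w1 @ w2" for w1 w2
      proof -
        define S where "S = src B w1"
        \<comment> \<open>The degree in which the value of \<psi> starts. All letters of
          \<open>t1\<close> have degree -1 and the category is concentrated in degree 0, so \<psi>,
          of degree \<open>q\<close>, is nonzero only on words of \<open>q + 1\<close> letters; only
          these have to end in \<open>l0\<close>.\<close>
        define l0 where "l0 = l - wdeg w1 - q - 1"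
        have sw: "sword KQ B w1" "sword KQ S w2" using w ww by (auto simp: sword_append S_def)
        have S: "S \<in> QObj KQ" using sword_src[OF sw(1)] by (simp add: S_def)
        have Sl: "fst S l \<in> Obj C" for l using Obj_cplx[OF S] .
        have v: "\<psi> (fst B l) t1 \<in> Hom C (fst S l0) (fst B l)" if t1: "(e, t1) \<in> set (delta_words C B w1 l)" for e t1
        proof (cases "wdeg t1 = - q - 1")
          case True
          then have "l - wdeg w1 + wdeg t1 = l0" "wdeg t1 + q + 1 = 0" by (auto simp: l0_def)
          then show ?thesis
            using L.Cbr_val[OF \<psi>, of "fst B l" t1] delta_words_valid[OF t1 sw(1)] unfolding S_def
            by (metis QHom_LQ)
        next
          case False
          then show ?thesis
            using L.Cbr_val[OF \<psi>, of "fst B l" t1] delta_words_valid[OF t1 sw(1)] Hom_0[OF Sl Bl]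
            by (simp add: QHom_LQ)
        qed
        have each: "lsum (delta_words C S w2 (l - wdeg w1 + wdeg t1))
            (\<lambda>t2. lsum (brace_words Y' (s + l + wdeg t1) (src (fst B l) t1) t2)
              (\<lambda>t. F ((q + wdeg t1, \<psi> (fst B l) t1, src (fst B l) t1) # t))) =
           lsum (brace_words (embw Y') (s + wdeg w1) S w2) (\<lambda>t. lsum (delta_words C S t l0)
              (\<lambda>t. F ((- 1, \<psi> (fst B l) t1, fst S l0) # t)))"
          if t1: "(e, t1) \<in> set (delta_words C B w1 l)" for e t1
        proof -
          have t: "sword LQ (fst B l) t1" "src (fst B l) t1 = fst S (l - wdeg w1 + wdeg t1)"
            using delta_words_valid[OF t1 sw(1)] by (auto simp: S_def)
          show ?thesis
          proof (cases "wdeg t1 = - q - 1")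
            case True
            then have l0: "l - wdeg w1 + wdeg t1 = l0" and s': "s + l + wdeg t1 = (s + wdeg w1) + l0"
              by (auto simp: l0_def)
            show ?thesis
              unfolding s' t(2) l0
              using IH[of Y' w2 l0 S "\<lambda>t. F ((- 1, \<psi> (fst B l) t1, fst S l0) # t)" "s + wdeg w1"]
                sw(2) Yg' reg_Cons[OF mo F Bl Sl v[OF t1]] ww Y True by simp
          next
            case False
            then have z: "\<psi> (fst B l) t1 = 0"
              using L.Cbr_val[OF \<psi> t(1)] by (simp add: QHom_LQ split: if_splits)
            have F0: "F ((d, 0, A) # t) = 0" if "sword LQ A t" for d A t
              using L.mlin_head_0[OF mo, of "fst B l" F A t d] F Bl that by (simp add: reg_def)
            have "lsum (delta_words C S w2 (l - wdeg w1 + wdeg t1))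
              (\<lambda>t2. lsum (brace_words Y' (s + l + wdeg t1) (src (fst B l) t1) t2)
              (\<lambda>t. F ((q + wdeg t1, \<psi> (fst B l) t1, src (fst B l) t1) # t))) = 0"
              unfolding z t(2)
              using delta_words_valid[OF _ sw(2)] L.brace_words_valid[OF _ _ Yg'] F0 by (intro lsum_eq_0) blast
            moreover have "lsum (brace_words (embw Y') (s + wdeg w1) S w2) (\<lambda>t. lsum (delta_words C S t l0)
              (\<lambda>t. F ((- 1, \<psi> (fst B l) t1, fst S l0) # t))) = 0"
              unfolding z
              using K.brace_words_valid[OF _ sw(2) gword_embw[OF Yg']] delta_words_valid F0 by (intro lsum_eq_0) blast
            ultimately show ?thesis by simp
          qed
        qed
        have "lsum (delta_words C B w1 l) (\<lambda>t1. lsum (delta_words C S w2 (l - wdeg w1 + wdeg t1))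
          (\<lambda>t2. lsum (brace_words Y' (s + l + wdeg t1) (src (fst B l) t1) t2)
            (\<lambda>t. F ((q + wdeg t1, \<psi> (fst B l) t1, src (fst B l) t1) # t)))) =
          lsum (delta_words C B w1 l) (\<lambda>t1. lsum (brace_words (embw Y') (s + wdeg w1) S w2) (\<lambda>t. lsum (delta_words C S t l0)
              (\<lambda>t. F ((- 1, \<psi> (fst B l) t1, fst S l0) # t))))"
          by (rule lsum_cong) (rule each)
        also have "\<dots> = lsum (brace_words (embw Y') (s + wdeg w1) S w2) (\<lambda>t. lsum (delta_words C S t l0)
              (\<lambda>t. lsum (delta_words C B w1 l) (\<lambda>t1. F ((- 1, \<psi> (fst B l) t1, fst S l0) # t))))"
          unfolding lsum_swap[of "delta_words C B w1 l" "brace_words (embw Y') (s + wdeg w1) S w2"] lsum_swap[of "delta_words C B w1 l" "delta_words C S _ l0"] ..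
        also have "\<dots> = lsum (brace_words (embw Y') (s + wdeg w1) S w2) (\<lambda>t. lsum (delta_words C S t l0)
              (\<lambda>t. ksign ((q + 1) * l) (F ((- 1, emb q \<psi> B w1 l0, fst S l0) # t))))"
        proof (rule lsum_cong, rule lsum_cong)
          fix e t e' t' assume t: "(e, t) \<in> set (brace_words (embw Y') (s + wdeg w1) S w2)" and t': "(e', t') \<in> set (delta_words C S t l0)"
          have st: "sword LQ (fst S l0) t'"
            using delta_words_valid[OF t'] K.brace_words_valid[OF t sw(2) gword_embw[OF Yg']] by simp
          have Fm: "mlin sc sco LQ (fst B l) F" using F by (simp add: reg_def)
          have Bl': "fst B l \<in> QObj LQ" using Bl by simp
          have v': "\<psi> (fst B l) t1 \<in> QHom LQ (fst S l0) (fst B l) (- 1 + 1)"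
            if "(e, t1) \<in> set (delta_words C B w1 l)" for e t1
            using v[OF that] by (simp add: QHom_LQ)
          have "lsum (delta_words C B w1 l) (\<lambda>t1. F ((- 1, \<psi> (fst B l) t1, fst S l0) # t')) =
            F ((- 1, lsum (delta_words C B w1 l) (\<psi> (fst B l)), fst S l0) # t')"
            by (rule L.lsum_head(2)[OF mo Fm Bl' st v', symmetric])
          \<comment> \<open>The sum over all \<open>t1\<close> that stem from \<open>w1\<close> is,
            up to its normalizing sign, a component of the extension of \<psi>.\<close>
          also have "lsum (delta_words C B w1 l) (\<psi> (fst B l)) = ksign ((q + 1) * l) (emb q \<psi> B w1 l0)"
            using sw(1) by (simp add: emb_def l0_def ksign_ksign) (simp add: ksign_def)
          also have "F ((- 1, ksign ((q + 1) * l) (emb q \<psi> B w1 l0), fst S l0) # t') =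
            ksign ((q + 1) * l) (F ((- 1, emb q \<psi> B w1 l0, fst S l0) # t'))"
          proof (rule L.mlin_head_ksign[OF mo Fm])
            have "emb q \<psi> B w1 l0 \<in> Hom C (fst S l0) (fst B l)"
              using K.Cbr_val[OF emb_Cbr[OF \<psi>] sw(1)] unfolding QHom_KQ S_def[symmetric]
              by (metis (no_types, lifting) l0_def add.commute diff_add_cancel diff_diff_eq)
            then show "sword LQ (fst B l) ((- 1, emb q \<psi> B w1 l0, fst S l0) # t')"
              using st Bl by (simp add: QHom_LQ)
          qed
          finally show "lsum (delta_words C B w1 l) (\<lambda>t1. F ((- 1, \<psi> (fst B l) t1, fst S l0) # t')) =
            ksign ((q + 1) * l) (F ((- 1, emb q \<psi> B w1 l0, fst S l0) # t'))" .
        qed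
        finally show ?thesis
          by (simp add: lsum_ksign S_def l0_def)
      qed
      have "lsum (delta_words C B w l) (\<lambda>t. consume q \<psi> Y' (s + l) (fst B l) t F) =
        ksign (q * (s + l)) (lsum (delta_words C B w l) (\<lambda>t. lsum (splittings t) (\<lambda>(t1, t2).
          lsum (brace_words Y' (s + l + wdeg t1) (src (fst B l) t1) t2)
            (\<lambda>t. F ((q + wdeg t1, \<psi> (fst B l) t1, src (fst B l) t1) # t)))))"
        by (simp add: consume_def lsum_ksign)
      also have "\<dots> = ksign (q * (s + l)) (lsum (splittings w) (\<lambda>(w1, w2). ksign ((q + 1) * l)
         (lsum (brace_words (embw Y') (s + wdeg w1) (src B w1) w2)
          (\<lambda>t. lsum (delta_words C (src B w1) t (l - wdeg w1 - q - 1))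
           (\<lambda>t. F ((- 1, emb q \<psi> B w1 (l - wdeg w1 - q - 1), fst (src B w1) (l - wdeg w1 - q - 1)) # t))))))"
        unfolding lsum_delta_words_comult by (intro arg_cong[where f = "ksign _"] lsum_splittings_cong step)
      \<comment> \<open>The sign \<open>q * (s + l)\<close> of placing \<psi> and the sign
        \<open>(q + 1) * l\<close> of its extension add up to \<open>q * s + l\<close> modulo
        2.\<close>
      also have "\<dots> = E"
        unfolding E_def split_def lsum_ksign ksign_ksign
        by (rule ksign_cong) (simp add: algebra_simps)
      finally show ?thesis unfolding L R by simp
    qed
  qed
qed

text \<open>The brace in the linear category has degree 0 in front, whereas the compatibility of
  words requires degree \<open>l\<close>. The shift costs the sign \<open>l * wdeg Y\<close>, which
  is the difference between the normalizing signs in the degrees \<open>p + wdeg Y\<close> and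
  \<open>p\<close>.\<close>

lemma emb_brace:
  assumes \<phi>: "\<phi> \<in> Cbr sc LQ p" and Y: "gword (Cbr sc LQ) Y"
  shows "emb (p + wdeg Y) (brace LQ \<phi> Y) = brace KQ (emb p \<phi>) (embw Y)"
proof (intro ext)
  fix B w i
  show "emb (p + wdeg Y) (brace LQ \<phi> Y) B w i = brace KQ (emb p \<phi>) (embw Y) B w i"
  proof (cases "sword KQ B w")
    case False
    then show ?thesis by (simp add: emb_def brace_eq)
  next
    case w: True
    define l where "l = i + wdeg w + (p + wdeg Y) + 1"
    have Bl: "fst B l \<in> Obj C" using sword_obj[OF w] by (simp add: Obj_cplx)
    have "emb (p + wdeg Y) (brace LQ \<phi> Y) B w i = ksign ((p + wdeg Y + 1) * l)
      (lsum (delta_words C B w l) (\<lambda>t. lsum (brace_words Y 0 (fst B l) t) (\<phi> (fst B l))))"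
    proof -
      have "emb (p + wdeg Y) (brace LQ \<phi> Y) B w i =
        ksign ((p + wdeg Y + 1) * l) (lsum (delta_words C B w l) (brace LQ \<phi> Y (fst B l)))"
        using w by (simp add: emb_def l_def Let_def)
      also have "lsum (delta_words C B w l) (brace LQ \<phi> Y (fst B l)) =
        lsum (delta_words C B w l) (\<lambda>t. lsum (brace_words Y 0 (fst B l) t) (\<phi> (fst B l)))"
        using delta_words_valid[OF _ w] by (intro lsum_cong) (simp add: brace_eq)
      finally show ?thesis .
    qed
    also have "\<dots> = ksign ((p + 1) * l) (lsum (delta_words C B w l) (\<lambda>t. lsum (brace_words Y (0 + l) (fst B l) t) (\<phi> (fst B l))))"
      unfolding lsum_brace_words_shift lsum_ksign ksign_ksign
      by (rule ksign_cong) (simp add: algebra_simps)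
    also have "\<dots> = ksign ((p + 1) * l) (lsum (brace_words (embw Y) 0 B w) (\<lambda>t. lsum (delta_words C B t l) (\<phi> (fst B l))))"
      unfolding delta_words_brace_words[OF module_base w Y Cbr_reg[OF \<phi> Bl], of 0] ..
    also have "\<dots> = lsum (brace_words (embw Y) 0 B w) (\<lambda>t. emb p \<phi> B t i)"
    proof (subst lsum_ksign[symmetric], rule lsum_cong)
      fix e t assume t: "(e, t) \<in> set (brace_words (embw Y) 0 B w)"
      have "sword KQ B t" "wdeg t = wdeg Y + wdeg w"
        using K.brace_words_valid[OF t w gword_embw[OF Y]] by auto
      then show "ksign ((p + 1) * l) (lsum (delta_words C B t l) (\<phi> (fst B l))) = emb p \<phi> B t i"
        by (simp add: emb_def Let_def l_def algebra_simps)
    qed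
    also have "\<dots> = brace KQ (emb p \<phi>) (embw Y) B w i"
      using w by (simp add: brace_eq lsum_apply)
    finally show ?thesis .
  qed
qed

lemma emb_add: "emb p (\<phi> + \<psi>) = emb p \<phi> + emb p \<psi>"
  by (auto simp: fun_eq_iff emb_def Let_def lsum_plus ksign_add)

lemma emb_0 [simp]: "emb p 0 = 0"
  using emb_add[of p 0 0] by simp

lemma emb_diff: "emb p (\<phi> - \<psi>) = emb p \<phi> - emb p \<psi>"
  using emb_add[of p "\<phi> - \<psi>" \<psi>] by (simp add: algebra_simps)

lemma emb_ksign: "emb p (ksign e \<phi>) = ksign e (emb p \<phi>)"
  using emb_diff[of p 0 \<phi>] by (simp add: ksign_def)

lemma emb_scale: "emb p (cochain_scale sc c \<phi>) = cochain_scale csc c (emb p \<phi>)"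
proof -
  have k: "ksign e (sc c x) = sc c (ksign e x)" for e x by (simp add: ksign_def)
  show ?thesis
    by (auto simp: fun_eq_iff emb_def Let_def cochain_scale_def com_scale_def
        k lsum_additive[of "sc c", OF bm.scale_right_distrib, symmetric])
qed

lemma emb_Cbr_mul:
  assumes "gword (Cbr sc LQ) x" "gword (Cbr sc LQ) y"
  shows "emb (wdeg x + wdeg y) (Cbr_mul LQ x y) = Cbr_mul KQ (embw x) (embw y)"
proof -
  consider "x = []" "y = []" | q \<psi> where "x = []" "y = [(q, \<psi>)]" | "x = []" "2 \<le> length y"
    | p \<phi> where "x = [(p, \<phi>)]" | "2 \<le> length x"
    by (cases x; cases "tl x"; cases y; cases "tl y") auto
  then show ?thesis
  proof cases
    case 4
    then show ?thesis using emb_brace[of \<phi> p y] assms by (simp add: L.Cbr_mul_simps K.Cbr_mul_simps)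
  qed (auto simp: L.Cbr_mul_simps K.Cbr_mul_simps L.Cbr_mul_Nil_long K.Cbr_mul_Nil_long L.Cbr_mul_long K.Cbr_mul_long)
qed

end

section \<open>The dg structure of complexes as an extended cochain\<close>

definition arity12 :: "('o, 'm::zero) cochain \<Rightarrow> bool" where
  "arity12 b \<longleftrightarrow> (\<forall>B w. length w \<noteq> 1 \<longrightarrow> length w \<noteq> 2 \<longrightarrow> b B w = 0)"

context gquiver
begin

lemma lsum_brace_words_arity12_Nil:
  assumes "\<And>d A t. sword Q A t \<Longrightarrow> F ((d, 0, A) # t) = 0" "arity12 b" "B \<in> QObj Q"
  shows "lsum (brace_words [(p, b)] s B []) F = 0"
proof -
  have "b B [] = 0" using assms(2) by (simp add: arity12_def)
  then show ?thesis
    using assms(1)[of B "[]" p] assms(3) by (simp add: lsum_brace_words_ne consume_def)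
qed

text \<open>A structure of arities 1 and 2 placed in front can take in only one or two letters.
  \<open>F\<close> is assumed merely to vanish on a zero first letter, since in
  \<open>cross_words_brace_words_bK\<close> the lemma is applied to a functional \<open>J\<close>
  for which this is what is established.\<close>

lemma lsum_brace_words_arity12_Cons:
  assumes F0: "\<And>d A t. sword Q A t \<Longrightarrow> F ((d, 0, A) # t) = 0" and b: "arity12 b"
    and w: "sword Q B ((d, x, A) # w)"
  shows "lsum (brace_words [(p, b)] s B ((d, x, A) # w)) F =
    lsum (brace_words [(p, b)] (s + d) A w) (\<lambda>t. F ((d, x, A) # t)) +
    ksign (p * s) (F ((p + d, b B [(d, x, A)], A) # w) +
      (case w of [] \<Rightarrow> 0 | (d', y, A') # w' \<Rightarrow> F ((p + (d + d'), b B [(d, x, A), (d', y, A')], A') # w')))"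
proof -
  have long: "lsum (splittings v) (\<lambda>(u, t). F ((p + wdeg (x1 # x2 # a # u), b B (x1 # x2 # a # u), src B (x1 # x2 # a # u)) # t)) = 0"
    if "sword Q B (x1 # x2 # a # v)" for x1 x2 a v
  proof (rule lsum_eq_0)
    fix e p' assume "(e, p') \<in> set (splittings v)"
    then obtain u t where p': "p' = (u, t)" "u @ t = v" by (cases p') (auto simp: set_splittings)
    have "sword Q (src B (x1 # x2 # a # u)) t"
      using that p'(2) sword_append[of Q B "x1 # x2 # a # u" t] by auto
    moreover have "b B (x1 # x2 # a # u) = 0" using b by (simp add: arity12_def)
    ultimately show "(case p' of (u, t) \<Rightarrow> F ((p + wdeg (x1 # x2 # a # u), b B (x1 # x2 # a # u), src B (x1 # x2 # a # u)) # t)) = 0"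
      using F0 p'(1) by simp
  qed
  have b0: "b B [] = 0" using b by (simp add: arity12_def)
  have "consume p b [] s B ((d, x, A) # w) F = ksign (p * s) (F ((p + d, b B [(d, x, A)], A) # w) +
      (case w of [] \<Rightarrow> 0 | (d', y, A') # w' \<Rightarrow> F ((p + (d + d'), b B [(d, x, A), (d', y, A')], A') # w')))"
  proof (cases w)
    case Nil
    then show ?thesis using w b0 F0 by (simp add: consume_def)
  next
    case (Cons y w')
    obtain d' y' A' where y: "y = (d', y', A')" by (cases y) auto
    have "lsum (splittings w') (\<lambda>(u, t). F ((p + (d + (d' + wdeg u)), b B ((d, x, A) # (d', y', A') # u), src A' u) # t)) =
      F ((p + (d + d'), b B [(d, x, A), (d', y', A')], A') # w')"
    proof (cases w')
      case (Cons a v)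
      then show ?thesis
        using long[of "(d, x, A)" "(d', y', A')" a v] w \<open>w = y # w'\<close> y
        by (cases a) (simp add: split_def)
    qed simp
    then show ?thesis using w b0 F0 Cons y by (simp add: consume_def split_def)
  qed
  then show ?thesis by (simp add: lsum_brace_words_ne[of p b "[]" s B "(d, x, A) # w"])
qed

lemma lsum_brace_words_arity12_Cons_mlin:
  fixes sco :: "'k \<Rightarrow> 'v::ab_group_add \<Rightarrow> 'v"
  assumes "module sco" "mlin sc sco Q B F" "arity12 b" "sword Q B ((d, x, A) # w)"
  shows "lsum (brace_words [(p, b)] s B ((d, x, A) # w)) F =
    lsum (brace_words [(p, b)] (s + d) A w) (\<lambda>t. F ((d, x, A) # t)) +
    ksign (p * s) (F ((p + d, b B [(d, x, A)], A) # w) +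
      (case w of [] \<Rightarrow> 0 | (d', y, A') # w' \<Rightarrow> F ((p + (d + d'), b B [(d, x, A), (d', y, A')], A') # w')))"
  by (rule lsum_brace_words_arity12_Cons[OF _ assms(3,4)]) (rule mlin_head_0[OF assms(1,2) sword_obj[OF assms(4)]])

end

context lin_cat
begin

text \<open>Below the bound the left side is zero by definition, and so is the right side: all its
  words end at the zero object \<open>fst B l\<close>, where a regular \<open>F\<close> vanishes. So
  later computations need not distinguish the position of \<open>l\<close>.\<close>

lemma lsum_delta_words':
  fixes sco :: "'k \<Rightarrow> 'v::ab_group_add \<Rightarrow> 'v"
  assumes mo: "module sco" and w: "sword KQ B w" and F: "reg sco (fst B l) F"
  shows "lsum (delta_words C B w l) F =
     (case w of [] \<Rightarrow> F [] | (d, f, A) # w' \<Rightarrow>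
       ksign l (lsum (delta_words C A w' (l - (d + 1))) (\<lambda>t. F ((- 1, f (l - (d + 1)), fst A (l - (d + 1))) # t)))) +
     ksign l (lsum (delta_words C B w (l - 1)) (\<lambda>t. F ((- 1, snd B (l - 1), fst B (l - 1)) # t)))"
proof (cases "l < lower_bound C B")
  case False
  then show ?thesis by (rule lsum_delta_words)
next
  case True
  have B: "B \<in> QObj KQ" using sword_obj[OF w] .
  have Bl: "fst B l \<in> Obj C" for l using Obj_cplx[OF B] .
  have z: "zero_object C (fst B l)"
    using zero_object_below_lower_bound[OF _ True] B by (simp add: QObj_KQ)
  have F0: "F t = 0" if "sword LQ (fst B l) t" for t
    by (rule reg_zero_object[OF mo F z that])
  have "lsum (delta_words C B w (l - 1)) (\<lambda>t. F ((- 1, snd B (l - 1), fst B (l - 1)) # t)) = 0"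
  proof (rule lsum_eq_0)
    fix e t assume "(e, t) \<in> set (delta_words C B w (l - 1))"
    then have "sword LQ (fst B (l - 1)) t" using delta_words_valid w by blast
    then show "F ((- 1, snd B (l - 1), fst B (l - 1)) # t) = 0"
      using delta_words_delta[OF B, of l] Bl by (intro F0) (simp add: QHom_LQ)
  qed
  moreover have "lsum (delta_words C A w' (l - (d + 1))) (\<lambda>t. F ((- 1, f (l - (d + 1)), fst A (l - (d + 1))) # t)) = 0"
    if w': "w = (d, f, A) # w'" for d f A w'
  proof (rule lsum_eq_0)
    fix e t assume "(e, t) \<in> set (delta_words C A w' (l - (d + 1)))"
    then have "sword LQ (fst A (l - (d + 1))) t" using delta_words_valid w w' by simp
    then show "F ((- 1, f (l - (d + 1)), fst A (l - (d + 1))) # t) = 0"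
      using delta_words_letter[of B d f A w' l] w w' Bl by (intro F0) (simp add: QHom_LQ)
  qed
  moreover have "F [] = 0" using F0 Bl by simp
  ultimately show ?thesis using True by (simp add: delta_words_below split: list.splits)
qed

lemma cat: "category C"
  using lin by (simp add: linear_category_def)

lemma cmp_Hom:
  "X \<in> Obj C \<Longrightarrow> Y \<in> Obj C \<Longrightarrow> Z \<in> Obj C \<Longrightarrow> f \<in> Hom C X Y \<Longrightarrow> g \<in> Hom C Y Z \<Longrightarrow> cmp C X Y Z g f \<in> Hom C X Z"
  using cat by (auto simp: category_def)

lemma cmp_id:
  "X \<in> Obj C \<Longrightarrow> Y \<in> Obj C \<Longrightarrow> f \<in> Hom C X Y \<Longrightarrow> cmp C X X Y f (idn C X) = f"
  "X \<in> Obj C \<Longrightarrow> Y \<in> Obj C \<Longrightarrow> f \<in> Hom C X Y \<Longrightarrow> cmp C X Y Y (idn C Y) f = f"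
  using cat by (auto simp: category_def)

lemma idn_Hom: "X \<in> Obj C \<Longrightarrow> idn C X \<in> Hom C X X"
  using cat by (auto simp: category_def)

lemma cmp_assoc:
  "W \<in> Obj C \<Longrightarrow> X \<in> Obj C \<Longrightarrow> Y \<in> Obj C \<Longrightarrow> Z \<in> Obj C \<Longrightarrow>
   f \<in> Hom C W X \<Longrightarrow> g \<in> Hom C X Y \<Longrightarrow> h \<in> Hom C Y Z \<Longrightarrow>
   cmp C W X Z (cmp C X Y Z h g) f = cmp C W Y Z h (cmp C W X Y g f)"
  using cat by (auto simp: category_def)

lemma cmp_lin:
  assumes "X \<in> Obj C" "Y \<in> Obj C" "Z \<in> Obj C" "f \<in> Hom C X Y" "f' \<in> Hom C X Y" "g \<in> Hom C Y Z" "g' \<in> Hom C Y Z"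
  shows "cmp C X Y Z g (sc a f + sc c f') = sc a (cmp C X Y Z g f) + sc c (cmp C X Y Z g f')"
    and "cmp C X Y Z (sc a g + sc c g') f = sc a (cmp C X Y Z g f) + sc c (cmp C X Y Z g' f)"
proof -
  have s: "sc a f \<in> Hom C X Y" "sc c f' \<in> Hom C X Y" "sc a g \<in> Hom C Y Z" "sc c g' \<in> Hom C Y Z"
    using assms Hom_sub bm.subspace_scale by blast+
  note b = lin[unfolded linear_category_def, THEN conjunct2, THEN conjunct2, THEN conjunct2,
      rule_format, OF assms(1-3)]
  have "cmp C X Y Z g (sc a f + sc c f') = cmp C X Y Z g (sc a f) + cmp C X Y Z g (sc c f')"
    "cmp C X Y Z (sc a g + sc c g') f = cmp C X Y Z (sc a g) f + cmp C X Y Z (sc c g') f"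
    using b[OF s(1,2) assms(6,7)] b[OF assms(4,5) s(3,4)] by blast+
  then show "cmp C X Y Z g (sc a f + sc c f') = sc a (cmp C X Y Z g f) + sc c (cmp C X Y Z g f')"
    "cmp C X Y Z (sc a g + sc c g') f = sc a (cmp C X Y Z g f) + sc c (cmp C X Y Z g' f)"
    using b[OF assms(4,4,6,6)] b[OF assms(5,5,6,6)] b[OF assms(4,4,7,7)] by simp_all
qed

lemma cmp_0:
  assumes "X \<in> Obj C" "Y \<in> Obj C" "Z \<in> Obj C"
  shows "f \<in> Hom C X Y \<Longrightarrow> cmp C X Y Z 0 f = 0"
    and "g \<in> Hom C Y Z \<Longrightarrow> cmp C X Y Z g 0 = 0"
  using cmp_lin(1)[OF assms, of 0 0 g g 0 0] cmp_lin(2)[OF assms, of f f 0 0 0 0] Hom_0 assms by auto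

lemma cmp_ksign:
  assumes "X \<in> Obj C" "Y \<in> Obj C" "Z \<in> Obj C" "f \<in> Hom C X Y" "g \<in> Hom C Y Z"
  shows "cmp C X Y Z g (ksign e f) = ksign e (cmp C X Y Z g f)"
    and "cmp C X Y Z (ksign e g) f = ksign e (cmp C X Y Z g f)"
  using cmp_lin(1)[OF assms(1-3) assms(4,4,5,5), of "if even e then 1 else - 1" 0]
    cmp_lin(2)[OF assms(1-3) assms(4,4,5,5), of "if even e then 1 else - 1" 0]
  by (auto simp: ksign_def split: if_splits)

abbreviation "bL \<equiv> dg_structure LQ"
abbreviation "bK \<equiv> dg_structure KQ"

lemma bL_eq:
  "bL B w = (if sword LQ B w then (case w of [(d, g, A), (d', f, A')] \<Rightarrow> ksign (d + 1) (cmp C A' A B g f) | _ \<Rightarrow> 0) else 0)"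
  by (auto simp: dg_structure_def to_br_def shift_degs_def linear_dg_def length_Suc_conv numeral_2_eq_2
      split: list.splits)

lemma bL_long: "length w \<noteq> 2 \<Longrightarrow> bL B w = 0"
  by (auto simp: bL_eq split: list.splits)

lemma arity12_bL: "arity12 bL"
  by (simp add: arity12_def bL_long)

lemma bL_Cbr: "bL \<in> Cbr sc LQ 1"
proof (rule L.CbrI)
  fix B w assume w: "sword LQ B w"
  have o: "B \<in> QObj LQ" "src B w \<in> QObj LQ" using sword_obj[OF w] sword_src[OF w] .
  show "bL B w \<in> QHom LQ (src B w) B (wdeg w + 1 + 1)"
  proof (cases "length w = 2")
    case False
    then show ?thesis using o L.QHom_0 by (simp add: bL_long)
  next
    case True
    then obtain d g A d' f A' where w': "w = [(d, g, A), (d', f, A')]"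
      by (auto simp: length_Suc_conv numeral_2_eq_2)
    have ob: "B \<in> Obj C" "A \<in> Obj C" "A' \<in> Obj C" using w w' by auto
    show ?thesis
    proof (cases "d = - 1 \<and> d' = - 1")
      case True
      then show ?thesis using w ob w' by (auto simp: bL_eq QHom_LQ intro!: cmp_Hom)
    next
      case False
      then have "g = 0 \<and> f \<in> Hom C A' A \<or> f = 0 \<and> g \<in> Hom C A B"
        using w w' ob Hom_0 by (auto simp: QHom_LQ split: if_splits)
      then have "bL B w = 0" using w w' ob cmp_0 by (auto simp: bL_eq)
      then show ?thesis using L.QHom_0[OF o(2,1)] by simp
    qed
  qed
next
  fix B
  show "mlin sc sc LQ B (bL B)"
    unfolding mlin_def
  proof (intro allI impI)
    fix u d x y A v a c
    assume s: "sword LQ B (u @ (d, x, A) # v)" "sword LQ B (u @ (d, y, A) # v)"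
    note s' = L.sword_lin[OF s, of a c]
    have QH: "h \<in> Hom C X Y" if "h \<in> QHom LQ X Y n" "X \<in> Obj C" "Y \<in> Obj C" for h X Y n
      using that Hom_0 by (auto simp: QHom_LQ split: if_splits)
    consider "length (u @ (d, x, A) # v) \<noteq> 2" | d' f A' where "u = []" "v = [(d', f, A')]"
      | d' f A' where "u = [(d', f, A')]" "v = []"
      by (cases u; cases v) (auto simp: numeral_2_eq_2 length_Suc_conv)
    then show "bL B (u @ (d, sc a x + sc c y, A) # v) =
       sc a (bL B (u @ (d, x, A) # v)) + sc c (bL B (u @ (d, y, A) # v))"
    proof cases
      case 1
      then show ?thesis by (simp add: bL_long)
    next
      case 2
      have "A \<in> Obj C" "B \<in> Obj C" "A' \<in> Obj C" using s 2 by auto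
      then show ?thesis
        using s s' 2 cmp_lin(2)[of A' A B f f x y a c] QH[of x A B "d + 1"] QH[of y A B "d + 1"] QH[of f A' A "d' + 1"]
        by (auto simp: bL_eq ksign_add L.sc_ksign)
    next
      case 3
      have "A \<in> Obj C" "B \<in> Obj C" "A' \<in> Obj C" using s 3 by auto
      then show ?thesis
        using s s' 3 cmp_lin(1)[of A A' B x y f f a c] QH[of x A A' "d + 1"] QH[of y A A' "d + 1"] QH[of f A' B "d' + 1"]
        by (auto simp: bL_eq ksign_add L.sc_ksign)
    qed
  qed
qed (simp add: bL_eq)

text \<open>Only words of three letters contribute, and there the two positions of the inner
  composition are the two ways of bracketing. Their signs are \<open>d2 + 1\<close> and
  \<open>d2\<close> modulo 2 whatever the degrees are, so they cancel without a case distinction on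
  which letters have degree -1.\<close>

lemma bL_square: "brace LQ bL [(1, bL)] = 0"
proof (intro ext)
  fix B w
  show "brace LQ bL [(1, bL)] B w = 0 B w"
  proof (cases "sword LQ B w")
    case False
    then show ?thesis by (simp add: brace_eq)
  next
    case w: True
    have Bo: "B \<in> QObj LQ" using sword_obj[OF w] .
    have m: "mlin sc sc LQ B (bL B)" using L.Cbr_mlin[OF bL_Cbr] .
    have z: "bL D [x] = 0" "bL D [] = 0" "bL D (x # y # y' # t) = 0" for D x y y' t
      by (simp_all add: bL_long)
    have nil: "lsum (brace_words [(1, bL)] s D []) F = 0" if "mlin sc sc LQ D F" "D \<in> QObj LQ" for s D F
      by (rule L.lsum_brace_words_arity12_Nil[OF _ arity12_bL that(2)]) (rule L.mlin_head_0[OF module_base that])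
    note cons = L.lsum_brace_words_arity12_Cons_mlin[OF module_base _ arity12_bL]
    have "lsum (brace_words [(1, bL)] 0 B w) (bL B) = 0"
    proof (cases w)
      case Nil
      then show ?thesis using nil[OF m Bo] by simp
    next
      case (Cons x1 w1)
      obtain d1 h A1 where x1: "x1 = (d1, h, A1)" by (cases x1) auto
      have h: "h \<in> QHom LQ A1 B (d1 + 1)" and w1: "sword LQ A1 w1" using w Cons x1 by auto
      have A1: "A1 \<in> QObj LQ" using sword_obj[OF w1] .
      have m1: "mlin sc sc LQ A1 (\<lambda>t. bL B ((d1, h, A1) # t))" by (rule mlin_Cons[OF m Bo h])
      show ?thesis
      proof (cases w1)
        case Nil
        then show ?thesis
          using cons[OF m w[unfolded Cons x1], of 1 0] nil[OF m1 A1] by (simp add: Cons x1 z)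
      next
        case w1': (Cons x2 w2)
        obtain d2 g A2 where x2: "x2 = (d2, g, A2)" by (cases x2) auto
        have g: "g \<in> QHom LQ A2 A1 (d2 + 1)" and w2: "sword LQ A2 w2" using w1 w1' x2 by auto
        have A2: "A2 \<in> QObj LQ" using sword_obj[OF w2] .
        have m2: "mlin sc sc LQ A2 (\<lambda>t. bL B ((d1, h, A1) # (d2, g, A2) # t))"
          by (rule mlin_Cons[OF m1 A1 g])
        have F0: "bL B ((d, 0, A) # t) = 0" if "sword LQ A t" for d A t
          by (rule L.mlin_head_0[OF module_base m Bo that])
        have F1: "bL B ((d1, h, A1) # (d, 0, A) # t) = 0" if "sword LQ A t" for d A t
          by (rule L.mlin_head_0[OF module_base m1 A1 that])
        have r: "lsum (brace_words [(1, bL)] 0 B w) (bL B) =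
           lsum (brace_words [(1, bL)] (d1 + d2) A2 w2) (\<lambda>t. bL B ((d1, h, A1) # (d2, g, A2) # t)) +
           ksign d1 (case w2 of [] \<Rightarrow> 0 | (d3, f, A3) # w3 \<Rightarrow>
              bL B ((d1, h, A1) # (1 + (d2 + d3), bL A1 [(d2, g, A2), (d3, f, A3)], A3) # w3)) +
           bL B ((1 + (d1 + d2), bL B [(d1, h, A1), (d2, g, A2)], A2) # w2)"
          using cons[OF m w[unfolded Cons x1], of 1 0] cons[OF m1 w1[unfolded w1' x2], of 1 d1] F0[OF w2] F1[OF w2] F0[OF w1[unfolded w1' x2]]
          by (simp add: Cons x1 w1' x2 z cong: list.case_cong)
        show ?thesis
        proof (cases w2)
          case Nil
          then show ?thesis using nil[OF m2 A2] by (simp add: r z)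
        next
          case w2': (Cons x3 w3)
          obtain d3 f A3 where x3: "x3 = (d3, f, A3)" by (cases x3) auto
          have f: "f \<in> QHom LQ A3 A2 (d3 + 1)" and w3: "sword LQ A3 w3" using w2 w2' x3 by auto
          have A3: "A3 \<in> QObj LQ" using sword_obj[OF w3] .
          have l0: "lsum (brace_words [(1, bL)] (d1 + d2) A2 w2) (\<lambda>t. bL B ((d1, h, A1) # (d2, g, A2) # t)) = 0"
            using cons[OF m2 w2[unfolded w2' x3], of 1 "d1 + d2"] by (simp add: w2' x3 z split: list.splits)
          show ?thesis
          proof (cases w3)
            case (Cons x4 w4)
            then show ?thesis unfolding r l0 by (cases x4) (simp add: w2' x3 z)
          next
            case Nil
            have ob: "B \<in> Obj C" "A1 \<in> Obj C" "A2 \<in> Obj C" "A3 \<in> Obj C"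
              using Bo A1 A2 A3 by simp_all
            have QH: "k \<in> Hom C X Y" if "k \<in> QHom LQ X Y n" "X \<in> Obj C" "Y \<in> Obj C" for k X Y n
              using that Hom_0 by (auto simp: QHom_LQ split: if_splits)
            have H: "h \<in> Hom C A1 B" "g \<in> Hom C A2 A1" "f \<in> Hom C A3 A2"
              using QH[OF h] QH[OF g] QH[OF f] ob by auto
            have sw: "sword LQ B [(d1, h, A1), (d2, g, A2)]" "sword LQ A1 [(d2, g, A2), (d3, f, A3)]"
              using h g f ob by auto
            have v: "bL B [(d1, h, A1), (d2, g, A2)] \<in> QHom LQ A2 B (1 + (d1 + d2) + 1)"
              "bL A1 [(d2, g, A2), (d3, f, A3)] \<in> QHom LQ A3 A1 (1 + (d2 + d3) + 1)"
              using L.Cbr_val[OF bL_Cbr sw(1)] L.Cbr_val[OF bL_Cbr sw(2)] by (simp_all add: algebra_simps)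
            have e: "bL B [(d1, h, A1), (d2, g, A2)] = ksign (d1 + 1) (cmp C A2 A1 B h g)"
              "bL A1 [(d2, g, A2), (d3, f, A3)] = ksign (d2 + 1) (cmp C A3 A2 A1 g f)"
              using sw by (simp_all add: bL_eq)
            let ?X = "cmp C A3 A2 B (cmp C A2 A1 B h g) f"
            have "bL B [(1 + (d1 + d2), bL B [(d1, h, A1), (d2, g, A2)], A2), (d3, f, A3)] =
               ksign (1 + (d1 + d2) + 1) (cmp C A3 A2 B (bL B [(d1, h, A1), (d2, g, A2)]) f)"
              using v f ob by (simp add: bL_eq)
            also have "\<dots> = ksign (1 + (d1 + d2) + 1) (ksign (d1 + 1) ?X)"
              unfolding e cmp_ksign(2)[OF ob(4,3,1) H(3) cmp_Hom[OF ob(3,2,1) H(2,1)]] ..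
            finally have t1: "bL B [(1 + (d1 + d2), bL B [(d1, h, A1), (d2, g, A2)], A2), (d3, f, A3)] = \<dots>" .
            have "bL B [(d1, h, A1), (1 + (d2 + d3), bL A1 [(d2, g, A2), (d3, f, A3)], A3)] =
               ksign (d1 + 1) (cmp C A3 A1 B h (bL A1 [(d2, g, A2), (d3, f, A3)]))"
              using v h ob by (simp add: bL_eq)
            also have "\<dots> = ksign (d1 + 1) (ksign (d2 + 1) ?X)"
              unfolding e cmp_ksign(1)[OF ob(4,2,1) cmp_Hom[OF ob(4,3,2) H(3,2)] H(1)]
                cmp_assoc[OF ob(4,3,2,1) H(3,2,1)] ..
            finally have t2: "bL B [(d1, h, A1), (1 + (d2 + d3), bL A1 [(d2, g, A2), (d3, f, A3)], A3)] = \<dots>" .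
            show ?thesis
              unfolding r l0 unfolding w2' x3 Nil list.case prod.case t1 t2 by (simp add: ksign_def)
          qed
        qed
      qed
    qed
    then show ?thesis using w by (simp add: brace_eq)
  qed
qed

lemma arity12_bK: "arity12 bK"
  by (auto simp: arity12_def dg_structure_def to_br_def fun_eq_iff)

lemma bK_eq:
  "bK B w = (if sword KQ B w then (case w of
      [(d, f, A)] \<Rightarrow> - (com_cmp C A B B 1 (d + 1) (snd B) f - ksign (d + 1) (com_cmp C A A B (d + 1) 1 f (snd A)))
    | [(d, g, A), (d', f, A')] \<Rightarrow> ksign (d + 1) (com_cmp C A' A B (d + 1) (d' + 1) g f)
    | _ \<Rightarrow> 0) else 0)"
  by (auto simp: dg_structure_def to_br_def shift_degs_def Com_plus_def length_Suc_conv numeral_2_eq_2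
      ksign_def split: list.splits)

lemma delta_words_length: "(e, t) \<in> set (delta_words C B w l) \<Longrightarrow> length w \<le> length t"
proof (induction B w l arbitrary: e t rule: delta_words_induct[where C = C])
  case (step B w l)
  have nb: "\<not> l < lower_bound C B" using step(3) by (auto simp: delta_words_below)
  from step(3)
  consider (nil) "w = []" "t = []"
    | (pass) d f A w' e' t' where "w = (d, f, A) # w'" "t = (- 1, f (l - (d + 1)), fst A (l - (d + 1))) # t'"
        "(e', t') \<in> set (delta_words C A w' (l - (d + 1)))"
    | (delta) e' t' where "t = (- 1, snd B (l - 1), fst B (l - 1)) # t'" "(e', t') \<in> set (delta_words C B w (l - 1))"
    by (subst (asm) delta_words.simps) (use nb in \<open>auto simp: set_pre split: list.splits\<close>)
  then show ?case
  proof cases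
    case pass
    then show ?thesis using step(1)[OF nb pass(1,3)] by simp
  next
    case delta
    then show ?thesis using step(2)[OF nb delta(2)] by simp
  qed simp
qed

text \<open>The composition reads exactly two letters, so a word of \<open>n\<close> letters
  receives \<open>2 - n\<close> differentials. Two letters give the composition of complexes, one
  letter gives the differential of a morphism, and the empty word gives the square of the
  differential of the complex, which is zero. Multilinearity and \<open>b{b} = 0\<close> for
  complexes are then inherited through \<open>emb_Cbr\<close> and \<open>emb_brace\<close>.\<close>

lemma bK_eq_emb: "bK = emb 1 bL"
proof (intro ext)
  fix B w i
  show "bK B w i = emb 1 bL B w i"
  proof (cases "sword KQ B w")
    case False
    then show ?thesis by (simp add: bK_eq emb_def)
  next
    case w: True
    define l where "l = i + wdeg w + 2"
    have B: "B \<in> QObj KQ" using sword_obj[OF w] .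
    have Bl: "fst B j \<in> Obj C" for j by (rule Obj_cplx[OF B])
    define F where "F = bL (fst B l)"
    have F: "reg sc (fst B l) F" unfolding F_def by (rule Cbr_reg[OF bL_Cbr Bl])
    have Fl: "F t = 0" if "length t \<noteq> 2" for t using that by (simp add: F_def bL_long)
    have Fl3: "F (x # y # y' # t) = 0" "F [] = 0" "F [x] = 0" for x y y' t by (simp_all add: Fl)
    have emb: "emb 1 bL B w i = lsum (delta_words C B w l) F"
      using w by (simp add: emb_def Let_def l_def F_def ksign_def add.assoc)
    have ex: "lsum (delta_words C D v k) G =
     (case v of [] \<Rightarrow> G [] | (d, f, A) # w' \<Rightarrow>
       ksign k (lsum (delta_words C A w' (k - (d + 1))) (\<lambda>t. G ((- 1, f (k - (d + 1)), fst A (k - (d + 1))) # t)))) +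
     ksign k (lsum (delta_words C D v (k - 1)) (\<lambda>t. G ((- 1, snd D (k - 1), fst D (k - 1)) # t)))"
      if "sword KQ D v" "reg sc (fst D k) G" for D v k G
      by (rule lsum_delta_words'[OF module_base that])
    let ?\<delta> = "\<lambda>l D. (- 1, snd D (l - 1), fst D (l - 1))"
    have r\<delta>: "reg sc (fst D (k - 1)) (\<lambda>t. G (?\<delta> k D # t))" if "reg sc (fst D k) G" "D \<in> QObj KQ" for D k G
      by (rule reg_Cons[OF module_base that(1) Obj_cplx[OF that(2)] Obj_cplx[OF that(2)] delta_words_delta[OF that(2)]])
    have Hb: "bL D [(- 1, g, A), (- 1, f, A')] = cmp C A' A D g f"
      if "g \<in> Hom C A D" "f \<in> Hom C A' A" "D \<in> Obj C" "A \<in> Obj C" "A' \<in> Obj C" for g f A A' D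
      using that by (simp add: bL_eq QHom_LQ)
    have one: "lsum (delta_words C D [] k) (\<lambda>t. F (x # t)) = ksign k (F [x, ?\<delta> k D])"
      if "D \<in> QObj KQ" "reg sc (fst D k) (\<lambda>t. F (x # t))" for D k x
      using that ex[of D "[]" k "\<lambda>t. F (x # t)"] ex[of D "[]" "k - 1" "\<lambda>t. F (x # ?\<delta> k D # t)"] r\<delta>[OF that(2,1)]
      by (simp add: Fl3)
    have two: "lsum (delta_words C D v k) (\<lambda>t. F (x # y # t)) = (if v = [] then F [x, y] else 0)"
      if "sword KQ D v" "reg sc (fst D k) (\<lambda>t. F (x # y # t))" for D v k x y
      using ex[OF that] by (auto simp: Fl3 split: list.splits)
    \<comment> \<open>The possible curvature term vanishes because \<open>B\<close> is a
      complex.\<close>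
    have \<delta>\<delta>: "F [?\<delta> l B, ?\<delta> (l - 1) B] = 0"
    proof -
      have "F [?\<delta> l B, ?\<delta> (l - 1) B] = cmp C (fst B (l - 1 - 1)) (fst B (l - 1)) (fst B l) (snd B (l - 1)) (snd B (l - 1 - 1))"
        unfolding F_def by (intro Hb delta_words_delta[OF B] Bl)
      also have "\<dots> = 0"
      proof -
        have "cmp C (fst B j) (fst B (j + 1)) (fst B (j + 2)) (snd B (j + 1)) (snd B j) = 0" for j
          using B by (simp add: QObj_KQ bb_complex_def)
        from this[of "l - 1 - 1"] show ?thesis by (simp add: algebra_simps)
      qed
      finally show ?thesis .
    qed
    consider "w = []" | d f A where "w = [(d, f, A)]" | d g A d' f A' where "w = [(d, g, A), (d', f, A')]"
      | "3 \<le> length w"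
      by (cases w; cases "tl w"; cases "tl (tl w)") (auto simp: Suc_le_eq)
    then show ?thesis
    proof cases
      case 1
      have "lsum (delta_words C B w l) F = 0"
        using ex[OF w F] one[OF B r\<delta>[OF F B]] \<delta>\<delta> by (simp add: 1 Fl3)
      then show ?thesis unfolding emb by (simp add: 1 bK_eq)
    next
      case 2
      let ?l = "l - (d + 1)"
      have A: "A \<in> QObj KQ" using w 2 by simp
      have Al: "fst A j \<in> Obj C" for j by (rule Obj_cplx[OF A])
      have f: "f (k - (d + 1)) \<in> Hom C (fst A (k - (d + 1))) (fst B k)" for k
        using delta_words_letter[of B d f A "[]" k] w 2 by simp
      have rf: "reg sc (fst A ?l) (\<lambda>t. F ((- 1, f ?l, fst A ?l) # t))"
        by (rule reg_Cons[OF module_base F Bl Al f])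
      have rdf: "reg sc (fst A (l - 1 - (d + 1))) (\<lambda>t. F (?\<delta> l B # (- 1, f (l - 1 - (d + 1)), fst A (l - 1 - (d + 1))) # t))"
        by (rule reg_Cons[OF module_base r\<delta>[OF F B] Bl Al f])
      have "lsum (delta_words C B w l) F = ksign l (ksign ?l (F [(- 1, f ?l, fst A ?l), ?\<delta> ?l A])) +
         ksign l (ksign (l - 1) (F [?\<delta> l B, (- 1, f (l - 1 - (d + 1)), fst A (l - 1 - (d + 1)))]))"
        using ex[OF w F] one[OF A rf] ex[OF w r\<delta>[OF F B]] two[of A "[]", OF _ rdf]
          two[OF w r\<delta>[OF r\<delta>[OF F B] B]] A
        by (simp add: 2 Fl3)
      also have "F [(- 1, f ?l, fst A ?l), ?\<delta> ?l A] = cmp C (fst A (?l - 1)) (fst A ?l) (fst B l) (f ?l) (snd A (?l - 1))"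
        unfolding F_def by (intro Hb delta_words_delta[OF A] Al Bl f)
      also have "F [?\<delta> l B, (- 1, f (l - 1 - (d + 1)), fst A (l - 1 - (d + 1)))] =
          cmp C (fst A (l - 1 - (d + 1))) (fst B (l - 1)) (fst B l) (snd B (l - 1)) (f (l - 1 - (d + 1)))"
        unfolding F_def by (intro Hb delta_words_delta[OF B] Al Bl f)
      also have "?l = i + 1" using 2 by (simp add: l_def)
      also have "l - 1 - (d + 1) = i" using 2 by (simp add: l_def)
      finally have E: "emb 1 bL B w i = ksign l (ksign (i + 1) (cmp C (fst A i) (fst A (i + 1)) (fst B l) (f (i + 1)) (snd A i))) +
        ksign l (ksign (l - 1) (cmp C (fst A i) (fst B (l - 1)) (fst B l) (snd B (l - 1)) (f i)))"
        by (simp add: emb)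
      have l: "l = i + 1 + (d + 1)" "i + (d + 1) = l - 1" using 2 by (auto simp: l_def)
      show ?thesis
        unfolding E using w unfolding 2 by (simp add: bK_eq com_cmp_def ksign_apply l) (simp add: ksign_def algebra_simps)
    next
      case 3
      let ?l = "l - (d + 1)" and ?l' = "l - (d + 1) - (d' + 1)"
      have A: "A \<in> QObj KQ" "A' \<in> QObj KQ" using w 3 by auto
      have Al: "fst A j \<in> Obj C" "fst A' j \<in> Obj C" for j using Obj_cplx A by auto
      have g: "g ?l \<in> Hom C (fst A ?l) (fst B l)"
        using delta_words_letter[of B d g A "[(d', f, A')]" l] w 3 by simp
      have f: "f ?l' \<in> Hom C (fst A' ?l') (fst A ?l)"
        using delta_words_letter[of A d' f A' "[]" ?l] w 3 by simp
      have rg: "reg sc (fst A ?l) (\<lambda>t. F ((- 1, g ?l, fst A ?l) # t))"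
        by (rule reg_Cons[OF module_base F Bl Al(1) g])
      have rgf: "reg sc (fst A' ?l') (\<lambda>t. F ((- 1, g ?l, fst A ?l) # (- 1, f ?l', fst A' ?l') # t))"
        by (rule reg_Cons[OF module_base rg Al f])
      have wA: "sword KQ A [(d', f, A')]" using w 3 by simp
      have zero2: "lsum (delta_words C D v k) (\<lambda>t. F (x # t)) = 0" if "2 \<le> length v" for D v k x
        using delta_words_length that by (intro lsum_eq_0 Fl) fastforce
      have zero1: "lsum (delta_words C D v k) (\<lambda>t. F (x # y # t)) = 0" if "1 \<le> length v" for D v k x y
        using delta_words_length that by (intro lsum_eq_0 Fl) fastforce
      have "lsum (delta_words C B w l) F = ksign l (ksign ?l (F [(- 1, g ?l, fst A ?l), (- 1, f ?l', fst A' ?l')]))"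
        using ex[OF w F] ex[OF wA rg] two[of A' "[]", OF _ rgf] A
        by (simp add: 3 zero2 zero1)
      also have "F [(- 1, g ?l, fst A ?l), (- 1, f ?l', fst A' ?l')] =
         cmp C (fst A' ?l') (fst A ?l) (fst B l) (g ?l) (f ?l')"
        unfolding F_def by (intro Hb g f Al Bl)
      finally have E: "emb 1 bL B w i = ksign l (ksign ?l (cmp C (fst A' ?l') (fst A ?l) (fst B l) (g ?l) (f ?l')))"
        by (simp add: emb)
      have l: "?l' = i" "?l = i + (d' + 1)" "l = i + (d' + 1) + (d + 1)" using 3 by (auto simp: l_def)
      show ?thesis
        unfolding E l(1,2) using w unfolding 3
        by (simp add: bK_eq com_cmp_def ksign_apply l(3)) (simp add: ksign_def)
    next
      case 4
      have "lsum (delta_words C B w l) F = 0"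
        using delta_words_length 4 by (intro lsum_eq_0 Fl) fastforce
      moreover have "bK B w = 0"
        using arity12_bK[unfolded arity12_def, rule_format, of w B] 4 by simp
      ultimately show ?thesis by (simp add: emb)
    qed
  qed
qed

sublocale DL: dg_quiver sc LQ
  by unfold_locales (rule bL_Cbr, rule bL_square)

lemma bK_Cbr: "bK \<in> Cbr csc KQ 1"
  unfolding bK_eq_emb by (rule emb_Cbr[OF bL_Cbr])

sublocale DK: dg_quiver csc KQ
proof (unfold_locales, rule bK_Cbr)
  show "brace KQ bK [(1, bK)] = 0"
    using emb_brace[OF bL_Cbr, of "[(1, bL)]"] bL_Cbr by (simp add: bL_square bK_eq_emb)
qed

lemma emb_Cbr_dif:
  assumes x: "gword (Cbr sc LQ) x"
  shows "emb (wdeg x + 1) (Cbr_dif LQ bL x) = Cbr_dif KQ bK (embw x)"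
proof -
  have b: "gword (Cbr sc LQ) [(1, bL)]" using bL_Cbr by simp
  have "emb (wdeg x + 1) (Cbr_mul LQ [(1, bL)] x) = Cbr_mul KQ [(1, bK)] (embw x)"
    "emb (wdeg x + 1) (Cbr_mul LQ x [(1, bL)]) = Cbr_mul KQ (embw x) [(1, bK)]"
    using emb_Cbr_mul[OF b x] emb_Cbr_mul[OF x b] by (simp_all add: bK_eq_emb add.commute)
  then show ?thesis
    by (simp add: L.Cbr_dif_eq[OF bL_Cbr] K.Cbr_dif_eq[OF bK_Cbr] emb_diff emb_ksign)
qed

lemma emb_morphism:
  "binf_morphism (cochain_scale sc) (cochain_scale csc) (Cbr_binf sc LQ) (Cbr_binf csc KQ) emb"
  unfolding binf_morphism_def
  using DL.binf_algebra_Cbr DK.binf_algebra_Cbr emb_Cbr emb_add emb_scale emb_Cbr_mul emb_Cbr_dif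
  by (simp add: Cbr_binf_def)

end

lemma sum_fun_apply: "sum f A x = (\<Sum>i\<in>A. f i x)"
  by (induction A rule: infinite_finite_induct) auto

section \<open>Agreement of the extension with the sum of braces with \<delta>\<close>

context lin_cat
begin

text \<open>The term of \<open>delta_words\<close> without inserted differentials.\<close>

primrec letter_sum :: "(('o, 'm) cplx, int \<Rightarrow> 'm) qpath \<Rightarrow> int \<Rightarrow> (('o, 'm) qpath \<Rightarrow> 'v::ab_group_add) \<Rightarrow> 'v" where
  "letter_sum [] l F = F []"
| "letter_sum (x # w) l F = (case x of (d, f, A) \<Rightarrow>
     ksign l (letter_sum w (l - (d + 1)) (\<lambda>t. F ((- 1, f (l - (d + 1)), fst A (l - (d + 1))) # t))))"

lemma letter_sum_eq_0:
  "sword KQ B w \<Longrightarrow> (\<And>t. sword LQ (fst B l) t \<Longrightarrow> F t = 0) \<Longrightarrow> letter_sum w l F = 0"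
proof (induction w arbitrary: B l F)
  case Nil
  then show ?case by (simp add: Obj_cplx)
next
  case (Cons x w)
  obtain d f A where x: "x = (d, f, A)" by (cases x) auto
  have "letter_sum w (l - (d + 1)) (\<lambda>t. F ((- 1, f (l - (d + 1)), fst A (l - (d + 1))) # t)) = 0"
  proof (rule Cons.IH)
    show "sword KQ A w" using Cons.prems x by simp
    fix t assume t: "sword LQ (fst A (l - (d + 1))) t"
    show "F ((- 1, f (l - (d + 1)), fst A (l - (d + 1))) # t) = 0"
      using delta_words_letter[of B d f A w l] Cons.prems(1) x t sword_obj[OF Cons.prems(1)]
      by (intro Cons.prems(2)) (simp add: QHom_LQ Obj_cplx)
  qed
  then show ?case by (simp add: x)
qed

lemma shift_degs_simps [simp]:
  "shift_degs e [] = []" "shift_degs e ((d, x) # w) = (d + e, x) # shift_degs e w"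
  by (simp_all add: shift_degs_def)

lemma length_shift_degs [simp]: "length (shift_degs e w) = length w"
  by (simp add: shift_degs_def)

lemma wdeg_shift_degs: "wdeg (shift_degs e w) = wdeg w + int (length w) * e"
  by (induction w) (auto simp: algebra_simps)

lemma length_comp_word [simp]: "length (comp_word i w) = length w"
  by (induction i w rule: comp_word.induct) auto

lemma arg_sign_comp_word [simp]: "arg_sign (comp_word i w) = 0"
  by (induction i w rule: comp_word.induct) auto

text \<open>The recursive signs of the letters amount to the suspension sign \<open>arg_sign\<close>
  times a sign in \<open>length w\<close> and \<open>l\<close>; for a cochain of degree
  \<open>p\<close>, where \<open>length w = p + 1\<close>, the latter is exactly what the factor in
  \<open>emb\<close> removes.\<close>

lemma letter_sum_eq:
  "l = i + wdeg w + int (length w) \<Longrightarrow>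
   letter_sum w l F = ksign (int (length w) * l + arg_sign (shift_degs 1 w)) (F (shift_degs (- 1) (comp_word i (shift_degs 1 w))))"
proof (induction w arbitrary: l F)
  case Nil
  then show ?case by simp
next
  case (Cons x w)
  obtain d f A where x: "x = (d, f, A)" by (cases x) auto
  let ?l = "l - (d + 1)"
  have l: "?l = i + wdeg w + int (length w)" using Cons.prems by (simp add: x)
  have "letter_sum (x # w) l F = ksign (l + (int (length w) * ?l + arg_sign (shift_degs 1 w)))
     (F ((- 1, f ?l, fst A ?l) # shift_degs (- 1) (comp_word i (shift_degs 1 w))))"
    using Cons.IH[OF l] by (simp add: x ksign_ksign)
  also have "\<dots> = ksign (int (length (x # w)) * l + arg_sign (shift_degs 1 (x # w)))
     (F ((- 1, f ?l, fst A ?l) # shift_degs (- 1) (comp_word i (shift_degs 1 w))))"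
    by (rule ksign_cong) (simp add: x algebra_simps)
  finally show ?case
    using l by (simp add: x wdeg_shift_degs algebra_simps)
qed

abbreviation "\<delta> \<equiv> delta_elt C"

lemma delta_eq: "\<delta> B w = (if B \<in> QObj KQ \<and> w = [] then snd B else 0)"
  by (auto simp: delta_elt_def to_br_def)

lemma delta_Cbr: "\<delta> \<in> Cbr csc KQ 0"
proof (rule K.CbrI)
  fix B w assume w: "sword KQ B w"
  show "\<delta> B w \<in> QHom KQ (src B w) B (wdeg w + 0 + 1)"
  proof (cases "w = []")
    case True
    then show ?thesis using w by (auto simp: delta_eq QHom_KQ QObj_KQ bb_complex_def)
  next
    case False
    then show ?thesis using K.QHom_0 sword_src[OF w] sword_obj[OF w] by (simp add: delta_eq)
  qed
qed (auto simp: delta_eq mlin_def com_scale_def fun_eq_iff)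

text \<open>Sorts the words by the number \<open>m\<close> of inserted differentials. A functional
  that kills words longer than \<open>M\<close> sees none with more than \<open>M\<close>
  differentials. As \<delta> has degree 0 in \<open>Cbr\<close>, its insertions carry no Koszul
  sign, and \<open>s\<close> may be arbitrary.\<close>

lemma lsum_delta_words_eq_sum:
  fixes sco :: "'k \<Rightarrow> 'v::ab_group_add \<Rightarrow> 'v"
  assumes mo: "module sco"
  shows "sword KQ B w \<Longrightarrow> reg sco (fst B l) F \<Longrightarrow> (\<And>t. M < length t \<Longrightarrow> F t = 0) \<Longrightarrow>
    lsum (delta_words C B w l) F = (\<Sum>m\<le>M. lsum (brace_words (replicate m (0, \<delta>)) s B w) (\<lambda>t. letter_sum t l F))"
proof (induction B w l arbitrary: F M s rule: delta_words_induct[where C = C])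
  case (step B w l)
  note w = step(3) and F = step(4) and FM = step(5)
  have B: "B \<in> QObj KQ" using sword_obj[OF w] .
  have Bl: "fst B j \<in> Obj C" for j by (rule Obj_cplx[OF B])
  have Fm: "mlin sc sco LQ (fst B l) F" using F by (simp add: reg_def)
  have \<delta>g: "gword (Cbr csc KQ) (replicate m (0, \<delta>))" for m
    using delta_Cbr by (auto simp: gword_def)
  show ?case
  proof (cases "l < lower_bound C B")
    case True
    have z: "zero_object C (fst B l)"
      using zero_object_below_lower_bound[OF _ True] B by (simp add: QObj_KQ)
    have "letter_sum t l F = 0" if "sword KQ B t" for t
      using letter_sum_eq_0[OF that] reg_zero_object[OF mo F z] by blast
    then have "lsum (brace_words (replicate m (0, \<delta>)) s B w) (\<lambda>t. letter_sum t l F) = 0" for m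
      using K.brace_words_valid[OF _ w \<delta>g] by (intro lsum_eq_0) blast
    then show ?thesis using True by (simp add: delta_words_below)
  next
    case nb: False
    let ?F\<delta> = "\<lambda>t. F ((- 1, snd B (l - 1), fst B (l - 1)) # t)"
    have F\<delta>: "reg sco (fst B (l - 1)) ?F\<delta>" by (rule reg_Cons[OF mo F Bl Bl delta_words_delta[OF B]])
    let ?P = "\<lambda>m. case w of [] \<Rightarrow> (if m = 0 then F [] else 0) | (d, f, A) # w' \<Rightarrow>
       ksign l (lsum (brace_words (replicate m (0, \<delta>)) (s + d) A w') (\<lambda>t. letter_sum t (l - (d + 1))
          (\<lambda>t. F ((- 1, f (l - (d + 1)), fst A (l - (d + 1))) # t))))"
    let ?D = "\<lambda>m. ksign l (lsum (brace_words (replicate m (0, \<delta>)) s B w) (\<lambda>t. letter_sum t (l - 1) ?F\<delta>))"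
    have zero_letter: "letter_sum ((d, 0, A) # t) l F = 0" if "sword KQ A t" for d A t
    proof -
      have Al: "fst A j \<in> Obj C" for j using sword_obj[OF that] by (rule Obj_cplx)
      have "letter_sum t (l - (d + 1)) (\<lambda>t. F ((- 1, 0, fst A (l - (d + 1))) # t)) = 0"
        by (rule letter_sum_eq_0[OF that]) (use L.mlin_head_0[OF mo Fm] Bl in simp)
      then show ?thesis by simp
    qed
    have cons: "consume 0 \<delta> (replicate m (0, \<delta>)) s B w (\<lambda>t. letter_sum t l F) = ?D m" for m
    proof -
      have *: "lsum (splittings v) (\<lambda>(u, t'). lsum (brace_words (replicate m (0, \<delta>)) (s + (d + wdeg u)) (src A u) t')
           (\<lambda>t. letter_sum ((d + wdeg u, \<delta> B ((d, f, A) # u), src A u) # t) l F)) = 0"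
        if "w = (d, f, A) # v" for d f A v
      proof (rule lsum_eq_0)
        fix e p assume "(e, p) \<in> set (splittings v)"
        then obtain u t' where p: "p = (u, t')" "u @ t' = v" by (cases p) (auto simp: set_splittings)
        have \<delta>0: "\<delta> B ((d, f, A) # u) = 0" by (simp add: delta_eq)
        have "sword KQ (src A u) t'"
          using w that p(2) sword_append[of KQ A u t'] by auto
        then show "(case p of (u, t') \<Rightarrow> lsum (brace_words (replicate m (0, \<delta>)) (s + (d + wdeg u)) (src A u) t')
           (\<lambda>t. letter_sum ((d + wdeg u, \<delta> B ((d, f, A) # u), src A u) # t) l F)) = 0"
          unfolding p(1) prod.case \<delta>0 using K.brace_words_valid[OF _ _ \<delta>g]
          by (intro lsum_eq_0 zero_letter) blast
      qed
      have "consume 0 \<delta> (replicate m (0, \<delta>)) s B w (\<lambda>t. letter_sum t l F) =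
        lsum (brace_words (replicate m (0, \<delta>)) s B w) (\<lambda>t. letter_sum ((0, \<delta> B [], B) # t) l F)"
      proof (cases w)
        case Nil
        then show ?thesis by (simp add: consume_def)
      next
        case (Cons a v)
        obtain d f A where a: "a = (d, f, A)" by (cases a) auto
        have wv: "w = (d, f, A) # v" by (simp add: Cons a)
        show ?thesis
          using *[OF wv] unfolding wv
          by (simp add: consume_def split_def del: letter_sum.simps)
      qed
      then show ?thesis
        using B by (simp add: delta_eq lsum_ksign)
    qed
    have t0: "lsum (brace_words (replicate 0 (0, \<delta>)) s B w) (\<lambda>t. letter_sum t l F) = ?P 0"
      by (auto split: list.splits)
    \<comment> \<open>The first differential comes after the first letter of \<open>w\<close>, or
      stands in front of it; having arity zero, it swallows nothing there, and \<open>m\<close>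
      differentials are left.\<close>
    have tS: "lsum (brace_words (replicate (Suc m) (0, \<delta>)) s B w) (\<lambda>t. letter_sum t l F) = ?P (Suc m) + ?D m" for m
      unfolding replicate_Suc lsum_brace_words_ne[of 0 \<delta> "replicate m (0, \<delta>)" s B w] cons
      by (auto simp: lsum_ksign split: list.splits)
    have P: "(\<Sum>m\<le>M. ?P m) = (case w of [] \<Rightarrow> F [] | (d, f, A) # w' \<Rightarrow>
       ksign l (lsum (delta_words C A w' (l - (d + 1))) (\<lambda>t. F ((- 1, f (l - (d + 1)), fst A (l - (d + 1))) # t))))"
    proof (cases w)
      case Nil
      then show ?thesis by simp
    next
      case (Cons a v)
      obtain d f A where a: "a = (d, f, A)" by (cases a) auto
      have A: "A \<in> QObj KQ" using w Cons a sword_obj[of KQ A v] by simp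
      have "lsum (delta_words C A v (l - (d + 1))) (\<lambda>t. F ((- 1, f (l - (d + 1)), fst A (l - (d + 1))) # t)) =
        (\<Sum>m\<le>M. lsum (brace_words (replicate m (0, \<delta>)) (s + d) A v) (\<lambda>t. letter_sum t (l - (d + 1))
          (\<lambda>t. F ((- 1, f (l - (d + 1)), fst A (l - (d + 1))) # t))))"
      proof (rule step(1)[OF nb])
        show "w = (d, f, A) # v" by (simp add: Cons a)
        show "sword KQ A v" using w Cons a by simp
        show "reg sco (fst A (l - (d + 1))) (\<lambda>t. F ((- 1, f (l - (d + 1)), fst A (l - (d + 1))) # t))"
          by (rule reg_Cons[OF mo F Bl Obj_cplx[OF A] delta_words_letter]) (use w Cons a in auto)
      qed (use FM in auto)
      then show ?thesis by (simp add: Cons a ksign_sum)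
    qed
    \<comment> \<open>The differential in front uses up one of the at most \<open>M\<close> letters,
      so the induction hypothesis applies with the bound \<open>M - 1\<close>; for
      \<open>M = 0\<close> there is no such word.\<close>
    have D: "(\<Sum>m<M. ?D m) = ksign l (lsum (delta_words C B w (l - 1)) ?F\<delta>)"
    proof (cases M)
      case 0
      then have "lsum (delta_words C B w (l - 1)) ?F\<delta> = 0"
        using FM by (intro lsum_eq_0) auto
      then show ?thesis using 0 by simp
    next
      case (Suc M')
      have "lsum (delta_words C B w (l - 1)) ?F\<delta> =
        (\<Sum>m\<le>M'. lsum (brace_words (replicate m (0, \<delta>)) s B w) (\<lambda>t. letter_sum t (l - 1) ?F\<delta>))"
        by (rule step(2)[OF nb w F\<delta>]) (use FM Suc in auto)
      then show ?thesis by (simp add: Suc lessThan_Suc_atMost ksign_sum)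
    qed
    have "(\<Sum>m\<le>M. lsum (brace_words (replicate m (0, \<delta>)) s B w) (\<lambda>t. letter_sum t l F)) =
      (\<Sum>m\<le>M. ?P m) + (\<Sum>m<M. ?D m)"
    proof (induction M)
      case 0
      show ?case using t0 by (cases w) auto
    next
      case (Suc M)
      then show ?case using tS[of M] by (simp add: algebra_simps)
    qed
    then show ?thesis unfolding lsum_delta_words[OF nb] P D by simp
  qed
qed

lemma embr_eq_emb:
  assumes \<phi>: "\<phi> \<in> Cbr sc LQ p"
  shows "embr C p \<phi> = emb p \<phi>"
proof (intro ext)
  fix B w i
  let ?n = "nat (p + 1)"
  show "embr C p \<phi> B w i = emb p \<phi> B w i"
  proof (cases "sword KQ B w")
    case False
    then show ?thesis by (simp add: embr_def embr_arity_def brace_eq emb_def sum_fun_apply)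
  next
    case w: True
    define l where "l = i + wdeg w + p + 1"
    let ?\<phi> = "to_br KQ 0 ?n (componentwise (of_br 0 ?n \<phi>))"
    let ?F = "\<lambda>t. if length t = ?n then \<phi> (fst B l) t else 0"
    have Bl: "fst B l \<in> Obj C" using sword_obj[OF w] by (rule Obj_cplx)
    have \<delta>g: "gword (Cbr csc KQ) (replicate m (0, \<delta>))" for m
      using delta_Cbr by (auto simp: gword_def)
    \<comment> \<open>On words whose letters all have degree -1, only the arity \<open>p + 1\<close>
      of \<phi> can be nonzero. So replacing \<phi> by its part of this arity, as
      \<open>embr\<close> does, loses nothing.\<close>
    have 0: "\<phi> (fst B l) t = ?F t" if t: "sword LQ (fst B l) t" "wdeg t = - int (length t)" for t
    proof (cases "length t = ?n")
      case False
      then have "wdeg t + p + 1 \<noteq> 0" using t(2) by auto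
      then show ?thesis using L.Cbr_val[OF \<phi> t(1)] False by (simp add: QHom_LQ)
    qed simp
    have "reg sc (fst B l) ?F"
      using Cbr_reg[OF \<phi> Bl] by (auto simp: reg_def mlin_def)
    note e = lsum_delta_words_eq_sum[OF module_base w this, of ?n 0]
    have "embr C p \<phi> B w i = (\<Sum>m\<le>?n. lsum (brace_words (replicate m (0, \<delta>)) 0 B w) (\<lambda>t. ?\<phi> B t i))"
      using w by (simp add: embr_def embr_arity_def brace_eq sum_fun_apply lsum_apply)
    also have "\<dots> = (\<Sum>m\<le>?n. lsum (brace_words (replicate m (0, \<delta>)) 0 B w) (\<lambda>t. ksign ((p + 1) * l) (letter_sum t l ?F)))"
    proof (intro sum.cong refl lsum_cong)
      fix m e t assume "(e, t) \<in> set (brace_words (replicate m (0, \<delta>)) 0 B w)"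
      then have t: "sword KQ B t" "wdeg t = wdeg w"
        using K.brace_words_valid[OF _ w \<delta>g] by (auto simp: wdeg_def sum_list_replicate)
      show "?\<phi> B t i = ksign ((p + 1) * l) (letter_sum t l ?F)"
      proof (cases "length t = ?n")
        case False
        have "letter_sum t l' G = 0" if "\<And>v. length v = length t \<Longrightarrow> G v = 0" for l' and G :: "('o, 'm) qpath \<Rightarrow> 'm"
          using that
        proof (induction t arbitrary: l' G)
          case (Cons a t)
          then show ?case by (cases a) simp
        qed simp
        then show ?thesis using False by (simp add: to_br_def)
      next
        case True
        show ?thesis
        \<comment> \<open>For \<open>p < - 1\<close> the truncation \<open>nat (p + 1) = 0\<close>
          makes the empty word look admissible, but there the value of \<phi> lies in a zero
          module.\<close>
        proof (cases "p + 1 < 0")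
          case pneg: True
          then have "t = []" using True by simp
          moreover have "\<phi> (fst B l) [] = 0" if "B \<in> QObj KQ" for l
            using L.Cbr_val[OF \<phi>, of "fst B l" "[]"] pneg Obj_cplx[OF that] by (simp add: QHom_LQ)
          ultimately show ?thesis
            using t pneg by (auto simp: to_br_def componentwise_def of_br_def)
        next
          case False
          then have n: "int (length t) = p + 1" using True by simp
          then have l: "l = i + wdeg t + int (length t)" by (simp add: l_def t)
          have i: "i + wdeg (shift_degs 1 t) = l" by (simp add: wdeg_shift_degs l)
          have "componentwise (of_br 0 ?n \<phi>) B (shift_degs 1 t) i =
              \<phi> (fst B l) (shift_degs (- 1) (comp_word i (shift_degs 1 t)))"
            unfolding componentwise_def i using True by (simp add: of_br_def)
          then have "?\<phi> B t i = ksign (arg_sign (shift_degs 1 t))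
              (?F (shift_degs (- 1) (comp_word i (shift_degs 1 t))))"
            using t True by (simp add: to_br_def ksign_apply)
          also have "\<dots> = ksign ((p + 1) * l) (letter_sum t l ?F)"
            unfolding letter_sum_eq[OF l, of ?F] ksign_ksign n by (rule ksign_cong) simp
          finally show ?thesis .
        qed
      qed
    qed
    also have "\<dots> = ksign ((p + 1) * l) (lsum (delta_words C B w l) ?F)"
      by (simp add: e lsum_ksign ksign_sum)
    also have "lsum (delta_words C B w l) ?F = lsum (delta_words C B w l) (\<phi> (fst B l))"
      using delta_words_valid[OF _ w] 0 by (intro lsum_cong) (simp only:)
    also have "ksign ((p + 1) * l) \<dots> = emb p \<phi> B w i"
      using w by (simp add: emb_def l_def Let_def)
    finally show ?thesis .
  qed
qed


section \<open>Complexes concentrated in degree 0\<close>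

abbreviation st :: "'o \<Rightarrow> ('o, 'm) cplx" where "st \<equiv> stalk z"
abbreviation "stw w \<equiv> map (\<lambda>(d, f, A). (d, stalk_mor f, st A)) w"

lemma stalk_obj: "A \<in> Obj C \<Longrightarrow> st A \<in> QObj KQ"
proof -
  assume A: "A \<in> Obj C"
  have z: "z \<in> Obj C" using zero by (rule zero_object_Obj)
  have o: "(if P then A else z) \<in> Obj C" for P using A z by simp
  have "\<forall>i<0. zero_object C (fst (st A) i)" using zero by (simp add: stalk_def)
  then show ?thesis
    using Hom_0 cmp_0(1) o unfolding QObj_KQ bb_complex_def stalk_def fst_conv snd_conv by blast
qed

text \<open>A component that does not lead from degree 0 to degree 0 starts or ends at
  \<open>z\<close>. Hence complexes concentrated in degree 0 form a full copy of the linear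
  category.\<close>

lemma QHom_stalk:
  assumes "A \<in> Obj C" "B \<in> Obj C" "f \<in> QHom KQ (st A) (st B) n"
  shows "f = (if n = 0 then stalk_mor (f 0) else 0)" and "f 0 \<in> QHom LQ A B n"
proof -
  have z: "z \<in> Obj C" using zero by (rule zero_object_Obj)
  have f: "f i \<in> Hom C (if i = 0 then A else z) (if i + n = 0 then B else z)" for i
    using assms(3) by (simp add: QHom_KQ stalk_def)
  have f0: "f i = 0" if "i \<noteq> 0 \<or> n \<noteq> 0" for i
  proof (cases "i = 0")
    case True
    then show ?thesis using f[of i] that Hom_to_zero[OF zero assms(1)] by simp
  next
    case False
    then show ?thesis using f[of i] Hom_from_zero[OF zero] assms(2) z by (auto split: if_splits)
  qed
  then show "f = (if n = 0 then stalk_mor (f 0) else 0)"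
    by (auto simp: fun_eq_iff stalk_mor_def)
  show "f 0 \<in> QHom LQ A B n"
    using f[of 0] f0[of 0] by (cases "n = 0") (auto simp: QHom_LQ)
qed

lemma stalk_mor_QHom:
  assumes "A \<in> Obj C" "B \<in> Obj C" "x \<in> QHom LQ A B n"
  shows "stalk_mor x \<in> QHom KQ (st A) (st B) n"
proof -
  have z: "z \<in> Obj C" using zero by (rule zero_object_Obj)
  then show ?thesis
    using assms Hom_0 by (auto simp: QHom_KQ QHom_LQ stalk_def stalk_mor_def split: if_splits)
qed

lemma stalk_mor_lin: "stalk_mor (sc a x + sc c y) = csc a (stalk_mor x) + csc c (stalk_mor y)"
  by (auto simp: stalk_mor_def com_scale_def fun_eq_iff)

lemma stalk_mor_0 [simp]: "stalk_mor 0 = 0"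
  by (auto simp: stalk_mor_def fun_eq_iff)

lemma stalk_mor_at_0 [simp]: "stalk_mor x 0 = x"
  by (simp add: stalk_mor_def)

lemma fst_stalk_0 [simp]: "fst (st A) 0 = A"
  by (simp add: stalk_def)

lemma sword_stw: "sword LQ B w \<Longrightarrow> sword KQ (st B) (stw w)"
proof (induction w arbitrary: B)
  case (Cons x w)
  obtain d f A where x: "x = (d, f, A)" by (cases x) auto
  have "A \<in> Obj C" using Cons.prems x sword_obj[of LQ A w] by simp
  then show ?case using Cons x stalk_mor_QHom by (simp add: stalk_obj)
qed (simp add: stalk_obj)

lemma src_stw [simp]: "src (st B) (stw w) = st (src B w)"
  by (induction w arbitrary: B) auto

lemma wdeg_stw [simp]: "wdeg (stw w) = wdeg w"
  by (induction w) auto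

section \<open>The projection as a morphism and a retraction of the extension\<close>

abbreviation "pr \<equiv> proj C z"

lemma pr_eq: "pr p \<phi> B w = (if sword LQ B w then \<phi> (st B) (stw w) 0 else 0)"
  by (simp add: proj_def)

lemma pr_val:
  assumes "\<phi> \<in> Cbr csc KQ p" "sword LQ B w"
  shows "\<phi> (st B) (stw w) = stalk_mor (pr p \<phi> B w)"
    and "pr p \<phi> B w \<in> QHom LQ (src B w) B (wdeg w + p + 1)"
proof -
  have o: "src B w \<in> Obj C" "B \<in> Obj C" using sword_src[OF assms(2)] sword_obj[OF assms(2)] by auto
  have "\<phi> (st B) (stw w) \<in> QHom KQ (st (src B w)) (st B) (wdeg w + p + 1)"
    using K.Cbr_val[OF assms(1) sword_stw[OF assms(2)]] by simp
  note q = QHom_stalk[OF o this]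
  show "pr p \<phi> B w \<in> QHom LQ (src B w) B (wdeg w + p + 1)"
    using q(2) assms(2) by (simp add: pr_eq)
  show "\<phi> (st B) (stw w) = stalk_mor (pr p \<phi> B w)"
    using q assms(2) by (auto simp: pr_eq split: if_splits)
qed

lemma mlin_stw:
  assumes "mlin csc csc KQ (st B) F"
  shows "mlin sc sc LQ B (\<lambda>w. F (stw w) 0)"
  unfolding mlin_def
proof (intro allI impI)
  fix u d x y A v a c
  assume "sword LQ B (u @ (d, x, A) # v)" "sword LQ B (u @ (d, y, A) # v)"
  then have "sword KQ (st B) (stw u @ (d, stalk_mor x, st A) # stw v)"
    "sword KQ (st B) (stw u @ (d, stalk_mor y, st A) # stw v)"
    using sword_stw[of B "u @ (d, x, A) # v"] sword_stw[of B "u @ (d, y, A) # v"] by auto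
  then show "F (stw (u @ (d, sc a x + sc c y, A) # v)) 0 =
     sc a (F (stw (u @ (d, x, A) # v)) 0) + sc c (F (stw (u @ (d, y, A) # v)) 0)"
    using mlinD[OF assms] by (simp add: stalk_mor_lin com_scale_def)
qed

lemma pr_Cbr:
  assumes "\<phi> \<in> Cbr csc KQ p"
  shows "pr p \<phi> \<in> Cbr sc LQ p"
proof (rule L.CbrI)
  fix B
  show "mlin sc sc LQ B (pr p \<phi> B)"
    using mlin_stw[OF K.Cbr_mlin[OF assms], of B] L.sword_lin by (simp add: mlin_def pr_eq)
qed (use pr_val[OF assms] in \<open>auto simp: pr_eq\<close>)

abbreviation "prw Y \<equiv> map (\<lambda>(q, \<psi>). (q, pr q \<psi>)) Y"

lemma wdeg_prw [simp]: "wdeg (prw Y) = wdeg Y"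
  by (induction Y) auto

text \<open>Restriction to a full subcategory respects insertions: by \<open>pr_val\<close>, a value
  on words of stalks is again a stalk morphism, namely that of the restricted cochain.\<close>

lemma lsum_brace_words_stw:
  "sword LQ B w \<Longrightarrow> gword (Cbr csc KQ) Y \<Longrightarrow>
   lsum (brace_words Y s (st B) (stw w)) F = lsum (brace_words (prw Y) s B w) (\<lambda>t. F (stw t))"
proof (induction "(Y, w)" arbitrary: Y w s B F rule: wf_induct_rule[OF wf_measure[of "\<lambda>(Y, w). length Y + length w"]])
  case 1
  note IH = 1(1)[simplified]
  note w = 1(2) and Yg = 1(3)
  show ?case
  proof (cases Y)
    case Nil
    then show ?thesis by simp
  next
    case (Cons y Y')
    obtain q \<psi> where y: "y = (q, \<psi>)" by (cases y)
    have \<psi>: "\<psi> \<in> Cbr csc KQ q" and Y': "gword (Cbr csc KQ) Y'" using Yg Cons y by auto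
    have splittings_map: "lsum (splittings (map h v)) (\<lambda>(a, c). G a c) = lsum (splittings v) (\<lambda>(a, c). G (map h a) (map h c))"
      for h :: "'x \<Rightarrow> 'y" and v and G :: "'y list \<Rightarrow> 'y list \<Rightarrow> 'v::ab_group_add"
      by (induction v arbitrary: G) auto
    have "consume q \<psi> Y' s (st B) (stw w) F = consume q (pr q \<psi>) (prw Y') s B w (\<lambda>t. F (stw t))"
      unfolding consume_def splittings_map
    proof (rule arg_cong[where f = "ksign _"], rule lsum_splittings_cong)
      fix u v assume uv: "w = u @ v"
      have sw: "sword LQ B u" "sword LQ (src B u) v" using w uv by (auto simp: sword_append)
      show "lsum (brace_words Y' (s + wdeg (stw u)) (src (st B) (stw u)) (stw v))
           (\<lambda>t. F ((q + wdeg (stw u), \<psi> (st B) (stw u), src (st B) (stw u)) # t)) =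
         lsum (brace_words (prw Y') (s + wdeg u) (src B u) v) (\<lambda>t. F (stw ((q + wdeg u, pr q \<psi> B u, src B u) # t)))"
        using IH[of Y' v "src B u" "s + wdeg u" "\<lambda>t. F ((q + wdeg u, \<psi> (st B) (stw u), st (src B u)) # t)"]
          sw Y' uv Cons pr_val(1)[OF \<psi> sw(1)] by simp
    qed
    moreover have "(case stw w of [] \<Rightarrow> 0 | (d, x, A) # w' \<Rightarrow>
        lsum (brace_words ((q, \<psi>) # Y') (s + d) A w') (\<lambda>t. F ((d, x, A) # t))) =
      (case w of [] \<Rightarrow> 0 | (d, x, A) # w' \<Rightarrow>
        lsum (brace_words ((q, pr q \<psi>) # prw Y') (s + d) A w') (\<lambda>t. F (stw ((d, x, A) # t))))"
    proof (cases w)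
      case Nil
      then show ?thesis by simp
    next
      case w': (Cons a v)
      obtain d f A where a: "a = (d, f, A)" by (cases a) auto
      show ?thesis
        using IH[of Y v A "s + d" "\<lambda>t. F ((d, stalk_mor f, st A) # t)"] w Yg by (simp add: w' a Cons y)
    qed
    ultimately show ?thesis
      by (simp add: Cons y lsum_brace_words_ne[of q \<psi> Y' s "st B" "stw w" F]
          lsum_brace_words_ne[of q "pr q \<psi>" "prw Y'" s B w "\<lambda>t. F (stw t)"])
  qed
qed

lemma pr_brace:
  assumes "\<phi> \<in> Cbr csc KQ p" "gword (Cbr csc KQ) Y"
  shows "pr (p + wdeg Y) (brace KQ \<phi> Y) = brace LQ (pr p \<phi>) (prw Y)"
proof (intro ext)
  fix B w
  show "pr (p + wdeg Y) (brace KQ \<phi> Y) B w = brace LQ (pr p \<phi>) (prw Y) B w"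
  proof (cases "sword LQ B w")
    case False
    then show ?thesis by (simp add: pr_eq brace_eq)
  next
    case w: True
    have g: "gword (Cbr sc LQ) (prw Y)" using assms(2) by (auto simp: gword_def pr_Cbr)
    have "brace KQ \<phi> Y (st B) (stw w) 0 = lsum (brace_words (prw Y) 0 B w) (\<lambda>t. \<phi> (st B) (stw t) 0)"
      using sword_stw[OF w] lsum_brace_words_stw[OF w assms(2)] by (simp add: brace_eq lsum_apply)
    also have "\<dots> = lsum (brace_words (prw Y) 0 B w) (pr p \<phi> B)"
      using L.brace_words_valid[OF _ w g] by (intro lsum_cong) (simp add: pr_eq)
    finally show ?thesis using w by (simp add: brace_eq pr_eq)
  qed
qed

lemma pr_add: "pr p (\<phi> + \<psi>) = pr p \<phi> + pr p \<psi>"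
  by (auto simp: fun_eq_iff pr_eq)

lemma pr_0 [simp]: "pr p 0 = 0"
  using pr_add[of p 0 0] by simp

lemma pr_diff: "pr p (\<phi> - \<psi>) = pr p \<phi> - pr p \<psi>"
  using pr_add[of p "\<phi> - \<psi>" \<psi>] by (simp add: algebra_simps)

lemma pr_ksign: "pr p (ksign e \<phi>) = ksign e (pr p \<phi>)"
  using pr_diff[of p 0 \<phi>] by (simp add: ksign_def)

lemma pr_scale: "pr p (cochain_scale csc c \<phi>) = cochain_scale sc c (pr p \<phi>)"
  by (auto simp: fun_eq_iff pr_eq cochain_scale_def com_scale_def)

lemma pr_Cbr_mul:
  assumes "gword (Cbr csc KQ) x" "gword (Cbr csc KQ) y"
  shows "pr (wdeg x + wdeg y) (Cbr_mul KQ x y) = Cbr_mul LQ (prw x) (prw y)"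
proof -
  consider "x = []" "y = []" | q \<psi> where "x = []" "y = [(q, \<psi>)]" | "x = []" "2 \<le> length y"
    | p \<phi> where "x = [(p, \<phi>)]" | "2 \<le> length x"
    by (cases x; cases "tl x"; cases y; cases "tl y") auto
  then show ?thesis
  proof cases
    case 4
    then show ?thesis using pr_brace[of \<phi> p y] assms by (simp add: L.Cbr_mul_simps K.Cbr_mul_simps)
  qed (auto simp: L.Cbr_mul_simps K.Cbr_mul_simps L.Cbr_mul_Nil_long K.Cbr_mul_Nil_long L.Cbr_mul_long K.Cbr_mul_long)
qed

text \<open>The differentials of stalks are zero, so only the word without insertions remains.
  Letters of degree -1 keep \<open>l = 0\<close> throughout, where all signs are trivial.\<close>

lemma lsum_delta_words_stalk:
  fixes sco :: "'k \<Rightarrow> 'v::ab_group_add \<Rightarrow> 'v"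
  assumes mo: "module sco"
  shows "sword LQ B w \<Longrightarrow> (\<forall>(d, x)\<in>set w. d = - 1) \<Longrightarrow> reg sco B F \<Longrightarrow>
    lsum (delta_words C (st B) (stw w) 0) F = F w"
proof (induction w arbitrary: B F)
  case (Cons x w)
  obtain d f A where x: "x = (d, f, A)" by (cases x) auto
  have d: "d = - 1" using Cons.prems x by simp
  have w: "sword LQ A w" and f: "f \<in> Hom C A B" and B: "B \<in> Obj C"
    using Cons.prems x d by (auto simp: QHom_LQ)
  have A: "A \<in> Obj C" using sword_obj[OF w] by simp
  have m: "mlin sc sco LQ B F" using Cons.prems(3) by (simp add: reg_def)
  have "lsum (delta_words C (st B) (stw (x # w)) (0 - 1)) (\<lambda>t. F ((- 1, snd (st B) (0 - 1), fst (st B) (0 - 1)) # t)) = 0"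
  proof (rule lsum_eq_0)
    fix e t assume t: "(e, t) \<in> set (delta_words C (st B) (stw (x # w)) (0 - 1))"
    have "sword LQ (fst (st B) (0 - 1)) t"
      using delta_words_valid[OF t sword_stw[OF Cons.prems(1)]] by (rule conjunct1)
    then show "F ((- 1, snd (st B) (0 - 1), fst (st B) (0 - 1)) # t) = 0"
      using L.mlin_head_0[OF mo m, of "fst (st B) (0 - 1)" t "- 1"] B by (simp add: stalk_def)
  qed
  then have "lsum (delta_words C (st B) (stw (x # w)) 0) F =
    lsum (delta_words C (st A) (stw w) 0) (\<lambda>t. F ((- 1, f, A) # t))"
    using lsum_delta_words'[OF mo sword_stw[OF Cons.prems(1)], of 0 F] Cons.prems(3) by (simp add: x d)
  also have "\<dots> = F ((- 1, f, A) # w)"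
    by (rule Cons.IH[OF w]) (use Cons.prems x reg_Cons[OF mo Cons.prems(3) B A f] in auto)
  finally show ?case by (simp add: x d)
next
  case Nil
  have B: "B \<in> Obj C" using Nil by simp
  have m: "mlin sc sco LQ B F" using Nil by (simp add: reg_def)
  have s: "sword KQ (st B) []" using stalk_obj[OF B] by simp
  have "lsum (delta_words C (st B) [] (0 - 1)) (\<lambda>t. F ((- 1, snd (st B) (0 - 1), fst (st B) (0 - 1)) # t)) = 0"
  proof (rule lsum_eq_0)
    fix e t assume "(e, t) \<in> set (delta_words C (st B) [] (0 - 1))"
    then have "sword LQ (fst (st B) (0 - 1)) t" using delta_words_valid[OF _ s] by blast
    then show "F ((- 1, snd (st B) (0 - 1), fst (st B) (0 - 1)) # t) = 0"
      using L.mlin_head_0[OF mo m, of "fst (st B) (0 - 1)" t "- 1"] B by (simp add: stalk_def)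
  qed
  then show ?case using lsum_delta_words'[OF mo s, of 0 F] Nil by simp
qed

lemma pr_emb:
  assumes \<phi>: "\<phi> \<in> Cbr sc LQ p"
  shows "pr p (emb p \<phi>) = \<phi>"
proof (intro ext)
  fix B w
  show "pr p (emb p \<phi>) B w = \<phi> B w"
  proof (cases "sword LQ B w")
    case False
    then show ?thesis using L.Cbr_nosword[OF \<phi>] by (simp add: pr_eq)
  next
    case w: True
    have B: "B \<in> Obj C" using sword_obj[OF w] by simp
    note p = pr_val(2)[OF emb_Cbr[OF \<phi>] w]
    show ?thesis
    proof (cases "wdeg w + p + 1 = 0")
      case False
      then show ?thesis using p L.Cbr_val[OF \<phi> w] by (simp add: QHom_LQ)
    next
      case l: True
      show ?thesis
      proof (cases "\<forall>(d, x)\<in>set w. d = - 1")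
        case True
        then show ?thesis
          using w l lsum_delta_words_stalk[OF module_base w True Cbr_reg[OF \<phi> B]] sword_stw[OF w]
          by (simp add: pr_eq emb_def Let_def)
      next
        \<comment> \<open>In the linear category a letter of degree other than -1 is zero, so every
          cochain vanishes on \<open>w\<close>; this applies to both sides.\<close>
        case False
        then obtain d f A u v where uv: "w = u @ (d, f, A) # v" "d \<noteq> - 1"
          by (force dest: split_list)
        then have f: "f = 0" using w by (auto simp: sword_append QHom_LQ split: if_splits)
        have zl: "\<chi> B w = 0" if "\<chi> \<in> Cbr sc LQ p" for \<chi>
          using mlinD[OF L.Cbr_mlin[OF that] w[unfolded uv f] w[unfolded uv f], of 0 0] by (simp add: uv f)
        show ?thesis using zl[OF \<phi>] zl[OF pr_Cbr[OF emb_Cbr[OF \<phi>]]] by simp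
      qed
    qed
  qed
qed

lemma pr_Cbr_dif:
  assumes x: "gword (Cbr csc KQ) x"
  shows "pr (wdeg x + 1) (Cbr_dif KQ bK x) = Cbr_dif LQ bL (prw x)"
proof -
  have b: "gword (Cbr csc KQ) [(1, bK)]" using bK_Cbr by simp
  have pb: "pr 1 bK = bL" unfolding bK_eq_emb by (rule pr_emb[OF bL_Cbr])
  have "pr (wdeg x + 1) (Cbr_mul KQ [(1, bK)] x) = Cbr_mul LQ [(1, bL)] (prw x)"
    "pr (wdeg x + 1) (Cbr_mul KQ x [(1, bK)]) = Cbr_mul LQ (prw x) [(1, bL)]"
    using pr_Cbr_mul[OF b x] pr_Cbr_mul[OF x b] by (simp_all add: pb add.commute)
  then show ?thesis
    by (simp add: L.Cbr_dif_eq[OF bL_Cbr] K.Cbr_dif_eq[OF bK_Cbr] pr_diff pr_ksign)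
qed

lemma pr_morphism:
  "binf_morphism (cochain_scale csc) (cochain_scale sc) (Cbr_binf csc KQ) (Cbr_binf sc LQ) pr"
  unfolding binf_morphism_def
  using DL.binf_algebra_Cbr DK.binf_algebra_Cbr pr_Cbr pr_add pr_scale pr_Cbr_mul pr_Cbr_dif
  by (simp add: Cbr_binf_def)


section \<open>The homotopy\<close>

text \<open>The suspended morphism of degree \<open>-l\<close> from \<open>S\<close> to its component \<open>S\<^sup>l\<close>.\<close>

definition cross :: "('o, 'm) cplx \<Rightarrow> int \<Rightarrow> int \<times> (int \<Rightarrow> 'm) \<times> ('o, 'm) cplx" where
  "cross S l = (- l - 1, (\<lambda>i. if i = l then idn C (fst S l) else 0), S)"

text \<open>\<open>l - wdeg w1 + wdeg t\<close> is the degree in which \<open>t\<close> stops and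
  the crossing has to end. The extra sign in \<open>length t\<close> makes the terms alternate with
  the place of the crossing, without which nothing would telescope.\<close>

definition cross_words ::
  "('o, 'm) cplx \<Rightarrow> (('o, 'm) cplx, int \<Rightarrow> 'm) qpath \<Rightarrow> int \<Rightarrow>
   (int \<times> (('o, 'm) cplx, int \<Rightarrow> 'm) qpath) list" where
  "cross_words B w l = lbind (splittings w) (\<lambda>(w1, w2). map (\<lambda>(e, t).
     (e + int (length t), stw t @ cross (src B w1) (l - wdeg w1 + wdeg t) # w2)) (delta_words C B w1 l))"

lemma ksign_1plus: "ksign (1 + e) x = - ksign e x"
  by (simp add: ksign_def)

lemma lsum_map_sign: "lsum (map (\<lambda>(e, t). (e + k t, h t)) L) F = lsum L (\<lambda>t. ksign (k t) (F (h t)))"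
  by (induction L) (auto simp: ksign_ksign)

lemma lsum_cross_words_eq:
  "lsum (cross_words B w l) F = lsum (splittings w) (\<lambda>(w1, w2). lsum (delta_words C B w1 l)
     (\<lambda>t. ksign (int (length t)) (F (stw t @ cross (src B w1) (l - wdeg w1 + wdeg t) # w2))))"
  unfolding cross_words_def lsum_lbind
proof (rule lsum_cong)
  fix e and p :: "(('o, 'm) cplx, int \<Rightarrow> 'm) qpath \<times> (('o, 'm) cplx, int \<Rightarrow> 'm) qpath"
  obtain w1 w2 where p: "p = (w1, w2)" by (cases p)
  show "lsum (case p of (w1, w2) \<Rightarrow> map (\<lambda>(e, t).
     (e + int (length t), stw t @ cross (src B w1) (l - wdeg w1 + wdeg t) # w2)) (delta_words C B w1 l)) F =
     (case p of (w1, w2) \<Rightarrow> lsum (delta_words C B w1 l)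
     (\<lambda>t. ksign (int (length t)) (F (stw t @ cross (src B w1) (l - wdeg w1 + wdeg t) # w2))))"
    unfolding p prod.case by (rule lsum_map_sign)
qed

lemma set_xklD:
  assumes "(e, U) \<in> set (cross_words B w l)"
  obtains w1 w2 e' t where "w1 @ w2 = w" "(e', t) \<in> set (delta_words C B w1 l)"
    "U = stw t @ cross (src B w1) (l - wdeg w1 + wdeg t) # w2"
proof -
  from assms obtain e1 p e2 where p: "(e1, p) \<in> set (splittings w)"
    and m: "(e2, U) \<in> set (case p of (w1, w2) \<Rightarrow> map (\<lambda>(e, t).
     (e + int (length t), stw t @ cross (src B w1) (l - wdeg w1 + wdeg t) # w2)) (delta_words C B w1 l))"
    unfolding cross_words_def set_lbind by blast
  obtain w1 w2 where p': "p = (w1, w2)" by (cases p)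
  have "w1 @ w2 = w" using p by (simp add: p' set_splittings)
  moreover from m obtain e' t where "(e', t) \<in> set (delta_words C B w1 l)"
    "U = stw t @ cross (src B w1) (l - wdeg w1 + wdeg t) # w2"
    unfolding p' prod.case set_map by auto
  ultimately show thesis by (rule that)
qed

abbreviation (input) "lmap l f A \<equiv> (- 1, stalk_mor (f (l :: int)), st (fst A l))"

text \<open>A letter put in front of the crossing lengthens \<open>t\<close> by one. Therefore both
  recursive terms are negative, in contrast to \<open>lsum_delta_words\<close>.\<close>

lemma lsum_cross_words:
  assumes nb: "\<not> l < lower_bound C B"
  shows "lsum (cross_words B w l) F =
    F (cross B l # w) -
    (case w of [] \<Rightarrow> 0 | (d, f, A) # w' \<Rightarrow>
      ksign l (lsum (cross_words A w' (l - (d + 1))) (\<lambda>U. F (lmap (l - (d + 1)) f A # U)))) -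
    ksign l (lsum (cross_words B w (l - 1)) (\<lambda>U. F (lmap (l - 1) (snd B) B # U)))"
proof -
  let ?k = "\<lambda>t. ksign (int (length t))"
  let ?\<delta> = "lmap (l - 1) (snd B) B"
  have nil: "lsum (delta_words C B [] l) (\<lambda>t. ?k t (F (stw t @ cross B (l + wdeg t) # w))) =
     F (cross B l # w) - ksign l (lsum (delta_words C B [] (l - 1)) (\<lambda>t. ?k t (F (?\<delta> # stw t @ cross B (l - 1 + wdeg t) # w))))"
    by (subst lsum_delta_words[OF nb]) (simp add: ksign_1plus lsum_minus ksign_minus algebra_simps)
  show ?thesis
  proof (cases w)
    case Nil
    show ?thesis using nil by (simp add: Nil lsum_cross_words_eq)
  next
    case (Cons x w')
    obtain d f A where x: "x = (d, f, A)" by (cases x) auto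
    let ?l = "l - (d + 1)"
    have c: "lsum (delta_words C B (x # u) l) (\<lambda>t. ?k t (F (stw t @ cross (src A u) (l - wdeg (x # u) + wdeg t) # v))) =
       - ksign l (lsum (delta_words C A u ?l) (\<lambda>t. ?k t (F (lmap ?l f A # stw t @ cross (src A u) (?l - wdeg u + wdeg t) # v)))) -
       ksign l (lsum (delta_words C B (x # u) (l - 1)) (\<lambda>t. ?k t (F (?\<delta> # stw t @ cross (src A u) (l - 1 - wdeg (x # u) + wdeg t) # v))))"
      for u v
      by (subst lsum_delta_words[OF nb]) (simp add: x ksign_1plus lsum_minus ksign_minus algebra_simps)
    have "lsum (cross_words B w l) F = lsum (delta_words C B [] l) (\<lambda>t. ?k t (F (stw t @ cross B (l + wdeg t) # w))) +
       lsum (splittings w') (\<lambda>(u, v). lsum (delta_words C B (x # u) l) (\<lambda>t. ?k t (F (stw t @ cross (src A u) (l - wdeg (x # u) + wdeg t) # v))))"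
      by (simp add: lsum_cross_words_eq Cons x split_def)
    also have "\<dots> = F (cross B l # w) - ksign l (lsum (cross_words A w' ?l) (\<lambda>U. F (lmap ?l f A # U))) -
       ksign l (lsum (cross_words B w (l - 1)) (\<lambda>U. F (?\<delta> # U)))"
      unfolding nil c by (simp add: lsum_cross_words_eq Cons x split_def lsum_diff lsum_minus lsum_ksign ksign_add algebra_simps)
    finally show ?thesis by (simp add: Cons x)
  qed
qed

lemma cross_words_below: "l < lower_bound C B \<Longrightarrow> lsum (cross_words B w l) F = 0"
  by (simp add: lsum_cross_words_eq delta_words_below split_def)

lemma cross_QHom:
  assumes S: "S \<in> QObj KQ"
  shows "(\<lambda>i. if i = l then idn C (fst S l) else 0) \<in> QHom KQ S (st (fst S l)) (- l)"
  using Obj_cplx[OF S] zero_object_Obj[OF zero] idn_Hom Hom_0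
  by (auto simp: QHom_KQ stalk_def)

lemma sword_cross:
  assumes "sword KQ S w"
  shows "sword KQ (st (fst S l)) (cross S l # w)"
  using assms sword_obj[OF assms] cross_QHom[OF sword_obj[OF assms], of l] stalk_obj Obj_cplx
  by (simp add: cross_def)

lemma sword_lmap:
  assumes "f \<in> Hom C (fst A l) D" "D \<in> Obj C" "sword KQ (st (fst A l)) U" "A \<in> QObj KQ"
  shows "sword KQ (st D) ((- 1, stalk_mor f, st (fst A l)) # U)"
  using assms stalk_mor_QHom[of "fst A l" D f 0] Obj_cplx[OF assms(4)] stalk_obj
  by (simp add: QHom_LQ)

lemma cross_words_valid:
  assumes U: "(e, U) \<in> set (cross_words B w l)" and w: "sword KQ B w"
  shows "sword KQ (st (fst B l)) U \<and> src (st (fst B l)) U = src B w \<and> wdeg U = wdeg w - l - 1 \<and> U \<noteq> []"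
proof -
  obtain w1 w2 e' t where u: "w1 @ w2 = w" "(e', t) \<in> set (delta_words C B w1 l)"
    "U = stw t @ cross (src B w1) (l - wdeg w1 + wdeg t) # w2"
    using U by (rule set_xklD)
  have s: "sword KQ B w1" "sword KQ (src B w1) w2" using w u(1) by (auto simp: sword_append)
  have t: "sword LQ (fst B l) t" "src (fst B l) t = fst (src B w1) (l - wdeg w1 + wdeg t)"
    using delta_words_valid[OF u(2) s(1)] by auto
  have c: "sword KQ (st (src (fst B l) t)) (cross (src B w1) (l - wdeg w1 + wdeg t) # w2)"
    unfolding t(2) by (rule sword_cross[OF s(2)])
  have "src (st (fst B l)) U = src B w" using u(1,3) by (auto simp: cross_def)
  moreover have "wdeg U = wdeg w - l - 1" using u(1,3) by (auto simp: cross_def)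
  ultimately show ?thesis
    using c sword_stw[OF t(1)] u(3) by (simp add: sword_append)
qed

lemma QHom_st_zero:
  assumes "zero_object C D" "X \<in> QObj KQ" "x \<in> QHom KQ X (st D) n"
  shows "x = 0"
proof
  fix i
  have "x i \<in> Hom C (fst X i) (fst (st D) (i + n))" using assms(3) by (simp add: QHom_KQ)
  moreover have "zero_object C (fst (st D) (i + n))" using assms(1) zero by (simp add: stalk_def)
  ultimately have "x i = 0" using Obj_cplx[OF assms(2)] by (intro Hom_to_zero)
  then show "x i = 0 i" by simp
qed

lemma mlin_lsum_cross_words:
  fixes sco :: "'k \<Rightarrow> 'v::ab_group_add \<Rightarrow> 'v"
  assumes mo: "module sco"
  shows "sword KQ B (u @ (d, x, A) # v) \<Longrightarrow> sword KQ B (u @ (d, y, A) # v) \<Longrightarrow>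
     w = u @ (d, csc a x + csc c y, A) # v \<Longrightarrow> mlin csc sco KQ (st (fst B l)) F \<Longrightarrow>
     lsum (cross_words B w l) F =
       sco a (lsum (cross_words B (u @ (d, x, A) # v) l) F) + sco c (lsum (cross_words B (u @ (d, y, A) # v) l) F)"
proof (induction B w l arbitrary: u F rule: delta_words_induct[where C = C])
  case (step B w l)
  interpret o: module sco by fact
  have sum_lin: "lsum L (\<lambda>t. sco a (H t) + sco c (K t)) = sco a (lsum L H) + sco c (lsum L K)"
    for L :: "(int \<times> 'x) list" and H K a c
    unfolding lsum_add
    using lsum_additive[of "sco a" L H] lsum_additive[of "sco c" L K] by (simp add: o.scale_right_distrib)
  have sgn1: "ksign e (sco a x) = sco a (ksign e x)" for e a x
    by (simp add: ksign_def)
  note sx = step(3) and sy = step(4) and w = step(5) and F = step(6)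
  have B: "B \<in> QObj KQ" using sword_obj[OF sx] .
  have Bl: "fst B l \<in> Obj C" for l by (rule Obj_cplx[OF B])
  show ?case
  proof (cases "l < lower_bound C B")
    case True
    then show ?thesis by (simp add: cross_words_below)
  next
    case nb: False
    let ?E = "\<lambda>w. F (cross B l # w)"
    let ?P = "\<lambda>w. case w of [] \<Rightarrow> 0 | (d, f, A) # w' \<Rightarrow>
       ksign l (lsum (cross_words A w' (l - (d + 1))) (\<lambda>U. F (lmap (l - (d + 1)) f A # U)))"
    let ?D = "\<lambda>w. lsum (cross_words B w (l - 1)) (\<lambda>U. F (lmap (l - 1) (snd B) B # U))"
    have E: "?E w = sco a (?E (u @ (d, x, A) # v)) + sco c (?E (u @ (d, y, A) # v))"
      using mlinD[OF F, of "cross B l # u" d x A v y a c] sword_cross[OF sx, of l] sword_cross[OF sy, of l]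
      unfolding w by (simp del: plus_fun_apply)
    have m: "mlin csc sco KQ (st (fst A' l')) (\<lambda>U. F ((- 1, stalk_mor f, st (fst A' l')) # U))"
      if "f \<in> Hom C (fst A' l') (fst B l)" "A' \<in> QObj KQ" for f A' l'
      by (rule mlin_Cons[OF F stalk_obj[OF Bl]])
        (use stalk_mor_QHom[of "fst A' l'" "fst B l" f 0] that Bl Obj_cplx in \<open>simp add: QHom_LQ\<close>)
    have D: "?D w = sco a (?D (u @ (d, x, A) # v)) + sco c (?D (u @ (d, y, A) # v))"
      by (rule step(2)[OF nb sx sy w m[OF delta_words_delta[OF B] B]])
    have P: "?P w = sco a (?P (u @ (d, x, A) # v)) + sco c (?P (u @ (d, y, A) # v))"
    proof (cases u)
      case Nil
      let ?l = "l - (d + 1)"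
      have sA: "sword KQ A v" and A: "A \<in> QObj KQ" using sx Nil sword_obj[of KQ A v] by auto
      have xy: "x ?l \<in> Hom C (fst A ?l) (fst B l)" "y ?l \<in> Hom C (fst A ?l) (fst B l)"
        using delta_words_letter[of B d x A v l] delta_words_letter[of B d y A v l] sx sy Nil by auto
      have "lsum (cross_words A v ?l) (\<lambda>U. F (lmap ?l (csc a x + csc c y) A # U)) =
         lsum (cross_words A v ?l) (\<lambda>U. sco a (F (lmap ?l x A # U)) + sco c (F (lmap ?l y A # U)))"
      proof (rule lsum_cong)
        fix e t assume t: "(e, t) \<in> set (cross_words A v ?l)"
        have "stalk_mor ((csc a x + csc c y) ?l) = csc a (stalk_mor (x ?l)) + csc c (stalk_mor (y ?l))"
          using stalk_mor_lin by (simp add: com_scale_def)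
        moreover have "sword KQ (st (fst A ?l)) t" using cross_words_valid[OF t sA] by blast
        ultimately show "F (lmap ?l (csc a x + csc c y) A # t) = sco a (F (lmap ?l x A # t)) + sco c (F (lmap ?l y A # t))"
          using mlin_head[OF F, of "- 1" "stalk_mor (x ?l)" "st (fst A ?l)" t "stalk_mor (y ?l)" a c]
            sword_lmap[OF xy(1) Bl _ A] sword_lmap[OF xy(2) Bl _ A] by simp
      qed
      then show ?thesis unfolding w Nil append_Nil list.case prod.case by (simp only: sum_lin ksign_add sgn1)
    next
      case (Cons x' u')
      obtain d' f A' where x': "x' = (d', f, A')" by (cases x') auto
      have A': "A' \<in> QObj KQ" using sx Cons x' sword_obj[of KQ A'] by auto
      have "lsum (cross_words A' (u' @ (d, csc a x + csc c y, A) # v) (l - (d' + 1))) (\<lambda>U. F (lmap (l - (d' + 1)) f A' # U)) =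
          sco a (lsum (cross_words A' (u' @ (d, x, A) # v) (l - (d' + 1))) (\<lambda>U. F (lmap (l - (d' + 1)) f A' # U))) +
          sco c (lsum (cross_words A' (u' @ (d, y, A) # v) (l - (d' + 1))) (\<lambda>U. F (lmap (l - (d' + 1)) f A' # U)))"
      proof (rule step(1)[OF nb _ _ _ refl m[OF _ A']])
        show "f (l - (d' + 1)) \<in> Hom C (fst A' (l - (d' + 1))) (fst B l)"
          by (rule delta_words_letter[of B d' f A' "u' @ (d, x, A) # v"]) (use sx Cons x' in simp)
      qed (use sx sy w Cons x' in auto)
      then show ?thesis
        unfolding w Cons x' append_Cons list.case prod.case by (simp only: ksign_add sgn1)
    qed
    show ?thesis
      unfolding lsum_cross_words[OF nb, of w F] lsum_cross_words[OF nb, of "u @ (d, x, A) # v" F]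
        lsum_cross_words[OF nb, of "u @ (d, y, A) # v" F] E P D
      by (simp add: ksign_add ksign_minus sgn1 o.scale_right_distrib o.scale_right_diff_distrib algebra_simps)
  qed
qed

lemma lsum_cross_words':
  assumes w: "sword KQ B w"
    and F: "\<And>U. zero_object C (fst B l) \<Longrightarrow> sword KQ (st (fst B l)) U \<Longrightarrow> U \<noteq> [] \<Longrightarrow> F U = 0"
  shows "lsum (cross_words B w l) F =
    F (cross B l # w) -
    (case w of [] \<Rightarrow> 0 | (d, f, A) # w' \<Rightarrow>
      ksign l (lsum (cross_words A w' (l - (d + 1))) (\<lambda>U. F (lmap (l - (d + 1)) f A # U)))) -
    ksign l (lsum (cross_words B w (l - 1)) (\<lambda>U. F (lmap (l - 1) (snd B) B # U)))"
proof (cases "l < lower_bound C B")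
  case False
  then show ?thesis by (rule lsum_cross_words)
next
  case True
  have B: "B \<in> QObj KQ" using sword_obj[OF w] .
  have Bl: "fst B l \<in> Obj C" for l by (rule Obj_cplx[OF B])
  have z: "zero_object C (fst B l)"
    using zero_object_below_lower_bound[OF _ True] B by (simp add: QObj_KQ)
  have "F (cross B l # w) = 0" using F[OF z sword_cross[OF w]] by simp
  moreover have "lsum (cross_words B w (l - 1)) (\<lambda>U. F (lmap (l - 1) (snd B) B # U)) = 0"
  proof (rule lsum_eq_0)
    fix e t assume t: "(e, t) \<in> set (cross_words B w (l - 1))"
    show "F (lmap (l - 1) (snd B) B # t) = 0"
      by (rule F[OF z sword_lmap[OF delta_words_delta[OF B] Bl _ B]]) (use cross_words_valid[OF t w] in auto)
  qed
  moreover have "lsum (cross_words A w' (l - (d + 1))) (\<lambda>U. F (lmap (l - (d + 1)) f A # U)) = 0"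
    if w': "w = (d, f, A) # w'" for d f A w'
  proof (rule lsum_eq_0)
    fix e t assume t: "(e, t) \<in> set (cross_words A w' (l - (d + 1)))"
    have A: "A \<in> QObj KQ" "sword KQ A w'" using w w' sword_obj[of KQ A w'] by auto
    show "F (lmap (l - (d + 1)) f A # t) = 0"
      by (rule F[OF z sword_lmap[OF delta_words_letter[OF w[unfolded w']] Bl _ A(1)]]) (use cross_words_valid[OF t A(2)] in auto)
  qed
  ultimately show ?thesis using True by (simp add: cross_words_below split: list.splits)
qed

section \<open>Values of the dg structure around a crossing\<close>

lemma bK_pair:
  assumes "sword KQ B [(d, g, A), (d', f, A')]"
  shows "bK B [(d, g, A), (d', f, A')] = ksign (d + 1) (com_cmp C A' A B (d + 1) (d' + 1) g f)"
  using assms by (simp add: bK_eq)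

lemma bK_single:
  assumes "sword KQ B [(d, f, A)]"
  shows "bK B [(d, f, A)] i = ksign (d + 1) (cmp C (fst A i) (fst A (i + 1)) (fst B (i + (d + 2))) (f (i + 1)) (snd A i)) -
     cmp C (fst A i) (fst B (i + (d + 1))) (fst B (i + (d + 2))) (snd B (i + (d + 1))) (f i)"
  using assms by (simp add: bK_eq com_cmp_def ksign_apply algebra_simps)

lemma stalk_mor_cmp:
  assumes "f \<in> Hom C A' A" "g \<in> Hom C A D" "A' \<in> Obj C" "A \<in> Obj C" "D \<in> Obj C"
  shows "com_cmp C (st A') (st A) (st D) 0 0 (stalk_mor g) (stalk_mor f) = stalk_mor (cmp C A' A D g f)"
  using assms cmp_0 zero_object_Obj[OF zero] Hom_0
  by (auto simp: com_cmp_def stalk_mor_def stalk_def fun_eq_iff)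

text \<open>A single component \<open>f l\<close>, seen as a morphism from the whole complex to an
  object in degree 0. It is the composite of \<open>f\<close> with a crossing, on whichever side of
  \<open>f\<close> the crossing stands.\<close>

definition row :: "int \<Rightarrow> (int \<Rightarrow> 'm) \<Rightarrow> int \<Rightarrow> 'm" where
  "row l f = (\<lambda>i. if i = l then f l else 0)"

lemma bK_lmap_cross:
  assumes f: "f l \<in> Hom C (fst A l) D" and A: "A \<in> QObj KQ" and D: "D \<in> Obj C"
  shows "bK (st D) [lmap l f A, cross A l] = row l f"
proof -
  have Al: "fst A i \<in> Obj C" for i by (rule Obj_cplx[OF A])
  have z: "z \<in> Obj C" by (rule zero_object_Obj[OF zero])
  have "sword KQ A []" using A by simp
  then have s: "sword KQ (st D) [lmap l f A, cross A l]"
    using sword_lmap[OF f D sword_cross A] by blast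
  have "bK (st D) [lmap l f A, cross A l] = com_cmp C A (st (fst A l)) (st D) 0 (- l) (stalk_mor (f l))
      (\<lambda>i. if i = l then idn C (fst A l) else 0)"
    using bK_pair[OF s[unfolded cross_def]] by (simp add: cross_def)
  also have "\<dots> = row l f"
    using cmp_id(1)[OF Al D f] cmp_0[OF Al z z] Hom_0 z
    by (auto simp: fun_eq_iff com_cmp_def row_def stalk_def stalk_mor_def)
  finally show ?thesis .
qed

text \<open>The morphism of \<open>bK_lmap_cross\<close>, now with the sign of \<open>l\<close>. So
  exchanging the crossing with a letter costs exactly the sign that \<open>cross_words\<close> gives
  to that letter, and the minus sign there makes the two composites cancel.\<close>

lemma bK_cross_letter:
  assumes w: "sword KQ B [(d, f, A)]"
  shows "bK (st (fst B l)) [cross B l, (d, f, A)] = ksign l (row (l - (d + 1)) f)"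
proof -
  have A: "A \<in> QObj KQ" and B: "B \<in> QObj KQ" and f: "f \<in> QHom KQ A B (d + 1)" using w by auto
  have o: "fst A i \<in> Obj C" "fst B i \<in> Obj C" "z \<in> Obj C" for i
    using Obj_cplx A B zero_object_Obj[OF zero] by auto
  have f': "f i \<in> Hom C (fst A i) (fst B (i + (d + 1)))" for i using f by (simp add: QHom_KQ)
  have s: "sword KQ (st (fst B l)) [cross B l, (d, f, A)]" by (rule sword_cross[OF w])
  have "com_cmp C A B (st (fst B l)) (- l) (d + 1) (\<lambda>i. if i = l then idn C (fst B l) else 0) f i = row (l - (d + 1)) f i"
    for i
  proof (cases "i = l - (d + 1)")
    case True
    then show ?thesis using cmp_id(2)[OF o(1) o(2) f', of i] by (simp add: com_cmp_def row_def)
  next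
    case False
    then show ?thesis using cmp_0(1)[OF o(1) o(2) o(3) f', of i] by (simp add: com_cmp_def row_def stalk_def algebra_simps)
  qed
  then show ?thesis
    using bK_pair[OF s[unfolded cross_def]] by (simp add: cross_def fun_eq_iff ksign_uminus_exp ksign_apply)
qed

text \<open>The target has zero differential, so the boundary of the crossing is only its composite
  with the differential of \<open>B\<close>; again \<open>bK_lmap_cross\<close> gives the same
  morphism for the differential in front.\<close>

lemma bK_cross:
  assumes B: "B \<in> QObj KQ"
  shows "bK (st (fst B l)) [cross B l] = ksign l (row (l - 1) (snd B))"
proof
  fix i
  have o: "fst B i \<in> Obj C" "z \<in> Obj C" for i
    using Obj_cplx B zero_object_Obj[OF zero] by auto
  have d: "snd B i \<in> Hom C (fst B i) (fst B (i + 1))" for i using B by (simp add: QObj_KQ bb_complex_def)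
  have "sword KQ B []" using B by simp
  note s = sword_cross[OF this, of l]
  have c: "(if i = l then idn C (fst B l) else 0) \<in> Hom C (fst B i) (fst (st (fst B l)) (i - l))" for i
    using cross_QHom[OF B, of l] by (simp add: QHom_KQ)
  have so: "fst (st (fst B l)) j \<in> Obj C" for j using o by (simp add: stalk_def)
  have "bK (st (fst B l)) [cross B l] i = ksign (- l) (cmp C (fst B i) (fst B (i + 1)) (fst (st (fst B l)) (i + 1 - l))
      (if i + 1 = l then idn C (fst B l) else 0) (snd B i)) -
     cmp C (fst B i) (fst (st (fst B l)) (i - l)) (fst (st (fst B l)) (i + 1 - l)) 0 (if i = l then idn C (fst B l) else 0)"
    using bK_single[OF s[unfolded cross_def], of i] by (simp add: cross_def stalk_def algebra_simps)
  also have "\<dots> = ksign l (row (l - 1) (snd B)) i"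
  proof (cases "i = l - 1")
    case True
    then show ?thesis using cmp_id(2)[OF o(1) o(1) d[of i]] cmp_0(1)[OF o(1)[of "l - 1"] so[of "- 1"] o(1)[of l] Hom_0[OF o(1) so]]
      by (simp add: row_def ksign_apply ksign_uminus_exp)
  next
    case False
    then have "i + 1 \<noteq> l" by simp
    then show ?thesis using False cmp_0(1)[OF o(1) o(1) so d] cmp_0(1)[OF o(1) so so c, of i]
      by (simp add: row_def ksign_apply)
  qed
  finally show "bK (st (fst B l)) [cross B l] i = ksign l (row (l - 1) (snd B)) i" .
qed

lemma bK_stalk_single:
  assumes "f \<in> Hom C A D" "A \<in> Obj C" "D \<in> Obj C"
  shows "bK (st D) [(- 1, stalk_mor f, st A)] = 0"
proof
  fix i
  have z: "z \<in> Obj C" by (rule zero_object_Obj[OF zero])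
  have so: "fst (st X) j \<in> Obj C" if "X \<in> Obj C" for j X using that z by (simp add: stalk_def)
  have q: "stalk_mor f \<in> QHom KQ (st A) (st D) 0"
    using stalk_mor_QHom[of A D f 0] assms by (simp add: QHom_LQ)
  then have q': "stalk_mor f i \<in> Hom C (fst (st A) i) (fst (st D) i)" for i by (simp add: QHom_KQ)
  have s: "sword KQ (st D) [(- 1, stalk_mor f, st A)]" using q assms stalk_obj by simp
  have "snd (st X) j = 0" for X j by (simp add: stalk_def)
  then show "bK (st D) [(- 1, stalk_mor f, st A)] i = 0 i"
    using bK_single[OF s, of i] cmp_0(1)[OF so[OF assms(2)] so[OF assms(3)] so[OF assms(3)] q'[of i], of "i + 1"]
      cmp_0(2)[OF so[OF assms(2)] so[OF assms(2)] so[OF assms(3)] q'[of "i + 1"], of i] by simp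
qed

lemma bK_stalk_pair:
  assumes "f \<in> Hom C A' A" "g \<in> Hom C A D" "A' \<in> Obj C" "A \<in> Obj C" "D \<in> Obj C"
  shows "bK (st D) [(- 1, stalk_mor g, st A), (- 1, stalk_mor f, st A')] = stalk_mor (cmp C A' A D g f)"
proof -
  have "sword KQ (st D) [(- 1, stalk_mor g, st A), (- 1, stalk_mor f, st A')]"
    using assms stalk_mor_QHom[of A' A f 0] stalk_mor_QHom[of A D g 0] stalk_obj by (simp add: QHom_LQ)
  then show ?thesis using bK_pair stalk_mor_cmp[OF assms] by fastforce
qed

lemma row_QHom:
  assumes "f l \<in> Hom C (fst A l) D" "A \<in> QObj KQ" "D \<in> Obj C"
  shows "row l f \<in> QHom KQ A (st D) (- l)"
  using assms Obj_cplx[OF assms(2)] zero_object_Obj[OF zero] Hom_0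
  by (auto simp: QHom_KQ stalk_def row_def)

text \<open>The terms in which \<open>bK\<close> merges a component of \<open>g\<close> with the
  next letter. That letter is the crossing, which gives a row, or a component of the first letter of
  \<open>v\<close>, or a differential of \<open>X\<close>; the last two give composites in the
  linear category.\<close>

lemma lsum_cross_words_bK_lmap:
  fixes sco :: "'k \<Rightarrow> 'v::ab_group_add \<Rightarrow> 'v"
  assumes mo: "module sco" and F: "mlin csc sco KQ (st D) F" and D: "D \<in> Obj C"
    and g: "g m \<in> Hom C (fst X m) D" and v: "sword KQ X v"
  defines "H \<equiv> (\<lambda>U. case U of [] \<Rightarrow> 0 | (d', y, Y) # U' \<Rightarrow> F ((d', bK (st D) [lmap m g X, (d', y, Y)], Y) # U'))"
  shows "lsum (cross_words X v m) H =
     F ((- m - 1, row m g, X) # v) -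
     (case v of [] \<Rightarrow> 0 | (d, f, A) # v' \<Rightarrow> ksign m (lsum (cross_words A v' (m - (d + 1)))
        (\<lambda>U. F ((- 1, stalk_mor (cmp C (fst A (m - (d + 1))) (fst X m) D (g m) (f (m - (d + 1)))), st (fst A (m - (d + 1)))) # U)))) -
     ksign m (lsum (cross_words X v (m - 1))
        (\<lambda>U. F ((- 1, stalk_mor (cmp C (fst X (m - 1)) (fst X m) D (g m) (snd X (m - 1))), st (fst X (m - 1))) # U)))"
proof -
  have X: "X \<in> QObj KQ" using sword_obj[OF v] .
  have Xl: "fst X i \<in> Obj C" for i by (rule Obj_cplx[OF X])
  have F0: "F ((d, 0, Y) # t) = 0" if "sword KQ Y t" for d Y t
    by (rule K.mlin_head_0[OF mo F stalk_obj[OF D] that])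
  have "H U = 0" if z: "zero_object C (fst X m)" and U: "sword KQ (st (fst X m)) U" "U \<noteq> []" for U
  proof -
    obtain d' y Y U' where U': "U = (d', y, Y) # U'" using U(2) by (cases U) auto
    have Y: "sword KQ Y U'" "Y \<in> QObj KQ" and y: "y \<in> QHom KQ Y (st (fst X m)) (d' + 1)"
      using U(1) U' sword_obj[of KQ Y U'] by auto
    have y0: "y = 0" by (rule QHom_st_zero[OF z Y(2) y])
    have m': "mlin csc csc KQ (st (fst X m)) (\<lambda>t. bK (st D) (lmap m g X # t))"
      by (rule mlin_Cons[OF K.Cbr_mlin[OF bK_Cbr] stalk_obj[OF D]])
        (use stalk_mor_QHom[of "fst X m" D "g m" 0] g Xl D in \<open>simp add: QHom_LQ\<close>)
    have "bK (st D) [lmap m g X, (d', 0, Y)] = 0"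
      using K.mlin_head_0[OF module_com m' stalk_obj[OF Xl], of Y "[]" d'] Y by simp
    then show "H U = 0" using F0[OF Y(1)] by (simp add: H_def U' y0)
  qed
  note r = lsum_cross_words'[where F = H and l = m, OF v this]
  have c: "H (cross X m # v) = F ((- m - 1, row m g, X) # v)"
    using bK_lmap_cross[of g m X D, OF g X D] by (simp add: H_def cross_def)
  have d: "lsum (cross_words X v (m - 1)) (\<lambda>U. H (lmap (m - 1) (snd X) X # U)) = lsum (cross_words X v (m - 1))
      (\<lambda>U. F ((- 1, stalk_mor (cmp C (fst X (m - 1)) (fst X m) D (g m) (snd X (m - 1))), st (fst X (m - 1))) # U))"
    using bK_stalk_pair[OF delta_words_delta[OF X] g Xl Xl D] by (simp add: H_def)
  have e: "(case v of [] \<Rightarrow> 0 | (d, f, A) # v' \<Rightarrow>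
      ksign m (lsum (cross_words A v' (m - (d + 1))) (\<lambda>U. H (lmap (m - (d + 1)) f A # U)))) =
    (case v of [] \<Rightarrow> 0 | (d, f, A) # v' \<Rightarrow> ksign m (lsum (cross_words A v' (m - (d + 1)))
        (\<lambda>U. F ((- 1, stalk_mor (cmp C (fst A (m - (d + 1))) (fst X m) D (g m) (f (m - (d + 1)))), st (fst A (m - (d + 1)))) # U))))"
  proof (cases v)
    case (Cons a v')
    obtain d f A where a: "a = (d, f, A)" by (cases a) auto
    have A: "fst A i \<in> Obj C" for i using v Cons a sword_obj[of KQ A v'] by (intro Obj_cplx) simp
    show ?thesis
      using bK_stalk_pair[OF delta_words_letter[OF v[unfolded Cons a]] g A Xl D] by (simp add: H_def Cons a)
  qed simp
  show ?thesis using r unfolding c d e .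
qed

text \<open>Inserting the crossing anticommutes with \<open>b\<close>: this is the telescoping of the homotopy, in
  terms of words.\<close>

lemma cross_words_brace_words_bK:
  fixes sco :: "'k \<Rightarrow> 'v::ab_group_add \<Rightarrow> 'v"
  assumes mo: "module sco"
  shows "sword KQ B w \<Longrightarrow> mlin csc sco KQ (st (fst B l)) F \<Longrightarrow>
    lsum (cross_words B w l) (\<lambda>U. lsum (brace_words [(1, bK)] (s + l) (st (fst B l)) U) F) =
    - lsum (brace_words [(1, bK)] s B w) (\<lambda>w'. lsum (cross_words B w' l) F)"
proof (induction B w l arbitrary: F s rule: delta_words_induct[where C = C])
  case (step B w l)
  note w = step(3) and F = step(4)
  have B: "B \<in> QObj KQ" using sword_obj[OF w] .
  have Bl: "fst B i \<in> Obj C" for i by (rule Obj_cplx[OF B])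
  show ?case
  proof (cases "l < lower_bound C B")
    case True
    then show ?thesis by (simp add: cross_words_below)
  next
    case nb: False
    let ?D = "st (fst B l)"
    let ?\<beta> = "\<lambda>s D U F. lsum (brace_words [(1, bK)] s D U) F"
    let ?\<delta> = "lmap (l - 1) (snd B) B"
    have F0: "F ((d, 0, Y) # t) = 0" if "sword KQ Y t" for d Y t
      by (rule K.mlin_head_0[OF mo F stalk_obj[OF Bl] that])
    have Fk: "F ((d, ksign e x, Y) # t) = ksign e (F ((d, x, Y) # t))"
      if "x \<in> QHom KQ Y ?D (d + 1)" "sword KQ Y t" for d e x Y t
      by (rule K.mlin_head_ksign[OF mo F]) (use that stalk_obj[OF Bl] in simp)
    have m: "mlin csc sco KQ (st (fst A' l')) (\<lambda>U. F ((- 1, stalk_mor f, st (fst A' l')) # U))"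
      if "f \<in> Hom C (fst A' l') (fst B l)" "A' \<in> QObj KQ" for f A' l'
      by (rule mlin_Cons[OF F stalk_obj[OF Bl]])
        (use stalk_mor_QHom[of "fst A' l'" "fst B l" f 0] that Bl Obj_cplx in \<open>simp add: QHom_LQ\<close>)
    \<comment> \<open>In \<open>P0\<close>, \<open>XD\<close> and \<open>XA\<close>,
      \<open>bK\<close> acts behind a leading letter, which is the crossing, a differential or the
      first letter \<open>f\<close>. The other names tell what \<open>bK\<close> has merged: a
      differential or \<open>f\<close> with the crossing (\<open>Fde\<close>, \<open>Ffe\<close>),
      \<open>f\<close> with a differential on either side (\<open>Fdf\<close>, \<open>Ffd\<close>),
      and the first two letters of \<open>w\<close> (\<open>FG\<close>).\<close>
    define P0 where "P0 = ?\<beta> s B w (\<lambda>t. F (cross B l # t))"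
    define Fde where "Fde = F ((- l, row (l - 1) (snd B), B) # w)"
    define Ffe where "Ffe = (case w of [] \<Rightarrow> 0 | (d, f, A) # w' \<Rightarrow> F ((d - l, row (l - (d + 1)) f, A) # w'))"
    define XD where "XD = ?\<beta> s B w (\<lambda>w'. lsum (cross_words B w' (l - 1)) (\<lambda>U. F (?\<delta> # U)))"
    define XA where "XA = (case w of [] \<Rightarrow> 0 | (d, f, A) # w' \<Rightarrow>
      ?\<beta> (s + d) A w' (\<lambda>t. lsum (cross_words A t (l - (d + 1))) (\<lambda>U. F (lmap (l - (d + 1)) f A # U))))"
    define Fdf where "Fdf = (case w of [] \<Rightarrow> 0 | (d, f, A) # w' \<Rightarrow> lsum (cross_words A w' (l - (d + 1) - 1))
        (\<lambda>U. F ((- 1, stalk_mor (cmp C (fst A (l - (d + 1) - 1)) (fst B (l - 1)) (fst B l) (snd B (l - 1)) (f (l - (d + 1) - 1))),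
           st (fst A (l - (d + 1) - 1))) # U)))"
    define Ffd where "Ffd = (case w of [] \<Rightarrow> 0 | (d, f, A) # w' \<Rightarrow> ksign (d + 1) (lsum (cross_words A w' (l - (d + 1) - 1))
        (\<lambda>U. F ((- 1, stalk_mor (cmp C (fst A (l - (d + 1) - 1)) (fst A (l - (d + 1))) (fst B l) (f (l - (d + 1))) (snd A (l - (d + 1) - 1))),
           st (fst A (l - (d + 1) - 1))) # U))))"
    define FG where "FG = (case w of [] \<Rightarrow> 0 | (d, f, A) # w' \<Rightarrow> (case w' of [] \<Rightarrow> 0 | (d', g, A') # w'' \<Rightarrow>
       ksign (d + 1) (lsum (cross_words A' w'' (l - (d + 1) - (d' + 1)))
        (\<lambda>U. F ((- 1, stalk_mor (cmp C (fst A' (l - (d + 1) - (d' + 1))) (fst A (l - (d + 1))) (fst B l) (f (l - (d + 1))) (g (l - (d + 1) - (d' + 1)))),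
           st (fst A' (l - (d + 1) - (d' + 1)))) # U)))))"
    have E1: "?\<beta> (s + l) ?D (cross B l # w) F = - P0 + ksign s (Fde + Ffe)"
    proof -
      have "?\<beta> (s + l) ?D (cross B l # w) F = ?\<beta> (s - 1) B w (\<lambda>t. F (cross B l # t)) +
        ksign (s + l) (F ((- l, bK ?D [cross B l], B) # w) + (case w of [] \<Rightarrow> 0 | (d', y, A') # w' \<Rightarrow>
          F ((d' - l, bK ?D [cross B l, (d', y, A')], A') # w')))"
        using K.lsum_brace_words_arity12_Cons_mlin[OF mo F arity12_bK sword_cross[OF w, unfolded cross_def], of 1 "s + l"]
        by (simp add: cross_def add.commute cong: list.case_cong)
      also have "F ((- l, bK ?D [cross B l], B) # w) = ksign l Fde"
        unfolding bK_cross[OF B] Fde_def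
        by (rule Fk[OF _ w]) (use row_QHom[of "snd B" "l - 1" B "fst B l"] delta_words_delta[OF B] B Bl in simp)
      also have "(case w of [] \<Rightarrow> 0 | (d', y, A') # w' \<Rightarrow>
          F ((d' - l, bK ?D [cross B l, (d', y, A')], A') # w')) = ksign l Ffe"
      proof (cases w)
        case (Cons a w')
        obtain d f A where a: "a = (d, f, A)" by (cases a) auto
        have A: "sword KQ A w'" "A \<in> QObj KQ" "sword KQ B [(d, f, A)]"
          using w Cons a sword_obj[of KQ A w'] by auto
        have "F ((d - l, ksign l (row (l - (d + 1)) f), A) # w') = ksign l (F ((d - l, row (l - (d + 1)) f, A) # w'))"
          by (rule Fk[OF _ A(1)])
            (use row_QHom[of f "l - (d + 1)" A "fst B l", OF delta_words_letter[OF A(3)] A(2) Bl] in \<open>simp add: algebra_simps\<close>)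
        then show ?thesis by (simp add: Cons a Ffe_def bK_cross_letter[OF A(3)])
      qed (simp add: Ffe_def)
      also have "?\<beta> (s - 1) B w (\<lambda>t. F (cross B l # t)) = - P0"
        using lsum_brace_words_shift[of "[(1, bK)]" s "- 1" B w "\<lambda>t. F (cross B l # t)"]
        by (simp add: P0_def ksign_def)
      finally show ?thesis by (simp add: ksign_def)
    qed
    have lm: "?\<beta> (s + l) ?D (lmap l' g X # U) F = ?\<beta> (s + l - 1) (st (fst X l')) U (\<lambda>t. F (lmap l' g X # t)) +
       ksign (s + l) (case U of [] \<Rightarrow> 0 | (d', y, Y) # U' \<Rightarrow> F ((d', bK ?D [lmap l' g X, (d', y, Y)], Y) # U'))"
      if "g l' \<in> Hom C (fst X l') (fst B l)" "X \<in> QObj KQ" "sword KQ (st (fst X l')) U" for l' g X U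
    proof -
      have "F ((0, bK ?D [lmap l' g X], st (fst X l')) # U) = 0"
        unfolding bK_stalk_single[OF that(1) Obj_cplx[OF that(2)] Bl] by (rule F0[OF that(3)])
      then show ?thesis
        using K.lsum_brace_words_arity12_Cons_mlin[OF mo F arity12_bK sword_lmap[OF that(1) Bl that(3,2)], of 1 "s + l"]
        by (simp cong: list.case_cong)
    qed
    have lmX: "lsum (cross_words X v l') (\<lambda>U. ?\<beta> (s + l) ?D (lmap l' g X # U) F) =
       lsum (cross_words X v l') (\<lambda>U. ?\<beta> (s + l - 1) (st (fst X l')) U (\<lambda>t. F (lmap l' g X # t))) +
       ksign (s + l) (lsum (cross_words X v l') (\<lambda>U. case U of [] \<Rightarrow> 0 | (d', y, Y) # U' \<Rightarrow>
         F ((d', bK ?D [lmap l' g X, (d', y, Y)], Y) # U')))"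
      if g: "g l' \<in> Hom C (fst X l') (fst B l)" and X: "X \<in> QObj KQ" and v: "sword KQ X v" for l' g X v
      unfolding lsum_ksign[symmetric] lsum_add[symmetric]
      using lm[of g l' X, OF g X] cross_words_valid[OF _ v] by (intro lsum_cong) blast
    have E2: "lsum (cross_words B w (l - 1)) (\<lambda>U. ?\<beta> (s + l) ?D (?\<delta> # U) F) =
       - XD + ksign (s + l) (Fde - ksign (l - 1) Fdf)"
    proof -
      have IH: "lsum (cross_words B w (l - 1)) (\<lambda>U. ?\<beta> (s + l - 1) (st (fst B (l - 1))) U (\<lambda>t. F (?\<delta> # t))) = - XD"
        using step(2)[OF nb w m[OF delta_words_delta[OF B] B], of s] by (simp add: XD_def add_diff_eq)
      \<comment> \<open>Two adjacent differentials merge to zero, so this composite, for which the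
        right side has no counterpart, disappears.\<close>
      have dd: "cmp C (fst B (l - 1 - 1)) (fst B (l - 1)) (fst B l) (snd B (l - 1)) (snd B (l - 1 - 1)) = 0"
      proof -
        have "cmp C (fst B j) (fst B (j + 1)) (fst B (j + 2)) (snd B (j + 1)) (snd B j) = 0" for j
          using B by (simp add: QObj_KQ bb_complex_def)
        from this[of "l - 1 - 1"] show ?thesis by (simp add: algebra_simps)
      qed
      have dz: "lsum (cross_words B w (l - 1 - 1)) (\<lambda>U. F ((- 1, 0, st (fst B (l - 1 - 1))) # U)) = 0"
        using cross_words_valid[OF _ w] F0 by (intro lsum_eq_0) blast
      have i: "l - 1 - (d + 1) = l - (d + 1) - 1" for d :: int by simp
      show ?thesis
        unfolding lmX[of "snd B" "l - 1" B w, OF delta_words_delta[OF B] B w] IH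
          lsum_cross_words_bK_lmap[where g = "snd B" and m = "l - 1" and X = B, OF mo F Bl delta_words_delta[OF B] w] dd
        unfolding stalk_mor_0 dz i
        by (auto simp: Fde_def Fdf_def split: list.splits)
    qed
    have E3: "(case w of [] \<Rightarrow> 0 | (d, f, A) # w' \<Rightarrow>
        ksign l (lsum (cross_words A w' (l - (d + 1))) (\<lambda>U. ?\<beta> (s + l) ?D (lmap (l - (d + 1)) f A # U) F))) =
      - ksign l XA + ksign s (Ffe - ksign l (FG + Ffd))"
    proof (cases w)
      case Nil
      then show ?thesis by (simp add: XA_def Ffe_def FG_def Ffd_def)
    next
      case (Cons a w')
      obtain d f A where a: "a = (d, f, A)" by (cases a) auto
      let ?l = "l - (d + 1)"
      have A: "sword KQ A w'" "A \<in> QObj KQ" using w Cons a sword_obj[of KQ A w'] by auto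
      have f: "f ?l \<in> Hom C (fst A ?l) (fst B l)" by (rule delta_words_letter[OF w[unfolded Cons a]])
      have IH: "lsum (cross_words A w' ?l) (\<lambda>U. ?\<beta> (s + l - 1) (st (fst A ?l)) U (\<lambda>t. F (lmap ?l f A # t))) = - XA"
      proof -
        have "s + d + ?l = s + l - 1" by simp
        then show ?thesis
          using step(1)[OF nb Cons[unfolded a] A(1) m[OF f A(2)], of "s + d"] by (simp add: XA_def Cons a add_diff_eq)
      qed
      have k: "ksign ?l x = ksign l (ksign (d + 1) x)" for x :: 'v
        unfolding ksign_ksign by (rule ksign_cong) simp
      have "lsum (cross_words A w' ?l) (\<lambda>U. ?\<beta> (s + l) ?D (lmap ?l f A # U) F) =
        - XA + ksign (s + l) (Ffe - ksign l FG - ksign l Ffd)"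
        unfolding lmX[of f ?l A w', OF f A(2,1)] IH lsum_cross_words_bK_lmap[where g = f and m = ?l and X = A, OF mo F Bl f A(1)]
        unfolding k by (auto simp: Ffe_def FG_def Ffd_def Cons a algebra_simps split: list.splits)
      then show ?thesis by (simp add: Cons a) (simp add: ksign_def)
    qed
    have L: "lsum (cross_words B w l) (\<lambda>U. ?\<beta> (s + l) ?D U F) =
      - P0 + ksign s (Fde + Ffe) - (- ksign l XA + ksign s (Ffe - ksign l (FG + Ffd))) -
      ksign l (- XD + ksign (s + l) (Fde - ksign (l - 1) Fdf))"
      unfolding lsum_cross_words[OF nb, of w "\<lambda>U. ?\<beta> (s + l) ?D U F"] E1 E2 E3 ..
    define J where "J = (\<lambda>w. case w of [] \<Rightarrow> 0 | (d, f, A) # w' \<Rightarrow>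
      ksign l (lsum (cross_words A w' (l - (d + 1))) (\<lambda>U. F (lmap (l - (d + 1)) f A # U))))"
    have R: "?\<beta> s B w (\<lambda>w'. lsum (cross_words B w' l) F) = P0 - ?\<beta> s B w J - ksign l XD"
      unfolding lsum_cross_words[OF nb] by (simp add: lsum_diff lsum_ksign P0_def XD_def J_def)
    have J0: "J ((d, 0, A) # t) = 0" if t: "sword KQ A t" for d A t
    proof -
      have "lsum (cross_words A t (l - (d + 1))) (\<lambda>U. F ((- 1, 0, st (fst A (l - (d + 1)))) # U)) = 0"
        using cross_words_valid[OF _ t] F0 by (intro lsum_eq_0) blast
      then show ?thesis by (simp add: J_def)
    qed
    \<comment> \<open>On the right, \<open>bK\<close> acts on complexes before components are taken:
      the component of the boundary of \<open>f\<close> gives \<open>Ffd\<close> and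
      \<open>Fdf\<close>, the component of its composite with the next letter gives
      \<open>FG\<close>.\<close>
    have RJ: "?\<beta> s B w J = ksign l XA + ksign s (ksign l (Ffd - Fdf + FG))"
    proof (cases w)
      case Nil
      then show ?thesis
        using K.lsum_brace_words_arity12_Nil[of J, OF J0 arity12_bK B] by (simp add: XA_def Ffd_def Fdf_def FG_def)
    next
      case (Cons a w')
      obtain d f A where a: "a = (d, f, A)" by (cases a) auto
      let ?l = "l - (d + 1)"
      have w1: "sword KQ B ((d, f, A) # w')" using w Cons a by simp
      have A: "sword KQ A w'" "A \<in> QObj KQ" using w1 sword_obj[of KQ A w'] by auto
      have Al: "fst A i \<in> Obj C" for i by (rule Obj_cplx[OF A(2)])
      have f: "f (i - (d + 1)) \<in> Hom C (fst A (i - (d + 1))) (fst B i)" for i by (rule delta_words_letter[OF w1])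
      have pass: "?\<beta> (s + d) A w' (\<lambda>t. J ((d, f, A) # t)) = ksign l XA"
        by (simp add: J_def XA_def Cons a lsum_ksign)
      have s1: "J ((1 + d, bK B [(d, f, A)], A) # w') = ksign l (Ffd - Fdf)"
      proof -
        let ?i = "?l - 1"
        let ?p = "cmp C (fst A ?i) (fst A ?l) (fst B l) (f ?l) (snd A ?i)"
        let ?q = "cmp C (fst A ?i) (fst B (l - 1)) (fst B l) (snd B (l - 1)) (f ?i)"
        have "sword KQ B [(d, f, A)]" using w1 A by simp
        from bK_single[OF this, of ?i]
        have b: "bK B [(d, f, A)] ?i = sc (if even (d + 1) then 1 else - 1) ?p + sc (- 1) ?q"
          by (simp add: ksign_def algebra_simps)
        have pq: "?p \<in> Hom C (fst A ?i) (fst B l)" "?q \<in> Hom C (fst A ?i) (fst B l)"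
          using cmp_Hom[OF Al Al Bl delta_words_delta[OF A(2)] f[of l]]
            cmp_Hom[OF Al Bl Bl _ delta_words_delta[OF B], of "f ?i" ?i] f[of "l - 1"] by (simp_all add: algebra_simps)
        interpret o: module sco by fact
        have "F ((- 1, stalk_mor (bK B [(d, f, A)] ?i), st (fst A ?i)) # U) =
           ksign (d + 1) (F ((- 1, stalk_mor ?p, st (fst A ?i)) # U)) - F ((- 1, stalk_mor ?q, st (fst A ?i)) # U)"
          if "sword KQ (st (fst A ?i)) U" for U
          unfolding b stalk_mor_lin mlin_head[OF F sword_lmap[OF pq(1) Bl that A(2)] sword_lmap[OF pq(2) Bl that A(2)]]
          by (simp add: ksign_def)
        then have "lsum (cross_words A w' ?i) (\<lambda>U. F ((- 1, stalk_mor (bK B [(d, f, A)] ?i), st (fst A ?i)) # U)) = Ffd - Fdf"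
          unfolding Ffd_def Fdf_def Cons a list.case prod.case lsum_ksign[symmetric] lsum_diff[symmetric]
          using cross_words_valid[OF _ A(1)] by (intro lsum_cong) blast
        moreover have "l - (1 + d + 1) = ?i" by simp
        ultimately show ?thesis unfolding J_def list.case prod.case by (simp only:)
      qed
      have s2: "(case w' of [] \<Rightarrow> 0 | (d', y, A') # w'' \<Rightarrow> J ((1 + (d + d'), bK B [(d, f, A), (d', y, A')], A') # w'')) = ksign l FG"
      proof (cases w')
        case Nil
        then show ?thesis by (simp add: FG_def Cons a)
      next
        case w': (Cons a' w'')
        obtain d' g A' where a': "a' = (d', g, A')" by (cases a') auto
        let ?i = "?l - (d' + 1)"
        let ?p = "cmp C (fst A' ?i) (fst A ?l) (fst B l) (f ?l) (g ?i)"
        have A': "sword KQ A' w''" "A' \<in> QObj KQ" using A(1) w' a' sword_obj[of KQ A' w''] by auto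
        have sw: "sword KQ B [(d, f, A), (d', g, A')]" using w1 A' w' a' by simp
        have g: "g ?i \<in> Hom C (fst A' ?i) (fst A ?l)"
          by (rule delta_words_letter[of A d' g A' w'']) (use A w' a' in simp)
        have p: "?p \<in> Hom C (fst A' ?i) (fst B l)" by (rule cmp_Hom[OF Obj_cplx[OF A'(2)] Al Bl g f])
        have b: "bK B [(d, f, A), (d', g, A')] ?i = sc (if even (d + 1) then 1 else - 1) ?p + sc 0 ?p"
        proof -
          have i: "?i + (d' + 1) = ?l" "?l + (d + 1) = l" by simp_all
          show ?thesis
            unfolding bK_pair[OF sw] ksign_apply com_cmp_def i by (simp add: ksign_def)
        qed
        interpret o: module sco by fact
        have "F ((- 1, stalk_mor (bK B [(d, f, A), (d', g, A')] ?i), st (fst A' ?i)) # U) =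
           ksign (d + 1) (F ((- 1, stalk_mor ?p, st (fst A' ?i)) # U))"
          if "sword KQ (st (fst A' ?i)) U" for U
          unfolding b stalk_mor_lin mlin_head[OF F sword_lmap[OF p Bl that A'(2)] sword_lmap[OF p Bl that A'(2)]]
          by (simp add: ksign_def)
        then have "lsum (cross_words A' w'' ?i) (\<lambda>U. F ((- 1, stalk_mor (bK B [(d, f, A), (d', g, A')] ?i), st (fst A' ?i)) # U)) = FG"
          unfolding FG_def Cons a w' a' list.case prod.case lsum_ksign[symmetric]
          using cross_words_valid[OF _ A'(1)] by (intro lsum_cong) blast
        moreover have "l - (1 + (d + d') + 1) = ?i" by simp
        ultimately show ?thesis unfolding J_def w' a' list.case prod.case by (simp only:)
      qed
      have "?\<beta> s B ((d, f, A) # w') J = ?\<beta> (s + d) A w' (\<lambda>t. J ((d, f, A) # t)) +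
        ksign (1 * s) (J ((1 + d, bK B [(d, f, A)], A) # w') +
         (case w' of [] \<Rightarrow> 0 | (d', y, A') # w'' \<Rightarrow> J ((1 + (d + d'), bK B [(d, f, A), (d', y, A')], A') # w'')))"
        by (rule K.lsum_brace_words_arity12_Cons[OF _ arity12_bK w1]) (rule J0)
      then show ?thesis
        unfolding pass s1 s2 unfolding Cons a by (simp add: ksign_def)
    qed
    \<comment> \<open>Now \<open>Fde\<close> and \<open>Ffe\<close> occur twice on the left, with
      the crossing merged from either side and with opposite signs; this is the cancellation between
      neighbouring places of the crossing.\<close>
    show ?thesis unfolding L R RJ by (auto simp: ksign_def algebra_simps)
  qed
qed

end

section \<open>Braces of the dg structure with a cochain, and the chain homotopy\<close>

lemma brace_words_not_Nil: "(e, t) \<in> set (brace_words ((p, \<psi>) # Y) s B w) \<Longrightarrow> t \<noteq> []"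
  by (subst (asm) brace_words.simps(2)) (auto simp: set_pre set_lbind split: list.splits)

lemma lsum_splittings_last0:
  assumes "\<And>u v. v \<noteq> [] \<Longrightarrow> H u v = 0"
  shows "lsum (splittings w) (\<lambda>(u, v). H u v) = H w []"
  using assms by (induction w arbitrary: H) auto

lemma lsum_splittings_last1:
  assumes "\<And>u v. 2 \<le> length v \<Longrightarrow> H u v = 0"
  shows "lsum (splittings w) (\<lambda>(u, v). H u v) = H w [] + (if w = [] then 0 else H (butlast w) [last w])"
proof (cases w rule: rev_cases)
  case (snoc w0 g)
  have "lsum (splittings w0) (\<lambda>(u, v). H u (v @ [g])) = H w0 ([] @ [g])"
    by (rule lsum_splittings_last0[where H = "\<lambda>u v. H u (v @ [g])"]) (use assms in \<open>simp add: Suc_le_eq\<close>)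
  then show ?thesis by (simp add: snoc lsum_splittings_snoc)
qed simp

context gquiver
begin

text \<open>One of the at most two letters read by \<open>b\<close> is the value of \<phi>. So
  \<phi> takes the whole word, or leaves out exactly the first or exactly the last letter.\<close>

lemma brace_arity12:
  assumes b: "arity12 b" and w: "sword Q B w"
  shows "brace Q b [(p, \<phi>)] B w = b B [(p + wdeg w, \<phi> B w, src B w)] +
    (case w of [] \<Rightarrow> 0 | (d, x, A) # w' \<Rightarrow> ksign (p * d) (b B [(d, x, A), (p + wdeg w', \<phi> A w', src A w')])) +
    (if w = [] then 0 else b B [(p + wdeg (butlast w), \<phi> B (butlast w), src B (butlast w)), last w])"
proof -
  have b3: "b B t = 0" if "3 \<le> length t" for t
    using b that by (simp add: arity12_def)
  have "consume p \<phi> [] 0 B w (b B) = b B [(p + wdeg w, \<phi> B w, src B w)] +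
    (if w = [] then 0 else b B [(p + wdeg (butlast w), \<phi> B (butlast w), src B (butlast w)), last w])"
    unfolding consume_def
    using lsum_splittings_last1[of "\<lambda>u v. b B ((p + wdeg u, \<phi> B u, src B u) # v)" w] b3 by simp
  moreover have "lsum (brace_words [(p, \<phi>)] d A w') (\<lambda>t. b B ((d, x, A) # t)) =
     ksign (p * d) (b B [(d, x, A), (p + wdeg w', \<phi> A w', src A w')])" for d x A w'
  proof -
    have "(case w' of [] \<Rightarrow> 0 | (d', y, A') # w'' \<Rightarrow>
        lsum (brace_words [(p, \<phi>)] (d + d') A' w'') (\<lambda>t. b B ((d, x, A) # (d', y, A') # t))) = 0"
    proof (cases w')
      case (Cons a w'')
      obtain d' y A' where a: "a = (d', y, A')" by (cases a) auto
      have "lsum (brace_words [(p, \<phi>)] (d + d') A' w'') (\<lambda>t. b B ((d, x, A) # (d', y, A') # t)) = 0"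
      proof (rule lsum_eq_0)
        fix e t assume "(e, t) \<in> set (brace_words [(p, \<phi>)] (d + d') A' w'')"
        then have "t \<noteq> []" by (rule brace_words_not_Nil)
        then show "b B ((d, x, A) # (d', y, A') # t) = 0" by (intro b3) (simp add: Suc_le_eq)
      qed
      then show ?thesis by (simp add: Cons a)
    qed simp
    moreover have "consume p \<phi> [] d A w' (\<lambda>t. b B ((d, x, A) # t)) =
      ksign (p * d) (b B [(d, x, A), (p + wdeg w', \<phi> A w', src A w')])"
      unfolding consume_def
      using lsum_splittings_last0[of "\<lambda>u v. b B ((d, x, A) # (p + wdeg u, \<phi> A u, src A u) # v)" w'] b3
      by (simp add: Suc_le_eq)
    ultimately show ?thesis by (simp add: lsum_brace_words_ne[of p \<phi> "[]" d A w'])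
  qed
  ultimately show ?thesis
    using w by (simp add: brace_eq lsum_brace_words_ne[of p \<phi> "[]" 0 B w] cong: list.case_cong)
qed

end

context lin_cat
begin

text \<open>The result has degree \<open>p - 1\<close>, and both \<open>l\<close> and the sign
  follow the convention of \<open>emb\<close> for that degree. Words with a crossing end in degree 0
  of a stalk, so the component \<open>i\<close> of the value of \<phi> is a morphism into the object
  \<open>fst B l\<close>.\<close>

definition homotopy :: "int \<Rightarrow> (('o, 'm) cplx, int \<Rightarrow> 'm) cochain \<Rightarrow> (('o, 'm) cplx, int \<Rightarrow> 'm) cochain" where
  "homotopy p \<phi> B w = (if sword KQ B w
     then (\<lambda>i. let l = i + wdeg w + p in ksign (p * l) (lsum (cross_words B w l) (\<lambda>U. \<phi> (st (fst B l)) U i)))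
     else 0)"

lemma homotopy_eq:
  "sword KQ B w \<Longrightarrow> l = i + wdeg w + p \<Longrightarrow>
   homotopy p \<phi> B w i = ksign (p * l) (lsum (cross_words B w l) (\<lambda>U. \<phi> (st (fst B l)) U i))"
  by (simp add: homotopy_def Let_def)

lemma cross_words_Hom:
  assumes \<phi>: "\<phi> \<in> Cbr csc KQ p" and w: "sword KQ B w" and l: "l = i + wdeg w + p"
    and U: "(e, U) \<in> set (cross_words B w l)"
  shows "\<phi> (st (fst B l)) U i \<in> Hom C (fst (src B w) i) (fst B l)"
proof -
  have "wdeg U + p + 1 = - i" using cross_words_valid[OF U w] l by simp
  then have "\<phi> (st (fst B l)) U \<in> QHom KQ (src B w) (st (fst B l)) (- i)"
    using K.Cbr_val[OF \<phi>, of "st (fst B l)" U] cross_words_valid[OF U w] by simp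
  then have "\<phi> (st (fst B l)) U i \<in> Hom C (fst (src B w) i) (fst (st (fst B l)) (i + - i))"
    unfolding QHom_KQ by blast
  then show ?thesis by simp
qed

lemma lsum_Hom:
  assumes "X \<in> Obj C" "Y \<in> Obj C" "\<And>e t. (e, t) \<in> set L \<Longrightarrow> h t \<in> Hom C X Y"
  shows "lsum L h \<in> Hom C X Y"
proof -
  have "lsum L h \<in> Hom C X Y \<and> id (lsum L h) = lsum L (\<lambda>t. id (h t))"
    by (rule lsum_additive_on)
      (use assms Hom_sub[OF assms(1,2)] bm.subspace_add bm.subspace_neg Hom_0 in auto)
  then show ?thesis by blast
qed

lemma cmp_add:
  assumes "X \<in> Obj C" "Y \<in> Obj C" "Z \<in> Obj C"
  shows "f \<in> Hom C X Y \<Longrightarrow> g \<in> Hom C Y Z \<Longrightarrow> g' \<in> Hom C Y Z \<Longrightarrow>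
      cmp C X Y Z (g + g') f = cmp C X Y Z g f + cmp C X Y Z g' f"
    and "f \<in> Hom C X Y \<Longrightarrow> f' \<in> Hom C X Y \<Longrightarrow> g \<in> Hom C Y Z \<Longrightarrow>
      cmp C X Y Z g (f + f') = cmp C X Y Z g f + cmp C X Y Z g f'"
  using cmp_lin(1)[OF assms, of f f' g g 1 1] cmp_lin(2)[OF assms, of f f g g' 1 1] by auto

lemma lsum_cmp_left:
  assumes "X \<in> Obj C" "Y \<in> Obj C" "Z \<in> Obj C" "f \<in> Hom C X Y"
    and "\<And>e t. (e, t) \<in> set L \<Longrightarrow> h t \<in> Hom C Y Z"
  shows "lsum L (\<lambda>t. cmp C X Y Z (h t) f) = cmp C X Y Z (lsum L h) f"
proof -
  have "lsum L h \<in> Hom C Y Z \<and> cmp C X Y Z (lsum L h) f = lsum L (\<lambda>t. cmp C X Y Z (h t) f)"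
    by (rule lsum_additive_on[where g = "\<lambda>x. cmp C X Y Z x f"])
      (use assms Hom_sub[OF assms(2,3)] bm.subspace_add bm.subspace_neg Hom_0 cmp_add(1)[OF assms(1-4)] in auto)
  then show ?thesis by simp
qed

lemma lsum_cmp_right:
  assumes "X \<in> Obj C" "Y \<in> Obj C" "Z \<in> Obj C" "g \<in> Hom C Y Z"
    and "\<And>e t. (e, t) \<in> set L \<Longrightarrow> h t \<in> Hom C X Y"
  shows "lsum L (\<lambda>t. cmp C X Y Z g (h t)) = cmp C X Y Z g (lsum L h)"
proof -
  have "lsum L h \<in> Hom C X Y \<and> cmp C X Y Z g (lsum L h) = lsum L (\<lambda>t. cmp C X Y Z g (h t))"
    by (rule lsum_additive_on[where g = "\<lambda>x. cmp C X Y Z g x"])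
      (use assms Hom_sub[OF assms(1,2)] bm.subspace_add bm.subspace_neg Hom_0 cmp_add(2)[OF assms(1-3)] in auto)
  then show ?thesis by simp
qed

lemma mlin_component:
  assumes "mlin csc csc KQ D F"
  shows "mlin csc sc KQ D (\<lambda>U. F U i)"
  using assms by (simp add: mlin_def com_scale_def)

lemma homotopy_Cbr:
  assumes \<phi>: "\<phi> \<in> Cbr csc KQ p"
  shows "homotopy p \<phi> \<in> Cbr csc KQ (p - 1)"
proof (rule K.CbrI)
  fix B w assume w: "sword KQ B w"
  have o: "fst (src B w) i \<in> Obj C" "fst B l \<in> Obj C" for i l
    using sword_obj[OF w] sword_src[OF w] by (auto simp: Obj_cplx)
  have k: "ksign e x \<in> Hom C X Y" if "x \<in> Hom C X Y" "X \<in> Obj C" "Y \<in> Obj C" for e x X Y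
    using that Hom_sub bm.subspace_neg by (simp add: ksign_def)
  show "homotopy p \<phi> B w \<in> QHom KQ (src B w) B (wdeg w + (p - 1) + 1)"
    unfolding QHom_KQ
  proof
    fix i
    have "homotopy p \<phi> B w i \<in> Hom C (fst (src B w) i) (fst B (i + wdeg w + p))"
      unfolding homotopy_eq[OF w refl]
      by (intro k o lsum_Hom) (rule cross_words_Hom[OF \<phi> w refl])
    then show "homotopy p \<phi> B w i \<in> Hom C (fst (src B w) i) (fst B (i + (wdeg w + (p - 1) + 1)))"
      by (simp add: algebra_simps)
  qed
next
  fix B
  show "mlin csc csc KQ B (homotopy p \<phi> B)"
    unfolding mlin_def
  proof (intro allI impI ext)
    fix u d x y A v a c i
    assume s: "sword KQ B (u @ (d, x, A) # v)" "sword KQ B (u @ (d, y, A) # v)"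
    let ?l = "i + (wdeg u + (d + wdeg v)) + p"
    have k: "ksign e (sc a x) = sc a (ksign e x)" for e a x by (simp add: ksign_def)
    show "homotopy p \<phi> B (u @ (d, csc a x + csc c y, A) # v) i =
      (csc a (homotopy p \<phi> B (u @ (d, x, A) # v)) + csc c (homotopy p \<phi> B (u @ (d, y, A) # v))) i"
      using mlin_lsum_cross_words[OF module_base s refl mlin_component[OF K.Cbr_mlin[OF \<phi>]], of a c ?l i] s K.sword_lin[OF s, of a c]
      by (simp add: homotopy_def Let_def com_scale_def ksign_add k)
  qed
qed (simp add: homotopy_def)

lemma homotopy_diff: "homotopy p (\<phi> - \<psi>) = homotopy p \<phi> - homotopy p \<psi>"
  by (auto simp: fun_eq_iff homotopy_def Let_def lsum_diff ksign_diff)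

lemma homotopy_ksign: "homotopy p (ksign e \<phi>) = ksign e (homotopy p \<phi>)"
proof -
  have "homotopy p 0 = 0" by (auto simp: fun_eq_iff homotopy_def Let_def)
  then show ?thesis using homotopy_diff[of p 0 \<phi>] by (simp add: ksign_def)
qed

text \<open>Here the dg structure acts on the arguments of \<phi>, so the claim is about words
  alone: it is \<open>cross_words_brace_words_bK\<close>, applied to a component of \<phi>.\<close>

lemma homotopy_brace_right:
  assumes \<phi>: "\<phi> \<in> Cbr csc KQ p"
  shows "homotopy (p + 1) (brace KQ \<phi> [(1, bK)]) = - brace KQ (homotopy p \<phi>) [(1, bK)]"
proof (intro ext)
  fix B w i
  show "homotopy (p + 1) (brace KQ \<phi> [(1, bK)]) B w i = (- brace KQ (homotopy p \<phi>) [(1, bK)]) B w i"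
  proof (cases "sword KQ B w")
    case False
    then show ?thesis by (simp add: homotopy_def brace_eq)
  next
    case w: True
    define l where "l = i + wdeg w + p + 1"
    let ?F = "\<lambda>U. \<phi> (st (fst B l)) U i"
    have bg: "gword (Cbr csc KQ) [(1, bK)]" using bK_Cbr by simp
    have "homotopy (p + 1) (brace KQ \<phi> [(1, bK)]) B w i = ksign ((p + 1) * l)
       (lsum (cross_words B w l) (\<lambda>U. brace KQ \<phi> [(1, bK)] (st (fst B l)) U i))"
      by (rule homotopy_eq[OF w]) (simp add: l_def)
    also have "lsum (cross_words B w l) (\<lambda>U. brace KQ \<phi> [(1, bK)] (st (fst B l)) U i) =
       lsum (cross_words B w l) (\<lambda>U. ksign l (lsum (brace_words [(1, bK)] (0 + l) (st (fst B l)) U) ?F))"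
    proof (rule lsum_cong)
      fix e U assume "(e, U) \<in> set (cross_words B w l)"
      then have "sword KQ (st (fst B l)) U" using cross_words_valid[OF _ w] by blast
      then show "brace KQ \<phi> [(1, bK)] (st (fst B l)) U i = ksign l (lsum (brace_words [(1, bK)] (0 + l) (st (fst B l)) U) ?F)"
        unfolding lsum_brace_words_shift by (simp add: brace_eq lsum_apply ksign_ksign) (simp add: ksign_def)
    qed
    also have "\<dots> = ksign l (- lsum (brace_words [(1, bK)] 0 B w) (\<lambda>w'. lsum (cross_words B w' l) ?F))"
      unfolding lsum_ksign 
        cross_words_brace_words_bK[where F = ?F and s = 0 and l = l, OF module_base w mlin_component[OF K.Cbr_mlin[OF \<phi>]]] ..
    also have "ksign ((p + 1) * l) \<dots> = - lsum (brace_words [(1, bK)] 0 B w) (\<lambda>w'. ksign (p * l) (lsum (cross_words B w' l) ?F))"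
      unfolding lsum_ksign ksign_ksign ksign_minus[symmetric]
      by (rule ksign_cong) (simp add: algebra_simps)
    also have "\<dots> = - lsum (brace_words [(1, bK)] 0 B w) (\<lambda>w'. homotopy p \<phi> B w' i)"
    proof (rule arg_cong[where f = uminus], rule lsum_cong)
      fix e w' assume w': "(e, w') \<in> set (brace_words [(1, bK)] 0 B w)"
      show "ksign (p * l) (lsum (cross_words B w' l) ?F) = homotopy p \<phi> B w' i"
        by (rule homotopy_eq[symmetric]) (use K.brace_words_valid[OF w' w bg] in \<open>auto simp: l_def\<close>)
    qed
    also have "\<dots> = (- brace KQ (homotopy p \<phi>) [(1, bK)]) B w i"
      using w by (simp add: brace_eq lsum_apply)
    finally show ?thesis .
  qed
qed

text \<open>Splits off the terms with the crossing at the right end. In all others the last letter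
  of \<open>w\<close> is untouched and stays last.\<close>

lemma lsum_cross_words_last:
  "lsum (cross_words B w l) F =
     (if w = [] then 0 else lsum (cross_words B (butlast w) l) (\<lambda>U. F (U @ [last w]))) +
     lsum (delta_words C B w l) (\<lambda>t. ksign (int (length t)) (F (stw t @ [cross (src B w) (l - wdeg w + wdeg t)])))"
  by (cases w rule: rev_cases) (simp_all add: lsum_cross_words_eq lsum_splittings_snoc del: wdeg_append src_append)

text \<open>Here the dg structure acts on the value of \<phi>. When the letter left out by \<phi> is
  the crossing itself, one gets \<phi> (crossing at the left end) or the extension of its projection
  (at the right end); all other terms reassemble to the brace of the dg structure with the
  homotopy.\<close>

lemma homotopy_brace_left:
  assumes \<phi>: "\<phi> \<in> Cbr csc KQ p"
  shows "homotopy (p + 1) (brace KQ bK [(p, \<phi>)]) - brace KQ bK [(p - 1, homotopy p \<phi>)] = ksign p (\<phi> - emb p (pr p \<phi>))"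
proof (intro ext)
  fix B w i
  let ?hb = "homotopy (p + 1) (brace KQ bK [(p, \<phi>)])" and ?bh = "brace KQ bK [(p - 1, homotopy p \<phi>)]"
  have hC: "homotopy p \<phi> \<in> Cbr csc KQ (p - 1)" by (rule homotopy_Cbr[OF \<phi>])
  have prC: "pr p \<phi> \<in> Cbr sc LQ p" by (rule pr_Cbr[OF \<phi>])
  have bhC: "?bh \<in> Cbr csc KQ p" using K.brace_Cbr[OF bK_Cbr, of "[(p - 1, homotopy p \<phi>)]"] hC by simp
  have hbC: "?hb \<in> Cbr csc KQ p"
    using homotopy_Cbr[OF K.brace_Cbr[OF bK_Cbr, of "[(p, \<phi>)]"]] \<phi> by (simp add: add.commute)
  have eC: "emb p (pr p \<phi>) \<in> Cbr csc KQ p" by (rule emb_Cbr[OF prC])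
  show "(?hb - ?bh) B w i = ksign p (\<phi> - emb p (pr p \<phi>)) B w i"
  proof (cases "sword KQ B w")
    case False
    then have "?hb B w = 0" "?bh B w = 0" "\<phi> B w = 0" "emb p (pr p \<phi>) B w = 0"
      using K.Cbr_nosword hbC bhC \<phi> eC by blast+
    then show ?thesis by (simp add: ksign_apply)
  next
    case w: True
    define l where "l = i + wdeg w + p + 1"
    define S where "S = src B w"
    have B: "B \<in> QObj KQ" and S: "S \<in> QObj KQ" using sword_obj[OF w] sword_src[OF w] by (auto simp: S_def)
    have Bl: "fst B j \<in> Obj C" and Sl: "fst S j \<in> Obj C" for j using Obj_cplx B S by auto
    show ?thesis
    proof (cases "l < lower_bound C B")
      case True
      \<comment> \<open>Below the bound, all the values in question are morphisms to a zero
        object.\<close>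
      have z: "zero_object C (fst B l)" using zero_object_below_lower_bound[OF _ True] B by (simp add: QObj_KQ)
      have v0: "\<chi> B w i = 0" if "\<chi> \<in> Cbr csc KQ p" for \<chi>
      proof (rule Hom_to_zero[OF z Sl])
        show "\<chi> B w i \<in> Hom C (fst S i) (fst B l)"
          using K.Cbr_val[OF that w] by (simp add: QHom_KQ S_def l_def add.assoc)
      qed
      show ?thesis using v0[OF hbC] v0[OF bhC] v0[OF \<phi>] v0[OF eC] by (simp add: ksign_apply)
    next
      case nb: False
      let ?D = "st (fst B l)"
      let ?X = "\<lambda>X v m j. lsum (cross_words X v m) (\<lambda>U. \<phi> (st (fst X m)) U j)"
      have D: "?D \<in> QObj KQ" by (rule stalk_obj[OF Bl])
      have \<phi>s: "sword KQ D' ((p + wdeg v, \<phi> D' v, src D' v) # v')"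
        if "sword KQ D' v" "sword KQ (src D' v) v'" for D' v v'
        using K.Cbr_val[OF \<phi> that(1)] that sword_obj[OF that(1)] by (simp add: add_ac)
      \<comment> \<open>The three terms of \<open>brace_arity12\<close>: \<phi> takes all letters of
        \<open>U\<close>, all but the first, or all but the last.\<close>
      define T1 where "T1 = (\<lambda>U. bK ?D [(p + wdeg U, \<phi> ?D U, src ?D U)])"
      define T2 where "T2 = (\<lambda>U. case U of [] \<Rightarrow> 0 | (d, x, A) # U' \<Rightarrow>
        ksign (p * d) (bK ?D [(d, x, A), (p + wdeg U', \<phi> A U', src A U')]))"
      define T3 where "T3 = (\<lambda>U. bK ?D [(p + wdeg (butlast U), \<phi> ?D (butlast U), src ?D (butlast U)), last U])"
      \<comment> \<open>The composites of values of the homotopy with the differential of the source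
        (\<open>Z1\<close>), the differential of \<open>B\<close> (\<open>Z2\<close>), the first
        letter (\<open>Z3\<close>) and the last letter (\<open>Z4\<close>). They are the terms of
        the brace of the dg structure with the homotopy.\<close>
      define Z1 where "Z1 = cmp C (fst S i) (fst S (i + 1)) (fst B l) (?X B w l (i + 1)) (snd S i)"
      define Z2 where "Z2 = cmp C (fst S i) (fst B (l - 1)) (fst B l) (snd B (l - 1)) (?X B w (l - 1) i)"
      define Z3 where "Z3 = (case w of [] \<Rightarrow> 0 | (d, f, A) # w' \<Rightarrow>
        cmp C (fst S i) (fst A (l - (d + 1))) (fst B l) (f (l - (d + 1))) (?X A w' (l - (d + 1)) i))"
      define Z4 where "Z4 = (if w = [] then 0 else (case last w of (d, g, A) \<Rightarrow>
        cmp C (fst S i) (fst (src B (butlast w)) (i + (d + 1))) (fst B l) (?X B (butlast w) l (i + (d + 1))) (g i)))"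
      define E where "E = lsum (delta_words C B w l) (pr p \<phi> (fst B l))"
      have bS: "ksign e x \<in> Hom C X Y" if "x \<in> Hom C X Y" "X \<in> Obj C" "Y \<in> Obj C" for e x X Y
        using that Hom_sub bm.subspace_neg by (simp add: ksign_def)
      have hl: "(i + 1) + wdeg w + p = l" "i + wdeg w + p = l - 1" by (simp_all add: l_def)
      have split: "?hb B w i = ksign ((p + 1) * l) (lsum (cross_words B w l) (\<lambda>U. T1 U i) +
          lsum (cross_words B w l) (\<lambda>U. T2 U i) + lsum (cross_words B w l) (\<lambda>U. T3 U i))"
      proof -
        have "?hb B w i = ksign ((p + 1) * l) (lsum (cross_words B w l) (\<lambda>U. brace KQ bK [(p, \<phi>)] ?D U i))"
          by (rule homotopy_eq[OF w]) (simp add: l_def)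
        also have "lsum (cross_words B w l) (\<lambda>U. brace KQ bK [(p, \<phi>)] ?D U i) =
          lsum (cross_words B w l) (\<lambda>U. T1 U i + T2 U i + T3 U i)"
        proof (rule lsum_cong)
          fix e U assume "(e, U) \<in> set (cross_words B w l)"
          then have U: "sword KQ ?D U" "U \<noteq> []" using cross_words_valid[OF _ w] by auto
          show "brace KQ bK [(p, \<phi>)] ?D U i = T1 U i + T2 U i + T3 U i"
            unfolding K.brace_arity12[OF arity12_bK U(1)] T1_def T2_def T3_def using U(2) by simp
        qed
        finally show ?thesis by (simp only: lsum_add)
      qed
      have st_simps: "fst ?D 0 = fst B l" "snd (st X) j = 0" for X j by (simp_all add: stalk_def)
      have Do: "fst ?D j \<in> Obj C" for j by (rule Obj_cplx[OF D])
      have dS: "snd S i \<in> Hom C (fst S i) (fst S (i + 1))" using S by (simp add: QObj_KQ bb_complex_def)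
      have S1: "lsum (cross_words B w l) (\<lambda>U. T1 U i) = ksign (i + 1) Z1"
      proof -
        have "T1 U i = ksign (i + 1) (cmp C (fst S i) (fst S (i + 1)) (fst B l) (\<phi> ?D U (i + 1)) (snd S i))"
          if "(e, U) \<in> set (cross_words B w l)" for e U
        proof -
          have U: "sword KQ ?D U" "src ?D U = S" "wdeg U = wdeg w - l - 1"
            using cross_words_valid[OF that w] by (auto simp: S_def)
          let ?d = "p + wdeg U"
          have d: "i + (?d + 2) = 0" "i + (?d + 1) = - 1" "wdeg U + p + 1 = - (i + 1)"
            using U(3) by (auto simp: l_def)
          have k: "ksign (?d + 1) x = ksign (i + 1) x" for x :: 'm
            using U(3) by (intro ksign_cong) (simp add: l_def)
          have "sword KQ ?D [(?d, \<phi> ?D U, S)]" using \<phi>s[OF U(1), of "[]"] U(2) S by simp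
          from bK_single[OF this, of i]
          have "T1 U i = ksign (i + 1) (cmp C (fst S i) (fst S (i + 1)) (fst B l) (\<phi> ?D U (i + 1)) (snd S i)) -
              cmp C (fst S i) (fst ?D (- 1)) (fst B l) 0 (\<phi> ?D U i)"
            unfolding T1_def U(2) d(1,2) st_simps k .
          moreover have "\<phi> ?D U i \<in> Hom C (fst S i) (fst ?D (- 1))"
          proof -
            have "\<phi> ?D U i \<in> Hom C (fst S i) (fst ?D (i + - (i + 1)))"
              using K.Cbr_val[OF \<phi> U(1)] unfolding QHom_KQ U(2) d(3) by blast
            then show ?thesis by simp
          qed
          ultimately show ?thesis using cmp_0(1)[OF Sl Do Bl] by simp
        qed
        then have "lsum (cross_words B w l) (\<lambda>U. T1 U i) = lsum (cross_words B w l) (\<lambda>U. ksign (i + 1)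
            (cmp C (fst S i) (fst S (i + 1)) (fst B l) (\<phi> ?D U (i + 1)) (snd S i)))"
          by (rule lsum_cong)
        also have "\<dots> = ksign (i + 1) Z1"
          unfolding lsum_ksign Z1_def
          by (intro arg_cong[where f = "ksign _"] lsum_cmp_left[OF Sl Sl Bl dS])
            (use cross_words_Hom[OF \<phi> w hl(1)[symmetric]] in \<open>simp add: S_def\<close>)
        finally show ?thesis .
      qed
      have T2_lmap: "lsum (cross_words X v m) (\<lambda>U. T2 (lmap m g X # U) i) =
          ksign p (cmp C (fst S i) (fst X m) (fst B l) (g m) (?X X v m i))"
        if v: "sword KQ X v" and src: "src X v = S" and m: "m = i + wdeg v + p"
          and g: "g m \<in> Hom C (fst X m) (fst B l)" for X v m g
      proof -
        have X: "X \<in> QObj KQ" by (rule sword_obj[OF v])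
        have Xl: "fst X j \<in> Obj C" for j by (rule Obj_cplx[OF X])
        have "T2 (lmap m g X # U) i = ksign p (cmp C (fst S i) (fst X m) (fst B l) (g m) (\<phi> (st (fst X m)) U i))"
          if "(e, U) \<in> set (cross_words X v m)" for e U
        proof -
          have U: "sword KQ (st (fst X m)) U" "src (st (fst X m)) U = S" "wdeg U = wdeg v - m - 1"
            using cross_words_valid[OF that v] src by auto
          have d: "i + (p + wdeg U + 1) = 0" using U(3) m by simp
          have "sword KQ (st (fst X m)) [(p + wdeg U, \<phi> (st (fst X m)) U, S)]"
            using \<phi>s[OF U(1), of "[]"] U(2) S by simp
          then have "sword KQ ?D [lmap m g X, (p + wdeg U, \<phi> (st (fst X m)) U, S)]"
            by (rule sword_lmap[OF g Bl _ X])
          then have "bK ?D [lmap m g X, (p + wdeg U, \<phi> (st (fst X m)) U, S)] i =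
             cmp C (fst S i) (fst X m) (fst B l) (g m) (\<phi> (st (fst X m)) U i)"
            by (simp add: bK_pair com_cmp_def d)
          then show ?thesis by (simp add: T2_def U(2) ksign_apply ksign_uminus_exp)
        qed
        then have "lsum (cross_words X v m) (\<lambda>U. T2 (lmap m g X # U) i) =
          lsum (cross_words X v m) (\<lambda>U. ksign p (cmp C (fst S i) (fst X m) (fst B l) (g m) (\<phi> (st (fst X m)) U i)))"
          by (rule lsum_cong)
        also have "\<dots> = ksign p (cmp C (fst S i) (fst X m) (fst B l) (g m) (?X X v m i))"
          unfolding lsum_ksign
          by (intro arg_cong[where f = "ksign _"] lsum_cmp_right[OF Sl Xl Bl g])
            (use cross_words_Hom[OF \<phi> v m] src in simp)
        finally show ?thesis .
      qed
      have S2: "lsum (cross_words B w l) (\<lambda>U. T2 U i) =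
        ksign (p * (l + 1) + l) (\<phi> B w i) - ksign (l + p) Z3 - ksign (l + p) Z2"
      proof -
        \<comment> \<open>The first extreme term: the crossing stands in front, \<phi> reads all of
          \<open>w\<close>, and the choice of \<open>l\<close> makes the row pick the component
          \<open>i\<close>.\<close>
        have c: "T2 (cross B l # w) i = ksign (p * (l + 1) + l) (\<phi> B w i)"
        proof -
          have "sword KQ B [(p + wdeg w, \<phi> B w, S)]" using \<phi>s[OF w, of "[]"] S by (simp add: S_def)
          from bK_cross_letter[OF this, of l]
          have "bK ?D [cross B l, (p + wdeg w, \<phi> B w, S)] = ksign l (row i (\<phi> B w))"
            by (simp add: l_def)
          then have "T2 (cross B l # w) i = ksign (p * (- l - 1)) (ksign l (\<phi> B w i))"
            by (simp add: T2_def cross_def S_def ksign_apply row_def)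
          then show ?thesis unfolding ksign_ksign by (simp add: ksign_def)
        qed
        have d: "lsum (cross_words B w (l - 1)) (\<lambda>U. T2 (lmap (l - 1) (snd B) B # U) i) = ksign p Z2"
          unfolding Z2_def
          by (rule T2_lmap[of B w "l - 1" "snd B", OF w _ hl(2)[symmetric] delta_words_delta[OF B]]) (simp add: S_def)
        have e: "(case w of [] \<Rightarrow> 0 | (d, f, A) # w' \<Rightarrow> ksign l (lsum (cross_words A w' (l - (d + 1)))
            (\<lambda>U. T2 (lmap (l - (d + 1)) f A # U) i))) = ksign l (ksign p Z3)"
        proof (cases w)
          case Nil
          then show ?thesis by (simp add: Z3_def)
        next
          case (Cons a w')
          obtain d f A where a: "a = (d, f, A)" by (cases a) auto
          have w1: "sword KQ B ((d, f, A) # w')" using w Cons a by simp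
          have A: "sword KQ A w'" using w1 by simp
          have "src A w' = S" using Cons a by (simp add: S_def)
          moreover have "l - (d + 1) = i + wdeg w' + p" using Cons a by (simp add: l_def)
          ultimately have "lsum (cross_words A w' (l - (d + 1))) (\<lambda>U. T2 (lmap (l - (d + 1)) f A # U) i) = ksign p Z3"
            unfolding Z3_def Cons a list.case prod.case by (intro T2_lmap[of A w' "l - (d + 1)" f, OF A _ _ delta_words_letter[OF w1]])
          then show ?thesis by (simp add: Cons a)
        qed
        show ?thesis unfolding lsum_cross_words[OF nb, of w "\<lambda>U. T2 U i"] c d e ksign_ksign ..
      qed
      have S3: "lsum (cross_words B w l) (\<lambda>U. T3 U i) =
         (if w = [] then 0 else ksign (i + fst (last w) + 1) Z4) + ksign (p + 1) E"
      proof -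
        have "lsum (cross_words B (butlast w) l) (\<lambda>U. T3 (U @ [last w]) i) = ksign (i + fst (last w) + 1) Z4" if "w \<noteq> []"
        proof -
          obtain w0 d g A0 where w0: "w = w0 @ [(d, g, A0)]"
            using \<open>w \<noteq> []\<close> by (cases w rule: rev_cases) auto
          let ?S0 = "src B w0" and ?j = "i + (d + 1)"
          have A0: "A0 = S" by (simp add: S_def w0)
          have s0: "sword KQ B w0" "sword KQ ?S0 [(d, g, S)]" using w by (auto simp: w0 sword_append A0)
          have S0: "fst ?S0 k \<in> Obj C" for k by (rule Obj_cplx[OF sword_src[OF s0(1)]])
          have g: "g i \<in> Hom C (fst S i) (fst ?S0 ?j)" using s0(2) by (simp add: QHom_KQ)
          have l: "l = ?j + wdeg w0 + p" by (simp add: l_def w0)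
          have "T3 (U @ [(d, g, A0)]) i = ksign (i + d + 1) (cmp C (fst S i) (fst ?S0 ?j) (fst B l) (\<phi> ?D U ?j) (g i))"
            if "(e, U) \<in> set (cross_words B w0 l)" for e U
          proof -
            have U: "sword KQ ?D U" "src ?D U = ?S0" "wdeg U = wdeg w0 - l - 1"
              using cross_words_valid[OF that s0(1)] by auto
            have d: "?j + (p + wdeg U + 1) = 0" using U(3) l by simp
            have k: "ksign (p + wdeg U + 1) x = ksign (i + d + 1) x" for x :: 'm
              using U(3) l by (intro ksign_cong) simp
            have sw: "sword KQ ?D [(p + wdeg U, \<phi> ?D U, ?S0), (d, g, S)]"
              using \<phi>s[OF U(1), of "[(d, g, S)]"] U(2) s0(2) by simp
            have "bK ?D [(p + wdeg U, \<phi> ?D U, ?S0), (d, g, S)] i =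
               ksign (p + wdeg U + 1) (cmp C (fst S i) (fst ?S0 ?j) (fst B l) (\<phi> ?D U ?j) (g i))"
              unfolding bK_pair[OF sw] ksign_apply com_cmp_def d st_simps ..
            then show ?thesis by (simp add: T3_def U(2) A0 k)
          qed
          then have "lsum (cross_words B w0 l) (\<lambda>U. T3 (U @ [(d, g, A0)]) i) = lsum (cross_words B w0 l) (\<lambda>U. ksign (i + d + 1)
              (cmp C (fst S i) (fst ?S0 ?j) (fst B l) (\<phi> ?D U ?j) (g i)))"
            by (rule lsum_cong)
          also have "\<dots> = ksign (i + d + 1) (cmp C (fst S i) (fst ?S0 ?j) (fst B l) (?X B w0 l ?j) (g i))"
            unfolding lsum_ksign
            by (intro arg_cong[where f = "ksign _"] lsum_cmp_left[OF Sl S0 Bl g]) (rule cross_words_Hom[OF \<phi> s0(1) l])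
          finally show ?thesis by (simp add: w0 Z4_def)
        qed
        \<comment> \<open>The other extreme term: in front of the crossing \<phi> reads a word of
          stalks, so its value is that of the projection, and the identity in the crossing drops out
          of the composite.\<close>
        moreover have "lsum (delta_words C B w l) (\<lambda>t. ksign (int (length t)) (T3 (stw t @ [cross (src B w) (l - wdeg w + wdeg t)]) i)) =
          ksign (p + 1) E"
          unfolding E_def lsum_ksign[symmetric]
        proof (rule lsum_cong)
          fix e t assume "(e, t) \<in> set (delta_words C B w l)"
          note t = delta_words_valid[OF this w, folded S_def]
          let ?lc = "l - wdeg w + wdeg t"
          have st: "sword LQ (fst B l) t" using t by blast
          have sU: "sword KQ ?D (stw t)" by (rule sword_stw[OF st])
          have src: "src ?D (stw t) = st (fst S ?lc)" using t by simp
          have Snil: "sword KQ S []" using S by simp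
          have T: "T3 (stw t @ [cross (src B w) ?lc]) = bK ?D [(p + wdeg t, \<phi> ?D (stw t), st (fst S ?lc)), cross S ?lc]"
            using src by (simp add: T3_def S_def[symmetric])
          show "ksign (int (length t)) (T3 (stw t @ [cross (src B w) ?lc]) i) = ksign (p + 1) (pr p \<phi> (fst B l) t)"
          proof (cases "wdeg t + p + 1 = 0")
            case True
            then have lc: "?lc = i" and len: "int (length t) = p + 1" using t by (auto simp: l_def)
            have sw: "sword KQ ?D [(p + wdeg t, \<phi> ?D (stw t), st (fst S i)), cross S i]"
              using \<phi>s[OF sU, of "[cross S i]"] src lc sword_cross[OF Snil, of i] by simp
            have d: "i + (- i - 1 + 1) = 0" "p + wdeg t + 1 = 0" using True by auto
            have v: "\<phi> ?D (stw t) 0 \<in> Hom C (fst S i) (fst B l)"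
            proof -
              have "\<phi> ?D (stw t) \<in> QHom KQ (st (fst S i)) ?D 0"
                using K.Cbr_val[OF \<phi> sU] src lc True by simp
              then have "\<phi> ?D (stw t) 0 \<in> Hom C (fst (st (fst S i)) 0) (fst ?D (0 + 0))" unfolding QHom_KQ by blast
              then show ?thesis by simp
            qed
            have "bK ?D [(p + wdeg t, \<phi> ?D (stw t), st (fst S i)), cross S i] i =
               cmp C (fst S i) (fst S i) (fst B l) (\<phi> ?D (stw t) 0) (idn C (fst S i))"
              using bK_pair[OF sw[unfolded cross_def]] d by (simp add: cross_def com_cmp_def)
            also have "\<dots> = \<phi> ?D (stw t) 0" by (rule cmp_id(1)[OF Sl Bl v])
            finally show ?thesis using T[unfolded lc] st len unfolding lc by (simp add: pr_eq)
          next
            case False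
            have pz: "pr p \<phi> (fst B l) t = 0"
              using pr_val(2)[OF \<phi> st] False by (simp add: QHom_LQ)
            then have z: "\<phi> ?D (stw t) = 0" using pr_val(1)[OF \<phi> st] by simp
            have "bK ?D [(p + wdeg t, 0, st (fst S ?lc)), cross S ?lc] = 0"
              by (rule K.mlin_head_0[OF module_com K.Cbr_mlin[OF bK_Cbr] D sword_cross[OF Snil]])
            then show ?thesis unfolding T z pz by simp
          qed
        qed
        ultimately show ?thesis unfolding lsum_cross_words_last[of B w l "\<lambda>U. T3 U i"] by simp
      qed
      have R: "?bh B w i = ksign (p + wdeg w + p * l) Z1 - ksign (p * (l - 1)) Z2 + ksign (p * l + p + 1) Z3 +
         (if w = [] then 0 else ksign (p + wdeg (butlast w) + p * l) Z4)"
      proof -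
        let ?h = "homotopy p \<phi>"
        have hs: "sword KQ D' ((p - 1 + wdeg v, ?h D' v, src D' v) # v')"
          if "sword KQ D' v" "sword KQ (src D' v) v'" for D' v v'
          using K.Cbr_val[OF hC that(1)] that sword_obj[OF that(1)] by (simp add: add_ac)
        have R1: "bK B [(p - 1 + wdeg w, ?h B w, src B w)] i = ksign (p + wdeg w + p * l) Z1 - ksign (p * (l - 1)) Z2"
        proof -
          let ?d = "p - 1 + wdeg w"
          have d: "i + (?d + 2) = l" "i + (?d + 1) = l - 1" "?d + 1 = p + wdeg w" by (auto simp: l_def)
          have "sword KQ B [(?d, ?h B w, S)]" using hs[OF w, of "[]"] S by (simp add: S_def)
          note e = bK_single[OF this, of i, unfolded d(1,2), unfolded d(3)]
          have h1: "?h B w (i + 1) = ksign (p * l) (?X B w l (i + 1))" by (rule homotopy_eq[OF w hl(1)[symmetric]])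
          have h2: "?h B w i = ksign (p * (l - 1)) (?X B w (l - 1) i)" by (rule homotopy_eq[OF w hl(2)[symmetric]])
          have x1: "?X B w l (i + 1) \<in> Hom C (fst S (i + 1)) (fst B l)"
            by (rule lsum_Hom[OF Sl Bl]) (use cross_words_Hom[OF \<phi> w hl(1)[symmetric]] in \<open>simp add: S_def\<close>)
          have x2: "?X B w (l - 1) i \<in> Hom C (fst S i) (fst B (l - 1))"
            by (rule lsum_Hom[OF Sl Bl]) (use cross_words_Hom[OF \<phi> w hl(2)[symmetric]] in \<open>simp add: S_def\<close>)
          show ?thesis
            unfolding S_def[symmetric] e h1 h2 cmp_ksign(2)[OF Sl Sl Bl dS x1] cmp_ksign(1)[OF Sl Bl Bl x2 delta_words_delta[OF B]]
            by (simp add: Z1_def Z2_def ksign_ksign)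
        qed
        have R2: "(case w of [] \<Rightarrow> 0 | (d, x, A) # w' \<Rightarrow> ksign ((p - 1) * d)
            (bK B [(d, x, A), (p - 1 + wdeg w', ?h A w', src A w')])) i = ksign (p * l + p + 1) Z3"
        proof (cases w)
          case Nil
          then show ?thesis by (simp add: Z3_def)
        next
          case (Cons a w')
          obtain d f A where a: "a = (d, f, A)" by (cases a) auto
          let ?l = "l - (d + 1)"
          have w1: "sword KQ B ((d, f, A) # w')" using w Cons a by simp
          have A: "sword KQ A w'" "A \<in> QObj KQ" using w1 sword_obj[of KQ A w'] by auto
          have Al: "fst A j \<in> Obj C" for j by (rule Obj_cplx[OF A(2)])
          have sA: "src A w' = S" using Cons a by (simp add: S_def)
          have m: "?l = i + wdeg w' + p" using Cons a by (simp add: l_def)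
          have f: "f ?l \<in> Hom C (fst A ?l) (fst B l)" by (rule delta_words_letter[OF w1])
          have d: "i + (p - 1 + wdeg w' + 1) = ?l" "?l + (d + 1) = l" using m by auto
          have sw: "sword KQ B [(d, f, A), (p - 1 + wdeg w', ?h A w', S)]"
            using w1 hs[OF A(1), of "[]"] sA S by simp
          have h: "?h A w' i = ksign (p * ?l) (?X A w' ?l i)" by (rule homotopy_eq[OF A(1) m])
          have x: "?X A w' ?l i \<in> Hom C (fst S i) (fst A ?l)"
            by (rule lsum_Hom[OF Sl Al]) (use cross_words_Hom[OF \<phi> A(1) m] sA in simp)
          have "bK B [(d, f, A), (p - 1 + wdeg w', ?h A w', S)] i = ksign (d + 1)
             (cmp C (fst S i) (fst A ?l) (fst B l) (f ?l) (?h A w' i))"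
            unfolding bK_pair[OF sw] ksign_apply com_cmp_def d ..
          also have "\<dots> = ksign (d + 1) (ksign (p * ?l) Z3)"
            unfolding h cmp_ksign(1)[OF Sl Al Bl x f] by (simp add: Z3_def Cons a)
          finally have b: "bK B [(d, f, A), (p - 1 + wdeg w', ?h A w', S)] i = \<dots>" .
          have "ksign ((p - 1) * d) (ksign (d + 1) (ksign (p * ?l) Z3)) = ksign (p * l + p + 1) Z3"
            unfolding ksign_ksign by (rule ksign_cong) (simp add: algebra_simps)
          then show ?thesis unfolding Cons a list.case prod.case sA ksign_apply b .
        qed
        have R3: "(if w = [] then 0 else bK B [(p - 1 + wdeg (butlast w), ?h B (butlast w), src B (butlast w)), last w]) i =
           (if w = [] then 0 else ksign (p + wdeg (butlast w) + p * l) Z4)"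
        proof (cases "w = []")
          case False
          then obtain w0 d g A0 where w0: "w = w0 @ [(d, g, A0)]"
            by (cases w rule: rev_cases) auto
          let ?S0 = "src B w0" and ?j = "i + (d + 1)"
          have A0: "A0 = S" by (simp add: S_def w0)
          have s0: "sword KQ B w0" "sword KQ ?S0 [(d, g, S)]" using w by (auto simp: w0 sword_append A0)
          have S0: "fst ?S0 k \<in> Obj C" for k by (rule Obj_cplx[OF sword_src[OF s0(1)]])
          have g: "g i \<in> Hom C (fst S i) (fst ?S0 ?j)" using s0(2) by (simp add: QHom_KQ)
          have l: "l = ?j + wdeg w0 + p" by (simp add: l_def w0)
          have d: "?j + (p - 1 + wdeg w0 + 1) = l" using l by simp
          have sw: "sword KQ B [(p - 1 + wdeg w0, ?h B w0, ?S0), (d, g, S)]" using hs[OF s0] .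
          have h: "?h B w0 ?j = ksign (p * l) (?X B w0 l ?j)" by (rule homotopy_eq[OF s0(1) l])
          have x: "?X B w0 l ?j \<in> Hom C (fst ?S0 ?j) (fst B l)"
            by (rule lsum_Hom[OF S0 Bl]) (rule cross_words_Hom[OF \<phi> s0(1) l])
          have "bK B [(p - 1 + wdeg w0, ?h B w0, ?S0), (d, g, S)] i = ksign (p - 1 + wdeg w0 + 1)
             (cmp C (fst S i) (fst ?S0 ?j) (fst B l) (?h B w0 ?j) (g i))"
            unfolding bK_pair[OF sw] ksign_apply com_cmp_def d ..
          also have "\<dots> = ksign (p + wdeg w0 + p * l) Z4"
            unfolding h cmp_ksign(2)[OF Sl S0 Bl g x] by (simp add: Z4_def w0 ksign_ksign)
          finally show ?thesis by (simp add: w0 A0)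
        qed simp
        show ?thesis
          unfolding K.brace_arity12[OF arity12_bK w, of "p - 1" ?h] plus_fun_apply R1 R2 R3 ..
      qed
      have EE: "emb p (pr p \<phi>) B w i = ksign ((p + 1) * l) E"
        using w by (simp add: emb_def Let_def E_def l_def)
      have s4: "ksign ((p + 1) * l + (i + fst (last w) + 1)) Z4 = ksign (p + wdeg (butlast w) + p * l) Z4" if "w \<noteq> []"
      proof -
        have "wdeg w = wdeg (butlast w) + fst (last w)"
          using that by (cases w rule: rev_cases) (auto simp: wdeg_def)
        then show ?thesis by (intro ksign_cong) (simp add: l_def algebra_simps)
      qed
      have s1: "ksign ((p + 1) * l + (i + 1)) Z1 = ksign (p + wdeg w + p * l) Z1"
        by (rule ksign_cong) (simp add: l_def algebra_simps)
      have s2: "ksign ((p + 1) * l + (l + p)) Z2 = ksign (p * (l - 1)) Z2"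
        by (rule ksign_cong) (simp add: algebra_simps)
      have s3: "ksign ((p + 1) * l + (l + p)) Z3 = - ksign (p * l + p + 1) Z3"
        by (cases "even p"; cases "even l"; simp add: ksign_def)
      have s0: "ksign ((p + 1) * l + (p * (l + 1) + l)) x = ksign p x" for x :: 'm
        by (rule ksign_cong) (simp add: algebra_simps)
      have s5: "ksign ((p + 1) * l + (p + 1)) E = - ksign p (emb p (pr p \<phi>) B w i)"
        unfolding EE by (cases "even p"; cases "even l"; simp add: ksign_def)
      have "?hb B w i - ?bh B w i = ksign p (\<phi> B w i) - ksign p (emb p (pr p \<phi>) B w i)"
        unfolding split S1 S2 S3 R
        by (cases "w = []") (simp_all add: ksign_add ksign_diff ksign_ksign s0 s1 s2 s3 s4 s5)
      then show ?thesis by (simp add: ksign_apply ksign_diff)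
    qed
  qed
qed

text \<open>For a cocycle, applying the homotopy to its boundary gives 0. By
  \<open>homotopy_brace_right\<close> this replaces the first term in
  \<open>homotopy_brace_left\<close> by the missing half of the boundary of the homotopy; the factor
  \<open>ksign (p + 1)\<close> absorbs the remaining sign.\<close>

lemma chain_homotopy:
  assumes \<phi>: "\<phi> \<in> Cbr csc KQ p" and c: "Cbr_dif KQ bK [(p, \<phi>)] = 0"
  shows "\<phi> - emb p (pr p \<phi>) = Cbr_dif KQ bK [(p - 1, ksign (p + 1) (homotopy p \<phi>))]"
proof -
  let ?h = "homotopy p \<phi>" and ?e = "emb p (pr p \<phi>)"
  have hC: "?h \<in> Cbr csc KQ (p - 1)" by (rule homotopy_Cbr[OF \<phi>])
  have "homotopy (p + 1) (Cbr_dif KQ bK [(p, \<phi>)]) = homotopy (p + 1) (brace KQ bK [(p, \<phi>)]) + ksign p (brace KQ ?h [(1, bK)])"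
    by (simp add: homotopy_diff homotopy_ksign homotopy_brace_right[OF \<phi>] ksign_minus)
  moreover have "homotopy (p + 1) 0 = 0" by (auto simp: fun_eq_iff homotopy_def Let_def)
  ultimately have a: "homotopy (p + 1) (brace KQ bK [(p, \<phi>)]) = - ksign p (brace KQ ?h [(1, bK)])"
    using c by (simp add: eq_neg_iff_add_eq_0)
  have d: "Cbr_dif KQ bK [(p - 1, ?h)] = brace KQ bK [(p - 1, ?h)] + ksign p (brace KQ ?h [(1, bK)])"
    by (simp add: ksign_def)
  have "ksign p (\<phi> - ?e) = - Cbr_dif KQ bK [(p - 1, ?h)]"
    using homotopy_brace_left[OF \<phi>] unfolding a d by (simp add: algebra_simps)
  then have "ksign p (ksign p (\<phi> - ?e)) = - ksign p (Cbr_dif KQ bK [(p - 1, ?h)])"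
    by (simp only: ksign_minus)
  moreover have "ksign p (ksign p (\<phi> - ?e)) = \<phi> - ?e" by (simp add: ksign_def)
  ultimately have "\<phi> - ?e = - ksign p (Cbr_dif KQ bK [(p - 1, ?h)])" by (simp only:)
  also have "\<dots> = ksign (p + 1) (Cbr_dif KQ bK [(p - 1, ?h)])" by (simp add: ksign_def)
  also have "\<dots> = Cbr_dif KQ bK [(p - 1, ksign (p + 1) ?h)]"
    using multilinear_ksign[OF DK.Cbr_dif_multilinear K.module_cochain K.Cbr_sub _ _ hC, of "[]" "[]" "p + 1"] by simp
  finally show ?thesis .
qed

end


section \<open>Transport and localization\<close>

locale transport =
  fixes sc :: "'k::comm_ring_1 \<Rightarrow> 'v::ab_group_add \<Rightarrow> 'v" and scu :: "'k \<Rightarrow> 'u::ab_group_add \<Rightarrow> 'u"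
    and j :: "'v \<Rightarrow> 'u"
  assumes hom: "module_hom sc scu j" and inj: "inj j"
begin

sublocale h: module_hom sc scu j by (rule hom)

definition "J = map (map_prod id j)"
definition "I = map (map_prod id (inv j))"

lemma inv_j [simp]: "inv j (j x) = x"
  using inj by simp

lemma J_simps [simp]:
  "J [] = []" "J ((p, x) # w) = (p, j x) # J w" "J (u @ v) = J u @ J v"
  "J w = [] \<longleftrightarrow> w = []" "length (J w) = length w"
  "take a (J w) = J (take a w)" "drop a (J w) = J (drop a w)"
  by (simp_all add: J_def take_map drop_map)

lemma I_J [simp]: "I (J w) = w"
  by (induction w) (auto simp: I_def J_def)

lemma wdeg_J [simp]: "wdeg (J w) = wdeg w"
  by (induction w) (auto simp: wdeg_def)

lemma I_append [simp]: "I [] = []" "I (u @ v) = I u @ I v"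
  by (simp_all add: I_def)

lemma I_J_Cons [simp]: "I ((p, j x) # w) = (p, x) # I w"
  by (simp add: I_def)

lemma binf_transport_eq:
  "binf_transport j A =
     \<lparr>homog = \<lambda>p. j ` homog A p, bmul = \<lambda>x y. j (bmul A (I x) (I y)), bdif = \<lambda>x. j (bdif A (I x))\<rparr>"
  by (simp add: binf_transport_def I_def)

lemma gword_J:
  assumes "gword (\<lambda>p. j ` V p) w"
  obtains w0 where "w = J w0" "gword V w0"
  using assms
proof (induction w arbitrary: thesis)
  case Nil
  then show ?case by (intro Nil(1)[of "[]"]) (simp_all add: gword_def)
next
  case (Cons a w)
  obtain p x where a: "a = (p, j x)" "x \<in> V p" using Cons.prems(2) by (cases a) (auto simp: gword_def)
  have "gword (\<lambda>p. j ` V p) w" using Cons.prems(2) by (simp add: gword_def)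
  then obtain w0 where "w = J w0" "gword V w0" using Cons.IH by blast
  then show ?case using a by (intro Cons.prems(1)[of "(p, x) # w0"]) (auto simp: gword_def)
qed

lemma j_ksign: "j (ksign e x) = ksign e (j x)"
  by (simp add: ksign_def h.neg)

text \<open>\<open>F'\<close> is compared with \<open>F\<close> only on words from the image of
  \<open>j\<close>. This suffices, because the letters produced by the transported product lie in
  that image again.\<close>

lemma mul_word_J:
  assumes "\<And>t. F' (J t) = j (F t)"
  shows "mul_word (\<lambda>x y. j (m (I x) (I y))) r F' (J x) (J y) = j (mul_word m r F x y)"
  using assms
proof (induction r arbitrary: F F' x y)
  case 0
  then show ?case using 0[of "[]"] by (simp add: h.zero)
next
  case (Suc r)
  have F: "F' ((p, j v) # J t) = j (F ((p, v) # t))" for p v t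
    using Suc.prems[of "(p, v) # t"] by simp
  have "mul_word (\<lambda>x y. j (m (I x) (I y))) r (\<lambda>t. F' ((p, j v) # t)) (J x) (J y) =
      j (mul_word m r (\<lambda>t. F ((p, v) # t)) x y)" for p v x y
    by (rule Suc.IH) (rule F)
  then show ?case by (simp add: h.sum j_ksign split_def)
qed

lemma mul_total_J:
  assumes "\<And>t. F' (J t) = j (F t)"
  shows "mul_total (\<lambda>x y. j (m (I x) (I y))) F' (J x) (J y) = j (mul_total m F x y)"
  by (simp add: mul_total_def mul_word_J[of F' F, OF assms] h.sum)

lemma der_total_J:
  assumes "\<And>t. F' (J t) = j (F t)"
  shows "der_total (\<lambda>x. j (D (I x))) F' (J x) = j (der_total D F x)"
proof -
  have "F' (J u @ (p, j v) # J t) = j (F (u @ (p, v) # t))" for u p v t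
    using assms[of "u @ (p, v) # t"] by simp
  then show ?thesis by (simp add: der_total_def h.sum j_ksign)
qed

lemma multilinear_J:
  assumes "multilinear sc V F"
  shows "multilinear scu (\<lambda>p. j ` V p) (\<lambda>w. j (F (I w)))"
  unfolding multilinear_def
proof (intro allI impI ballI)
  fix u v p x y c
  assume "gword (\<lambda>p. j ` V p) u" "gword (\<lambda>p. j ` V p) v" and xy: "x \<in> j ` V p" "y \<in> j ` V p"
  then obtain u0 v0 where u: "u = J u0" "gword V u0" and v: "v = J v0" "gword V v0"
    by (metis gword_J)
  from xy obtain x0 y0 where x: "x = j x0" "x0 \<in> V p" and y: "y = j y0" "y0 \<in> V p" by auto
  have e: "x + y = j (x0 + y0)" "scu c x = j (sc c x0)" by (simp_all add: x y h.add h.scale)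
  show "j (F (I (u @ (p, x + y) # v))) = j (F (I (u @ (p, x) # v))) + j (F (I (u @ (p, y) # v))) \<and>
     j (F (I (u @ (p, scu c x) # v))) = scu c (j (F (I (u @ (p, x) # v))))"
    using assms u(2) v(2) x(2) y(2) unfolding multilinear_def e unfolding u(1) v(1) x(1) y(1)
    by (simp add: h.add[symmetric] h.scale[symmetric])
qed

lemma binf_algebra_transport:
  assumes "binf_algebra sc A"
  shows "binf_algebra scu (binf_transport j A)"
proof -
  let ?V = "\<lambda>p. j ` homog A p"
  let ?m = "\<lambda>x y. j (bmul A (I x) (I y))" and ?d = "\<lambda>x. j (bdif A (I x))"
  note A = assms[unfolded binf_algebra_def]
  have sub: "module.subspace scu (?V p)" for p
    using A h.subspace_image by blast
  have 1: "?m x y \<in> ?V (wdeg x + wdeg y)" if g: "gword ?V x" "gword ?V y" for x y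
  proof -
    obtain x0 y0 where "x = J x0" "gword (homog A) x0" "y = J y0" "gword (homog A) y0"
      using gword_J[OF g(1)] gword_J[OF g(2)] by metis
    then show ?thesis using A by (simp)
  qed
  have 2: "?d x \<in> ?V (wdeg x + 1)" if g: "gword ?V x" for x
  proof -
    obtain x0 where "x = J x0" "gword (homog A) x0" using g gword_J by metis
    then show ?thesis using A by (simp)
  qed
  have 3: "multilinear scu ?V (?m x)" if g: "gword ?V x" for x
  proof -
    obtain x0 where x: "x = J x0" "gword (homog A) x0" using g gword_J by metis
    have "multilinear sc (homog A) (bmul A x0)" using A x(2) by blast
    from multilinear_J[OF this] show ?thesis by (simp add: x(1))
  qed
  have 4: "multilinear scu ?V (\<lambda>x. ?m x y)" if g: "gword ?V y" for y
  proof -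
    obtain y0 where y: "y = J y0" "gword (homog A) y0" using g gword_J by metis
    have "multilinear sc (homog A) (\<lambda>x. bmul A x y0)" using A y(2) by blast
    from multilinear_J[OF this] show ?thesis by (simp add: y(1))
  qed
  have 5: "multilinear scu ?V ?d" using A by (intro multilinear_J) blast
  have 6: "?d [] = 0" using A by (simp add: h.zero)
  have 7: "?m x [] = (if length x = 1 then snd (hd x) else 0) \<and> ?m [] x = (if length x = 1 then snd (hd x) else 0)"
    if g: "gword ?V x" for x
  proof -
    obtain x0 where x: "x = J x0" "gword (homog A) x0" using g gword_J by metis
    have "bmul A x0 [] = (if length x0 = 1 then snd (hd x0) else 0)" "bmul A [] x0 = (if length x0 = 1 then snd (hd x0) else 0)"
      using A x(2) by blast+
    then show ?thesis by (cases x0) (auto simp: x(1) h.zero)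
  qed
  have 8: "mul_total ?m (\<lambda>t. ?m t z) x y = mul_total ?m (?m x) y z"
    if g: "gword ?V x" "gword ?V y" "gword ?V z" for x y z
  proof -
    obtain x0 y0 z0 where w: "x = J x0" "gword (homog A) x0" "y = J y0" "gword (homog A) y0" "z = J z0" "gword (homog A) z0"
      using gword_J[OF g(1)] gword_J[OF g(2)] gword_J[OF g(3)] by metis
    have "mul_total (bmul A) (\<lambda>t. bmul A t z0) x0 y0 = mul_total (bmul A) (bmul A x0) y0 z0"
      using A w by blast
    moreover have "mul_total ?m (\<lambda>t. ?m t (J z0)) (J x0) (J y0) = j (mul_total (bmul A) (\<lambda>t. bmul A t z0) x0 y0)"
      by (rule mul_total_J) simp
    moreover have "mul_total ?m (?m (J x0)) (J y0) (J z0) = j (mul_total (bmul A) (bmul A x0) y0 z0)"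
      by (rule mul_total_J) simp
    ultimately show ?thesis
      unfolding w(1,3,5) by simp
  qed
  have 9: "der_total ?d ?d x = 0" if g: "gword ?V x" for x
  proof -
    obtain x0 where x: "x = J x0" "gword (homog A) x0" using g gword_J by metis
    have "der_total (bdif A) (bdif A) x0 = 0" using A x by blast
    then show ?thesis
      unfolding x(1) by (subst der_total_J[of _ "bdif A"]) (simp_all add: h.zero)
  qed
  have 10: "mul_total ?m ?d x y = der_total ?d (\<lambda>t. ?m t y) x + ksign (wdeg x) (der_total ?d (?m x) y)"
    if g: "gword ?V x" "gword ?V y" for x y
  proof -
    obtain x0 y0 where w: "x = J x0" "gword (homog A) x0" "y = J y0" "gword (homog A) y0"
      using gword_J[OF g(1)] gword_J[OF g(2)] by metis
    have "mul_total (bmul A) (bdif A) x0 y0 =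
          der_total (bdif A) (\<lambda>t. bmul A t y0) x0 + ksign (wdeg x0) (der_total (bdif A) (bmul A x0) y0)"
      using A w by blast
    moreover have "mul_total ?m ?d (J x0) (J y0) = j (mul_total (bmul A) (bdif A) x0 y0)"
      by (rule mul_total_J) simp
    moreover have "der_total ?d (\<lambda>t. ?m t (J y0)) (J x0) = j (der_total (bdif A) (\<lambda>t. bmul A t y0) x0)"
      by (rule der_total_J) simp
    moreover have "der_total ?d (?m (J x0)) (J y0) = j (der_total (bdif A) (bmul A x0) y0)"
      by (rule der_total_J) simp
    ultimately show ?thesis
      unfolding w(1,3) by (simp add: h.add j_ksign)
  qed
  show ?thesis
    unfolding binf_algebra_def binf_transport_eq binf.simps
    using h.m2.module_axioms sub 1 2 3 4 5 6 7 8 9 10 by blast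
qed

end

lemma binf_algebraD:
  assumes "binf_algebra sc A"
  shows "x \<in> homog A p \<Longrightarrow> y \<in> homog A p \<Longrightarrow> x + y \<in> homog A p"
    "x \<in> homog A p \<Longrightarrow> sc c x \<in> homog A p"
    "gword (homog A) u \<Longrightarrow> gword (homog A) v \<Longrightarrow> bmul A u v \<in> homog A (wdeg u + wdeg v)"
    "gword (homog A) u \<Longrightarrow> bdif A u \<in> homog A (wdeg u + 1)"
proof -
  note A = assms[unfolded binf_algebra_def]
  interpret module sc using A by blast
  have s: "subspace (homog A p)" using A by blast
  show "x + y \<in> homog A p" if "x \<in> homog A p" "y \<in> homog A p" using subspace_add[OF s] that .
  show "sc c x \<in> homog A p" if "x \<in> homog A p" using subspace_scale[OF s] that .
  show "bmul A u v \<in> homog A (wdeg u + wdeg v)" if "gword (homog A) u" "gword (homog A) v" using A that by blast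
  show "bdif A u \<in> homog A (wdeg u + 1)" if "gword (homog A) u" using A that by blast
qed

lemma binf_morphismD:
  assumes "binf_morphism sc sc' A B f"
  shows "binf_algebra sc A" "binf_algebra sc' B"
    "x \<in> homog A p \<Longrightarrow> f p x \<in> homog B p"
    "x \<in> homog A p \<Longrightarrow> y \<in> homog A p \<Longrightarrow> f p (x + y) = f p x + f p y"
    "x \<in> homog A p \<Longrightarrow> f p (sc c x) = sc' c (f p x)"
    "gword (homog A) u \<Longrightarrow> gword (homog A) v \<Longrightarrow>
       f (wdeg u + wdeg v) (bmul A u v) = bmul B (map (\<lambda>(p, v). (p, f p v)) u) (map (\<lambda>(p, v). (p, f p v)) v)"
    "gword (homog A) u \<Longrightarrow> f (wdeg u + 1) (bdif A u) = bdif B (map (\<lambda>(p, v). (p, f p v)) u)"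
  using assms unfolding binf_morphism_def by blast+

text \<open>Morphisms are tested on homogeneous elements only. This carries the result for
  \<open>emb\<close> over to \<open>embr\<close>, whose agreement with it is known on
  cochains.\<close>

lemma binf_morphism_cong:
  assumes f: "binf_morphism sc sc' A B f" and e: "\<And>p x. x \<in> homog A p \<Longrightarrow> g p x = f p x"
  shows "binf_morphism sc sc' A B g"
proof -
  note F = binf_morphismD[OF f] and A = binf_algebraD[OF binf_morphismD(1)[OF f]]
  have m: "map (\<lambda>(p, v). (p, g p v)) w = map (\<lambda>(p, v). (p, f p v)) w" if "gword (homog A) w" for w
    using that e by (auto simp: gword_def)
  show ?thesis
    unfolding binf_morphism_def
  proof (intro conjI allI impI ballI)
    show "binf_algebra sc A" "binf_algebra sc' B" by (rule F)+
  next
    fix p x assume "x \<in> homog A p"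
    then show "g p x \<in> homog B p" by (simp add: e F(3))
  next
    fix p x y c assume "x \<in> homog A p" "y \<in> homog A p"
    then show "g p (x + y) = g p x + g p y" "g p (sc c x) = sc' c (g p x)"
      by (simp_all add: e A(1,2) F(4,5))
  next
    fix x y assume "gword (homog A) x" "gword (homog A) y"
    then show "g (wdeg x + wdeg y) (bmul A x y) =
       bmul B (map (\<lambda>(p, v). (p, g p v)) x) (map (\<lambda>(p, v). (p, g p v)) y)"
      by (simp add: e m A(3) F(6))
  next
    fix x assume "gword (homog A) x"
    then show "g (wdeg x + 1) (bdif A x) = bdif B (map (\<lambda>(p, v). (p, g p v)) x)"
      by (simp add: e m A(4) F(7))
  qed
qed

lemma binf_morphism_transport:
  assumes i: "transport sc scu i" and j: "transport sc' scu j" and f: "binf_morphism sc sc' A B f"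
  shows "binf_morphism scu scu (binf_transport i A) (binf_transport j B) (map_transport i j A f)"
proof -
  interpret i: transport sc scu i by fact
  interpret j: transport sc' scu j by fact
  note F = binf_morphismD[OF f] and A = binf_algebraD[OF binf_morphismD(1)[OF f]]
  let ?f = "map_transport i j A f"
  have fi: "?f p (i x) = j (f p x)" if "x \<in> homog A p" for p x
    using that by (simp add: map_transport_def)
  have fw: "map (\<lambda>(p, v). (p, ?f p v)) (i.J w) = j.J (map (\<lambda>(p, v). (p, f p v)) w)" if "gword (homog A) w" for w
    using that fi by (induction w) (auto simp: gword_def)
  show ?thesis
    unfolding binf_morphism_def i.binf_transport_eq j.binf_transport_eq binf.simps
  proof (intro conjI allI impI ballI)
    show "binf_algebra scu \<lparr>homog = \<lambda>p. i ` homog A p, bmul = \<lambda>x y. i (bmul A (i.I x) (i.I y)), bdif = \<lambda>x. i (bdif A (i.I x))\<rparr>"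
      using i.binf_algebra_transport[OF F(1)] by (simp add: i.binf_transport_eq)
    show "binf_algebra scu \<lparr>homog = \<lambda>p. j ` homog B p, bmul = \<lambda>x y. j (bmul B (j.I x) (j.I y)), bdif = \<lambda>x. j (bdif B (j.I x))\<rparr>"
      using j.binf_algebra_transport[OF F(2)] by (simp add: j.binf_transport_eq)
  next
    fix p x assume "x \<in> i ` homog A p"
    then show "?f p x \<in> j ` homog B p" using fi F(3) by auto
  next
    fix p x y c assume "x \<in> i ` homog A p" "y \<in> i ` homog A p"
    then obtain x0 y0 where x: "x = i x0" "x0 \<in> homog A p" and y: "y = i y0" "y0 \<in> homog A p" by auto
    have m: "x0 + y0 \<in> homog A p" "sc c x0 \<in> homog A p" using x y by (simp_all add: A(1,2))
    show "?f p (x + y) = ?f p x + ?f p y" "?f p (scu c x) = scu c (?f p x)"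
      using fi[OF m(1)] fi[OF m(2)] fi[OF x(2)] fi[OF y(2)]
      by (simp_all add: x y F(4,5) i.h.add[symmetric] i.h.scale[symmetric] j.h.add j.h.scale)
  next
    fix x y assume "gword (\<lambda>p. i ` homog A p) x" "gword (\<lambda>p. i ` homog A p) y"
    then obtain x0 y0 where w: "x = i.J x0" "gword (homog A) x0" "y = i.J y0" "gword (homog A) y0"
      by (metis i.gword_J)
    show "?f (wdeg x + wdeg y) (i (bmul A (i.I x) (i.I y))) =
      j (bmul B (j.I (map (\<lambda>(p, v). (p, ?f p v)) x)) (j.I (map (\<lambda>(p, v). (p, ?f p v)) y)))"
      using fi[OF A(3)[OF w(2,4)]] by (simp add: w fw F(6))
  next
    fix x assume "gword (\<lambda>p. i ` homog A p) x"
    then obtain x0 where w: "x = i.J x0" "gword (homog A) x0" by (elim i.gword_J)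
    show "?f (wdeg x + 1) (i (bdif A (i.I x))) = j (bdif B (j.I (map (\<lambda>(p, v). (p, ?f p v)) x)))"
      using fi[OF A(4)[OF w(2)]] by (simp add: w fw F(7))
  qed
qed

section \<open>Cohomology classes and deformation retracts\<close>

lemma binf_algebra_bdif_single:
  assumes "binf_algebra sc A"
  shows "0 \<in> homog A p" "x \<in> homog A p \<Longrightarrow> y \<in> homog A p \<Longrightarrow> x + y \<in> homog A p"
    "x \<in> homog A p \<Longrightarrow> - x \<in> homog A p" "x \<in> homog A p \<Longrightarrow> y \<in> homog A p \<Longrightarrow> x - y \<in> homog A p"
    "x \<in> homog A p \<Longrightarrow> y \<in> homog A p \<Longrightarrow> bdif A [(p, x + y)] = bdif A [(p, x)] + bdif A [(p, y)]"
    "bdif A [(p, 0)] = 0" "x \<in> homog A p \<Longrightarrow> bdif A [(p, - x)] = - bdif A [(p, x)]"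
proof -
  note A = assms[unfolded binf_algebra_def]
  interpret module sc using A by blast
  have s: "subspace (homog A p)" using A by blast
  show 0: "0 \<in> homog A p" using subspace_0[OF s] .
  show "x + y \<in> homog A p" if "x \<in> homog A p" "y \<in> homog A p" for x y using subspace_add[OF s] that .
  show m: "- x \<in> homog A p" if "x \<in> homog A p" for x using subspace_neg[OF s] that .
  show "x - y \<in> homog A p" if "x \<in> homog A p" "y \<in> homog A p" for x y using subspace_diff[OF s] that .
  have "multilinear sc (homog A) (bdif A)" using A by blast
  then show add: "bdif A [(p, x + y)] = bdif A [(p, x)] + bdif A [(p, y)]" if "x \<in> homog A p" "y \<in> homog A p" for x y
    using that unfolding multilinear_def by (metis append_Nil gword_def empty_iff list.set(1))
  show z: "bdif A [(p, 0)] = 0" using add[OF 0 0] by simp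
  show "bdif A [(p, - x)] = - bdif A [(p, x)]" if "x \<in> homog A p" for x
    using add[OF that m[OF that]] z by (simp add: eq_neg_iff_add_eq_0 add.commute)
qed

lemma equiv_cohomologous:
  assumes "binf_algebra sc A"
  shows "equiv (cocycles A p) (cohomologous A p)"
proof (rule equivI)
  note b = binf_algebra_bdif_single[OF assms]
  show "cohomologous A p \<subseteq> cocycles A p \<times> cocycles A p"
    by (auto simp: cohomologous_def)
  show "refl_on (cocycles A p) (cohomologous A p)"
    using b(1,6) by (force simp: refl_on_def cohomologous_def)
  show "sym (cohomologous A p)"
  proof (rule symI)
    fix x y assume "(x, y) \<in> cohomologous A p"
    then obtain z where "x \<in> cocycles A p" "y \<in> cocycles A p" "z \<in> homog A (p - 1)" "x - y = bdif A [(p - 1, z)]"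
      by (auto simp: cohomologous_def)
    moreover have "y - x = bdif A [(p - 1, - z)]" using calculation b(7) by (metis minus_diff_eq)
    ultimately show "(y, x) \<in> cohomologous A p" using b(3) by (auto simp: cohomologous_def)
  qed
  show "trans (cohomologous A p)"
  proof (rule transI)
    fix x y w assume "(x, y) \<in> cohomologous A p" "(y, w) \<in> cohomologous A p"
    then obtain z z' where c: "x \<in> cocycles A p" "w \<in> cocycles A p" "z \<in> homog A (p - 1)" "z' \<in> homog A (p - 1)"
      "x - y = bdif A [(p - 1, z)]" "y - w = bdif A [(p - 1, z')]"
      by (auto simp: cohomologous_def)
    have "x - w = (x - y) + (y - w)" by simp
    also have "\<dots> = bdif A [(p - 1, z + z')]" using b(5) c by simp
    finally show "(x, w) \<in> cohomologous A p" using b(2) c by (auto simp: cohomologous_def)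
  qed
qed

lemma morphism_cohomologous:
  assumes f: "binf_morphism sc sc' A B f" and xy: "(x, y) \<in> cohomologous A p"
  shows "(f p x, f p y) \<in> cohomologous B p"
proof -
  note F = binf_morphismD[OF f]
  note a = binf_algebra_bdif_single[OF F(1)] and b = binf_algebra_bdif_single[OF F(2)]
  have f_bdif: "f (q + 1) (bdif A [(q, x)]) = bdif B [(q, f q x)]" if "x \<in> homog A q" for q x
    using F(7)[of "[(q, x)]"] that by (simp add: gword_def)
  have f0: "f q 0 = 0" for q using F(4)[OF a(1) a(1), of q] by simp
  have coc: "f p x \<in> cocycles B p" if "x \<in> cocycles A p" for x
    using that f_bdif[of x p] f0[of "p + 1"] F(3) by (auto simp: cocycles_def)
  obtain z where z: "x \<in> cocycles A p" "y \<in> cocycles A p" "z \<in> homog A (p - 1)" "x - y = bdif A [(p - 1, z)]"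
    using xy by (auto simp: cohomologous_def)
  have "f p x = f p (x - y) + f p y"
  proof -
    have "x \<in> homog A p" and y: "y \<in> homog A p" using z by (auto simp: cocycles_def)
    then have "x - y \<in> homog A p" by (rule a(4))
    from this y have "f p ((x - y) + y) = f p (x - y) + f p y" by (rule F(4))
    then show ?thesis by simp
  qed
  then have "f p x - f p y = bdif B [(p - 1, f (p - 1) z)]"
    using f_bdif[OF z(3)] z(4) by simp
  then show ?thesis using coc z(1-3) F(3) by (auto simp: cohomologous_def)
qed

text \<open>The image of a class need not be a whole class, hence the saturation by
  \<open>cohomologous\<close>; it makes the induced map computable on representatives.\<close>

lemma morphism_class:
  assumes f: "binf_morphism sc sc' A B f" and x: "x \<in> cocycles A p"
  shows "cohomologous B p `` (f p ` (cohomologous A p `` {x})) = cohomologous B p `` {f p x}"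
proof -
  have A: "equiv (cocycles A p) (cohomologous A p)" and B: "equiv (cocycles B p) (cohomologous B p)"
    using f equiv_cohomologous unfolding binf_morphism_def by auto
  have "x \<in> cohomologous A p `` {x}" using equiv_class_self[OF A x] .
  moreover have "cohomologous B p `` {f p y} = cohomologous B p `` {f p x}" if "y \<in> cohomologous A p `` {x}" for y
  proof -
    have "(x, y) \<in> cohomologous A p" using that by simp
    from equiv_class_eq[OF B morphism_cohomologous[OF f this]] show ?thesis by simp
  qed
  ultimately show ?thesis by blast
qed

text \<open>The maps induced by \<open>f\<close> and \<open>g\<close> on cohomology are inverse to
  each other: one composite is the identity already on elements, the other changes a cocycle by a
  boundary.\<close>

lemma deformation_retract_quasi_iso:
  assumes f: "binf_morphism sc sc' A B f" and g: "binf_morphism sc' sc B A g"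
    and fg: "\<And>p y. y \<in> homog B p \<Longrightarrow> f p (g p y) = y"
    and gf: "\<And>p x. x \<in> cocycles A p \<Longrightarrow> \<exists>z\<in>homog A (p - 1). x - g p (f p x) = bdif A [(p - 1, z)]"
  shows "binf_quasi_iso sc sc' A B f" "binf_quasi_iso sc' sc B A g"
proof -
  have A: "equiv (cocycles A p) (cohomologous A p)" and B: "equiv (cocycles B p) (cohomologous B p)" for p
    using f equiv_cohomologous unfolding binf_morphism_def by auto
  let ?F = "\<lambda>p c. cohomologous B p `` (f p ` c)" and ?G = "\<lambda>p c. cohomologous A p `` (g p ` c)"
  have fc: "f p x \<in> cocycles B p" if "x \<in> cocycles A p" for p x
  proof -
    have "(x, x) \<in> cohomologous A p" using A that by (auto simp: equiv_def refl_on_def)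
    from morphism_cohomologous[OF f this] show ?thesis by (simp add: cohomologous_def)
  qed
  have gc: "g p x \<in> cocycles A p" if "x \<in> cocycles B p" for p x
  proof -
    have "(x, x) \<in> cohomologous B p" using B that by (auto simp: equiv_def refl_on_def)
    from morphism_cohomologous[OF g this] show ?thesis by (simp add: cohomologous_def)
  qed
  have GF: "?G p (?F p c) = c" and FF: "?F p c \<in> cohomology B p" if "c \<in> cohomology A p" for p c
  proof -
    obtain x where x: "x \<in> cocycles A p" "c = cohomologous A p `` {x}"
      using \<open>c \<in> cohomology A p\<close> unfolding cohomology_def by (elim quotientE)
    have "(x, g p (f p x)) \<in> cohomologous A p"
      using gf[OF x(1)] x(1) gc[OF fc[OF x(1)]] by (auto simp: cohomologous_def)
    then have e: "cohomologous A p `` {g p (f p x)} = c"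
      using equiv_class_eq[OF A] x(2) by metis
    show "?G p (?F p c) = c" "?F p c \<in> cohomology B p"
      unfolding x(2) morphism_class[OF f x(1)] morphism_class[OF g fc[OF x(1)]]
      using e x(2) fc[OF x(1)] by (auto simp: cohomology_def intro: quotientI)
  qed
  have FG: "?F p (?G p c) = c" and GG: "?G p c \<in> cohomology A p" if "c \<in> cohomology B p" for p c
  proof -
    obtain x where x: "x \<in> cocycles B p" "c = cohomologous B p `` {x}"
      using \<open>c \<in> cohomology B p\<close> unfolding cohomology_def by (elim quotientE)
    have "f p (g p x) = x" using fg x(1) by (simp add: cocycles_def)
    then show "?F p (?G p c) = c" "?G p c \<in> cohomology A p"
      unfolding x(2) morphism_class[OF g x(1)] morphism_class[OF f gc[OF x(1)]]
      using gc[OF x(1)] by (auto simp: cohomology_def intro: quotientI)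
  qed
  have bF: "bij_betw (?F p) (cohomology A p) (cohomology B p)" for p
    by (rule bij_betw_byWitness[where f' = "?G p"]) (use FF GG GF FG in auto)
  have bG: "bij_betw (?G p) (cohomology B p) (cohomology A p)" for p
    by (rule bij_betw_byWitness[where f' = "?F p"]) (use FF GG GF FG in auto)
  show "binf_quasi_iso sc sc' A B f"
    unfolding binf_quasi_iso_def using f bF by blast
  show "binf_quasi_iso sc' sc B A g"
    unfolding binf_quasi_iso_def using g bG by blast
qed

section \<open>Sections of inverted arrows in a localization\<close>

lemma zz_class_eqI: "zz_eq C W X Y z z' \<Longrightarrow> zz_class C W X Y z = zz_class C W X Y z'"
  unfolding zz_class_def by (auto intro: zz_trans zz_sym)

text \<open>Composition is defined as a union over all representatives. By \<open>zz_append\<close>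
  the classes that are united coincide, and since representatives exist the union is that
  class.\<close>

lemma localization_cmp:
  assumes "zigzag C W X u Y" "zigzag C W Y v Z"
  shows "cmp (localization C W) X Y Z (zz_class C W Y Z v) (zz_class C W X Y u) = zz_class C W X Z (u @ v)"
proof -
  have e: "zz_class C W X Z (f @ g) = zz_class C W X Z (u @ v)"
    if "f \<in> zz_class C W X Y u" "g \<in> zz_class C W Y Z v" for f g
    using zz_class_eqI[OF zz_sym[OF zz_append]] that unfolding zz_class_def mem_Collect_eq by metis
  have u: "u \<in> zz_class C W X Y u" and v: "v \<in> zz_class C W Y Z v"
    using assms by (simp_all add: zz_class_def zz_refl)
  have "cmp (localization C W) X Y Z (zz_class C W Y Z v) (zz_class C W X Y u) =
      (\<Union>f\<in>zz_class C W X Y u. \<Union>g\<in>zz_class C W Y Z v. zz_class C W X Z (f @ g))"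
    by (simp add: localization_def)
  also have "\<dots> = (\<Union>f\<in>zz_class C W X Y u. \<Union>g\<in>zz_class C W Y Z v. zz_class C W X Z (u @ v))"
    by (intro SUP_cong refl e)
  also have "\<dots> = zz_class C W X Z (u @ v)" using u v by auto
  finally show ?thesis .
qed

text \<open>A section of an invertible arrow is its inverse. So only \<open>f\<close>, and not
  \<open>g\<close>, has to belong to the arrows that are inverted.\<close>

lemma localization_section:
  assumes X: "X \<in> Obj C" and Y: "Y \<in> Obj C" and g: "g \<in> Hom C X Y" and f: "f \<in> Hom C Y X" and fW: "f \<in> W Y X"
    and fg: "cmp C X Y X f g = idn C X"
  shows "inverse_arrows (localization C W) X Y (loc_arrow C W X Y g) (loc_arrow C W Y X f)"
proof -
  have z: "zigzag C W X [Fwd X g Y] Y" "zigzag C W Y [Fwd Y f X] X"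
    using X Y f g by (auto intro: zigzag.intros)
  have zB: "zigzag C W X [Bwd X f Y] Y" using X Y fW by (auto intro: zigzag.intros)
  have 1: "zz_eq C W X X [Fwd X g Y, Fwd Y f X] []"
    using zz_trans[OF zz_comp[OF X Y X g f]] zz_id[OF X] fg by simp
  have inv: "zz_eq C W Y Y [Fwd Y f X, Bwd X f Y] []" by (rule zz_inv1[where W = W, OF Y X fW])
  \<comment> \<open>The zigzag \<open>f\<close>, \<open>g\<close>, \<open>f\<close>, formal inverse
    of \<open>f\<close> is reduced in two ways: by cancelling its last two steps, or the two steps
    in the middle.\<close>
  have "zz_eq C W Y Y ([Fwd Y f X, Fwd X g Y] @ [Fwd Y f X, Bwd X f Y]) ([Fwd Y f X, Fwd X g Y] @ [])"
    by (rule zz_append[OF zz_refl inv]) (use X Y f g in \<open>auto intro: zigzag.intros\<close>)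
  moreover have "zz_eq C W Y Y ([Fwd Y f X] @ ([Fwd X g Y, Fwd Y f X] @ [Bwd X f Y])) ([Fwd Y f X] @ ([] @ [Bwd X f Y]))"
    by (rule zz_append[OF zz_refl[OF z(2)] zz_append[OF 1 zz_refl[OF zB]]])
  ultimately have 2: "zz_eq C W Y Y [Fwd Y f X, Fwd X g Y] []"
    using inv by simp (rule zz_trans[OF zz_sym], assumption, rule zz_trans, assumption, assumption)
  have "cmp (localization C W) X Y X (loc_arrow C W Y X f) (loc_arrow C W X Y g) = idn (localization C W) X"
    unfolding loc_arrow_def localization_cmp[OF z] using zz_class_eqI[OF 1] by (simp add: localization_def)
  moreover have "cmp (localization C W) Y X Y (loc_arrow C W X Y g) (loc_arrow C W Y X f) = idn (localization C W) Y"
    unfolding loc_arrow_def localization_cmp[OF z(2,1)] using zz_class_eqI[OF 2] by (simp add: localization_def)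
  ultimately show ?thesis
    unfolding inverse_arrows_def using X Y z by (auto simp: localization_def loc_arrow_def)
qed

text \<open>The arrow inverted in the homotopy category is the transported one, so it is the
  transported pair that must be shown to be a deformation retract. Injectivity of \<open>i\<close>
  is what lets a cocycle of the transported algebra be pulled back to a cocycle.\<close>

lemma Ho_inverse:
  assumes i: "transport sc scu i" and j: "transport sc' scu j"
    and f: "binf_morphism sc sc' A B f" and g: "binf_morphism sc' sc B A g"
    and fg: "\<And>p y. y \<in> homog B p \<Longrightarrow> f p (g p y) = y"
    and gf: "\<And>p x. x \<in> cocycles A p \<Longrightarrow> \<exists>z\<in>homog A (p - 1). x - g p (f p x) = bdif A [(p - 1, z)]"
  shows "inverse_arrows (Ho_binf scu) (binf_transport j B) (binf_transport i A)
     (Ho_arrow scu j i B A g) (Ho_arrow scu i j A B f)"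
proof -
  interpret i: transport sc scu i by fact
  interpret j: transport sc' scu j by fact
  let ?A = "binf_transport i A" and ?B = "binf_transport j B"
  let ?f = "map_transport i j A f" and ?g = "map_transport j i B g"
  note F = binf_morphismD[OF f] and G = binf_morphismD[OF g]
  have fm: "binf_morphism scu scu ?A ?B ?f" by (rule binf_morphism_transport[OF i j f])
  have gm: "binf_morphism scu scu ?B ?A ?g" by (rule binf_morphism_transport[OF j i g])
  have hA: "homog ?A p = i ` homog A p" and hB: "homog ?B p = j ` homog B p" for p
    by (simp_all add: binf_transport_def)
  have fi: "?f p (i x) = j (f p x)" if "x \<in> homog A p" for p x
    using that by (simp add: map_transport_def)
  have gj: "?g p (j x) = i (g p x)" if "x \<in> homog B p" for p x
    using that by (simp add: map_transport_def)
  have fg': "?f p (?g p y) = y" if y: "y \<in> homog ?B p" for p y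
  proof -
    obtain y0 where y0: "y = j y0" "y0 \<in> homog B p" using y hB by auto
    have "g p y0 \<in> homog A p" by (rule G(3)[OF y0(2)])
    then show ?thesis using y0 fg by (simp add: gj fi)
  qed
  have "\<exists>z\<in>homog ?A (p - 1). x - ?g p (?f p x) = bdif ?A [(p - 1, z)]" if x: "x \<in> cocycles ?A p" for p x
  proof -
    obtain x0 where x0: "x = i x0" "x0 \<in> homog A p" using x hA by (auto simp: cocycles_def)
    have "i (bdif A [(p, x0)]) = i 0"
      using x x0 by (simp add: cocycles_def binf_transport_def i.h.zero)
    then have "bdif A [(p, x0)] = 0" using inj_eq[OF i.inj] by metis
    then have "x0 \<in> cocycles A p" using x0 by (simp add: cocycles_def)
    from gf[OF this] obtain z where z: "z \<in> homog A (p - 1)" "x0 - g p (f p x0) = bdif A [(p - 1, z)]" by blast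
    have "f p x0 \<in> homog B p" using F(3) x0 by blast
    then have "x - ?g p (?f p x) = i (x0 - g p (f p x0))"
      using x0 by (simp add: fi gj i.h.diff)
    also have "\<dots> = bdif ?A [(p - 1, i z)]" by (simp add: z(2) binf_transport_def)
    finally show ?thesis using z(1) hA by blast
  qed
  from deformation_retract_quasi_iso(1)[OF fm gm fg' this]
  have fq: "binf_quasi_iso scu scu ?A ?B ?f" .
  have fH: "?f \<in> Hom (binf_cat scu) ?A ?B" using fm by (simp add: binf_cat_def hA map_transport_def)
  have gH: "?g \<in> Hom (binf_cat scu) ?B ?A" using gm by (simp add: binf_cat_def hB map_transport_def)
  have c: "cmp (binf_cat scu) ?B ?A ?B ?f ?g = idn (binf_cat scu) ?B"
    using fg' by (simp add: binf_cat_def fun_eq_iff)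
  have o: "?A \<in> Obj (binf_cat scu)" "?B \<in> Obj (binf_cat scu)"
    using fm by (auto simp: binf_cat_def binf_morphism_def)
  show ?thesis
    unfolding Ho_binf_def Ho_arrow_def
    by (rule localization_section[OF o(2,1) gH fH _ c]) (use fq fH in \<open>simp add: binf_weq_def\<close>)
qed

section \<open>The linear category of injectives, and the comparison of the two Hochschild
  complexes\<close>

lemma linear_category_Inj:
  assumes "linear_category sc A"
  shows "linear_category sc (Inj A)"
proof -
  have O: "X \<in> Obj (Inj A) \<Longrightarrow> X \<in> Obj A" for X
    by (simp add: Inj_def injective_object_def)
  have e: "Hom (Inj A) = Hom A" "cmp (Inj A) = cmp A" "idn (Inj A) = idn A"
    by (simp_all add: Inj_def)
  show ?thesis
    using assms unfolding linear_category_def category_def e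
    by (intro conjI; elim conjE; meson O)
qed

theorem theorem3p22:
  fixes sc :: "'k::comm_ring_1 \<Rightarrow> 'm::ab_group_add \<Rightarrow> 'm"
    and A :: "('o, 'm) cat"
    and z :: 'o
  assumes abelian: "linear_abelian_category sc A"
    and enough: "enough_injectives A"
    and zero: "zero_object (Inj A) z"
  shows
    "binf_morphism (cochain_scale (com_scale sc)) (cochain_scale sc)
       (C_ex sc A) (C_ab sc A) (proj (Inj A) z) \<and>
     binf_morphism (cochain_scale sc) (cochain_scale (com_scale sc))
       (C_ab sc A) (C_ex sc A) (embr (Inj A)) \<and>
     (\<forall>p. \<forall>\<phi>\<in>homog (C_ab sc A) p. proj (Inj A) z p (embr (Inj A) p \<phi>) = \<phi>) \<and>
     binf_quasi_iso (cochain_scale (com_scale sc)) (cochain_scale sc)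
       (C_ex sc A) (C_ab sc A) (proj (Inj A) z) \<and>
     binf_quasi_iso (cochain_scale sc) (cochain_scale (com_scale sc))
       (C_ab sc A) (C_ex sc A) (embr (Inj A)) \<and>
     (\<forall>(scu :: 'k \<Rightarrow> 'u::ab_group_add \<Rightarrow> 'u)
       (i :: ('o, 'm) cochain \<Rightarrow> 'u)
       (j :: (('o, 'm) cplx, int \<Rightarrow> 'm) cochain \<Rightarrow> 'u).
        module_hom (cochain_scale sc) scu i \<longrightarrow> inj i \<longrightarrow>
        module_hom (cochain_scale (com_scale sc)) scu j \<longrightarrow> inj j \<longrightarrow>
          inverse_arrows (Ho_binf scu)
            (binf_transport i (C_ab sc A)) (binf_transport j (C_ex sc A))
            (Ho_arrow scu i j (C_ab sc A) (C_ex sc A) (embr (Inj A)))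
            (Ho_arrow scu j i (C_ex sc A) (C_ab sc A) (proj (Inj A) z)) \<and>
          isomorphic (Ho_binf scu)
            (binf_transport i (C_ab sc A)) (binf_transport j (C_ex sc A)))"
proof -
  interpret lin_cat sc "Inj A" z
    using abelian zero by unfold_locales (auto simp: linear_abelian_category_def intro: linear_category_Inj)
  have hab: "homog (C_ab sc A) p = Cbr sc LQ p" and hex: "homog (C_ex sc A) p = Cbr csc KQ p" for p
    by (simp_all add: C_ab_def C_ex_def D_plus_dg_def Cbr_binf_def)
  have pr: "binf_morphism (cochain_scale csc) (cochain_scale sc) (C_ex sc A) (C_ab sc A) (proj (Inj A) z)"
    using pr_morphism by (simp add: C_ab_def C_ex_def D_plus_dg_def)
  have em: "binf_morphism (cochain_scale sc) (cochain_scale csc) (C_ab sc A) (C_ex sc A) (embr (Inj A))"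
    using binf_morphism_cong[OF emb_morphism, of "embr (Inj A)"] embr_eq_emb
    by (simp add: C_ab_def C_ex_def D_plus_dg_def Cbr_binf_def)
  have sec: "proj (Inj A) z p (embr (Inj A) p \<phi>) = \<phi>" if "\<phi> \<in> homog (C_ab sc A) p" for p \<phi>
    using that pr_emb embr_eq_emb by (simp add: hab)
  \<comment> \<open>The retraction datum for cocycles that both the quasi-isomorphisms and the
    isomorphism in the homotopy category are deduced from.\<close>
  have hom: "\<exists>\<eta>\<in>homog (C_ex sc A) (p - 1). \<phi> - embr (Inj A) p (proj (Inj A) z p \<phi>) = bdif (C_ex sc A) [(p - 1, \<eta>)]"
    if "\<phi> \<in> cocycles (C_ex sc A) p" for p \<phi>
  proof -
    have \<phi>: "\<phi> \<in> Cbr csc KQ p" and c: "Cbr_dif KQ bK [(p, \<phi>)] = 0"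
      using that by (simp_all add: cocycles_def C_ex_def D_plus_dg_def Cbr_binf_def)
    have "ksign (p + 1) (homotopy p \<phi>) \<in> homog (C_ex sc A) (p - 1)"
      unfolding hex by (rule K.Cbr_ksign[OF homotopy_Cbr[OF \<phi>]])
    moreover have "\<phi> - embr (Inj A) p (proj (Inj A) z p \<phi>) = bdif (C_ex sc A) [(p - 1, ksign (p + 1) (homotopy p \<phi>))]"
      using chain_homotopy[OF \<phi> c] embr_eq_emb[OF pr_Cbr[OF \<phi>]]
      by (simp add: C_ex_def D_plus_dg_def Cbr_binf_def)
    ultimately show ?thesis by blast
  qed
  note qi = deformation_retract_quasi_iso[OF pr em, OF sec hom]
  have "inverse_arrows (Ho_binf scu)
            (binf_transport i (C_ab sc A)) (binf_transport j (C_ex sc A))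
            (Ho_arrow scu i j (C_ab sc A) (C_ex sc A) (embr (Inj A)))
            (Ho_arrow scu j i (C_ex sc A) (C_ab sc A) (proj (Inj A) z))"
    if "module_hom (cochain_scale sc) scu i" "inj i" "module_hom (cochain_scale csc) scu j" "inj j"
    for scu :: "'k \<Rightarrow> 'u::ab_group_add \<Rightarrow> 'u" and i :: "('o, 'm) cochain \<Rightarrow> 'u"
      and j :: "(('o, 'm) cplx, int \<Rightarrow> 'm) cochain \<Rightarrow> 'u"
    by (rule Ho_inverse[OF transport.intro transport.intro pr em, OF _ _ _ _ sec hom]) (use that in auto)
  then show ?thesis
    using pr em sec qi unfolding isomorphic_def by blast
qed

end
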